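(* For every ``$F$-crystal'' $(M,\phi)$ over $k$ one has $n_M = \ell_M$, where $n_M$ is its isomorphism number and $\ell_M$ its level torsion.
   Context: Let $k$ be an algebraically closed field of characteristic $p>0$, let $q$ be a power of $p$, and let $\sigma$ be the automorphism of $k((\epsilon))$ given by $\sigma(\sum a_n\epsilon^n)=\sum a_n^q\epsilon^n$ ($a_n\in k$). An ``$F$-crystal'' over $k$ is a pair $(M,\phi)$ where $M$ is a free $k[[\epsilon]]$-module of finite rank, $V=M\otimes_{k[[\epsilon]]}k((\epsilon))$, and $\phi$ is a $\sigma$-linear bijection of $V$ with $\phi(M)\subset M$. Its isomorphism number $n_M$ is the smallest integer $n\ge 0$ such that for every $h\in GL(M)$ with $h\equiv 1 \bmod \epsilon^n$ there exists $g\in GL(M)$ with $h\phi=g^{-1}\phi g$. Let $\tilde\phi$ be the $\sigma$-linear bijection of $\mathrm{End}(V)$ given by $f\mapsto \phi f\phi^{-1}$. By the Dieudonné–Manin classification, $V=\bigoplus_{\lambda\in\mathbb Q}V^{\lambda}$ with each $V^\lambda$ a $\phi$-stable $k((\epsilon))$-subspace on which $\phi$ is isoclinic of slope $\lambda$. Put $V_+=\bigoplus_{\lambda_1<\lambda_2}\mathrm{Hom}(V^{\lambda_1},V^{\lambda_2})$, $V_0=\bigoplus_\lambda\mathrm{Hom}(V^\lambda,V^\lambda)$, $V_-=\bigoplus_{\lambda_1<\lambda_2}\mathrm{Hom}(V^{\lambda_2},V^{\lambda_1})$. For a lattice $H$ of $\mathrm{End}(V)$ let $O_{H,+}\subset V_+\cap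 H$, $O_{H,0}\subset V_0\cap H$, $O_{H,-}\subset V_-\cap H$ be the maximal $k[[\epsilon]]$-submodules with $\tilde\phi(O_{H,+})\subset O_{H,+}$, $\tilde\phi(O_{H,0})=O_{H,0}$, $\tilde\phi^{-1}(O_{H,-})\subset O_{H,-}$, and set $O_H=O_{H,+}\oplus O_{H,0}\oplus O_{H,-}$. With $H=\mathrm{End}(M)$, the level torsion $\ell_M$ is defined by: (a) $\ell_M=1$ if $H=O_H$ and $O_{H,+}\oplus O_{H,-}$ is not topologically nilpotent; (b) otherwise $\ell_M=\min\{n\in\mathbb Z_{\ge0};\ \epsilon^nH\subset O_H\}$. *)

theory Defs
  imports
    "HOL-Computational_Algebra.Computational_Algebra"
    "HOL-Library.Function_Algebras"
begin

text \<open>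
  For a field \<open>k\<close> (a type \<open>'k\<close>), \<open>k((\<epsilon>))\<close> is the type \<open>'k fls\<close>, \<open>k[[\<epsilon>]]\<close> is the type
  \<open>'k fps\<close>, embedded by \<open>fps_to_fls\<close>, and \<open>\<epsilon>\<close> is \<open>fls_X\<close>.
\<close>

definition fls_frob :: "nat \<Rightarrow> 'k::field fls \<Rightarrow> 'k fls" where
  "fls_frob q f = Abs_fls (\<lambda>n. fls_nth f n ^ q)"

lemma fls_nth_fls_frob:
  assumes "q > 0"
  shows "fls_nth (fls_frob q f) n = fls_nth f n ^ q"
proof -
  have "\<forall>\<^sub>\<infinity>n::nat. fls_nth f (- int n) ^ q = 0"
    using fls_nth[of f] assms by (auto elim!: MOST_mono)
  then show ?thesis
    by (simp add: fls_frob_def Abs_fls_inverse)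
qed

locale fls_vector_space = vector_space scale
  for scale :: "'k::field fls \<Rightarrow> 'v::ab_group_add \<Rightarrow> 'v"
begin

definition int_scale :: "'k fps \<Rightarrow> 'v \<Rightarrow> 'v" where
  "int_scale a v = scale (fps_to_fls a) v"

definition end_scale :: "'k fls \<Rightarrow> ('v \<Rightarrow> 'v) \<Rightarrow> 'v \<Rightarrow> 'v" where
  "end_scale c f = (\<lambda>v. scale c (f v))"

definition end_int_scale :: "'k fps \<Rightarrow> ('v \<Rightarrow> 'v) \<Rightarrow> 'v \<Rightarrow> 'v" where
  "end_int_scale a f = end_scale (fps_to_fls a) f"

sublocale int: module int_scale
  by unfold_locales
    (simp_all add: int_scale_def fls_times_fps_to_fls algebra_simps)

sublocale endo: vector_space end_scale
  by unfold_locales (auto simp: end_scale_def algebra_simps fun_eq_iff)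

sublocale end_int: module end_int_scale
  by unfold_locales
    (simp_all add: end_int_scale_def fls_times_fps_to_fls algebra_simps)

text \<open>\<open>L\<close> is a \<open>k[[\<epsilon>]]\<close>-lattice of the (finite-dimensional) subspace \<open>W\<close>: it is free on
  a \<open>k((\<epsilon>))\<close>-basis of \<open>W\<close>, so that \<open>W\<close> is \<open>L \<otimes> k((\<epsilon>))\<close>.\<close>

definition lattice_of :: "'v set \<Rightarrow> 'v set \<Rightarrow> bool" where
  "lattice_of W L \<longleftrightarrow>
     (\<exists>B. finite B \<and> independent B \<and> span B = W \<and> L = int.span B)"

definition End_space :: "('v \<Rightarrow> 'v) set" where
  "End_space = {f. Vector_Spaces.linear scale scale f}"

definition End_lattice :: "'v set \<Rightarrow> ('v \<Rightarrow> 'v) set" where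
  "End_lattice M = {f \<in> End_space. f ` M \<subseteq> M}"

definition GL_lattice :: "'v set \<Rightarrow> ('v \<Rightarrow> 'v) set" where
  "GL_lattice M = {g \<in> End_space. bij g \<and> g ` M = M}"

definition eps_mult :: "nat \<Rightarrow> ('v \<Rightarrow> 'v) set \<Rightarrow> ('v \<Rightarrow> 'v) set" where
  "eps_mult n H = end_scale (fls_X ^ n) ` H"

text \<open>The slope is \<open>s/r\<close>; replacing \<open>(r, s)\<close> by a multiple does not change the notion.\<close>

definition isoclinic :: "('v \<Rightarrow> 'v) \<Rightarrow> rat \<Rightarrow> 'v set \<Rightarrow> bool" where
  "isoclinic \<phi> l W \<longleftrightarrow>
     (\<exists>L (r::nat) (s::int). lattice_of W L \<and> r > 0 \<and> l = of_int s / of_nat r \<and>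
        (\<phi> ^^ r) ` L = scale (fls_X_intpow s) ` L)"

definition slope_decomposition :: "('v \<Rightarrow> 'v) \<Rightarrow> (rat \<Rightarrow> 'v set) \<Rightarrow> bool" where
  "slope_decomposition \<phi> D \<longleftrightarrow>
     (\<forall>l. subspace (D l) \<and> \<phi> ` D l \<subseteq> D l \<and> isoclinic \<phi> l (D l)) \<and>
     (\<forall>v. \<exists>!c. finite {l. c l \<noteq> 0} \<and> (\<forall>l. c l \<in> D l) \<and> v = (\<Sum>l | c l \<noteq> 0. c l))"

text \<open>By the Dieudonne--Manin classification a slope decomposition exists (when \<open>k\<close> is
  algebraically closed); it is unique, so the choice below is harmless.\<close>

definition slope_component :: "('v \<Rightarrow> 'v) \<Rightarrow> rat \<Rightarrow> 'v set" where
  "slope_component \<phi> = (SOME D. slope_decomposition \<phi> D)"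

text \<open>\<open>Hom(V\<^sup>l, V\<^sup>m)\<close> inside \<open>End(V)\<close>, extending by zero on the other slope components.\<close>

definition Hom_slope :: "('v \<Rightarrow> 'v) \<Rightarrow> rat \<Rightarrow> rat \<Rightarrow> ('v \<Rightarrow> 'v) set" where
  "Hom_slope \<phi> l m =
     {f \<in> End_space. f ` slope_component \<phi> l \<subseteq> slope_component \<phi> m \<and>
        (\<forall>l'. l' \<noteq> l \<longrightarrow> f ` slope_component \<phi> l' \<subseteq> {0})}"

definition V_plus :: "('v \<Rightarrow> 'v) \<Rightarrow> ('v \<Rightarrow> 'v) set" where
  "V_plus \<phi> = endo.span (\<Union>{Hom_slope \<phi> l1 l2 | l1 l2. l1 < l2})"

definition V_zero :: "('v \<Rightarrow> 'v) \<Rightarrow> ('v \<Rightarrow> 'v) set" where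
  "V_zero \<phi> = endo.span (\<Union>{Hom_slope \<phi> l l | l. True})"

definition V_minus :: "('v \<Rightarrow> 'v) \<Rightarrow> ('v \<Rightarrow> 'v) set" where
  "V_minus \<phi> = endo.span (\<Union>{Hom_slope \<phi> l2 l1 | l1 l2. l1 < l2})"

definition conj_map :: "('v \<Rightarrow> 'v) \<Rightarrow> ('v \<Rightarrow> 'v) \<Rightarrow> 'v \<Rightarrow> 'v" where
  "conj_map \<phi> f = \<phi> \<circ> f \<circ> inv \<phi>"

text \<open>Sums of submodules with one of the stability properties below have it again, so the
  maximal submodules are greatest ones with respect to inclusion.\<close>

definition O_plus :: "('v \<Rightarrow> 'v) \<Rightarrow> ('v \<Rightarrow> 'v) set \<Rightarrow> ('v \<Rightarrow> 'v) set" where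
  "O_plus \<phi> H =
     (GREATEST N. end_int.subspace N \<and> N \<subseteq> V_plus \<phi> \<inter> H \<and> conj_map \<phi> ` N \<subseteq> N)"

definition O_zero :: "('v \<Rightarrow> 'v) \<Rightarrow> ('v \<Rightarrow> 'v) set \<Rightarrow> ('v \<Rightarrow> 'v) set" where
  "O_zero \<phi> H =
     (GREATEST N. end_int.subspace N \<and> N \<subseteq> V_zero \<phi> \<inter> H \<and> conj_map \<phi> ` N = N)"

definition O_minus :: "('v \<Rightarrow> 'v) \<Rightarrow> ('v \<Rightarrow> 'v) set \<Rightarrow> ('v \<Rightarrow> 'v) set" where
  "O_minus \<phi> H =
     (GREATEST N. end_int.subspace N \<and> N \<subseteq> V_minus \<phi> \<inter> H \<and> inv (conj_map \<phi>) ` N \<subseteq> N)"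

definition O_level :: "('v \<Rightarrow> 'v) \<Rightarrow> ('v \<Rightarrow> 'v) set \<Rightarrow> ('v \<Rightarrow> 'v) set" where
  "O_level \<phi> H = {a + b + c | a b c. a \<in> O_plus \<phi> H \<and> b \<in> O_zero \<phi> H \<and> c \<in> O_minus \<phi> H}"

text \<open>The powers \<open>A\<^sup>N\<close> (products being compositions) tend to zero in the topology defined by
  the lattice \<open>H\<close> of \<open>End(V)\<close>.\<close>

definition topologically_nilpotent :: "('v \<Rightarrow> 'v) set \<Rightarrow> ('v \<Rightarrow> 'v) set \<Rightarrow> bool" where
  "topologically_nilpotent H A \<longleftrightarrow>
     (\<forall>m. \<exists>N. \<forall>fs. set fs \<subseteq> A \<and> length fs \<ge> N \<longrightarrow> foldr (\<circ>) fs id \<in> eps_mult m H)"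

definition isomorphism_number :: "'v set \<Rightarrow> ('v \<Rightarrow> 'v) \<Rightarrow> nat" where
  "isomorphism_number M \<phi> =
     (LEAST n. \<forall>h \<in> GL_lattice M. h - id \<in> eps_mult n (End_lattice M) \<longrightarrow>
        (\<exists>g \<in> GL_lattice M. h \<circ> \<phi> = inv g \<circ> \<phi> \<circ> g))"

definition level_torsion :: "'v set \<Rightarrow> ('v \<Rightarrow> 'v) \<Rightarrow> nat" where
  "level_torsion M \<phi> =
     (let H = End_lattice M in
      if H = O_level \<phi> H \<and>
         \<not> topologically_nilpotent H {a + c | a c. a \<in> O_plus \<phi> H \<and> c \<in> O_minus \<phi> H}
      then 1
      else (LEAST n. eps_mult n H \<subseteq> O_level \<phi> H))"

end

text \<open>A free \<open>k[[\<epsilon>]]\<close>-module \<open>M\<close> of finite rank is given as a lattice in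
  \<open>V = M \<otimes> k((\<epsilon>))\<close>, the whole type \<open>'v\<close>.\<close>

locale F_crystal = fls_vector_space scale
  for scale :: "'k::field fls \<Rightarrow> 'v::ab_group_add \<Rightarrow> 'v" +
  fixes q :: nat and M :: "'v set" and \<phi> :: "'v \<Rightarrow> 'v"
  assumes lattice: "lattice_of UNIV M"
    and phi_add: "\<phi> (x + y) = \<phi> x + \<phi> y"
    and phi_scale: "\<phi> (scale c x) = scale (fls_frob q c) (\<phi> x)"
    and phi_bij: "bij \<phi>"
    and phi_lattice: "\<phi> ` M \<subseteq> M"

end

theory Submission
  imports Defs
begin

text \<open>
  Let \<open>T f = \<phi> f \<phi>\<^sup>-\<^sup>1\<close> on \<open>End V\<close> and \<open>H\<^sub>m = \<epsilon>\<^sup>m End M\<close> (called \<open>FilE m\<close>). The equation \<open>h \<phi> = g\<^sup>-\<^sup>1 \<phi> g\<close>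
  reads \<open>T g = g h\<close>; for \<open>g = 1 + y\<close> and \<open>h = 1 + z\<close> its linear part is \<open>T y - y = z\<close>. On \<open>V\<^sub>+\<close> this is
  solved by \<open>- \<Sum> T\<^sup>i z\<close>, on \<open>V\<^sub>-\<close> by \<open>\<Sum> T\<^sup>-\<^sup>i z\<close>, and on \<open>V\<^sub>0\<close> by Lang's theorem over \<open>k\<close>; the
  solution is integral when \<open>z\<close> is in \<open>O\<^sub>H\<close>. If \<open>m \<ge> 1\<close> and \<open>H\<^sub>m \<subseteq> O\<^sub>H\<close>, then \<open>y\<close> can be taken in a
  topologically nilpotent ring, so that the nonlinear equation is solved by iteration.

  Conversely, suppose that every \<open>h \<equiv> 1\<close> modulo \<open>\<epsilon>\<^sup>m\<close> is of the form \<open>g\<^sup>-\<^sup>1 T g\<close> with \<open>m \<ge> 1\<close>. There are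
  only finitely many \<open>g\<close> modulo that ring, so a pigeonhole argument solves \<open>T y - y = a z\<close> modulo
  \<open>H\<^sub>m\<^sub>+\<^sub>1\<close> for infinitely many \<open>a\<close> in \<open>k\<close>. With \<open>a = b ^ (q ^ I)\<close>, comparing the coefficients of the
  powers \<open>b ^ (q ^ n)\<close> shows that \<open>z\<close> is in \<open>O\<^sub>H\<close>, provided that \<open>H\<^sub>m\<^sub>+\<^sub>1 \<subseteq> O\<^sub>H\<close>; now use descending
  induction on \<open>m\<close>. For \<open>m = 0\<close> both sides amount to \<open>\<phi> M = \<epsilon>\<^sup>s M\<close> for some \<open>s\<close>.
\<close>

section \<open>Frobenius exponents\<close>

text \<open>The obstacle is the quadratic term. A solution y of the linear equation for z in
  \<open>FilE m\<close> need not be divisible by \<epsilon>, so y z is in general no smaller than z.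
  What saves the iteration is that y can be taken in \<open>RI m\<close>, whose long products are
  divisible by \<epsilon>: each round of correction puts one more factor from \<open>RI m\<close>
  into the error, and finitely many rounds gain a power of \<epsilon>. Counting such factors drives
  the converse as well (\<open>ZZ\<close>). The finiteness of the g rests on semilinearity: in a
  finite-dimensional quotient over k, classes fixed by T have coordinates with c^q = c. Scalars b ^
  (q ^ I) are chosen because the inverse of T extracts q-th roots; the exponent I leaves room for
  all the roots that occur, so that the coefficients stay powers of b. At m = 0 the elements 1 + y
  are no longer units automatically. This is also the origin of case (a) of the level torsion: H =
  O_H only yields level 1, and level 0 holds exactly when, in addition, O_+ and O_- together are
  topologically nilpotent, which forces V_+ and V_- to be zero.\<close>

definition frob_exponent :: "'k::field itself \<Rightarrow> nat \<Rightarrow> bool" where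
  "frob_exponent t q \<longleftrightarrow> q > 1 \<and> (\<forall>x y::'k. (x + y) ^ q = x ^ q + y ^ q)"

text \<open>Afterwards the characteristic no longer appears: every use of q goes through q > 1 and
  the additivity of the q-th power.\<close>

lemma frob_exponent_prime_power:
  assumes "CHAR('k::field) = p" "p > 0" "e > 0"
  shows "frob_exponent TYPE('k) (p ^ e)"
proof -
  have "prime p" using assms prime_CHAR_semidom[where 'a='k] by simp
  moreover have "p ^ e > 1" using \<open>prime p\<close> assms(3) prime_gt_1_nat one_less_power by blast
  ultimately show ?thesis
    unfolding frob_exponent_def using freshmans_dream'[where 'a='k] assms by metis
qed

text \<open>For a finite field, the product of all X - a, increased by 1, would be a nonconstant
  polynomial without a root. Infinity of k feeds the pigeonhole argument in the converse.\<close>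

lemma infinite_UNIV_alg_closed: "infinite (UNIV :: 'k::alg_closed_field set)"
proof
  assume fin: "finite (UNIV :: 'k set)"
  define P :: "'k poly" where "P = (\<Prod>a\<in>UNIV. [:-a, 1:]) + 1"
  have d: "degree (\<Prod>a\<in>(UNIV::'k set). [:-a, 1:]) = card (UNIV :: 'k set)"
    by (subst degree_prod_sum_eq) auto
  have "card (UNIV :: 'k set) > 0" using fin by (simp add: card_gt_0_iff)
  hence "degree P > 0" unfolding P_def using d
    by (metis degree_1 degree_add_eq_left)
  then obtain x where "poly P x = 0" using alg_closed_imp_poly_has_root by blast
  moreover have "poly (\<Prod>a\<in>(UNIV::'k set). [:-a, 1:]) x = 0"
    unfolding poly_prod using fin by (intro prod_zero) auto
  ultimately show False by (simp add: P_def)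
qed

context
  fixes q :: nat
  assumes q: "frob_exponent TYPE('k::alg_closed_field) q"
begin

lemma frob_q_gt_1: "q > 1" using q by (simp add: frob_exponent_def)

lemma frob_add: "(x + y :: 'k) ^ q = x ^ q + y ^ q"
  using q by (simp add: frob_exponent_def)

lemma frob_minus: "(- x :: 'k) ^ q = - (x ^ q)"
  using frob_add[of x "-x"] frob_q_gt_1 by (simp add: power_0_left eq_neg_iff_add_eq_0 add.commute)

lemma frob_diff: "(x - y :: 'k) ^ q = x ^ q - y ^ q"
  using frob_add[of x "-y"] frob_minus[of y] by simp

lemma frob_sum: "(\<Sum>i\<in>A. f i :: 'k) ^ q = (\<Sum>i\<in>A. f i ^ q)"
  using frob_q_gt_1 by (induction A rule: infinite_finite_induct) (auto simp: frob_add power_0_left)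

lemma frob_eq_0: "x ^ q = 0 \<longleftrightarrow> x = (0::'k)"
  using frob_q_gt_1 by auto

lemma frob_inj: "x ^ q = y ^ q \<longleftrightarrow> x = (y::'k)"
  by (metis frob_diff frob_eq_0 right_minus_eq)

lemma frob_root: "\<exists>y. y ^ q = (x::'k)"
  using nth_root_exists[of q x] frob_q_gt_1 by auto

lemma frob_pow_root: "\<exists>y. y ^ (q ^ n) = (x::'k)"
  using nth_root_exists[of "q ^ n" x] frob_q_gt_1 by auto

text \<open>These are the roots of X^q - X. This is the source of the finiteness of solutions g
  modulo \<open>RI m\<close>.\<close>

lemma finite_frob_fixed: "finite {c::'k. c ^ q = c}"
proof -
  let ?P = "monom 1 q - monom 1 1 :: 'k poly"
  have "coeff ?P q = 1" using frob_q_gt_1 by simp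
  hence "?P \<noteq> 0" by (metis coeff_0 zero_neq_one)
  moreover have "{c::'k. c ^ q = c} = {c. poly ?P c = 0}" by (auto simp: poly_monom)
  ultimately show ?thesis using poly_roots_finite by metis
qed

lemma fls_nth_frob [simp]: "fls_nth (fls_frob q f) n = fls_nth (f::'k fls) n ^ q"
  using frob_q_gt_1 by (simp add: fls_nth_fls_frob)

lemma fls_frob_0 [simp]: "fls_frob q (0::'k fls) = 0"
  by (rule fls_eqI) (use frob_q_gt_1 in \<open>simp add: power_0_left\<close>)

lemma fls_frob_eq_0_iff: "fls_frob q f = 0 \<longleftrightarrow> f = (0::'k fls)"
  by (metis fls_nth_frob fls_frob_0 fls_nonzero_nth fls_zero_nth frob_eq_0)

lemma fls_subdegree_frob [simp]: "fls_subdegree (fls_frob q f) = fls_subdegree (f::'k fls)"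
proof (cases "f = 0")
  case False
  show ?thesis
    by (rule fls_subdegree_eqI) (use False frob_q_gt_1 in \<open>auto simp: frob_eq_0\<close>)
qed simp

lemma fls_frob_const [simp]: "fls_frob q (fls_const a :: 'k fls) = fls_const (a ^ q)"
  by (rule fls_eqI) (use frob_q_gt_1 in \<open>simp add: power_0_left\<close>)

lemma fls_frob_intpow [simp]: "fls_frob q (fls_X_intpow n :: 'k fls) = fls_X_intpow n"
  by (rule fls_eqI) (use frob_q_gt_1 in \<open>simp add: power_0_left\<close>)

lemma fls_frob_surj: "\<exists>d. fls_frob q d = (c::'k fls)"
proof -
  define r :: "'k \<Rightarrow> 'k" where "r x = (SOME y. y ^ q = x)" for x
  have r: "r x ^ q = x" for x unfolding r_def using someI_ex[OF frob_root] .
  \<comment> \<open>Needed so that the chosen roots again vanish in all sufficiently negative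
    degrees and form a Laurent series.\<close>
  have r0: "r 0 = 0" using r[of 0] frob_eq_0 by blast
  have "\<forall>\<^sub>\<infinity>n::nat. r (fls_nth c (- int n)) = 0"
    using fls_nth[of c] unfolding mem_Collect_eq by (rule MOST_mono) (simp add: r0)
  hence "fls_nth (Abs_fls (\<lambda>n. r (fls_nth c n))) n = r (fls_nth c n)" for n
    by (simp add: Abs_fls_inverse)
  hence "fls_frob q (Abs_fls (\<lambda>n. r (fls_nth c n))) = c"
    by (intro fls_eqI) (simp add: r)
  thus ?thesis by blast
qed

end

section \<open>Subspaces of finite codimension\<close>

locale linear_space = vector_space scale
  for scale :: "'a::field \<Rightarrow> 'b::ab_group_add \<Rightarrow> 'b"
begin

text \<open>For nested subspaces this says that F/E has finite dimension. The chain form avoids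
  quotient spaces and dimensions, and stabilisation of chains is exactly how finiteness is consumed
  below.\<close>

definition artinian_between :: "'b set \<Rightarrow> 'b set \<Rightarrow> bool" where
  "artinian_between E F \<longleftrightarrow>
     (\<forall>U. (\<forall>n::nat. subspace (U n) \<and> E \<subseteq> U n \<and> U n \<subseteq> F) \<and>
          ((\<forall>n. U n \<subseteq> U (Suc n)) \<or> (\<forall>n. U (Suc n) \<subseteq> U n)) \<longrightarrow>
          (\<exists>n0. \<forall>n\<ge>n0. U n = U n0))"

text \<open>The modular law: an element of B differs from an element of A by an element of G, and
  this difference lies in both B and G, hence in A.\<close>

lemma modular_eq:
  assumes "subspace G" "subspace B" "A \<subseteq> B" "A \<inter> G = B \<inter> G"
    and "{x + y |x y. x \<in> A \<and> y \<in> G} = {x + y |x y. x \<in> B \<and> y \<in> G}"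
    and "subspace A"
  shows "A = B"
proof (intro equalityI assms(3) subsetI)
  fix b assume b: "b \<in> B"
  hence "b + 0 \<in> {x + y |x y. x \<in> B \<and> y \<in> G}" using subspace_0[OF assms(1)] by blast
  then obtain a g where ag: "b + 0 = a + g" "a \<in> A" "g \<in> G" unfolding assms(5)[symmetric] by auto
  hence "g = b - a" by (simp add: algebra_simps)
  hence "g \<in> B \<inter> G" using subspace_diff[OF assms(2) b] ag assms(3) by blast
  hence "g \<in> A" using assms(4) by blast
  thus "b \<in> A" using ag subspace_add[OF assms(6)] by force
qed

text \<open>A chain between E and F is controlled by its traces on G and its sums with G; once both
  are stationary, \<open>modular_eq\<close> makes the chain itself stationary.\<close>

lemma artinian_trans:
  assumes EG: "artinian_between E G" and GF: "artinian_between G F"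
    and sG: "subspace G" and sE: "subspace E" and sF: "subspace F" and sub: "E \<subseteq> G" "G \<subseteq> F"
  shows "artinian_between E F"
  unfolding artinian_between_def
proof (intro allI impI, elim conjE)
  fix U :: "nat \<Rightarrow> 'b set"
  assume U: "\<forall>n. subspace (U n) \<and> E \<subseteq> U n \<and> U n \<subseteq> F"
    and mono: "(\<forall>n. U n \<subseteq> U (Suc n)) \<or> (\<forall>n. U (Suc n) \<subseteq> U n)"
  define A where "A n = U n \<inter> G" for n
  define S where "S n = {x + y |x y. x \<in> U n \<and> y \<in> G}" for n
  have "(\<forall>n. subspace (A n) \<and> E \<subseteq> A n \<and> A n \<subseteq> G) \<and>
     ((\<forall>n. A n \<subseteq> A (Suc n)) \<or> (\<forall>n. A (Suc n) \<subseteq> A n))"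
    using U mono sG sub unfolding A_def by (auto intro: subspace_inter)
  then obtain n1 where n1: "\<forall>n\<ge>n1. A n = A n1" using EG unfolding artinian_between_def by blast
  have SF: "S n \<subseteq> F" for n
    unfolding S_def using U sub subspace_add[OF sF] by blast
  have GS: "G \<subseteq> S n" for n
  proof
    fix g assume "g \<in> G"
    moreover have "0 \<in> U n" using U subspace_0 by blast
    ultimately have "0 + g \<in> S n" unfolding S_def by blast
    thus "g \<in> S n" by simp
  qed
  have sS: "subspace (S n)" for n unfolding S_def using U sG by (intro subspace_sums) auto
  have "(\<forall>n. S n \<subseteq> S (Suc n)) \<or> (\<forall>n. S (Suc n) \<subseteq> S n)"
    using mono unfolding S_def by (elim disjE) blast+
  hence "(\<forall>n. subspace (S n) \<and> G \<subseteq> S n \<and> S n \<subseteq> F) \<and>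
     ((\<forall>n. S n \<subseteq> S (Suc n)) \<or> (\<forall>n. S (Suc n) \<subseteq> S n))"
    using sS GS SF by blast
  then obtain n2 where n2: "\<forall>n\<ge>n2. S n = S n2" using GF unfolding artinian_between_def by blast
  define N where "N = max n1 n2"
  show "\<exists>n0. \<forall>n\<ge>n0. U n = U n0"
  proof (intro exI[of _ N] allI impI)
    fix n assume n: "n \<ge> N"
    have eq: "A n = A N" "S n = S N" using n n1 n2 unfolding N_def by (metis max.bounded_iff max.cobounded1 max.cobounded2)+
    have "U n \<subseteq> U N \<or> U N \<subseteq> U n"
      using mono n by (metis lift_Suc_antimono_le lift_Suc_mono_le)
    thus "U n = U N"
    proof
      assume "U n \<subseteq> U N"
      thus ?thesis using modular_eq[of G "U N" "U n"] U sG eq unfolding A_def S_def by blast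
    next
      assume "U N \<subseteq> U n"
      thus ?thesis using modular_eq[of G "U n" "U N"] U sG eq unfolding A_def S_def by blast
    qed
  qed
qed

lemma artinian_refl: "artinian_between E E"
  unfolding artinian_between_def by blast

text \<open>With one generator added there are only the two extreme intermediate subspaces, so a
  monotone chain changes at most once.\<close>

lemma artinian_insert:
  assumes sE: "subspace E"
  shows "artinian_between E {x + y |x y. x \<in> E \<and> y \<in> span {g}}"
  unfolding artinian_between_def
proof (intro allI impI, elim conjE)
  let ?F = "{x + y |x y. x \<in> E \<and> y \<in> span {g}}"
  fix U :: "nat \<Rightarrow> 'b set"
  assume U: "\<forall>n. subspace (U n) \<and> E \<subseteq> U n \<and> U n \<subseteq> ?F"
    and mono: "(\<forall>n. U n \<subseteq> U (Suc n)) \<or> (\<forall>n. U (Suc n) \<subseteq> U n)"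
  have two: "U n = E \<or> U n = ?F" for n
  proof (cases "U n \<subseteq> E")
    case False
    then obtain u where u: "u \<in> U n" "u \<notin> E" by blast
    then obtain x a where xa: "u = x + scale a g" "x \<in> E" using U unfolding span_singleton by blast
    hence "a \<noteq> 0" using u by auto
    have "scale a g \<in> U n" using subspace_diff[of "U n" u x] U u xa by auto
    hence "scale (1/a) (scale a g) \<in> U n" using U subspace_scale by blast
    hence "g \<in> U n" using \<open>a \<noteq> 0\<close> by simp
    hence "span {g} \<subseteq> U n" using U by (intro span_minimal) auto
    hence "?F \<subseteq> U n" using U subspace_add[of "U n"] by blast
    thus ?thesis using U by blast
  qed (use U in blast)
  show "\<exists>n0. \<forall>n\<ge>n0. U n = U n0"
    using mono
  proof
    assume inc: "\<forall>n. U n \<subseteq> U (Suc n)"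
    hence le: "n \<le> m \<Longrightarrow> U n \<subseteq> U m" for n m using lift_Suc_mono_le by blast
    show ?thesis
    proof (cases "\<exists>n. U n = ?F")
      case True
      then obtain n0 where n0: "U n0 = ?F" by blast
      have "U n = U n0" if "n \<ge> n0" for n using le[OF that] U n0 by blast
      thus ?thesis by blast
    next
      case False
      have "U n = E" for n using two[of n] False by blast
      thus ?thesis by blast
    qed
  next
    assume dec: "\<forall>n. U (Suc n) \<subseteq> U n"
    hence le: "n \<le> m \<Longrightarrow> U m \<subseteq> U n" for n m using lift_Suc_antimono_le by blast
    show ?thesis
    proof (cases "\<exists>n. U n = E")
      case True
      then obtain n0 where n0: "U n0 = E" by blast
      have "U n = U n0" if "n \<ge> n0" for n using le[OF that] U n0 by blast
      thus ?thesis by blast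
    next
      case False
      have "U n = ?F" for n using two[of n] False by blast
      thus ?thesis by blast
    qed
  qed
qed

lemma artinian_finite_span:
  assumes "finite G" and sE: "subspace E"
  shows "artinian_between E {x + y |x y. x \<in> E \<and> y \<in> span G}"
  using assms(1)
proof (induction G)
  case empty
  have "{x + y |x y. x \<in> E \<and> y \<in> span {}} = E" by simp
  thus ?case using artinian_refl by simp
next
  case (insert g G)
  let ?A = "{x + y |x y. x \<in> E \<and> y \<in> span G}"
  let ?B = "{x + y |x y. x \<in> ?A \<and> y \<in> span {g}}"
  have sA: "subspace ?A" using sE by (intro subspace_sums) auto
  have B: "?B = {x + y |x y. x \<in> E \<and> y \<in> span (insert g G)}" (is "_ = ?C")
  proof (intro equalityI subsetI)
    fix v assume "v \<in> ?B"
    then obtain x y z where v: "v = x + y + z" "x \<in> E" "y \<in> span G" "z \<in> span {g}" by blast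
    have "y + z \<in> span (insert g G)"
      using v span_mono[of G "insert g G"] span_mono[of "{g}" "insert g G"]
      by (intro span_add) auto
    thus "v \<in> ?C" using v by (auto simp: add.assoc)
  next
    fix v assume "v \<in> ?C"
    then obtain x y where v: "v = x + y" "x \<in> E" "y \<in> span (insert g G)" by blast
    then obtain a where a: "y - scale a g \<in> span G" using span_breakdown_eq by blast
    have "v = (x + (y - scale a g)) + scale a g" using v by simp
    thus "v \<in> ?B" using v a span_scale[OF span_base, of g "{g}" a] by blast
  qed
  have "subspace ?B" by (rule subspace_sums[OF sA subspace_span])
  moreover have "E \<subseteq> ?A"
  proof
    fix v assume "v \<in> E"
    hence "v + 0 \<in> ?A" using span_zero by blast
    thus "v \<in> ?A" by simp
  qed
  moreover have "?A \<subseteq> ?B"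
  proof
    fix v assume "v \<in> ?A"
    hence "v + 0 \<in> ?B" using span_zero by blast
    thus "v \<in> ?B" by simp
  qed
  ultimately have "artinian_between E ?B"
    using artinian_trans[OF insert.IH artinian_insert[OF sA] sA sE] by blast
  thus ?case unfolding B .
qed

lemma artinian_mono:
  assumes "artinian_between E F" "E \<subseteq> E'" "F' \<subseteq> F"
  shows "artinian_between E' F'"
  unfolding artinian_between_def
proof (intro allI impI)
  fix U :: "nat \<Rightarrow> 'b set"
  assume U: "(\<forall>n. subspace (U n) \<and> E' \<subseteq> U n \<and> U n \<subseteq> F') \<and>
     ((\<forall>n. U n \<subseteq> U (Suc n)) \<or> (\<forall>n. U (Suc n) \<subseteq> U n))"
  hence "(\<forall>n. subspace (U n) \<and> E \<subseteq> U n \<and> U n \<subseteq> F) \<and>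
     ((\<forall>n. U n \<subseteq> U (Suc n)) \<or> (\<forall>n. U (Suc n) \<subseteq> U n))" using assms by blast
  thus "\<exists>n0. \<forall>n\<ge>n0. U n = U n0" using assms(1) unfolding artinian_between_def by blast
qed

text \<open>A chain between E' and F' is recovered as the trace on F' of its sums with E, and these
  sums form a chain between E and F.\<close>

lemma artinian_restrict:
  assumes art: "artinian_between E F" and sE: "subspace E" and sF: "subspace F"
    and E': "E \<inter> F' \<subseteq> E'" and F': "subspace F'" "F' \<subseteq> F" and EF: "E \<subseteq> F"
  shows "artinian_between E' F'"
  unfolding artinian_between_def
proof (intro allI impI, elim conjE)
  fix U :: "nat \<Rightarrow> 'b set"
  assume U: "\<forall>n. subspace (U n) \<and> E' \<subseteq> U n \<and> U n \<subseteq> F'"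
    and mono: "(\<forall>n. U n \<subseteq> U (Suc n)) \<or> (\<forall>n. U (Suc n) \<subseteq> U n)"
  define S where "S n = {x + y |x y. x \<in> U n \<and> y \<in> E}" for n
  have SF: "S n \<subseteq> F" for n
    unfolding S_def using U EF F' subspace_add[OF sF] by blast
  have ES: "E \<subseteq> S n" for n
  proof
    fix g assume "g \<in> E"
    moreover have "0 \<in> U n" using U subspace_0 by blast
    ultimately have "0 + g \<in> S n" unfolding S_def by blast
    thus "g \<in> S n" by simp
  qed
  have sS: "subspace (S n)" for n unfolding S_def using U sE by (intro subspace_sums) auto
  have "(\<forall>n. S n \<subseteq> S (Suc n)) \<or> (\<forall>n. S (Suc n) \<subseteq> S n)"
    using mono unfolding S_def by (elim disjE) blast+
  hence "(\<forall>n. subspace (S n) \<and> E \<subseteq> S n \<and> S n \<subseteq> F) \<and>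
     ((\<forall>n. S n \<subseteq> S (Suc n)) \<or> (\<forall>n. S (Suc n) \<subseteq> S n))"
    using sS ES SF by blast
  then obtain n2 where n2: "\<forall>n\<ge>n2. S n = S n2" using art unfolding artinian_between_def by blast
  have rec: "U n = S n \<inter> F'" for n
  proof (intro equalityI subsetI)
    fix u assume "u \<in> U n"
    moreover have "u + 0 \<in> S n" unfolding S_def using \<open>u \<in> U n\<close> subspace_0[OF sE] by blast
    ultimately show "u \<in> S n \<inter> F'" using U by auto
  next
    fix u assume u: "u \<in> S n \<inter> F'"
    then obtain x e where xe: "u = x + e" "x \<in> U n" "e \<in> E" unfolding S_def by blast
    have "x \<in> F'" using xe U by blast
    hence "u - x \<in> F'" using u subspace_diff[OF F'(1)] by blast
    hence "e \<in> U n" using xe E' U by auto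
    thus "u \<in> U n" using xe U subspace_add by blast
  qed
  show "\<exists>n0. \<forall>n\<ge>n0. U n = U n0" using n2 rec by metis
qed

section \<open>Linear dependence modulo a subspace, and Vandermonde arguments\<close>

lemma span_lessThan_sum:
  assumes "x \<in> span (y ` {..<n::nat})"
  shows "\<exists>c. x = (\<Sum>i<n. scale (c i) (y i))"
  using assms
proof (induction n arbitrary: x)
  case (Suc n)
  hence "x \<in> span (insert (y n) (y ` {..<n}))" by (simp add: lessThan_Suc)
  then obtain a where "x - scale a (y n) \<in> span (y ` {..<n})" using span_breakdown_eq by blast
  then obtain c where c: "x - scale a (y n) = (\<Sum>i<n. scale (c i) (y i))" using Suc.IH by blast
  have "x = (\<Sum>i<Suc n. scale ((c(n := a)) i) (y i))"
    using c by (simp add: algebra_simps)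
  thus ?case by blast
qed simp

text \<open>The spans of initial segments stabilise modulo R, so some y d depends on its
  predecessors; for the least such d the earlier vectors are independent modulo R. The typical use
  is the sequence of iterates of one vector under a semilinear map.\<close>

lemma artinian_dependence:
  fixes y :: "nat \<Rightarrow> 'b"
  assumes art: "artinian_between R F" and R: "subspace R" "R \<subseteq> F" and F: "subspace F"
    and y: "\<And>i. y i \<in> F"
  obtains d c where "y d - (\<Sum>i<d. scale (c i) (y i)) \<in> R"
    and "\<And>a i. (\<Sum>i<d. scale (a i) (y i)) \<in> R \<Longrightarrow> i < d \<Longrightarrow> a i = 0"
proof -
  define U where "U d = {x + r |x r. x \<in> span (y ` {..<d}) \<and> r \<in> R}" for d :: nat
  have "subspace (U n)" for n unfolding U_def using R by (intro subspace_sums) auto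
  moreover have "R \<subseteq> U n" for n
  proof
    fix v assume "v \<in> R"
    hence "0 + v \<in> U n" unfolding U_def using span_zero by blast
    thus "v \<in> U n" by simp
  qed
  moreover have "U n \<subseteq> F" for n
    unfolding U_def using span_minimal[of "y ` {..<n}" F] y F R subspace_add[OF F] by blast
  moreover have "U n \<subseteq> U (Suc n)" for n
  proof -
    have "span (y ` {..<n}) \<subseteq> span (y ` {..<Suc n})" by (intro span_mono) auto
    thus ?thesis unfolding U_def by blast
  qed
  ultimately obtain n0 where n0: "\<forall>n\<ge>n0. U n = U n0" using art unfolding artinian_between_def by blast
  have "y n0 + 0 \<in> U (Suc n0)" unfolding U_def
    using subspace_0[OF R(1)] span_base[of "y n0" "y ` {..<Suc n0}"] by blast
  hence "y n0 \<in> U n0" using n0 by (metis Suc_leD le_refl Suc_n_not_le_n add.right_neutral le_SucI)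
  then obtain x r where xr: "y n0 = x + r" "x \<in> span (y ` {..<n0})" "r \<in> R" unfolding U_def by blast
  then obtain c where "x = (\<Sum>i<n0. scale (c i) (y i))" using span_lessThan_sum by blast
  hence "y n0 - (\<Sum>i<n0. scale (c i) (y i)) \<in> R" using xr by simp
  hence ex: "\<exists>d. \<exists>c. y d - (\<Sum>i<d. scale (c i) (y i)) \<in> R" (is "\<exists>d. ?P d") by blast
  define d where "d = (LEAST d. ?P d)"
  have "?P d" unfolding d_def by (rule LeastI_ex[OF ex])
  then obtain c where c: "y d - (\<Sum>i<d. scale (c i) (y i)) \<in> R" by blast
  have "a i = 0" if a: "(\<Sum>i<d. scale (a i) (y i)) \<in> R" and i: "i < d" for a i
  proof (rule ccontr)
    assume "a i \<noteq> 0"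
    \<comment> \<open>The last index with nonzero coefficient: solving for y j would give a
      dependence at an index below the minimal d.\<close>
    define j where "j = Max {i. i < d \<and> a i \<noteq> 0}"
    have j: "j \<in> {i. i < d \<and> a i \<noteq> 0}" unfolding j_def
      using i \<open>a i \<noteq> 0\<close> by (intro Max_in) auto
    have jmax: "a l = 0" if "l < d" "j < l" for l
    proof (rule ccontr)
      assume "a l \<noteq> 0"
      hence "l \<le> j" unfolding j_def using that by (intro Max_ge) auto
      thus False using that by simp
    qed
    have "(\<Sum>i<d. scale (a i) (y i)) = (\<Sum>i<Suc j. scale (a i) (y i))"
      by (rule sum.mono_neutral_right) (use j jmax in \<open>auto simp: less_Suc_eq_le not_less\<close>)
    also have "\<dots> = (\<Sum>i<j. scale (a i) (y i)) + scale (a j) (y j)" by simp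
    finally have "scale (1 / a j) ((\<Sum>i<j. scale (a i) (y i)) + scale (a j) (y j)) \<in> R"
      using a R subspace_scale by metis
    moreover have "scale (1 / a j) ((\<Sum>i<j. scale (a i) (y i)) + scale (a j) (y j))
        = y j - (\<Sum>i<j. scale (- a i / a j) (y i))"
      using j by (simp add: scale_right_distrib scale_sum_right sum_negf)
    ultimately have "?P j" by metis
    hence "d \<le> j" unfolding d_def by (rule Least_le)
    thus False using j by simp
  qed
  thus thesis using that c by blast
qed

text \<open>Induction on K: subtracting the value at one point b0 leaves a sum divisible by b - b0,
  and the quotient has one coefficient fewer and still takes values in U.\<close>

lemma vandermonde_subspace:
  assumes U: "subspace U" and inf: "infinite S"
    and w: "\<And>b. b \<in> S \<Longrightarrow> (\<Sum>i<K. scale (b ^ i) (w i)) \<in> U" and "j < (K::nat)"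
  shows "w j \<in> U"
  using assms(2-)
proof (induction K arbitrary: w j S)
  case (Suc K)
  obtain b0 where b0: "b0 \<in> S" using Suc.prems(1) by (meson finite.emptyI finite_subset subsetI ex_in_conv)
  \<comment> \<open>Coefficients of the quotient (P(b) - P(b0)) / (b - b0) for P(b) = \<Sum> b^i
    w_i; the recursion \<open>w'_rec\<close> is Horner's rule, from which the w i are
    recovered.\<close>
  define w' where "w' j = (\<Sum>i\<in>{Suc j..K}. scale (b0 ^ (i - 1 - j)) (w i))" for j
  have w'_rec: "w' j = w (Suc j) + scale b0 (w' (Suc j))" if "j < K" for j
  proof -
    have "{Suc j..K} = insert (Suc j) {Suc (Suc j)..K}" using that by auto
    hence "w' j = w (Suc j) + (\<Sum>i\<in>{Suc (Suc j)..K}. scale (b0 ^ (i - 1 - j)) (w i))"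
      unfolding w'_def by simp
    also have "(\<Sum>i\<in>{Suc (Suc j)..K}. scale (b0 ^ (i - 1 - j)) (w i)) =
      (\<Sum>i\<in>{Suc (Suc j)..K}. scale (b0 * b0 ^ (i - 1 - Suc j)) (w i))"
    proof (rule sum.cong[OF refl])
      fix i assume "i \<in> {Suc (Suc j)..K}"
      hence "i - 1 - j = Suc (i - 1 - Suc j)" by auto
      thus "scale (b0 ^ (i - 1 - j)) (w i) = scale (b0 * b0 ^ (i - 1 - Suc j)) (w i)" by simp
    qed
    also have "\<dots> = scale b0 (w' (Suc j))" unfolding w'_def by (simp add: scale_sum_right)
    finally show ?thesis .
  qed
  have w'K: "w' K = 0" unfolding w'_def by simp
  have pow: "b ^ i - b0 ^ i = (b - b0) * (\<Sum>l<i. b ^ l * b0 ^ (i - 1 - l))" for b i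
    using power_diff_sumr2[of b i b0] by (simp add: mult.commute)
  have swap: "(\<Sum>i<Suc K. scale (b ^ i - b0 ^ i) (w i)) = scale (b - b0) (\<Sum>l<K. scale (b ^ l) (w' l))" for b
  proof -
    have "(\<Sum>i<Suc K. scale (b ^ i - b0 ^ i) (w i)) =
      (\<Sum>i<Suc K. \<Sum>l<i. scale (b - b0) (scale (b ^ l) (scale (b0 ^ (i - 1 - l)) (w i))))"
      unfolding pow by (simp add: scale_sum_left sum_distrib_left mult.assoc)
    also have "\<dots> = (\<Sum>l<K. \<Sum>i\<in>{Suc l..K}. scale (b - b0) (scale (b ^ l) (scale (b0 ^ (i - 1 - l)) (w i))))"
      unfolding sum.Sigma[OF finite_lessThan ballI[OF finite_lessThan]]
        sum.Sigma[OF finite_lessThan ballI[OF finite_atLeastAtMost]]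
      by (rule sum.reindex_bij_witness[of _ "\<lambda>(l,i). (i,l)" "\<lambda>(i,l). (l,i)"]) auto
    also have "\<dots> = scale (b - b0) (\<Sum>l<K. scale (b ^ l) (w' l))"
      unfolding w'_def by (simp add: scale_sum_right)
    finally show ?thesis .
  qed
  have w'U: "w' l \<in> U" if "l < K" for l
  proof (rule Suc.IH[of "S - {b0}"])
    show "infinite (S - {b0})" using Suc.prems(1) by simp
  next
    fix b assume b: "b \<in> S - {b0}"
    have "(\<Sum>i<Suc K. scale (b ^ i) (w i)) - (\<Sum>i<Suc K. scale (b0 ^ i) (w i)) \<in> U"
      using b b0 Suc.prems(2) by (intro subspace_diff[OF U]) auto
    also have "(\<Sum>i<Suc K. scale (b ^ i) (w i)) - (\<Sum>i<Suc K. scale (b0 ^ i) (w i))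
      = (\<Sum>i<Suc K. scale (b ^ i - b0 ^ i) (w i))"
      by (simp only: sum_subtractf[symmetric] scale_left_diff_distrib)
    finally have "scale (1 / (b - b0)) (scale (b - b0) (\<Sum>l<K. scale (b ^ l) (w' l))) \<in> U"
      unfolding swap using subspace_scale[OF U] by blast
    thus "(\<Sum>i<K. scale (b ^ i) (w' i)) \<in> U" using b by simp
  qed (use that in simp)
  have w'U': "w' l \<in> U" if "l \<le> K" for l
    using that w'U w'K subspace_0[OF U] by (cases "l = K") auto
  have wS: "w (Suc l) \<in> U" if "l < K" for l
  proof -
    have "w (Suc l) = w' l - scale b0 (w' (Suc l))" using w'_rec[OF that] by simp
    thus ?thesis using w'U' that subspace_diff[OF U] subspace_scale[OF U] by (metis Suc_leI less_imp_le)
  qed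
  show ?case
  proof (cases j)
    case 0
    have "(\<Sum>i<Suc K. scale (b0 ^ i) (w i)) = w 0 + (\<Sum>i<K. scale (b0 ^ Suc i) (w (Suc i)))"
      unfolding sum.lessThan_Suc_shift by simp
    moreover have "(\<Sum>i<K. scale (b0 ^ Suc i) (w (Suc i))) \<in> U"
      using wS by (intro subspace_sum[OF U] subspace_scale[OF U]) auto
    ultimately have "w 0 \<in> U" using Suc.prems(2)[OF b0] subspace_diff[OF U] by (metis add_diff_cancel_right')
    thus ?thesis using 0 by simp
  qed (use wS Suc.prems in auto)
qed simp

text \<open>The exponents q ^ n are distinct, so such a sum is an ordinary polynomial sum of length
  q ^ K with zeros in the gaps.\<close>

lemma vandermonde_frob_subspace:
  assumes U: "subspace U" and inf: "infinite S" and q: "q > (1::nat)"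
    and w: "\<And>b. b \<in> S \<Longrightarrow> (\<Sum>n<K. scale (b ^ (q ^ n)) (w n)) \<in> U" and j: "j < (K::nat)"
  shows "w j \<in> U"
proof -
  have inj: "inj_on (\<lambda>n. q ^ n) A" for A using q by (auto intro: inj_onI)
  define w' where "w' i = (if \<exists>n<K. i = q ^ n then w (THE n. i = q ^ n) else 0)" for i
  have w'q: "w' (q ^ n) = w n" if "n < K" for n
    unfolding w'_def using that q by auto
  have sum: "(\<Sum>i<q ^ K. scale (b ^ i) (w' i)) = (\<Sum>n<K. scale (b ^ (q ^ n)) (w n))" for b
  proof -
    have "(\<Sum>i<q ^ K. scale (b ^ i) (w' i)) = (\<Sum>i\<in>(\<lambda>n. q ^ n) ` {..<K}. scale (b ^ i) (w' i))"
      by (rule sum.mono_neutral_right) (use q in \<open>auto simp: w'_def\<close>)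
    also have "\<dots> = (\<Sum>n<K. scale (b ^ (q ^ n)) (w' (q ^ n)))"
      by (subst sum.reindex[OF inj]) simp
    also have "\<dots> = (\<Sum>n<K. scale (b ^ (q ^ n)) (w n))" using w'q by simp
    finally show ?thesis .
  qed
  have "w' (q ^ j) \<in> U"
    by (rule vandermonde_subspace[OF U inf, where w = w' and K = "q ^ K"]) (use w sum q j in auto)
  thus ?thesis using w'q[OF j] by simp
qed

end

section \<open>Frobenius-semilinear maps\<close>

locale frobenius_map = linear_space scale
  for scale :: "'k::alg_closed_field \<Rightarrow> 'b::ab_group_add \<Rightarrow> 'b" +
  fixes q :: nat and T :: "'b \<Rightarrow> 'b"
  assumes q: "frob_exponent TYPE('k) q"
    and T_add: "T (x + y) = T x + T y"
    and T_scale: "T (scale a x) = scale (a ^ q) (T x)"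
begin

lemma T_0 [simp]: "T 0 = 0" using T_add[of 0 0] by simp

lemma T_minus: "T (- x) = - T x" using T_add[of x "-x"] by (simp add: eq_neg_iff_add_eq_0 add.commute)

lemma T_diff: "T (x - y) = T x - T y" using T_add[of x "-y"] by (simp add: T_minus)

lemma T_sum: "T (\<Sum>i\<in>A. f i) = (\<Sum>i\<in>A. T (f i))"
  by (induction A rule: infinite_finite_induct) (auto simp: T_add)

text \<open>The coefficients \<open>X i\<close> are found by comparing coefficients in \<open>x - T x = t w\<close> for
  \<open>x = \<Sum> X i T\<^sup>i w\<close>; the only remaining condition is the equation for \<open>s = X (d - 1)\<close>.\<close>

lemma frobenius_cyclic_solution:
  assumes d: "d > 0" and t: "t ^ q = t"
    and s: "s = t + (\<Sum>i<d. a i ^ (q ^ (d - 1 - i)) * s ^ (q ^ (d - i)))"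
  obtains X where "X (d - 1) = s"
    and "(\<Sum>i<d. scale (X i) ((T ^^ i) w)) - T (\<Sum>i<d. scale (X i) ((T ^^ i) w)) - scale t w =
         - scale (s ^ q) ((T ^^ d) w - (\<Sum>i<d. scale (a i) ((T ^^ i) w)))"
proof -
  obtain e where e: "d = Suc e" using d by (cases d) auto
  define X where "X = rec_nat (t + a 0 * s ^ q) (\<lambda>i x. x ^ q + a (Suc i) * s ^ q)"
  have X0: "X 0 = t + a 0 * s ^ q" and XS: "X (Suc i) = X i ^ q + a (Suc i) * s ^ q" for i
    by (simp_all add: X_def)
  have X: "X n = t + (\<Sum>i\<le>n. a i ^ (q ^ (n - i)) * s ^ (q ^ (Suc n - i)))" for n
  proof (induction n)
    case (Suc n)
    have "X (Suc n) = t + (\<Sum>i\<le>n. (a i ^ (q ^ (n - i)) * s ^ (q ^ (Suc n - i))) ^ q) + a (Suc n) * s ^ q"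
      unfolding XS Suc.IH by (simp add: frob_add[OF q] frob_sum[OF q] t)
    also have "(\<Sum>i\<le>n. (a i ^ (q ^ (n - i)) * s ^ (q ^ (Suc n - i))) ^ q) =
       (\<Sum>i\<le>n. a i ^ (q ^ (Suc n - i)) * s ^ (q ^ (Suc (Suc n) - i)))"
      by (intro sum.cong refl)
        (simp add: Suc_diff_le power_mult_distrib power_mult[symmetric] mult.commute)
    finally show ?case by simp
  qed (simp add: X0)
  have Xe: "X e = s" unfolding X using s by (simp add: e lessThan_Suc_atMost)
  let ?w = "\<lambda>i. (T ^^ i) w"
  have "T (\<Sum>i<d. scale (X i) (?w i)) = (\<Sum>i<d. scale (X i ^ q) (?w (Suc i)))"
    by (simp add: T_sum T_scale)
  also have "\<dots> = (\<Sum>i<e. scale (X i ^ q) (?w (Suc i))) + scale (s ^ q) (?w d)"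
    unfolding e by (simp add: Xe)
  finally have 1: "T (\<Sum>i<d. scale (X i) (?w i)) =
    (\<Sum>i<e. scale (X i ^ q) (?w (Suc i))) + scale (s ^ q) (?w d)" .
  have 2: "(\<Sum>i<d. scale (X i) (?w i)) =
     scale (t + a 0 * s ^ q) w + (\<Sum>i<e. scale (X i ^ q + a (Suc i) * s ^ q) (?w (Suc i)))"
    unfolding e sum.lessThan_Suc_shift by (simp add: X0 XS)
  have 3: "scale (s ^ q) (\<Sum>i<d. scale (a i) (?w i)) =
     scale (a 0 * s ^ q) w + (\<Sum>i<e. scale (a (Suc i) * s ^ q) (?w (Suc i)))"
    unfolding e sum.lessThan_Suc_shift by (simp add: scale_right_distrib scale_sum_right mult.commute)
  have "(\<Sum>i<d. scale (X i) (?w i)) - T (\<Sum>i<d. scale (X i) (?w i)) - scale t w =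
      - scale (s ^ q) (?w d - (\<Sum>i<d. scale (a i) (?w i)))"
    unfolding 1 unfolding 2 scale_right_diff_distrib 3
    by (simp add: scale_left_distrib sum.distrib algebra_simps)
  thus thesis using that Xe e by auto
qed

lemma funpow_closed:
  assumes "T ` N \<subseteq> N" "w \<in> N" shows "(T ^^ i) w \<in> N"
  using assms by (induction i) auto

text \<open>The additive form of Lang's theorem modulo N1. The equation is solved inside the cyclic
  span of w, where it reduces to one polynomial equation for s with t = 1, solvable since k is
  algebraically closed.\<close>

lemma lang_surjective:
  assumes N: "subspace N" and N1: "subspace N1" "N1 \<subseteq> N" and TN: "T ` N \<subseteq> N" and w: "w \<in> N"
    and art: "artinian_between N1 N"
  obtains x where "x \<in> N" "T x - x - w \<in> N1"
proof -
  obtain d a where dep: "(T ^^ d) w - (\<Sum>i<d. scale (a i) ((T ^^ i) w)) \<in> N1"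
    by (rule artinian_dependence[OF art N1 N, of "\<lambda>i. (T ^^ i) w"]) (rule funpow_closed[OF TN w])
  show thesis
  proof (cases "d = 0")
    case True
    thus thesis using dep that[of 0] subspace_0[OF N] subspace_neg[OF N1(1)] by simp
  next
    case False
    define P :: "'k poly" where
      "P = [:-1, 1:] - (\<Sum>i<d. monom (a i ^ (q ^ (d - 1 - i))) (q ^ (d - i)))"
    \<comment> \<open>Every other exponent exceeds 1, so the coefficient of X in P is exactly 1, and
      P is not constant whatever the a i are.\<close>
    have "q ^ (d - i) \<noteq> Suc 0" if "i < d" for i
      using frob_q_gt_1[OF q] that by (simp add: one_less_power nat_neq_iff)
    hence "coeff P 1 = 1" unfolding P_def by (simp add: coeff_sum)
    hence "degree P > 0" using le_degree[of P 1] by simp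
    then obtain s where "poly P s = 0" using alg_closed_imp_poly_has_root by blast
    hence s: "s = 1 + (\<Sum>i<d. a i ^ (q ^ (d - 1 - i)) * s ^ (q ^ (d - i)))"
      by (simp add: P_def poly_sum poly_monom algebra_simps)
    obtain X where X: "(\<Sum>i<d. scale (X i) ((T ^^ i) w)) - T (\<Sum>i<d. scale (X i) ((T ^^ i) w)) - scale 1 w =
         - scale (s ^ q) ((T ^^ d) w - (\<Sum>i<d. scale (a i) ((T ^^ i) w)))"
      using frobenius_cyclic_solution[OF _ _ s, of w] False by auto
    define x where "x = - (\<Sum>i<d. scale (X i) ((T ^^ i) w))"
    have "x \<in> N" unfolding x_def using funpow_closed[OF TN w]
      by (intro subspace_neg[OF N] subspace_sum[OF N] subspace_scale[OF N])
    moreover have "T x - x - w = - scale (s ^ q) ((T ^^ d) w - (\<Sum>i<d. scale (a i) ((T ^^ i) w)))"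
      using X unfolding x_def T_minus by simp
    hence "T x - x - w \<in> N1" using subspace_neg[OF N1(1) subspace_scale[OF N1(1) dep, of "s ^ q"]] by simp
    ultimately show thesis by (rule that)
  qed
qed

text \<open>Suppose that w lies outside the span X of the fixed vectors. A nonzero root s for t = 0
  produces some x outside X with x - T x in X; solving Lang's equation inside X then corrects x to a
  fixed vector outside X.\<close>

lemma fixed_vectors_span:
  assumes N: "subspace N" and TN: "T ` N \<subseteq> N" and inj: "inj_on T N"
    and art: "artinian_between {0} N"
  shows "N \<subseteq> span {x \<in> N. T x = x}"
proof (rule ccontr)
  define X where "X = span {x \<in> N. T x = x}"
  assume "\<not> N \<subseteq> span {x \<in> N. T x = x}"
  then obtain w where w: "w \<in> N" "w \<notin> X" unfolding X_def by blast
  have sX: "subspace X" unfolding X_def by simp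
  have XN: "X \<subseteq> N" unfolding X_def by (rule span_minimal) (use N in auto)
  have TX: "T x \<in> X" if "x \<in> X" for x
    using that unfolding X_def
  proof (induction rule: span_induct_alt)
    case (step c x y)
    thus ?case by (auto simp: T_add T_scale intro!: span_add span_scale intro: span_base)
  qed (simp add: span_zero)
  have TXs: "\<exists>y\<in>X. T y = x" if "x \<in> X" for x
    using that unfolding X_def
  proof (induction rule: span_induct_alt)
    case (step c x y)
    then obtain z where z: "z \<in> span {x \<in> N. T x = x}" "T z = y" by blast
    obtain c' where c': "c' ^ q = c" using frob_root[OF q] by blast
    have "T (scale c' x + z) = scale c x + y" using step c' z by (simp add: T_add T_scale)
    moreover have "scale c' x + z \<in> span {x \<in> N. T x = x}"
      using step z by (intro span_add span_scale) (auto intro: span_base)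
    ultimately show ?case by blast
  qed (use span_zero in force)
  have TXs': "\<exists>y\<in>X. (T ^^ d) y = x" if "x \<in> X" for x d
    using that
  proof (induction d arbitrary: x)
    case (Suc d)
    then obtain y where y: "y \<in> X" "T y = x" using TXs by blast
    then obtain z where "z \<in> X" "(T ^^ d) z = y" using Suc.IH by blast
    thus ?case using y by auto
  qed auto
  have injd: "x = y" if "(T ^^ d) x = (T ^^ d) y" "x \<in> N" "y \<in> N" for x y d
    using that
  proof (induction d)
    case (Suc d)
    have "(T ^^ d) x = (T ^^ d) y"
      using inj_onD[OF inj] Suc.prems funpow_closed[OF TN] by simp
    thus ?case using Suc by blast
  qed simp
  have art': "artinian_between X N" using artinian_mono[OF art, of X N] subspace_0[OF sX] by blast
  obtain d a where dep: "(T ^^ d) w - (\<Sum>i<d. scale (a i) ((T ^^ i) w)) \<in> X"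
    and indep: "\<And>c i. (\<Sum>i<d. scale (c i) ((T ^^ i) w)) \<in> X \<Longrightarrow> i < d \<Longrightarrow> c i = 0"
    using artinian_dependence[OF art' sX XN N, of "\<lambda>i. (T ^^ i) w"] funpow_closed[OF TN w(1)] by blast
  \<comment> \<open>If all a i vanished, T^d w would lie in X, hence be T^d of an element of X, and
    injectivity would put w into X.\<close>
  have "\<exists>i<d. a i \<noteq> 0"
  proof (rule ccontr)
    assume "\<not> ?thesis"
    hence "(T ^^ d) w \<in> X" using dep by simp
    then obtain y where "y \<in> X" "(T ^^ d) y = (T ^^ d) w" using TXs' by blast
    thus False using injd[of d y w] w XN by blast
  qed
  then obtain i0 where i0: "i0 < d" "a i0 \<noteq> 0" by blast
  hence d: "d > 0" by simp
  \<comment> \<open>The equation for s with t = 0, divided by s: the constant term 1 makes every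
    root nonzero, and since the exponents are distinct, the nonzero a i0 gives positive
    degree.\<close>
  define P :: "'k poly" where
    "P = 1 - (\<Sum>i<d. monom (a i ^ (q ^ (d - 1 - i))) (q ^ (d - i) - 1))"
  have q1: "q > 1" using frob_q_gt_1[OF q] .
  have pos: "q ^ (d - i) > 1" if "i < d" for i using that q1 by (intro one_less_power) auto
  have "coeff P (q ^ (d - i0) - 1) = - (\<Sum>i<d. if q ^ (d - i) - 1 = q ^ (d - i0) - 1 then a i ^ (q ^ (d - 1 - i)) else 0)"
    unfolding P_def using pos[OF i0(1)] by (simp add: coeff_sum coeff_1 cong: if_cong)
  also have "(\<Sum>i<d. if q ^ (d - i) - 1 = q ^ (d - i0) - 1 then a i ^ (q ^ (d - 1 - i)) else 0) =
    (\<Sum>i<d. if i = i0 then a i ^ (q ^ (d - 1 - i)) else 0)"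
  proof (rule sum.cong[OF refl])
    fix i assume "i \<in> {..<d}"
    hence i: "i < d" by simp
    have "q ^ (d - i) - 1 = q ^ (d - i0) - 1 \<longleftrightarrow> q ^ (d - i) = q ^ (d - i0)"
      using pos[OF i] pos[OF i0(1)] by auto
    also have "\<dots> \<longleftrightarrow> d - i = d - i0" using q1 power_inject_exp by blast
    also have "\<dots> \<longleftrightarrow> i = i0" using i i0 by auto
    finally show "(if q ^ (d - i) - 1 = q ^ (d - i0) - 1 then a i ^ (q ^ (d - 1 - i)) else 0) =
      (if i = i0 then a i ^ (q ^ (d - 1 - i)) else 0)" by simp
  qed
  also have "\<dots> = a i0 ^ (q ^ (d - 1 - i0))" using i0 by simp
  finally have "coeff P (q ^ (d - i0) - 1) \<noteq> 0" using i0 by simp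
  hence "degree P > 0" using pos[OF i0(1)] by (metis le_degree less_le_trans zero_less_diff)
  then obtain s where "poly P s = 0" using alg_closed_imp_poly_has_root by blast
  hence s1: "1 = (\<Sum>i<d. a i ^ (q ^ (d - 1 - i)) * s ^ (q ^ (d - i) - 1))"
    by (simp add: P_def poly_sum poly_monom)
  have s0: "s \<noteq> 0"
  proof
    assume "s = 0"
    hence "a i ^ (q ^ (d - 1 - i)) * s ^ (q ^ (d - i) - 1) = 0" if "i < d" for i
      using pos[OF that] by simp
    hence "(\<Sum>i<d. a i ^ (q ^ (d - 1 - i)) * s ^ (q ^ (d - i) - 1)) = 0"
      by (intro sum.neutral) blast
    thus False using s1 by (metis zero_neq_one)
  qed
  have "s * 1 = s * (\<Sum>i<d. a i ^ (q ^ (d - 1 - i)) * s ^ (q ^ (d - i) - 1))" using s1 by simp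
  also have "\<dots> = (\<Sum>i<d. a i ^ (q ^ (d - 1 - i)) * s ^ (q ^ (d - i)))"
    unfolding sum_distrib_left
  proof (rule sum.cong[OF refl])
    fix i assume "i \<in> {..<d}"
    hence "q ^ (d - i) = Suc (q ^ (d - i) - 1)" using pos[of i] by simp
    hence "s ^ (q ^ (d - i)) = s * s ^ (q ^ (d - i) - 1)" by (metis power_Suc)
    thus "s * (a i ^ (q ^ (d - 1 - i)) * s ^ (q ^ (d - i) - 1)) = a i ^ (q ^ (d - 1 - i)) * s ^ (q ^ (d - i))"
      by simp
  qed
  finally have s: "s = 0 + (\<Sum>i<d. a i ^ (q ^ (d - 1 - i)) * s ^ (q ^ (d - i)))" by simp
  obtain Y where Ys: "Y (d - 1) = s" and
    Y: "(\<Sum>i<d. scale (Y i) ((T ^^ i) w)) - T (\<Sum>i<d. scale (Y i) ((T ^^ i) w)) - scale 0 w =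
         - scale (s ^ q) ((T ^^ d) w - (\<Sum>i<d. scale (a i) ((T ^^ i) w)))"
    using frobenius_cyclic_solution[OF d _ s, of w] q1 by (auto simp: power_0_left)
  define x where "x = (\<Sum>i<d. scale (Y i) ((T ^^ i) w))"
  have xN: "x \<in> N" unfolding x_def using funpow_closed[OF TN w(1)]
      by (intro subspace_sum[OF N] subspace_scale[OF N])
  have xX: "x \<notin> X" using indep[of Y "d - 1"] Ys s0 d unfolding x_def by auto
  have "x - T x = - scale (s ^ q) ((T ^^ d) w - (\<Sum>i<d. scale (a i) ((T ^^ i) w)))"
    using Y unfolding x_def by simp
  hence xTx: "x - T x \<in> X" using subspace_neg[OF sX subspace_scale[OF sX dep, of "s ^ q"]] by simp
  have artX: "artinian_between {0} X" by (rule artinian_mono[OF art subset_refl XN])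
  have TX': "T ` X \<subseteq> X" using TX by blast
  have X0: "{0} \<subseteq> X" using subspace_0[OF sX] by blast
  obtain x' where x': "x' \<in> X" "T x' - x' - (x - T x) \<in> {0}"
    by (rule lang_surjective[OF sX subspace_single_0 X0 TX' xTx artX])
  have "T (x + x') = x + x'" using x' by (simp add: T_add algebra_simps)
  moreover have "x + x' \<in> N" using x' xN XN subspace_add[OF N] by blast
  ultimately have "x + x' \<in> X" unfolding X_def by (intro span_base) simp
  hence "x \<in> X" using x' subspace_diff[OF sX, of "x + x'" x'] by simp
  thus False using xX by simp
qed

end

section \<open>Filtered spaces\<close>

text \<open>Valuation at least n, expressed by coefficients because \<open>fls_subdegree 0\<close>
  is 0 whereas the zero series must satisfy every such bound.\<close>

definition fls_ge :: "int \<Rightarrow> 'k::zero fls \<Rightarrow> bool" where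
  "fls_ge n c \<longleftrightarrow> (\<forall>i<n. fls_nth c i = 0)"

lemma fls_ge_0 [simp]: "fls_ge n 0" by (simp add: fls_ge_def)

lemma fls_ge_mono: "fls_ge n c \<Longrightarrow> m \<le> n \<Longrightarrow> fls_ge m c" by (auto simp: fls_ge_def)

lemma fls_ge_add: "fls_ge n c \<Longrightarrow> fls_ge n d \<Longrightarrow> fls_ge n (c + d :: 'k::field fls)"
  by (auto simp: fls_ge_def)

lemma fls_ge_sum: "(\<And>i. i \<in> A \<Longrightarrow> fls_ge n (f i)) \<Longrightarrow> fls_ge n (\<Sum>i\<in>A. f i :: 'k::field fls)"
  by (induction A rule: infinite_finite_induct) (auto intro: fls_ge_add)

lemma fls_ge_iff_subdegree: "fls_ge n c \<longleftrightarrow> c = (0::'k::field fls) \<or> n \<le> fls_subdegree c"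
  by (cases "c = 0")
    (auto simp: fls_ge_def intro: fls_subdegree_geI fls_eq0_below_subdegree)

lemma fls_ge_mult: "fls_ge m c \<Longrightarrow> fls_ge n d \<Longrightarrow> fls_ge (m + n) (c * d :: 'k::field fls)"
  unfolding fls_ge_iff_subdegree by (cases "c = 0 \<or> d = 0") auto

lemma fls_ge_intpow: "fls_ge n (fls_X_intpow n :: 'k::field fls)" by (simp add: fls_ge_def)

lemma fls_ge_fps: "fls_ge 0 (fps_to_fls a :: 'k::field fls)" by (simp add: fls_ge_def)

lemma fls_ge_0_fps: "fls_ge 0 c \<Longrightarrow> \<exists>a. c = (fps_to_fls a :: 'k::field fls)"
  by (intro exI[of _ "fls_regpart c"] fls_eqI) (auto simp: fls_ge_def)

lemma fls_ge_ex: "\<exists>n. fls_ge n (c::'k::field fls)"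
  unfolding fls_ge_iff_subdegree by auto

lemma fls_ge_ex_finite:
  assumes "finite A" shows "\<exists>n. \<forall>x\<in>A. fls_ge n (f x :: 'k::field fls)"
  using assms
proof (induction A)
  case (insert x A)
  then obtain n where n: "\<forall>x\<in>A. fls_ge n (f x)" by blast
  obtain m where "fls_ge m (f x)" using fls_ge_ex by blast
  thus ?case using n by (intro exI[of _ "min m n"]) (auto intro: fls_ge_mono)
qed simp

lemma fls_ge_all_0: "(\<And>n. fls_ge n c) \<Longrightarrow> c = 0"
  by (rule fls_eqI) (metis fls_ge_def fls_zero_nth less_add_one)

lemma fls_ge_frob:
  assumes "frob_exponent TYPE('k::alg_closed_field) q"
  shows "fls_ge n (fls_frob q c) \<longleftrightarrow> fls_ge n (c::'k fls)"
  using frob_q_gt_1[OF assms] by (auto simp: fls_ge_def fls_nth_frob[OF assms])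

lemma fls_limit:
  fixes x :: "nat \<Rightarrow> 'k::field fls"
  assumes "\<And>n. fls_ge (int n) (x (Suc n) - x n)"
  shows "\<exists>y. \<forall>n. fls_ge (int n) (y - x n)"
proof -
  \<comment> \<open>The coefficient of degree i no longer changes from index i + 1 on; for negative
    i it is constant from index 0 on.\<close>
  define f where "f i = fls_nth (x (nat (i + 1))) i" for i
  have stab: "fls_nth (x n) i = fls_nth (x m) i" if "n \<ge> m" "int m > i" for i m n
    using that(1)
  proof (induction n rule: dec_induct)
    case (step n)
    thus ?case using assms[of n] that(2) by (simp add: fls_ge_def)
  qed simp
  have "\<forall>\<^sub>\<infinity>n::nat. fls_nth (x 0) (- int n) = 0" using fls_nth[of "x 0"] by simp
  \<comment> \<open>Degree 0 is excluded because its coefficient is read off from x 1, not from x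
    0.\<close>
  moreover have "\<forall>\<^sub>\<infinity>n::nat. n \<noteq> 0" by (auto simp: MOST_nat)
  ultimately have "\<forall>\<^sub>\<infinity>n::nat. fls_nth (x 0) (- int n) = 0 \<and> n \<noteq> 0" by (rule MOST_conjI)
  hence "\<forall>\<^sub>\<infinity>n::nat. f (- int n) = 0"
  proof (rule MOST_mono)
    fix n :: nat assume "fls_nth (x 0) (- int n) = 0 \<and> n \<noteq> 0"
    moreover have "nat (- int n + 1) = 0" if "n \<noteq> 0" using that by simp
    ultimately show "f (- int n) = 0" unfolding f_def by simp
  qed
  hence nth: "fls_nth (Abs_fls f) i = f i" for i by (simp add: Abs_fls_inverse)
  have "fls_ge (int n) (Abs_fls f - x n)" for n
    unfolding fls_ge_def
  proof (intro allI impI)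
    fix i assume i: "i < int n"
    have "fls_nth (x n) i = fls_nth (x (nat (i + 1))) i"
      by (rule stab) (use i in auto)
    thus "fls_nth (Abs_fls f - x n) i = 0" by (simp add: nth f_def)
  qed
  thus ?thesis by blast
qed

section \<open>Spaces over k((\<epsilon>)) with a complete filtration\<close>

context fls_vector_space
begin

definition ks :: "'k \<Rightarrow> 'v \<Rightarrow> 'v" where "ks a v = scale (fls_const a) v"

definition sh :: "int \<Rightarrow> 'v \<Rightarrow> 'v" where "sh n v = scale (fls_X_intpow n) v"

text \<open>Lattices are compared through their quotients, which are finite-dimensional over k;
  hence the structure over the constants beside those over k((\<epsilon>)) and
  k[[\<epsilon>]].\<close>

sublocale k: linear_space ks
  by unfold_locales (simp_all add: ks_def scale_right_distrib scale_left_distrib fls_plus_const[symmetric])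

lemma sh_sh [simp]: "sh m (sh n v) = sh (m + n) v"
  by (simp add: sh_def fls_X_intpow_times_fls_X_intpow)

lemma sh_0 [simp]: "sh 0 v = v" by (simp add: sh_def)

lemma sh_add: "sh n (u + v) = sh n u + sh n v" by (simp add: sh_def scale_right_distrib)

lemma sh_diff: "sh n (u - v) = sh n u - sh n v" by (simp add: sh_def scale_right_diff_distrib)

lemma sh_ks: "sh n (ks a v) = ks a (sh n v)"
  by (simp add: ks_def sh_def mult.commute)

lemma sh_scale: "sh n (scale a v) = scale a (sh n v)"
  by (simp add: sh_def mult.commute)

lemma int_scale_const: "int_scale (fps_const a) v = ks a v"
  by (simp add: int_scale_def ks_def)

lemma int_subspace_k: "int.subspace U \<Longrightarrow> k.subspace U"
  unfolding k.subspace_def int.subspace_def int_scale_const[symmetric] by blast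

lemma subspace_int: "subspace U \<Longrightarrow> int.subspace U"
  unfolding subspace_def int.subspace_def int_scale_def by blast

lemma subspace_k: "subspace U \<Longrightarrow> k.subspace U"
  using subspace_int int_subspace_k by blast

lemma int_span_subset_span: "int.span S \<subseteq> span S"
  by (rule int.span_minimal) (auto intro: span_base subspace_int)

end

text \<open>Instantiated twice: for V with the multiples of M, and for endomorphisms with the
  multiples of End(M). The second instance lives on the type of all functions, so the filtration is
  not assumed to exhaust the space.\<close>

locale filtered_space = fls_vector_space scale
  for scale :: "'k::field fls \<Rightarrow> 'v::ab_group_add \<Rightarrow> 'v" +
  fixes Fil :: "int \<Rightarrow> 'v set"
  assumes Fil_int: "int.subspace (Fil n)"
    and Fil_shift: "v \<in> Fil n \<Longrightarrow> sh m v \<in> Fil (n + m)"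
    and Fil_sep: "(\<And>n. v \<in> Fil n) \<Longrightarrow> v = 0"
    and Fil_complete: "(\<And>n. u (Suc n) - u n \<in> Fil (int n)) \<Longrightarrow> \<exists>w. \<forall>n. w - u n \<in> Fil (int n)"
    and Fil_finite: "\<exists>G. finite G \<and> (\<forall>v\<in>Fil 0. \<exists>w\<in>k.span G. v - w \<in> Fil 1)"
begin

lemma Fil_k: "k.subspace (Fil n)" using Fil_int int_subspace_k by blast

lemma Fil_0 [simp]: "0 \<in> Fil n" using int.subspace_0[OF Fil_int] .
lemma Fil_add: "u \<in> Fil n \<Longrightarrow> v \<in> Fil n \<Longrightarrow> u + v \<in> Fil n" using int.subspace_add[OF Fil_int] .
lemma Fil_diff: "u \<in> Fil n \<Longrightarrow> v \<in> Fil n \<Longrightarrow> u - v \<in> Fil n" using int.subspace_diff[OF Fil_int] .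
lemma Fil_neg: "u \<in> Fil n \<Longrightarrow> - u \<in> Fil n" using int.subspace_neg[OF Fil_int] .
lemma Fil_sum: "(\<And>i. i \<in> A \<Longrightarrow> f i \<in> Fil n) \<Longrightarrow> sum f A \<in> Fil n" using int.subspace_sum[OF Fil_int] .
lemma Fil_ks: "u \<in> Fil n \<Longrightarrow> ks a u \<in> Fil n" using k.subspace_scale[OF Fil_k] .

lemma Fil_shift_iff: "sh m v \<in> Fil n \<longleftrightarrow> v \<in> Fil (n - m)"
  using Fil_shift[of "sh m v" n "-m"] Fil_shift[of v "n - m" m] by auto

lemma Fil_mult: "fls_ge m a \<Longrightarrow> v \<in> Fil n \<Longrightarrow> scale a v \<in> Fil (n + m)"
proof -
  assume a: "fls_ge m a" and v: "v \<in> Fil n"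
  have "fls_ge (- m + m) (fls_X_intpow (- m) * a)" using fls_ge_mult[OF fls_ge_intpow a] .
  then obtain b where b: "fls_X_intpow (- m) * a = fps_to_fls b" using fls_ge_0_fps by auto
  have "scale a v = sh m (scale (fls_X_intpow (- m) * a) v)"
    by (simp only: scale_scale[symmetric] sh_def[symmetric] sh_sh) simp
  also have "\<dots> = sh m (int_scale b v)" by (simp only: b int_scale_def)
  finally show ?thesis using Fil_shift int.subspace_scale[OF Fil_int v] by metis
qed

lemma Fil_mono: "m \<le> n \<Longrightarrow> Fil n \<subseteq> Fil m"
proof
  fix v assume "m \<le> n" "v \<in> Fil n"
  moreover have "fls_ge (m - n) (1::'k fls)" using \<open>m \<le> n\<close> by (simp add: fls_ge_def)
  ultimately show "v \<in> Fil m" using Fil_mult[of "m - n" 1 v n] by simp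
qed

lemma Fil_monoD: "v \<in> Fil n \<Longrightarrow> m \<le> n \<Longrightarrow> v \<in> Fil m" using Fil_mono by blast

text \<open>Consecutive quotients are shifts of Fil 0 / Fil 1, which \<open>Fil_finite\<close> makes
  finite-dimensional over k.\<close>

lemma Fil_artinian: "a \<le> b \<Longrightarrow> k.artinian_between (Fil b) (Fil a)"
proof (induction b rule: int_ge_induct)
  case base
  show ?case by (rule k.artinian_refl)
next
  case (step n)
  obtain G where G: "finite G" "\<forall>v\<in>Fil 0. \<exists>w\<in>k.span G. v - w \<in> Fil 1" using Fil_finite by blast
  have span: "sh n w \<in> k.span (sh n ` G)" if "w \<in> k.span G" for w
    using that
  proof (induction rule: k.span_induct_alt)
    case (step c x y)
    have "sh n (ks c x + y) = ks c (sh n x) + sh n y" by (simp only: sh_add sh_ks)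
    moreover have "ks c (sh n x) + sh n y \<in> k.span (sh n ` G)"
      using step by (intro k.span_add k.span_scale) (auto intro: k.span_base)
    ultimately show ?case by metis
  qed (simp add: k.span_zero sh_def)
  let ?F = "{x + y |x y. x \<in> Fil (n + 1) \<and> y \<in> k.span (sh n ` G)}"
  have "Fil n \<subseteq> ?F"
  proof
    fix v assume "v \<in> Fil n"
    hence "sh (- n) v \<in> Fil 0" by (simp add: Fil_shift_iff)
    then obtain w where w: "w \<in> k.span G" "sh (- n) v - w \<in> Fil 1" using G by blast
    have "sh n (sh (- n) v - w) \<in> Fil (1 + n)" using Fil_shift[OF w(2)] .
    hence "v - sh n w \<in> Fil (n + 1)" by (simp add: sh_diff add.commute)
    moreover have "v = (v - sh n w) + sh n w" by simp
    ultimately show "v \<in> ?F" using span[OF w(1)] by blast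
  qed
  hence "k.artinian_between (Fil (n + 1)) (Fil n)"
    using k.artinian_mono[OF k.artinian_finite_span[OF _ Fil_k, of "sh n ` G" "n + 1"] subset_refl] G(1) by blast
  thus ?case using k.artinian_trans[OF _ step.IH Fil_k Fil_k Fil_k] Fil_mono step by simp
qed

end

section \<open>Coordinates with respect to a basis of the lattice\<close>

locale based_space = fls_vector_space scale
  for scale :: "'k::field fls \<Rightarrow> 'v::ab_group_add \<Rightarrow> 'v" +
  fixes B :: "'v set"
  assumes fin_B: "finite B" and indep_B: "independent B" and span_B: "span B = UNIV"
begin

sublocale finite_dimensional_vector_space scale B
  by unfold_locales (use fin_B indep_B span_B in auto)

abbreviation cf :: "'v \<Rightarrow> 'v \<Rightarrow> 'k fls" where "cf v b \<equiv> representation B v b"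

text \<open>This is \<epsilon>^n M when M is spanned by B over k[[\<epsilon>]]
  (\<open>Fil_0_eq\<close>); in coordinates completeness becomes a statement about Laurent
  series.\<close>

definition Fil :: "int \<Rightarrow> 'v set" where "Fil n = {v. \<forall>b\<in>B. fls_ge n (cf v b)}"

lemma cf_add: "cf (u + v) b = cf u b + cf v b"
  by (simp add: representation_add[OF indep_B] span_B)

lemma cf_scale: "cf (scale c v) b = c * cf v b"
  by (rule fun_cong[OF representation_scale[OF indep_B], simplified]) (simp_all add: span_B)

lemma cf_diff: "cf (u - v) b = cf u b - cf v b"
  by (simp add: representation_diff[OF indep_B] span_B)

lemma cf_0: "cf 0 b = 0" using cf_scale[of 0 0 b] by simp

lemma cf_sum: "cf (\<Sum>i\<in>A. f i) b = (\<Sum>i\<in>A. cf (f i) b)"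
  by (induction A rule: infinite_finite_induct) (auto simp: cf_add cf_0)

lemma cf_basis: "b \<in> B \<Longrightarrow> cf b b' = (if b' = b then 1 else 0)"
  using representation_basis[OF indep_B] by simp

lemma cf_expand: "v = (\<Sum>b\<in>B. scale (cf v b) b)"
proof -
  have "(\<Sum>b | cf v b \<noteq> 0. scale (cf v b) b) = v"
    by (rule sum_nonzero_representation_eq[OF indep_B]) (simp add: span_B)
  moreover have "(\<Sum>b | cf v b \<noteq> 0. scale (cf v b) b) = (\<Sum>b\<in>B. scale (cf v b) b)"
    by (rule sum.mono_neutral_left[OF fin_B]) (use representation_ne_zero in auto)
  ultimately show ?thesis by simp
qed

lemma cf_combination: "b \<in> B \<Longrightarrow> cf (\<Sum>b\<in>B. scale (x b) b) b = x b"
proof -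
  assume b: "b \<in> B"
  have "cf (\<Sum>b\<in>B. scale (x b) b) b = (\<Sum>b'\<in>B. if b' = b then x b' else 0)"
    unfolding cf_sum cf_scale by (intro sum.cong refl) (simp add: cf_basis)
  thus ?thesis using b fin_B by simp
qed

lemma cf_eqI: "(\<And>b. b \<in> B \<Longrightarrow> cf u b = cf v b) \<Longrightarrow> u = v"
  using cf_expand[of u] cf_expand[of v] by (metis (mono_tags, lifting) sum.cong)

lemma Fil_complete':
  assumes "\<And>n. u (Suc n) - u n \<in> Fil (int n)"
  shows "\<exists>w. \<forall>n. w - u n \<in> Fil (int n)"
proof -
  have "\<exists>y. \<forall>n. fls_ge (int n) (y - cf (u n) b)" if "b \<in> B" for b
    using assms that unfolding Fil_def by (intro fls_limit) (auto simp: cf_diff)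
  then obtain y where y: "\<And>b n. b \<in> B \<Longrightarrow> fls_ge (int n) (y b - cf (u n) b)" by metis
  have "(\<Sum>b\<in>B. scale (y b) b) - u n \<in> Fil (int n)" for n
    unfolding Fil_def using y by (simp add: cf_diff cf_combination)
  thus ?thesis by blast
qed

lemma Fil_finite': "\<exists>G. finite G \<and> (\<forall>v\<in>Fil 0. \<exists>w\<in>k.span G. v - w \<in> Fil 1)"
proof (intro exI[of _ B] conjI fin_B ballI)
  fix v assume v: "v \<in> Fil 0"
  define w where "w = (\<Sum>b\<in>B. ks (fls_nth (cf v b) 0) b)"
  have "w \<in> k.span B" unfolding w_def by (intro k.span_sum k.span_scale k.span_base)
  moreover have "v - w \<in> Fil 1"
    using v unfolding Fil_def w_def ks_def by (auto simp: cf_diff cf_combination fls_ge_def)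
  ultimately show "\<exists>w\<in>k.span B. v - w \<in> Fil 1" by blast
qed

sublocale filtered_space scale Fil
proof
  show "int.subspace (Fil n)" for n
    unfolding int.subspace_def Fil_def int_scale_def
    using fls_ge_mult[OF fls_ge_fps] by (auto simp: cf_add cf_scale cf_0 intro: fls_ge_add)
  show "sh m v \<in> Fil (n + m)" if "v \<in> Fil n" for v n m
    using that fls_ge_mult[OF _ fls_ge_intpow[of m]] unfolding Fil_def sh_def
    by (auto simp: cf_scale mult.commute[of "fls_X_intpow m"])
  show "v = 0" if "\<And>n. v \<in> Fil n" for v
    by (rule cf_eqI) (use that in \<open>auto simp: Fil_def cf_0 intro: fls_ge_all_0\<close>)
qed (use Fil_complete' Fil_finite' in auto)

lemma Fil_exhaust: "\<exists>n. v \<in> Fil n"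
  unfolding Fil_def using fls_ge_ex_finite[OF fin_B] by auto

lemma Fil_exhaust_finite:
  assumes "finite A" shows "\<exists>n. A \<subseteq> Fil n"
  using assms
proof (induction A)
  case (insert x A)
  then obtain n where n: "A \<subseteq> Fil n" by blast
  obtain m where "x \<in> Fil m" using Fil_exhaust by blast
  thus ?case using n Fil_mono[of "min m n" n] Fil_mono[of "min m n" m] by (intro exI[of _ "min m n"]) auto
qed simp

lemma Fil_0_eq: "Fil 0 = int.span B"
proof
  show "int.span B \<subseteq> Fil 0"
    by (rule int.span_minimal[OF _ Fil_int]) (auto simp: Fil_def cf_basis fls_ge_def)
  show "Fil 0 \<subseteq> int.span B"
  proof
    fix v assume "v \<in> Fil 0"
    hence "\<forall>b\<in>B. \<exists>a. cf v b = fps_to_fls a" unfolding Fil_def using fls_ge_0_fps by blast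
    then obtain a where a: "\<And>b. b \<in> B \<Longrightarrow> cf v b = fps_to_fls (a b)" by metis
    have "v = (\<Sum>b\<in>B. int_scale (a b) b)"
      using cf_expand[of v] by (simp add: a int_scale_def)
    thus "v \<in> int.span B" by (metis (no_types, lifting) int.span_sum int.span_scale int.span_base)
  qed
qed

lemma linear_functional_bounded:
  assumes add: "\<And>x y. r (x + y) = r x + r y" and sc: "\<And>c x. r (scale c x) = c * r x"
  shows "\<exists>c. \<forall>n. \<forall>v\<in>Fil n. fls_ge (n - c) (r v :: 'k fls)"
proof -
  obtain c where c: "\<forall>b\<in>B. fls_ge c (r b)" using fls_ge_ex_finite[OF fin_B] by blast
  have r0: "r 0 = 0" using sc[of 0 0] by simp
  have rsum: "r (\<Sum>i\<in>A. f i) = (\<Sum>i\<in>A. r (f i))" for A and f :: "'v \<Rightarrow> 'v"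
    by (induction A rule: infinite_finite_induct) (auto simp: r0 add)
  have "fls_ge (n - (- c)) (r v)" if "v \<in> Fil n" for n v
  proof -
    have "r v = (\<Sum>b\<in>B. cf v b * r b)"
      by (subst cf_expand[of v]) (simp only: rsum sc)
    moreover have "fls_ge (n + c) (cf v b * r b)" if "b \<in> B" for b
      using c that \<open>v \<in> Fil n\<close> by (intro fls_ge_mult) (auto simp: Fil_def)
    ultimately show ?thesis by (simp add: fls_ge_sum)
  qed
  thus ?thesis by blast
qed

lemma semilinear_bounded:
  assumes add: "\<And>x y. f (x + y) = f x + f y" and sc: "\<And>c x. f (scale c x) = scale (\<sigma> c) (f x)"
    and \<sigma>: "\<And>n c. fls_ge n c \<Longrightarrow> fls_ge n (\<sigma> c)"
  shows "\<exists>c\<ge>0. \<forall>n. f ` Fil n \<subseteq> Fil (n - c)"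
proof -
  obtain c where c: "f ` B \<subseteq> Fil c" using Fil_exhaust_finite[of "f ` B"] fin_B by blast
  define d where "d = max 0 (- c)"
  have "- d \<le> c" unfolding d_def by simp
  hence c': "f ` B \<subseteq> Fil (- d)" using c Fil_mono by blast
  have f0: "f 0 = 0" using add[of 0 0] by simp
  have fsum: "f (\<Sum>i\<in>A. g i) = (\<Sum>i\<in>A. f (g i))" for A and g :: "'v \<Rightarrow> 'v"
    by (induction A rule: infinite_finite_induct) (auto simp: f0 add)
  have "f v \<in> Fil (n - d)" if "v \<in> Fil n" for n v
  proof -
    have "f v = (\<Sum>b\<in>B. scale (\<sigma> (cf v b)) (f b))"
      by (subst cf_expand[of v]) (simp only: fsum sc)
    moreover have "scale (\<sigma> (cf v b)) (f b) \<in> Fil (- d + n)" if "b \<in> B" for b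
      using c' that \<open>v \<in> Fil n\<close> by (intro Fil_mult \<sigma>) (auto simp: Fil_def)
    ultimately show ?thesis by (simp add: Fil_sum)
  qed
  thus ?thesis by (intro exI[of _ d]) (auto simp: d_def)
qed

text \<open>After extending C to a basis of V, the coordinates are linear functionals on V, hence
  bounded on the filtration, and one bound serves the finitely many members of C.\<close>

lemma representation_bounded:
  assumes C: "finite C" "independent C"
  shows "\<exists>c. \<forall>n. \<forall>v\<in>Fil n \<inter> span C. \<forall>b\<in>C. fls_ge (n - c) (representation C v b)"
proof -
  define C' where "C' = extend_basis C"
  have C': "C \<subseteq> C'" "independent C'" "span C' = UNIV"
    unfolding C'_def using extend_basis_superset[OF C(2)] independent_extend_basis[OF C(2)]
      span_extend_basis[OF C(2)] by auto
  have "\<exists>c. \<forall>n. \<forall>v\<in>Fil n. fls_ge (n - c) (representation C' v b)" for b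
    by (rule linear_functional_bounded)
      (simp_all add: representation_add[OF C'(2)] representation_scale[OF C'(2)] C'(3))
  then obtain c where c: "\<And>b n v. v \<in> Fil n \<Longrightarrow> fls_ge (n - c b) (representation C' v b)" by metis
  obtain e where e: "\<And>b. b \<in> C \<Longrightarrow> c b \<le> e" using C(1) by (metis (full_types) finite_imageI imageI Max_ge)
  have "fls_ge (n - e) (representation C v b)" if "v \<in> Fil n" "v \<in> span C" "b \<in> C" for n v b
  proof -
    have "representation C' v = representation C v"
      by (rule representation_extend[OF C'(2) that(2) C'(1)])
    thus ?thesis using c[OF that(1), of b] e[OF that(3)] by (auto intro: fls_ge_mono)
  qed
  thus ?thesis by blast
qed

end

context linear_space
begin

lemma artinian_increasing:
  assumes "artinian_between E F" "\<And>n. subspace (U n)" "\<And>n. E \<subseteq> U n" "\<And>n. U n \<subseteq> F" "\<And>n. U n \<subseteq> U (Suc n)"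
  shows "\<exists>n0. \<forall>n\<ge>n0. U n = U n0"
proof -
  have "(\<forall>n. subspace (U n) \<and> E \<subseteq> U n \<and> U n \<subseteq> F) \<and>
     ((\<forall>n. U n \<subseteq> U (Suc n)) \<or> (\<forall>n. U (Suc n) \<subseteq> U n))" using assms(2-) by simp
  with assms(1)[unfolded artinian_between_def, THEN spec[of _ U]] show ?thesis by (rule mp)
qed

lemma artinian_decreasing:
  assumes "artinian_between E F" "\<And>n. subspace (U n)" "\<And>n. E \<subseteq> U n" "\<And>n. U n \<subseteq> F" "\<And>n. U (Suc n) \<subseteq> U n"
  shows "\<exists>n0. \<forall>n\<ge>n0. U n = U n0"
proof -
  have "(\<forall>n. subspace (U n) \<and> E \<subseteq> U n \<and> U n \<subseteq> F) \<and>
     ((\<forall>n. U n \<subseteq> U (Suc n)) \<or> (\<forall>n. U (Suc n) \<subseteq> U n))" using assms(2-) by simp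
  with assms(1)[unfolded artinian_between_def, THEN spec[of _ U]] show ?thesis by (rule mp)
qed

end

lemma finite_int_bound: "finite C \<Longrightarrow> \<exists>d::int. \<forall>b\<in>C. f b \<le> d"
  using Max_ge[of "f ` C"] by blast

lemma finite_nat_bound: "finite C \<Longrightarrow> \<exists>d::nat. \<forall>b\<in>C. f b \<le> d"
  using Max_ge[of "f ` C"] by blast

section \<open>Lattices in subspaces\<close>

context fls_vector_space
begin

lemma int_span_independent_subset:
  assumes "finite G"
  shows "\<exists>B'\<subseteq>G. independent B' \<and> int.span B' = int.span G"
  using assms
proof (induction G rule: finite_psubset_induct)
  case (psubset G)
  show ?case
  proof (cases "independent G")
    case False
    then obtain u v where u: "v \<in> G" "u v \<noteq> 0" "(\<Sum>v\<in>G. scale (u v) v) = 0"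
      using dependent_finite[OF psubset.hyps] by blast
    let ?S = "{g \<in> G. u g \<noteq> 0}"
    have fS: "finite ?S" "?S \<noteq> {}" using psubset.hyps u by auto
    define g0 where "g0 = arg_min_on (\<lambda>g. fls_subdegree (u g)) ?S"
    have g0: "g0 \<in> G" "u g0 \<noteq> 0" unfolding g0_def using arg_min_if_finite(1)[OF fS] by auto
    have min: "fls_subdegree (u g0) \<le> fls_subdegree (u g)" if "g \<in> G" "u g \<noteq> 0" for g
    proof -
      have "g \<in> ?S" using that by simp
      from arg_min_least[OF fS this] show ?thesis unfolding g0_def .
    qed
    have ge: "fls_ge 0 (- u g / u g0)" if "g \<in> G" for g
      unfolding fls_ge_iff_subdegree using min[OF that] g0(2)
      by (cases "u g = 0") (auto simp: fls_divide_subdegree)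
    have "(\<Sum>v\<in>G. scale (u v) v) = scale (u g0) g0 + (\<Sum>v\<in>G - {g0}. scale (u v) v)"
      using psubset.hyps g0 by (simp add: sum.remove)
    hence "scale (u g0) g0 = - (\<Sum>v\<in>G - {g0}. scale (u v) v)" using u by (simp add: eq_neg_iff_add_eq_0)
    hence "scale (1 / u g0) (scale (u g0) g0) = (\<Sum>v\<in>G - {g0}. scale (- u v / u g0) v)"
      by (simp add: scale_sum_right sum_negf)
    hence e: "g0 = (\<Sum>v\<in>G - {g0}. scale (- u v / u g0) v)" using g0 by simp
    have S: "(\<Sum>v\<in>G - {g0}. scale (- u v / u g0) v) \<in> int.span (G - {g0})"
    proof (rule int.span_sum)
      fix v assume v: "v \<in> G - {g0}"
      hence "v \<in> G" by blast
      then obtain a where "- u v / u g0 = fps_to_fls a" using fls_ge_0_fps[OF ge] by blast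
      thus "scale (- u v / u g0) v \<in> int.span (G - {g0})"
        using int.span_scale[OF int.span_base[OF v], of a] by (simp add: int_scale_def)
    qed
    have g0s: "g0 \<in> int.span (G - {g0})"
      by (rule ssubst[OF e, where P = "\<lambda>x. x \<in> int.span (G - {g0})"]) (rule S)
    have "g \<in> int.span (G - {g0})" if "g \<in> G" for g
      by (cases "g = g0") (use g0s that in \<open>auto intro: int.span_base\<close>)
    hence "G \<subseteq> int.span (G - {g0})" by (rule subsetI)
    hence "int.span G \<subseteq> int.span (G - {g0})" by (rule int.span_minimal) simp
    hence eq: "int.span (G - {g0}) = int.span G" using int.span_mono[OF Diff_subset, of G "{g0}"] by (rule antisym[rotated])
    have ss: "G - {g0} \<subset> G" using g0 by blast
    obtain B' where B': "B' \<subseteq> G - {g0}" "independent B'" "int.span B' = int.span (G - {g0})"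
      using psubset.IH[OF ss] by (elim exE conjE)
    thus ?thesis unfolding eq by (intro exI[of _ B'] conjI) auto
  qed blast
qed

end

context based_space
begin

lemma representation_sum_eq:
  assumes "finite C" "independent C" "v \<in> span C"
  shows "v = (\<Sum>b\<in>C. scale (representation C v b) b)"
proof -
  have "(\<Sum>b | representation C v b \<noteq> 0. scale (representation C v b) b) = v"
    by (rule sum_nonzero_representation_eq[OF assms(2,3)])
  moreover have "(\<Sum>b | representation C v b \<noteq> 0. scale (representation C v b) b) =
      (\<Sum>b\<in>C. scale (representation C v b) b)"
    by (rule sum.mono_neutral_left[OF assms(1)]) (use representation_ne_zero in auto)
  ultimately show ?thesis by simp
qed

lemma Fil_span_bound:
  assumes C: "finite C" "independent C"
  shows "\<exists>e. Fil e \<inter> span C \<subseteq> int.span (sh c ` C)"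
proof -
  obtain c' where c': "\<And>n v b. v \<in> Fil n \<Longrightarrow> v \<in> span C \<Longrightarrow> b \<in> C \<Longrightarrow> fls_ge (n - c') (representation C v b)"
    using representation_bounded[OF C] by blast
  have "v \<in> int.span (sh c ` C)" if v: "v \<in> Fil (c + c')" "v \<in> span C" for v
  proof -
    have "scale (representation C v b) b \<in> int.span (sh c ` C)" if b: "b \<in> C" for b
    proof -
      have "fls_ge (c + (- c)) (representation C v b * fls_X_intpow (- c))"
        by (rule fls_ge_mult[OF _ fls_ge_intpow]) (use c'[OF v b] in simp)
      then obtain a where a: "representation C v b * fls_X_intpow (- c) = fps_to_fls a"
        using fls_ge_0_fps by auto
      have "scale (representation C v b) b = scale (representation C v b) (sh (- c) (sh c b))" by simp
      also have "\<dots> = int_scale a (sh c b)"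
        unfolding sh_def[of "-c"] scale_scale a int_scale_def ..
      finally show ?thesis using int.span_scale[OF int.span_base, of "sh c b" "sh c ` C" a] b by simp
    qed
    hence "(\<Sum>b\<in>C. scale (representation C v b) b) \<in> int.span (sh c ` C)" by (rule int.span_sum)
    thus ?thesis using representation_sum_eq[OF C v(2)] by simp
  qed
  thus ?thesis by blast
qed

lemma subspace_finite_basis:
  assumes "subspace W"
  obtains C where "finite C" "independent C" "span C = W"
proof -
  obtain C where C: "finite C" "C \<subseteq> W" "independent C" "span C = W" "card C = dim W"
    by (rule basis_subspace_exists[OF assms])
  from C(1,3,4) show thesis by (rule that)
qed

text \<open>Coordinates of u outside a basis of W are bounded functionals vanishing on W, hence
  arbitrarily small on u, hence zero.\<close>

lemma subspace_closed:
  assumes W: "subspace W" and u: "\<And>n. \<exists>w\<in>W. u - w \<in> Fil n"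
  shows "u \<in> W"
proof -
  obtain C where C: "finite C" "independent C" "span C = W" by (rule subspace_finite_basis[OF W])
  define C' where "C' = extend_basis C"
  have C': "C \<subseteq> C'" "independent C'" "span C' = UNIV"
    unfolding C'_def using extend_basis_superset[OF C(2)] independent_extend_basis[OF C(2)]
      span_extend_basis[OF C(2)] by auto
  have fC': "finite C'" using finiteI_independent[OF C'(2)] .
  have "representation C' u b = 0" if b: "b \<notin> C" for b
  proof (rule fls_ge_all_0)
    fix n
    have "\<exists>c. \<forall>n. \<forall>v\<in>Fil n. fls_ge (n - c) (representation C' v b)"
      by (rule linear_functional_bounded)
        (simp_all add: representation_add[OF C'(2)] representation_scale[OF C'(2)] C'(3))
    then obtain c where c: "\<And>n v. v \<in> Fil n \<Longrightarrow> fls_ge (n - c) (representation C' v b)" by blast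
    obtain w where w: "w \<in> W" "u - w \<in> Fil (n + c)" using u by blast
    have "representation C' w = representation C w"
      by (rule representation_extend[OF C'(2) _ C'(1)]) (use w C in simp)
    hence "representation C' w b = 0" using b representation_ne_zero by metis
    hence "representation C' (u - w) b = representation C' u b"
      by (simp add: representation_diff[OF C'(2)] C'(3))
    thus "fls_ge n (representation C' u b)" using c[OF w(2)] by simp
  qed
  hence "(\<Sum>b\<in>C'. scale (representation C' u b) b) \<in> span C"
    by (metis (no_types, lifting) span_sum span_scale span_base scale_zero_left span_zero)
  thus ?thesis using representation_sum_eq[OF fC' C'(2), of u] C'(3) C(3) by simp
qed

text \<open>N contains a shift of C and is bounded, so it has finite codimension over k above a deep
  Fil e. Were it not finitely generated, adjoining generators one at a time would give a strictly
  increasing infinite chain; \<open>int_span_independent_subset\<close> then makes the generators a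
  basis.\<close>

lemma lattice_of_bounded:
  assumes C: "finite C" "independent C" and N: "int.subspace N" "N \<subseteq> span C" "N \<subseteq> Fil a"
    and cN: "\<And>b. b \<in> C \<Longrightarrow> sh c b \<in> N"
  shows "lattice_of (span C) N"
proof -
  obtain e0 where "Fil e0 \<inter> span C \<subseteq> int.span (sh c ` C)" using Fil_span_bound[OF C] by blast
  moreover define e where "e = max a e0"
  ultimately have e: "Fil e \<inter> span C \<subseteq> int.span (sh c ` C)" "a \<le> e"
    using Fil_mono[of e0 e] by auto
  have "\<exists>G. finite G \<and> G \<subseteq> N \<and> int.span G = N"
  proof (rule ccontr)
    assume neg: "\<not> ?thesis"
    have "\<exists>x. x \<in> N \<and> x \<notin> int.span G" if "finite G" "G \<subseteq> N" for G
      using neg that int.span_minimal[OF that(2) N(1)] by blast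
    then obtain f where f: "\<And>G. finite G \<Longrightarrow> G \<subseteq> N \<Longrightarrow> f G \<in> N \<and> f G \<notin> int.span G" by metis
    define G where "G n = ((\<lambda>G. insert (f G) G) ^^ n) (sh c ` C)" for n
    have GS: "G (Suc n) = insert (f (G n)) (G n)" for n unfolding G_def by simp
    have G: "finite (G n) \<and> G n \<subseteq> N \<and> sh c ` C \<subseteq> G n" for n
    proof (induction n)
      case 0
      show ?case unfolding G_def using C cN by auto
    next
      case (Suc n)
      thus ?case unfolding GS using f by auto
    qed
    define U where "U n = int.span (G n)" for n
    have art: "k.artinian_between (Fil e \<inter> N) N"
      by (rule k.artinian_restrict[OF Fil_artinian[OF e(2)]])
        (use Fil_k N int_subspace_k Fil_mono[OF e(2)] in auto)
    have U1: "k.subspace (U n)" for n unfolding U_def by (rule int_subspace_k[OF int.subspace_span])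
    have U2: "Fil e \<inter> N \<subseteq> U n" for n
    proof -
      have "int.span (sh c ` C) \<subseteq> U n" unfolding U_def using G by (intro int.span_mono) blast
      thus ?thesis using e N by blast
    qed
    have U3: "U n \<subseteq> N" for n unfolding U_def using G by (intro int.span_minimal N) blast
    have U4: "U n \<subseteq> U (Suc n)" for n unfolding U_def GS by (intro int.span_mono) blast
    obtain n0 where n0: "\<forall>n\<ge>n0. U n = U n0"
      using k.artinian_increasing[where U = U, OF art U1 U2 U3 U4] by blast
    have "U (Suc n0) = U n0" by (rule n0[rule_format]) simp
    moreover have "f (G n0) \<in> U (Suc n0)" unfolding U_def GS by (intro int.span_base) blast
    moreover have "f (G n0) \<notin> U n0" unfolding U_def using f G by blast
    ultimately show False by blast
  qed
  then obtain G where G: "finite G" "G \<subseteq> N" "int.span G = N" by blast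
  obtain B' where B': "B' \<subseteq> G" "independent B'" "int.span B' = N"
    using int_span_independent_subset[OF G(1)] G by auto
  have "C \<subseteq> span B'"
  proof
    fix b assume "b \<in> C"
    hence "sh c b \<in> span B'" using cN B' int_span_subset_span by blast
    hence "sh (- c) (sh c b) \<in> span B'" unfolding sh_def[of "-c"] by (rule span_scale)
    thus "b \<in> span B'" by simp
  qed
  hence "span C \<subseteq> span B'" by (rule span_minimal) simp
  moreover have "span B' \<subseteq> span C" using B' G N by (intro span_minimal) auto
  ultimately have "span B' = span C" by blast
  thus ?thesis unfolding lattice_of_def using B' G finite_subset by metis
qed

lemma lattice_of_Fil:
  assumes "lattice_of W L"
  obtains c where "L \<subseteq> Fil (- c)" "\<And>n. Fil n \<inter> W \<subseteq> sh (n - c) ` L" "L \<subseteq> W" "int.subspace L" "subspace W"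
proof -
  obtain C where C: "finite C" "independent C" "span C = W" "L = int.span C"
    using assms unfolding lattice_of_def by blast
  obtain n where "C \<subseteq> Fil n" using Fil_exhaust_finite[OF C(1)] by blast
  hence 1: "L \<subseteq> Fil n" unfolding C(4) using int.span_minimal Fil_int by blast
  obtain e where "Fil e \<inter> span C \<subseteq> int.span (sh 0 ` C)" using Fil_span_bound[OF C(1,2)] by blast
  hence e: "Fil e \<inter> W \<subseteq> L" using C by simp
  define c where "c = max (- n) e"
  have sW: "subspace W" using C subspace_span by blast
  have sL: "int.subspace L" using C by simp
  have "- c \<le> n" unfolding c_def by simp
  hence "L \<subseteq> Fil (- c)" using 1 Fil_mono by blast
  moreover have "Fil m \<inter> W \<subseteq> sh (m - c) ` L" for m
  proof
    fix v assume v: "v \<in> Fil m \<inter> W"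
    have "sh (c - m) v \<in> Fil c" using v by (simp add: Fil_shift_iff)
    hence "sh (c - m) v \<in> Fil e" by (rule Fil_monoD) (simp add: c_def)
    moreover have "sh (c - m) v \<in> W" using v subspace_scale[OF sW] by (simp add: sh_def)
    ultimately have "sh (c - m) v \<in> L" using e by blast
    moreover have "v = sh (m - c) (sh (c - m) v)" by simp
    ultimately show "v \<in> sh (m - c) ` L" by blast
  qed
  moreover have "L \<subseteq> W" using C int_span_subset_span by blast
  ultimately show thesis using that sL sW by blast
qed

end

section \<open>Fitting decomposition\<close>

text \<open>A semilinear bijection \<open>\<psi>\<close> with bounded forward orbits: Fitting's decomposition into the
  part on which \<open>\<psi>\<close> is topologically nilpotent and the part with bounded backward orbits.\<close>

locale bounded_semilinear = based_space scale B
  for scale :: "'k::field fls \<Rightarrow> 'v::ab_group_add \<Rightarrow> 'v" and B +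
  fixes \<psi> :: "'v \<Rightarrow> 'v" and \<tau> :: "'k fls \<Rightarrow> 'k fls" and W :: "'v set"
  assumes psi_add: "\<psi> (x + y) = \<psi> x + \<psi> y"
    and psi_scale: "\<psi> (scale c x) = scale (\<tau> c) (\<psi> x)"
    and psi_bij: "bij \<psi>"
    and tau_ge: "fls_ge n (\<tau> c) \<longleftrightarrow> fls_ge n c"
    and tau_bij: "bij \<tau>"
    and psi_sh: "\<psi> (sh n x) = sh n (\<psi> x)"
    and W_sub: "subspace W"
    and psi_W: "x \<in> W \<longleftrightarrow> \<psi> x \<in> W"
    and orbits: "x \<in> W \<Longrightarrow> \<exists>c. \<forall>n. (\<psi> ^^ n) x \<in> Fil c"
begin

definition "\<psi>' = inv \<psi>"

lemma psi_inv [simp]: "\<psi> (\<psi>' x) = x" "\<psi>' (\<psi> x) = x"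
  unfolding \<psi>'_def using psi_bij by (simp_all add: bij_is_surj surj_f_inv_f bij_is_inj)

lemma psi_0 [simp]: "\<psi> 0 = 0" using psi_add[of 0 0] by simp
lemma psi_diff: "\<psi> (x - y) = \<psi> x - \<psi> y" using psi_add[of "x - y" y] by simp

lemma psi'_add: "\<psi>' (x + y) = \<psi>' x + \<psi>' y" by (metis psi_inv psi_add)
lemma psi'_0 [simp]: "\<psi>' 0 = 0" using psi'_add[of 0 0] by simp
lemma psi'_scale: "\<psi>' (scale c x) = scale (inv \<tau> c) (\<psi>' x)"
proof -
  have "\<tau> (inv \<tau> c) = c" using tau_bij by (simp add: bij_is_surj surj_f_inv_f)
  hence "\<psi> (scale (inv \<tau> c) (\<psi>' x)) = scale c x" by (simp add: psi_scale)
  thus ?thesis by (metis psi_inv(2))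
qed
lemma psi'_sh: "\<psi>' (sh n x) = sh n (\<psi>' x)" by (metis psi_inv psi_sh)
lemma psi'_W: "\<psi>' x \<in> W \<longleftrightarrow> x \<in> W" using psi_W[of "\<psi>' x"] by simp

lemma tau'_ge: "fls_ge n c \<Longrightarrow> fls_ge n (inv \<tau> c)"
  using tau_ge[of n "inv \<tau> c"] tau_bij by (simp add: bij_is_surj surj_f_inv_f)

lemma pow_add: "(\<psi> ^^ n) (x + y) = (\<psi> ^^ n) x + (\<psi> ^^ n) y" by (induction n) (auto simp: psi_add)
lemma pow_diff: "(\<psi> ^^ n) (x - y) = (\<psi> ^^ n) x - (\<psi> ^^ n) y" by (induction n) (auto simp: psi_diff)
lemma pow_0 [simp]: "(\<psi> ^^ n) 0 = 0" by (induction n) auto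
lemma pow_scale: "(\<psi> ^^ n) (scale c x) = scale ((\<tau> ^^ n) c) ((\<psi> ^^ n) x)"
  by (induction n) (auto simp: psi_scale)
lemma pow_sh: "(\<psi> ^^ n) (sh m x) = sh m ((\<psi> ^^ n) x)" by (induction n) (auto simp: psi_sh)
lemma pow'_add: "(\<psi>' ^^ n) (x + y) = (\<psi>' ^^ n) x + (\<psi>' ^^ n) y" by (induction n) (auto simp: psi'_add)
lemma pow'_0 [simp]: "(\<psi>' ^^ n) 0 = 0" by (induction n) auto
lemma pow'_scale: "(\<psi>' ^^ n) (scale c x) = scale ((inv \<tau> ^^ n) c) ((\<psi>' ^^ n) x)"
  by (induction n) (auto simp: psi'_scale)
lemma pow'_sh: "(\<psi>' ^^ n) (sh m x) = sh m ((\<psi>' ^^ n) x)" by (induction n) (auto simp: psi'_sh)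
lemma pow'_W: "(\<psi>' ^^ n) x \<in> W \<longleftrightarrow> x \<in> W" by (induction n) (auto simp: psi'_W)
lemma tau_pow_ge: "fls_ge n ((\<tau> ^^ j) c) \<longleftrightarrow> fls_ge n c" by (induction j) (auto simp: tau_ge)
lemma tau'_pow_ge: "fls_ge n c \<Longrightarrow> fls_ge n ((inv \<tau> ^^ j) c)" by (induction j) (auto simp: tau'_ge)

lemma pow_pow' [simp]: "(\<psi> ^^ n) ((\<psi>' ^^ n) x) = x"
  by (induction n arbitrary: x) (simp_all add: funpow_swap1)
lemma pow'_pow [simp]: "(\<psi>' ^^ n) ((\<psi> ^^ n) x) = x"
  by (induction n arbitrary: x) (simp_all add: funpow_swap1)

text \<open>The largest \<psi>-stable submodule of Fil 0 \<inter> W. Bounded orbits make it a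
  lattice of W (\<open>eL\<close>), and on it \<psi> acts integrally.\<close>

definition L :: "'v set" where "L = {w \<in> W. \<forall>n. (\<psi> ^^ n) w \<in> Fil 0}"

lemma int_scale_pow: "(\<psi> ^^ n) (int_scale a x) = scale ((\<tau> ^^ n) (fps_to_fls a)) ((\<psi> ^^ n) x)"
  unfolding int_scale_def by (rule pow_scale)

lemma L_int: "int.subspace L"
  unfolding int.subspace_def
proof (intro conjI ballI allI)
  show "0 \<in> L" unfolding L_def using subspace_0[OF W_sub] by simp
  fix x y assume "x \<in> L" "y \<in> L"
  thus "x + y \<in> L" unfolding L_def using subspace_add[OF W_sub] Fil_add by (auto simp: pow_add)
next
  fix a x assume x: "x \<in> L"
  have "scale ((\<tau> ^^ n) (fps_to_fls a)) ((\<psi> ^^ n) x) \<in> Fil (0 + 0)" for n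
    by (rule Fil_mult) (use x in \<open>auto simp: tau_pow_ge fls_ge_fps L_def\<close>)
  thus "int_scale a x \<in> L" unfolding L_def int_scale_pow mem_Collect_eq
    using x subspace_scale[OF W_sub] by (auto simp: L_def int_scale_def)
qed

lemma L_k: "k.subspace L" using L_int int_subspace_k by blast
lemma L_W: "L \<subseteq> W" and L_Fil: "L \<subseteq> Fil 0"
  unfolding L_def by (auto dest: spec[of _ 0])
lemma psi_L: "x \<in> L \<Longrightarrow> \<psi> x \<in> L"
  unfolding L_def using psi_W by (auto simp flip: funpow_Suc_right simp: funpow_swap1 dest: spec[of _ "Suc _"])
lemma pow_L: "x \<in> L \<Longrightarrow> (\<psi> ^^ n) x \<in> L" by (induction n) (auto intro: psi_L)

definition eL :: int where "eL = (SOME e. e \<ge> 0 \<and> Fil e \<inter> W \<subseteq> L)"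

lemma eL: "eL \<ge> 0" "Fil eL \<inter> W \<subseteq> L"
proof -
  obtain C where C: "finite C" "independent C" "span C = W" by (rule subspace_finite_basis[OF W_sub])
  have "\<forall>b\<in>C. \<exists>c. sh c b \<in> L"
  proof
    fix b assume "b \<in> C"
    hence bW: "b \<in> W" using C span_base by blast
    then obtain c where c: "\<forall>n. (\<psi> ^^ n) b \<in> Fil c" using orbits by blast
    have "sh (- c) b \<in> L" unfolding L_def using c bW subspace_scale[OF W_sub]
      by (auto simp: pow_sh Fil_shift_iff) (simp add: sh_def)
    thus "\<exists>c. sh c b \<in> L" by blast
  qed
  then obtain c where c: "\<And>b. b \<in> C \<Longrightarrow> sh (c b) b \<in> L" by metis
  obtain d where d: "\<And>b. b \<in> C \<Longrightarrow> c b \<le> d" using finite_int_bound[OF C(1)] by blast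
  have "sh d b \<in> L" if b: "b \<in> C" for b
  proof -
    have "fls_ge 0 (fls_X_intpow (d - c b) :: 'k fls)" using d[OF b] by (simp add: fls_ge_def)
    then obtain a where a: "(fls_X_intpow (d - c b) :: 'k fls) = fps_to_fls a" using fls_ge_0_fps by blast
    have "sh d b = sh (d - c b) (sh (c b) b)" by simp
    also have "\<dots> = int_scale a (sh (c b) b)" unfolding sh_def[of "d - c b"] int_scale_def a ..
    finally show ?thesis using int.subspace_scale[OF L_int c[OF b]] by simp
  qed
  hence "int.span (sh d ` C) \<subseteq> L" using L_int by (intro int.span_minimal) auto
  moreover obtain e where "Fil e \<inter> span C \<subseteq> int.span (sh d ` C)" using Fil_span_bound[OF C(1,2)] by blast
  ultimately have "Fil (max 0 e) \<inter> W \<subseteq> L" using C Fil_mono[of e "max 0 e"] by auto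
  hence "\<exists>e. e \<ge> 0 \<and> Fil e \<inter> W \<subseteq> L" by (intro exI[of _ "max 0 e"]) auto
  thus "eL \<ge> 0" "Fil eL \<inter> W \<subseteq> L" unfolding eL_def by (rule someI2_ex; blast)+
qed

definition LN :: "int \<Rightarrow> 'v set" where "LN n = {w. sh (- n) w \<in> L}"

lemma LN_k: "k.subspace (LN n)"
  unfolding LN_def k.subspace_def using L_k[unfolded k.subspace_def]
  by (auto simp: sh_add sh_ks) (simp add: sh_def)

lemma LN_Fil: "LN n \<subseteq> Fil n"
  unfolding LN_def using L_Fil Fil_shift_iff by fastforce

lemma Fil_LN: "w \<in> Fil (n + eL) \<Longrightarrow> w \<in> W \<Longrightarrow> w \<in> LN n"
proof -
  assume w: "w \<in> Fil (n + eL)" "w \<in> W"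
  have "sh (- n) w \<in> Fil eL" using w by (simp add: Fil_shift_iff add.commute)
  moreover have "sh (- n) w \<in> W" using w subspace_scale[OF W_sub] by (simp add: sh_def)
  ultimately show ?thesis unfolding LN_def using eL by blast
qed

lemma LN_mono: "m \<le> n \<Longrightarrow> LN n \<subseteq> LN m"
proof
  fix w assume mn: "m \<le> n" and w: "w \<in> LN n"
  have "fls_ge 0 (fls_X_intpow (n - m) :: 'k fls)" using mn by (simp add: fls_ge_def)
  then obtain a where a: "(fls_X_intpow (n - m) :: 'k fls) = fps_to_fls a" using fls_ge_0_fps by blast
  have "sh (- m) w = sh (n - m) (sh (- n) w)" by simp
  also have "\<dots> = int_scale a (sh (- n) w)" unfolding sh_def[of "n - m"] int_scale_def a ..
  finally show "w \<in> LN m" using int.subspace_scale[OF L_int] w unfolding LN_def by auto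
qed

lemma LN_0: "LN 0 = L" unfolding LN_def by simp

lemma pow_LN: "x \<in> LN m \<Longrightarrow> (\<psi> ^^ n) x \<in> LN m"
  unfolding LN_def using pow_L by (simp flip: pow_sh)

text \<open>A scalar outside a semilinear map is its inverse twist inside; this twist is again
  integral, so L absorbs it.\<close>

lemma pow_image_k: "k.subspace ((\<psi> ^^ n) ` L)"
  unfolding k.subspace_def
proof (intro conjI ballI allI)
  show "0 \<in> (\<psi> ^^ n) ` L" using k.subspace_0[OF L_k] pow_0[of n] by (metis imageI)
  fix x y assume "x \<in> (\<psi> ^^ n) ` L" "y \<in> (\<psi> ^^ n) ` L"
  thus "x + y \<in> (\<psi> ^^ n) ` L" using k.subspace_add[OF L_k] by (auto simp flip: pow_add)
next
  fix a x assume "x \<in> (\<psi> ^^ n) ` L"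
  then obtain y where y: "y \<in> L" "x = (\<psi> ^^ n) y" by blast
  have "fls_ge 0 ((inv \<tau> ^^ n) (fls_const a))" by (rule tau'_pow_ge) (simp add: fls_ge_def)
  then obtain b where b: "(inv \<tau> ^^ n) (fls_const a) = fps_to_fls b" using fls_ge_0_fps by blast
  have "(\<tau> ^^ n) ((inv \<tau> ^^ n) c) = c" for c
    by (induction n arbitrary: c) (simp_all add: funpow_swap1 surj_f_inv_f[OF bij_is_surj[OF tau_bij]])
  hence "(\<psi> ^^ n) (int_scale b y) = ks a x"
    unfolding int_scale_pow b[symmetric] ks_def y by simp
  thus "ks a x \<in> (\<psi> ^^ n) ` L" using int.subspace_scale[OF L_int y(1), of b] by (metis imageI)
qed

lemma pow'_bounded: "\<exists>c\<ge>0. \<forall>n. (\<psi>' ^^ j) ` Fil n \<subseteq> Fil (n - c)"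
  by (rule semilinear_bounded[OF pow'_add pow'_scale tau'_pow_ge])

lemma Fil_pow_image: "\<exists>c. \<forall>x\<in>Fil c \<inter> W. x \<in> (\<psi> ^^ n) ` L"
proof -
  obtain c where c: "\<forall>m. (\<psi>' ^^ n) ` Fil m \<subseteq> Fil (m - c)" using pow'_bounded by blast
  have "x \<in> (\<psi> ^^ n) ` L" if "x \<in> Fil (eL + c)" "x \<in> W" for x
  proof -
    have "(\<psi>' ^^ n) x \<in> Fil eL \<inter> W" using c[rule_format, of "eL + c"] that by (auto simp: pow'_W)
    hence "(\<psi>' ^^ n) x \<in> L" using eL by blast
    thus ?thesis by (metis imageI pow_pow')
  qed
  thus ?thesis by blast
qed

lemma L_artinian: "k.artinian_between (LN n) L" if "n \<ge> 0"
  by (rule k.artinian_restrict[OF Fil_artinian[of 0 "n + eL"]])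
    (use that eL Fil_k L_k L_Fil L_W Fil_LN Fil_mono in auto)

definition "Wn = {w \<in> W. \<forall>N. \<exists>j0. \<forall>j\<ge>j0. (\<psi> ^^ j) w \<in> Fil N}"
definition "Wu = {w \<in> W. \<exists>c. \<forall>j. (\<psi>' ^^ j) w \<in> Fil c}"
definition "Lu = {w \<in> W. \<forall>j. (\<psi>' ^^ j) w \<in> L}"

lemma Wn_sub: "subspace Wn"
  unfolding subspace_def
proof (intro conjI ballI allI)
  show "0 \<in> Wn" unfolding Wn_def using subspace_0[OF W_sub] by simp
next
  fix x y assume xy: "x \<in> Wn" "y \<in> Wn"
  have "\<exists>j0. \<forall>j\<ge>j0. (\<psi> ^^ j) (x + y) \<in> Fil N" for N
  proof -
    obtain j1 j2 where "\<forall>j\<ge>j1. (\<psi> ^^ j) x \<in> Fil N" "\<forall>j\<ge>j2. (\<psi> ^^ j) y \<in> Fil N"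
      using xy unfolding Wn_def by blast
    thus ?thesis by (intro exI[of _ "max j1 j2"]) (auto simp: pow_add intro: Fil_add)
  qed
  moreover have "x + y \<in> W" using xy subspace_add[OF W_sub] unfolding Wn_def by simp
  ultimately show "x + y \<in> Wn" unfolding Wn_def by simp
next
  fix c :: "'k fls" and x assume x: "x \<in> Wn"
  obtain m where m: "fls_ge m c" using fls_ge_ex by blast
  have "\<exists>j0. \<forall>j\<ge>j0. (\<psi> ^^ j) (scale c x) \<in> Fil N" for N
  proof -
    obtain j1 where "\<forall>j\<ge>j1. (\<psi> ^^ j) x \<in> Fil (N - m)" using x unfolding Wn_def by blast
    thus ?thesis using Fil_mult[of m _ _ "N - m"] m
      by (intro exI[of _ j1]) (auto simp: pow_scale tau_pow_ge)
  qed
  moreover have "scale c x \<in> W" using x subspace_scale[OF W_sub] unfolding Wn_def by simp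
  ultimately show "scale c x \<in> Wn" unfolding Wn_def by simp
qed

lemma Wu_sub: "subspace Wu"
  unfolding subspace_def
proof (intro conjI ballI allI)
  show "0 \<in> Wu" unfolding Wu_def using subspace_0[OF W_sub] by simp
next
  fix x y assume xy: "x \<in> Wu" "y \<in> Wu"
  obtain c1 c2 where "\<forall>j. (\<psi>' ^^ j) x \<in> Fil c1" "\<forall>j. (\<psi>' ^^ j) y \<in> Fil c2"
    using xy unfolding Wu_def by blast
  hence "\<forall>j. (\<psi>' ^^ j) (x + y) \<in> Fil (min c1 c2)"
    using Fil_mono[of "min c1 c2" c1] Fil_mono[of "min c1 c2" c2] by (auto simp: pow'_add intro!: Fil_add)
  moreover have "x + y \<in> W" using xy subspace_add[OF W_sub] unfolding Wu_def by simp
  ultimately show "x + y \<in> Wu" unfolding Wu_def by blast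
next
  fix c :: "'k fls" and x assume x: "x \<in> Wu"
  obtain m where m: "fls_ge m c" using fls_ge_ex by blast
  obtain c1 where "\<forall>j. (\<psi>' ^^ j) x \<in> Fil c1" using x unfolding Wu_def by blast
  hence "\<forall>j. (\<psi>' ^^ j) (scale c x) \<in> Fil (c1 + m)"
    using m by (auto simp: pow'_scale intro!: Fil_mult tau'_pow_ge)
  moreover have "scale c x \<in> W" using x subspace_scale[OF W_sub] unfolding Wu_def by simp
  ultimately show "scale c x \<in> Wu" unfolding Wu_def by blast
qed

text \<open>On the finite-dimensional space \<open>Wn\<close> one fixed power of \<psi> raises the
  filtration of every vector by 1. Each backward iterate of w is that power applied to a later
  backward iterate, so the common lower bound of the backward orbit improves without end.\<close>

lemma Wu_Wn_0:
  assumes "w \<in> Wu" "w \<in> Wn" shows "w = 0"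
proof -
  obtain C where C: "finite C" "independent C" "span C = Wn" by (rule subspace_finite_basis[OF Wn_sub])
  obtain c where c: "\<And>n v b. v \<in> Fil n \<Longrightarrow> v \<in> span C \<Longrightarrow> b \<in> C \<Longrightarrow> fls_ge (n - c) (representation C v b)"
    using representation_bounded[OF C(1,2)] by blast
  \<comment> \<open>The surplus c + 1 outweighs the loss c incurred in passing to
    coordinates.\<close>
  have "\<forall>b\<in>C. \<exists>j0. \<forall>j\<ge>j0. (\<psi> ^^ j) b \<in> Fil (c + 1)"
    using C span_base unfolding Wn_def by blast
  then obtain j0 where j0: "\<And>b j. b \<in> C \<Longrightarrow> j \<ge> j0 b \<Longrightarrow> (\<psi> ^^ j) b \<in> Fil (c + 1)" by metis
  obtain j where j: "\<And>b. b \<in> C \<Longrightarrow> j0 b \<le> j" using finite_nat_bound[OF C(1)] by blast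
  have powsum: "(\<psi> ^^ j) (\<Sum>b\<in>A. f b) = (\<Sum>b\<in>A. (\<psi> ^^ j) (f b))" for A and f :: "'v \<Rightarrow> 'v"
    by (induction A rule: infinite_finite_induct) (auto simp: pow_add)
  have step: "(\<psi> ^^ j) x \<in> Fil (a + 1)" if x: "x \<in> Fil a" "x \<in> Wn" for x a
  proof -
    have xs: "x \<in> span C" using x C by simp
    have "(\<psi> ^^ j) x = (\<Sum>b\<in>C. scale ((\<tau> ^^ j) (representation C x b)) ((\<psi> ^^ j) b))"
      by (subst representation_sum_eq[OF C(1,2) xs]) (simp only: powsum pow_scale)
    moreover have "scale ((\<tau> ^^ j) (representation C x b)) ((\<psi> ^^ j) b) \<in> Fil (c + 1 + (a - c))" if "b \<in> C" for b
      using c[OF x(1) xs that] j0[OF that j[OF that]] by (intro Fil_mult) (auto simp: tau_pow_ge)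
    ultimately show ?thesis by (simp add: Fil_sum add.commute)
  qed
  have psi'_Wn: "\<psi>' x \<in> Wn" if "x \<in> Wn" for x
  proof -
    have "\<exists>j0. \<forall>j\<ge>j0. (\<psi> ^^ j) (\<psi>' x) \<in> Fil N" for N
    proof -
      obtain j1 where j1: "\<forall>j\<ge>j1. (\<psi> ^^ j) x \<in> Fil N" using \<open>x \<in> Wn\<close> unfolding Wn_def by blast
      have "(\<psi> ^^ j) (\<psi>' x) \<in> Fil N" if "j \<ge> Suc j1" for j
      proof -
        obtain i where "j = Suc i" "i \<ge> j1" using \<open>j \<ge> Suc j1\<close> by (metis Suc_le_D Suc_le_mono)
        thus ?thesis using j1 by (simp add: funpow_swap1)
      qed
      thus ?thesis by blast
    qed
    thus ?thesis using that unfolding Wn_def by (auto simp: psi'_W)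
  qed
  have pow'_Wn: "(\<psi>' ^^ i) w \<in> Wn" for i using assms(2) by (induction i) (auto intro: psi'_Wn)
  obtain c0 where c0: "\<And>i. (\<psi>' ^^ i) w \<in> Fil c0" using assms(1) unfolding Wu_def by blast
  have pow'_step: "(\<psi>' ^^ i) w = (\<psi> ^^ j) ((\<psi>' ^^ (j + i)) w)" for i by (simp add: funpow_add)
  have "(\<psi>' ^^ i) w \<in> Fil (c0 + int n)" for n i
  proof (induction n arbitrary: i)
    case (Suc n)
    show ?case using step[OF Suc.IH[of "j + i"] pow'_Wn] unfolding pow'_step[of i] by (simp add: add.commute add.left_commute)
  qed (use c0 in simp)
  from this[of 0] have wF: "w \<in> Fil (c0 + int n)" for n by simp
  have "w \<in> Fil n" for n 
  proof -
    have "n \<le> c0 + int (nat (n - c0))" by simp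
    thus ?thesis by (rule Fil_monoD[OF wF])
  qed
  thus ?thesis by (rule Fil_sep)
qed

lemma Lu_lattice: "lattice_of Wu Lu" and psi_Lu: "\<psi> ` Lu = Lu"
proof -
  obtain C where C: "finite C" "independent C" "span C = Wu" by (rule subspace_finite_basis[OF Wu_sub])
  have LuWu: "Lu \<subseteq> Wu" unfolding Lu_def Wu_def using L_Fil by blast
  have int: "int.subspace Lu"
    unfolding int.subspace_def
  proof (intro conjI ballI allI)
    show "0 \<in> Lu" unfolding Lu_def using subspace_0[OF W_sub] int.subspace_0[OF L_int] by simp
    fix x y assume "x \<in> Lu" "y \<in> Lu"
    thus "x + y \<in> Lu" unfolding Lu_def using subspace_add[OF W_sub] int.subspace_add[OF L_int] by (auto simp: pow'_add)
  next
    fix a x assume x: "x \<in> Lu"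
    have "(\<psi>' ^^ j) (int_scale a x) \<in> L" for j
    proof -
      have "fls_ge 0 ((inv \<tau> ^^ j) (fps_to_fls a))" by (rule tau'_pow_ge) (rule fls_ge_fps)
      then obtain b where "(inv \<tau> ^^ j) (fps_to_fls a) = fps_to_fls b" using fls_ge_0_fps by blast
      hence "(\<psi>' ^^ j) (int_scale a x) = int_scale b ((\<psi>' ^^ j) x)" by (simp add: int_scale_def pow'_scale)
      thus ?thesis using x int.subspace_scale[OF L_int] unfolding Lu_def by simp
    qed
    thus "int_scale a x \<in> Lu" unfolding Lu_def using x subspace_scale[OF W_sub] by (auto simp: Lu_def int_scale_def)
  qed
  have "\<forall>b\<in>C. \<exists>c. \<forall>j. (\<psi>' ^^ j) b \<in> Fil c" using C span_base unfolding Wu_def by blast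
  then obtain c where c: "\<And>b j. b \<in> C \<Longrightarrow> (\<psi>' ^^ j) b \<in> Fil (c b)" by metis
  obtain d where d: "\<And>b. b \<in> C \<Longrightarrow> - c b \<le> d" using finite_int_bound[OF C(1), of "\<lambda>b. - c b"] by blast
  \<comment> \<open>The shift by d brings the whole backward orbit of b into Fil 0, the further
    shift by eL into L.\<close>
  have "sh (d + eL) b \<in> Lu" if b: "b \<in> C" for b
  proof -
    have bW: "b \<in> W" using b C span_base unfolding Wu_def by blast
    hence shW: "sh (d + eL) b \<in> W" using subspace_scale[OF W_sub] by (simp add: sh_def)
    have "(\<psi>' ^^ j) (sh (d + eL) b) \<in> Fil eL" for j
      unfolding pow'_sh Fil_shift_iff using c[OF b, of j] d[OF b] by (auto intro: Fil_monoD)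
    hence "(\<psi>' ^^ j) (sh (d + eL) b) \<in> L" for j using eL(2) pow'_W shW by blast
    thus ?thesis unfolding Lu_def using shW by blast
  qed
  note sh_Lu = this
  have "Lu \<subseteq> Fil 0"
  proof
    fix w assume "w \<in> Lu"
    hence "(\<psi>' ^^ 0) w \<in> L" unfolding Lu_def by blast
    thus "w \<in> Fil 0" using L_Fil by auto
  qed
  hence "lattice_of (span C) Lu"
    using LuWu C by (intro lattice_of_bounded[OF C(1,2) int _ _ sh_Lu]) auto
  thus "lattice_of Wu Lu" using C by simp
  show "\<psi> ` Lu = Lu"
  proof (intro equalityI subsetI)
    fix y assume "y \<in> \<psi> ` Lu"
    then obtain x where x: "x \<in> Lu" "y = \<psi> x" by blast
    have "(\<psi>' ^^ j) (\<psi> x) \<in> L" for j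
    proof (cases j)
      case 0
      have "(\<psi>' ^^ 0) x \<in> L" using x unfolding Lu_def by blast
      hence "x \<in> L" by simp
      thus ?thesis using 0 psi_L by simp
    next
      case (Suc i)
      thus ?thesis using x unfolding Lu_def by (simp add: funpow_swap1)
    qed
    thus "y \<in> Lu" using x psi_W unfolding Lu_def by blast
  next
    fix y assume y: "y \<in> Lu"
    have "(\<psi>' ^^ j) (\<psi>' y) \<in> L" for j
    proof -
      have "(\<psi>' ^^ Suc j) y \<in> L" using y unfolding Lu_def by blast
      thus ?thesis by (simp add: funpow_swap1)
    qed
    hence "\<psi>' y \<in> Lu" using y psi'_W unfolding Lu_def by blast
    thus "y \<in> \<psi> ` Lu" by (metis imageI psi_inv(1))
  qed
qed

end

section \<open>Existence of the Fitting decomposition\<close>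

context bounded_semilinear
begin

lemma LN_int: "int.subspace (LN n)"
proof -
  have "sh (- n) (int_scale a w) = int_scale a (sh (- n) w)" for a w
    by (simp add: int_scale_def sh_scale)
  moreover have "sh (- n) 0 = 0" by (simp add: sh_def)
  ultimately show ?thesis using L_int unfolding LN_def int.subspace_def by (simp add: sh_add)
qed

lemma pow_LN_le: "(\<psi> ^^ j) u \<in> LN n \<Longrightarrow> j \<le> J \<Longrightarrow> (\<psi> ^^ J) u \<in> LN n"
proof -
  assume u: "(\<psi> ^^ j) u \<in> LN n" and "j \<le> J"
  have "(\<psi> ^^ J) u = (\<psi> ^^ (J - j)) ((\<psi> ^^ j) u)"
    using \<open>j \<le> J\<close> by (metis comp_apply funpow_add le_add_diff_inverse2)
  thus ?thesis using pow_LN[OF u] by simp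
qed

lemma pow_image_dec: "(\<psi> ^^ Suc j) ` L \<subseteq> (\<psi> ^^ j) ` L"
  using psi_L by (auto simp: funpow_swap1)

lemma pow_image_L: "(\<psi> ^^ j) ` L \<subseteq> L" using pow_L by blast

text \<open>Fitting's lemma modulo \<epsilon>^N: the images of \<psi>^j become stationary there, so
  \<psi>^j0 v agrees with some \<psi>^(j0 + N) x, and u = \<psi>^N x differs from v by something
  that \<psi>^j0 makes small.\<close>

lemma fitting_approx:
  assumes v: "v \<in> L"
  shows "\<exists>u\<in>(\<psi> ^^ N) ` L. \<exists>j. (\<psi> ^^ j) (v - u) \<in> LN (int N)"
proof -
  define A where "A j = {x + y |x y. x \<in> (\<psi> ^^ j) ` L \<and> y \<in> LN (int N)}" for j
  have LNL: "LN (int N) \<subseteq> L" using LN_mono[of 0 "int N"] LN_0 by simp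
  have A1: "k.subspace (A j)" for j unfolding A_def by (rule k.subspace_sums[OF pow_image_k LN_k])
  have A2: "LN (int N) \<subseteq> A j" for j
  proof
    fix y assume "y \<in> LN (int N)"
    hence "0 + y \<in> A j" unfolding A_def using k.subspace_0[OF pow_image_k] by blast
    thus "y \<in> A j" by simp
  qed
  have A3: "A j \<subseteq> L" for j
    unfolding A_def using pow_image_L LNL k.subspace_add[OF L_k] by blast
  have A4: "A (Suc j) \<subseteq> A j" for j unfolding A_def using pow_image_dec[of j] by blast
  obtain j0 where j0: "\<forall>j\<ge>j0. A j = A j0"
    using k.artinian_decreasing[where U = A, OF L_artinian[of "int N"] A1 A2 A3 A4] by auto
  have "(\<psi> ^^ j0) v + 0 \<in> A j0" unfolding A_def using v k.subspace_0[OF LN_k] by blast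
  moreover have "A (j0 + N) = A j0" by (rule j0[rule_format]) simp
  ultimately have "(\<psi> ^^ j0) v \<in> A (j0 + N)" by simp
  then obtain x y where xy: "(\<psi> ^^ j0) v = (\<psi> ^^ (j0 + N)) x + y" "x \<in> L" "y \<in> LN (int N)"
    unfolding A_def by blast
  have "(\<psi> ^^ j0) (v - (\<psi> ^^ N) x) = y"
    unfolding pow_diff xy(1) by (simp add: funpow_add)
  thus ?thesis using xy by (intro bexI[of _ "(\<psi> ^^ N) x"] exI[of _ j0]) auto
qed

text \<open>The approximants of level N form the set S N, a coset of Q N. They must be chosen
  compatibly to converge; the limit u lies in every image of \<psi>^N, so it has bounded backward
  orbit, and v - u is topologically nilpotent.\<close>

lemma fitting_L:
  assumes v: "v \<in> L"
  shows "\<exists>u\<in>Wu. v - u \<in> Wn"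
proof -
  define Q where "Q N = {u \<in> (\<psi> ^^ N) ` L. \<exists>j. (\<psi> ^^ j) u \<in> LN (int N)}" for N
  define S where "S N = {u \<in> (\<psi> ^^ N) ` L. \<exists>j. (\<psi> ^^ j) (v - u) \<in> LN (int N)}" for N
  have S_ne: "\<exists>u. u \<in> S N" for N using fitting_approx[OF v, of N] unfolding S_def by blast
  have Qk: "k.subspace (Q N)" for N
    unfolding k.subspace_def
  proof (intro conjI ballI allI)
    show "0 \<in> Q N" unfolding Q_def using k.subspace_0[OF pow_image_k] k.subspace_0[OF LN_k] by simp
  next
    fix x y assume xy: "x \<in> Q N" "y \<in> Q N"
    then obtain i j where "(\<psi> ^^ i) x \<in> LN (int N)" "(\<psi> ^^ j) y \<in> LN (int N)" unfolding Q_def by blast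
    hence "(\<psi> ^^ max i j) x + (\<psi> ^^ max i j) y \<in> LN (int N)"
      by (intro k.subspace_add[OF LN_k]) (auto elim: pow_LN_le)
    hence "(\<psi> ^^ max i j) (x + y) \<in> LN (int N)" by (simp only: pow_add)
    thus "x + y \<in> Q N" unfolding Q_def using xy k.subspace_add[OF pow_image_k] unfolding Q_def by blast
  next
    fix a x assume x: "x \<in> Q N"
    then obtain j where j: "(\<psi> ^^ j) x \<in> LN (int N)" unfolding Q_def by blast
    have "fls_ge 0 ((\<tau> ^^ j) (fls_const a))" unfolding tau_pow_ge by (simp add: fls_ge_def)
    then obtain b where "(\<tau> ^^ j) (fls_const a) = fps_to_fls b" using fls_ge_0_fps by blast
    hence "(\<psi> ^^ j) (ks a x) = int_scale b ((\<psi> ^^ j) x)" unfolding ks_def pow_scale int_scale_def by simp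
    hence "(\<psi> ^^ j) (ks a x) \<in> LN (int N)" using int.subspace_scale[OF LN_int j] by simp
    thus "ks a x \<in> Q N" unfolding Q_def using x k.subspace_scale[OF pow_image_k] unfolding Q_def by blast
  qed
  have LNS: "LN (int (Suc N)) \<subseteq> LN (int N)" for N by (rule LN_mono) simp
  have Q_dec: "Q (Suc N) \<subseteq> Q N" for N unfolding Q_def using pow_image_dec[of N] LNS[of N] by blast
  have S_dec1: "S (Suc N) \<subseteq> S N" for N unfolding S_def using pow_image_dec[of N] LNS[of N] by blast
  have S_dec: "S N \<subseteq> S N'" if "N' \<le> N" for N N' using lift_Suc_antimono_le[of S] S_dec1 that by blast
  have S_diff: "s - s' \<in> Q N" if ss: "s \<in> S N" "s' \<in> S N" for s s' N
  proof -
    obtain i j where "(\<psi> ^^ i) (v - s) \<in> LN (int N)" "(\<psi> ^^ j) (v - s') \<in> LN (int N)"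
      using ss unfolding S_def by blast
    hence "(\<psi> ^^ max i j) (v - s') - (\<psi> ^^ max i j) (v - s) \<in> LN (int N)"
      by (intro k.subspace_diff[OF LN_k]) (auto elim: pow_LN_le)
    hence "(\<psi> ^^ max i j) (s - s') \<in> LN (int N)" by (simp add: pow_diff)
    moreover have "s - s' \<in> (\<psi> ^^ N) ` L"
      by (rule k.subspace_diff[OF pow_image_k]) (use ss in \<open>auto simp: S_def\<close>)
    ultimately show ?thesis unfolding Q_def by blast
  qed
  have SQ: "s - r \<in> S N" if sr: "s \<in> S N" "r \<in> Q N" for s r N
  proof -
    obtain i j where "(\<psi> ^^ i) (v - s) \<in> LN (int N)" "(\<psi> ^^ j) r \<in> LN (int N)"
      using sr unfolding S_def Q_def by blast
    hence "(\<psi> ^^ max i j) (v - s) + (\<psi> ^^ max i j) r \<in> LN (int N)"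
      by (intro k.subspace_add[OF LN_k]) (auto elim: pow_LN_le)
    moreover have "(\<psi> ^^ max i j) (v - s) + (\<psi> ^^ max i j) r = (\<psi> ^^ max i j) (v - (s - r))"
      unfolding pow_diff by simp
    ultimately have "(\<psi> ^^ max i j) (v - (s - r)) \<in> LN (int N)" by simp
    moreover have "s - r \<in> (\<psi> ^^ N) ` L"
      by (rule k.subspace_diff[OF pow_image_k]) (use sr in \<open>auto simp: S_def Q_def\<close>)
    ultimately show ?thesis unfolding S_def by blast
  qed
  \<comment> \<open>The Mittag-Leffler condition: modulo each LN K the decreasing sequence Q N
    becomes stationary, because LN K has finite codimension in L.\<close>
  have "\<exists>n0. \<forall>N\<ge>n0. Q n0 \<subseteq> {x + y |x y. x \<in> Q N \<and> y \<in> LN (int K)}" for K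
  proof -
    define U where "U N = {x + y |x y. x \<in> Q N \<and> y \<in> LN (int K)}" for N
    have LNL: "LN (int K) \<subseteq> L" using LN_mono[of 0 "int K"] LN_0 by simp
    have U1: "k.subspace (U N)" for N unfolding U_def by (rule k.subspace_sums[OF Qk LN_k])
    have U2: "LN (int K) \<subseteq> U N" for N
    proof
      fix y assume "y \<in> LN (int K)"
      hence "0 + y \<in> U N" unfolding U_def using k.subspace_0[OF Qk] by blast
      thus "y \<in> U N" by simp
    qed
    have QL: "Q N \<subseteq> L" for N unfolding Q_def using pow_image_L by blast
    have U3: "U N \<subseteq> L" for N unfolding U_def using QL LNL k.subspace_add[OF L_k] by blast
    have U4: "U (Suc N) \<subseteq> U N" for N unfolding U_def using Q_dec[of N] by blast
    obtain n0 where n0: "\<forall>N\<ge>n0. U N = U n0"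
      using k.artinian_decreasing[where U = U, OF L_artinian[of "int K"] U1 U2 U3 U4] by auto
    have "Q n0 \<subseteq> U n0"
    proof
      fix y assume "y \<in> Q n0"
      hence "y + 0 \<in> U n0" unfolding U_def using k.subspace_0[OF LN_k] by blast
      thus "y \<in> U n0" by simp
    qed
    hence "Q n0 \<subseteq> U N" if "N \<ge> n0" for N using n0[rule_format, OF that] by (simp only:)
    hence "\<forall>N\<ge>n0. Q n0 \<subseteq> U N" by (intro allI impI)
    thus ?thesis unfolding U_def by (rule exI)
  qed
  hence "\<forall>K. \<exists>n0. \<forall>N\<ge>n0. Q n0 \<subseteq> {x + y |x y. x \<in> Q N \<and> y \<in> LN (int K)}" by (rule allI)
  from choice[OF this] obtain n0 where
    n0': "\<forall>K. \<forall>N\<ge>n0 K. Q (n0 K) \<subseteq> {x + y |x y. x \<in> Q N \<and> y \<in> LN (int K)}" by (elim exE)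
  note n0 = n0'[rule_format]
  \<comment> \<open>Dominates n0 K, is at least K, and increases with K, so that approximants at
    level NK K can be improved to level NK (K + 1) by a change within LN K.\<close>
  define NK where "NK K = K + (\<Sum>i\<le>K. n0 i)" for K
  have NK: "n0 K \<le> NK K" "K \<le> NK K" "NK K \<le> NK (Suc K)" for K
    unfolding NK_def by (auto intro: trans_le_add2 member_le_sum)
  have "\<exists>f. \<forall>K. f K \<in> S (NK K) \<and> f (Suc K) - f K \<in> LN (int K)"
  proof (rule dependent_nat_choice)
    show "\<exists>x. x \<in> S (NK 0)" by (rule S_ne)
  next
    fix w K assume w: "w \<in> S (NK K)"
    obtain s where s: "s \<in> S (NK (Suc K))" using S_ne by blast
    have le: "n0 K \<le> NK (Suc K)" by (rule order_trans[OF NK(1,3)])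
    have "s \<in> S (n0 K)" using s S_dec[OF le] by blast
    moreover have "w \<in> S (n0 K)" using w S_dec[OF NK(1)] by blast
    ultimately have "s - w \<in> Q (n0 K)" by (rule S_diff)
    with le obtain r y where ry: "s - w = r + y" "r \<in> Q (NK (Suc K))" "y \<in> LN (int K)"
      using n0[of K "NK (Suc K)"] by blast
    have "s - r \<in> S (NK (Suc K))" by (rule SQ[OF s ry(2)])
    moreover have "(s - r) - w = y" using ry(1) by (simp add: algebra_simps)
    ultimately show "\<exists>w'. w' \<in> S (NK (Suc K)) \<and> w' - w \<in> LN (int K)" using ry(3) by metis
  qed
  then obtain f where f: "\<And>K. f K \<in> S (NK K)" "\<And>K. f (Suc K) - f K \<in> LN (int K)" by blast
  obtain u where u: "\<And>K. u - f K \<in> Fil (int K)"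
    using Fil_complete[of f] f(2) LN_Fil by blast
  have fW: "f K \<in> W" for K using f(1)[of K] pow_image_L L_W unfolding S_def by blast
  have uW: "u \<in> W"
  proof (rule subspace_closed[OF W_sub])
    fix n
    have "u - f (nat n) \<in> Fil n" by (rule Fil_monoD[OF u]) simp
    thus "\<exists>w\<in>W. u - w \<in> Fil n" using fW by blast
  qed
  have ufW: "u - f K \<in> W" for K using subspace_diff[OF W_sub uW fW] .
  have u_img: "u \<in> (\<psi> ^^ N) ` L" for N
  proof -
    obtain c where c: "\<forall>x\<in>Fil c \<inter> W. x \<in> (\<psi> ^^ N) ` L" using Fil_pow_image by blast
    define K where "K = max N (nat c)"
    have "u - f K \<in> Fil c" by (rule Fil_monoD[OF u]) (simp add: K_def)
    hence "u - f K \<in> (\<psi> ^^ N) ` L" using c ufW by blast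
    moreover have "N \<le> NK K" by (rule order_trans[OF _ NK(2)]) (simp add: K_def)
    hence "f K \<in> S N" using f(1) S_dec by blast
    ultimately have "(u - f K) + f K \<in> (\<psi> ^^ N) ` L" unfolding S_def
      by (intro k.subspace_add[OF pow_image_k]) auto
    thus ?thesis by simp
  qed
  have "(\<psi>' ^^ j) u \<in> Fil 0" for j using u_img[of j] L_Fil by auto
  hence "u \<in> Wu" unfolding Wu_def using uW by blast
  moreover have "v - u \<in> Wn"
  proof -
    have "\<exists>j0. \<forall>j\<ge>j0. (\<psi> ^^ j) (v - u) \<in> Fil N" for N
    proof -
      define n where "n = nat N"
      define K where "K = n + nat eL"
      have "u - f K \<in> Fil (int n + eL)" by (rule Fil_monoD[OF u]) (use eL in \<open>simp add: K_def\<close>)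
      hence 1: "u - f K \<in> LN (int n)" using ufW by (rule Fil_LN)
      have "n \<le> NK K" by (rule order_trans[OF _ NK(2)]) (simp add: K_def)
      hence "f K \<in> S n" using f(1) S_dec by blast
      then obtain j0 where j0: "(\<psi> ^^ j0) (v - f K) \<in> LN (int n)" unfolding S_def by blast
      have "(\<psi> ^^ j) (v - u) \<in> Fil N" if "j \<ge> j0" for j
      proof -
        have "(\<psi> ^^ j) (v - f K) - (\<psi> ^^ j) (u - f K) \<in> LN (int n)"
          by (intro k.subspace_diff[OF LN_k] pow_LN_le[OF j0 that] pow_LN 1)
        hence "(\<psi> ^^ j) (v - u) \<in> LN (int n)" by (simp add: pow_diff)
        hence "(\<psi> ^^ j) (v - u) \<in> Fil (int n)" using LN_Fil by blast
        thus ?thesis by (rule Fil_monoD) (simp add: n_def)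
      qed
      thus ?thesis by blast
    qed
    moreover have "v - u \<in> W" using subspace_diff[OF W_sub _ uW] v L_W by blast
    ultimately show ?thesis unfolding Wn_def by blast
  qed
  ultimately show ?thesis by blast
qed

lemma fitting:
  assumes "v \<in> W" shows "\<exists>u\<in>Wu. v - u \<in> Wn"
proof -
  obtain n where "v \<in> Fil n" using Fil_exhaust by blast
  hence "sh (eL - n) v \<in> Fil eL" by (simp add: Fil_shift_iff)
  moreover have "sh (eL - n) v \<in> W" using assms subspace_scale[OF W_sub] by (simp add: sh_def)
  ultimately have "sh (eL - n) v \<in> L" using eL by blast
  then obtain u where u: "u \<in> Wu" "sh (eL - n) v - u \<in> Wn" using fitting_L by blast
  have "sh (n - eL) u \<in> Wu" using subspace_scale[OF Wu_sub u(1)] by (simp add: sh_def)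
  moreover have "sh (n - eL) (sh (eL - n) v - u) \<in> Wn" using subspace_scale[OF Wn_sub u(2)] by (simp add: sh_def)
  hence "v - sh (n - eL) u \<in> Wn" by (simp add: sh_diff)
  ultimately show ?thesis by blast
qed

end

section \<open>Slopes\<close>

locale crystal = based_space scale B
  for scale :: "'k::alg_closed_field fls \<Rightarrow> 'v::ab_group_add \<Rightarrow> 'v" and B +
  fixes q :: nat and \<phi> :: "'v \<Rightarrow> 'v"
  assumes q: "frob_exponent TYPE('k) q"
    and phi_add: "\<phi> (x + y) = \<phi> x + \<phi> y"
    and phi_scale: "\<phi> (scale c x) = scale (fls_frob q c) (\<phi> x)"
    and phi_bij: "bij \<phi>"
    and phi_Fil0: "\<phi> ` Fil 0 \<subseteq> Fil 0"
begin

abbreviation \<sigma> :: "'k fls \<Rightarrow> 'k fls" where "\<sigma> \<equiv> fls_frob q"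

definition \<phi>' :: "'v \<Rightarrow> 'v" where "\<phi>' = inv \<phi>"

lemma phi_inv [simp]: "\<phi> (\<phi>' x) = x" "\<phi>' (\<phi> x) = x"
  unfolding \<phi>'_def using phi_bij by (simp_all add: bij_is_surj surj_f_inv_f bij_is_inj)

lemma sigma_bij: "bij \<sigma>"
proof (rule bijI)
  show "inj \<sigma>"
  proof (rule injI)
    fix x y assume "\<sigma> x = \<sigma> y"
    hence "fls_nth x n ^ q = fls_nth y n ^ q" for n by (metis fls_nth_frob[OF q])
    thus "x = y" by (intro fls_eqI) (simp add: frob_inj[OF q])
  qed
  show "surj \<sigma>" using fls_frob_surj[OF q] by (metis surjI)
qed

lemma sigma_inv [simp]: "\<sigma> (inv \<sigma> c) = c" "inv \<sigma> (\<sigma> c) = c"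
  using sigma_bij by (simp_all add: bij_is_surj surj_f_inv_f bij_is_inj)

lemma phi_0 [simp]: "\<phi> 0 = 0" using phi_add[of 0 0] by simp
lemma phi_sum: "\<phi> (\<Sum>i\<in>A. f i) = (\<Sum>i\<in>A. \<phi> (f i))"
  by (induction A rule: infinite_finite_induct) (auto simp: phi_add)
lemma phi_sh: "\<phi> (sh n x) = sh n (\<phi> x)" by (simp add: sh_def phi_scale fls_frob_intpow[OF q])
lemma phi_eq_0: "\<phi> x = 0 \<longleftrightarrow> x = 0" by (metis phi_0 phi_inv(2))
lemma phi'_add: "\<phi>' (x + y) = \<phi>' x + \<phi>' y" by (metis phi_inv phi_add)
lemma phi'_0 [simp]: "\<phi>' 0 = 0" using phi'_add[of 0 0] by simp
lemma phi'_scale: "\<phi>' (scale c x) = scale (inv \<sigma> c) (\<phi>' x)"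
proof -
  have "\<phi> (scale (inv \<sigma> c) (\<phi>' x)) = scale c x" by (simp add: phi_scale)
  thus ?thesis by (metis phi_inv(2))
qed
lemma phi'_sh: "\<phi>' (sh n x) = sh n (\<phi>' x)" by (metis phi_inv phi_sh)

lemma sigma_ge: "fls_ge n (\<sigma> c) \<longleftrightarrow> fls_ge n c" by (rule fls_ge_frob[OF q])
lemma sigma'_ge: "fls_ge n c \<Longrightarrow> fls_ge n (inv \<sigma> c)" using sigma_ge[of n "inv \<sigma> c"] by simp

lemma phi_Fil: "x \<in> Fil n \<Longrightarrow> \<phi> x \<in> Fil n"
proof -
  assume "x \<in> Fil n"
  hence "sh (- n) x \<in> Fil 0" by (simp add: Fil_shift_iff)
  hence "\<phi> (sh (- n) x) \<in> Fil 0" using phi_Fil0 by blast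
  thus ?thesis by (simp add: phi_sh Fil_shift_iff)
qed

lemma phi_pow_Fil: "x \<in> Fil n \<Longrightarrow> (\<phi> ^^ j) x \<in> Fil n" by (induction j) (auto intro: phi_Fil)
lemma phi_pow_add: "(\<phi> ^^ j) (x + y) = (\<phi> ^^ j) x + (\<phi> ^^ j) y" by (induction j) (auto simp: phi_add)
lemma phi_pow_0 [simp]: "(\<phi> ^^ j) 0 = 0" by (induction j) auto
lemma phi_pow_eq_0: "(\<phi> ^^ j) x = 0 \<longleftrightarrow> x = 0" by (induction j) (auto simp: phi_eq_0)
lemma phi_pow_sh: "(\<phi> ^^ j) (sh n x) = sh n ((\<phi> ^^ j) x)" by (induction j) (auto simp: phi_sh)
lemma phi'_pow_add: "(\<phi>' ^^ j) (x + y) = (\<phi>' ^^ j) x + (\<phi>' ^^ j) y" by (induction j) (auto simp: phi'_add)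
lemma phi_pow_scale: "(\<phi> ^^ j) (scale c x) = scale ((\<sigma> ^^ j) c) ((\<phi> ^^ j) x)"
  by (induction j) (auto simp: phi_scale)
lemma phi'_pow_scale: "(\<phi>' ^^ j) (scale c x) = scale ((inv \<sigma> ^^ j) c) ((\<phi>' ^^ j) x)"
  by (induction j) (auto simp: phi'_scale)
lemma phi'_pow_sh: "(\<phi>' ^^ j) (sh n x) = sh n ((\<phi>' ^^ j) x)" by (induction j) (auto simp: phi'_sh)
lemma sigma_pow_ge: "fls_ge n ((\<sigma> ^^ j) c) \<longleftrightarrow> fls_ge n c" by (induction j) (auto simp: sigma_ge)
lemma sigma'_pow_ge: "fls_ge n c \<Longrightarrow> fls_ge n ((inv \<sigma> ^^ j) c)" by (induction j) (auto simp: sigma'_ge)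
lemma phi_pow_phi' [simp]: "(\<phi> ^^ n) ((\<phi>' ^^ n) x) = x"
  by (induction n arbitrary: x) (simp_all add: funpow_swap1)
lemma phi'_pow_phi [simp]: "(\<phi>' ^^ n) ((\<phi> ^^ n) x) = x"
  by (induction n arbitrary: x) (simp_all add: funpow_swap1)

lemma phi'_bounded: "\<exists>c\<ge>0. \<forall>n. (\<phi>' ^^ j) ` Fil n \<subseteq> Fil (n - c)"
  by (rule semilinear_bounded[OF phi'_pow_add phi'_pow_scale sigma'_pow_ge])

text \<open>The first slope of the Newton polygon of the twisted minimal polynomial of \<open>\<phi>\<close> at \<open>b\<close>:
  with \<open>\<phi>\<^sup>d b = \<Sum>i<d. a i \<phi>\<^sup>i b\<close>, the slope \<open>s/r\<close> is the minimum of \<open>val (a i) / (d - i)\<close>, and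
  \<open>i0\<close> is the smallest index where it is attained.\<close>

lemma newton_slope:
  assumes b: "b \<noteq> 0"
  shows "\<exists>r s c1 c2. r > 0 \<and> (\<forall>n. (\<phi> ^^ (r * n)) b \<in> Fil (s * int n - c1) \<and>
    (\<phi> ^^ (r * n)) b \<notin> Fil (s * int n + c2))"
proof -
  \<comment> \<open>Here the scalars are k((\<epsilon>)) itself, to obtain the first linear relation
    among the iterates of b.\<close>
  interpret F: linear_space scale by unfold_locales
  define e where "e i = (\<phi> ^^ i) b" for i
  have "{x + y |x y. x \<in> {0} \<and> y \<in> span B} = UNIV" using span_B by auto
  hence art: "F.artinian_between {0} UNIV" using F.artinian_finite_span[OF fin_B subspace_single_0] by simp
  obtain d a where dep: "e d - (\<Sum>i<d. scale (a i) (e i)) \<in> {0}"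
    and indep: "\<And>c i. (\<Sum>i<d. scale (c i) (e i)) \<in> {0} \<Longrightarrow> i < d \<Longrightarrow> c i = 0"
    by (rule F.artinian_dependence[OF art subspace_single_0 subset_UNIV subspace_UNIV, of e]) auto
  have ed: "e d = (\<Sum>i<d. scale (a i) (e i))" using dep by simp
  have e0: "e 0 = b" by (simp add: e_def)
  have ene: "e i \<noteq> 0" for i unfolding e_def using b by (simp add: phi_pow_eq_0)
  have d0: "d > 0"
  proof (rule ccontr)
    assume "\<not> d > 0" thus False using ed ene[of 0] by simp
  qed
  define I where "I = {i. i < d \<and> a i \<noteq> 0}"
  have fI: "finite I" unfolding I_def by simp
  have Ine: "I \<noteq> {}"
  proof
    assume "I = {}"
    hence "e d = 0" unfolding ed I_def by (intro sum.neutral) auto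
    thus False using ene by blast
  qed
  define l :: "nat \<Rightarrow> rat" where "l i = of_int (fls_subdegree (a i)) / of_nat (d - i)" for i
  define l0 where "l0 = Min (l ` I)"
  define i0 where "i0 = Min {i \<in> I. l i = l0}"
  have "l0 \<in> l ` I" unfolding l0_def using fI Ine by (intro Min_in) auto
  hence ne: "{i \<in> I. l i = l0} \<noteq> {}" by auto
  have "i0 \<in> {i \<in> I. l i = l0}" unfolding i0_def using fI ne by (intro Min_in) auto
  hence i0: "i0 \<in> I" "l i0 = l0" by auto
  have l0le: "l0 \<le> l i" if "i \<in> I" for i unfolding l0_def using fI that by (intro Min_le) auto
  have l0lt: "l0 < l i" if "i \<in> I" "i < i0" for i
  proof (rule ccontr)
    assume "\<not> l0 < l i"
    hence "l i = l0" using l0le[OF that(1)] by simp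
    hence "i0 \<le> i" unfolding i0_def using fI that by (intro Min_le) auto
    thus False using that by simp
  qed
  have i0d: "i0 < d" "a i0 \<noteq> 0" using i0 unfolding I_def by auto
  define r where "r = d - i0"
  define s where "s = fls_subdegree (a i0)"
  have r0: "r > 0" unfolding r_def using i0d by simp
  have ls: "l0 = of_int s / of_int (int r)" using i0 unfolding l_def s_def r_def by simp
  have a_ge: "s * int (d - i) \<le> int r * fls_subdegree (a i)" if "i < d" "a i \<noteq> 0" for i
  proof -
    have "i \<in> I" using that unfolding I_def by simp
    from l0le[OF this] have "(of_int s :: rat) / of_int (int r) \<le> of_int (fls_subdegree (a i)) / of_int (int (d - i))"
      unfolding ls l_def by simp
    hence "(of_int s :: rat) * of_int (int (d - i)) \<le> of_int (int r) * of_int (fls_subdegree (a i))"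
      using r0 that by (simp add: field_simps)
    thus ?thesis by (metis of_int_le_iff of_int_mult)
  qed
  have a_gt: "s * int (d - i) < int r * fls_subdegree (a i)" if "i < i0" "a i \<noteq> 0" for i
  proof -
    have i: "i \<in> I" "i < d" using that i0d unfolding I_def by auto
    from l0lt[OF i(1) that(1)] have "(of_int s :: rat) / of_int (int r) < of_int (fls_subdegree (a i)) / of_int (int (d - i))"
      unfolding ls l_def by simp
    hence "(of_int s :: rat) * of_int (int (d - i)) < of_int (int r) * of_int (fls_subdegree (a i))"
      using r0 i by (simp add: field_simps)
    thus ?thesis by (metis of_int_less_iff of_int_mult)
  qed
  \<comment> \<open>\<open>ge\<close> and \<open>eqv\<close> refer to the weight r val y + s j of a
    coefficient y of e j. Multiplying by r avoids fractions; the choice of s/r as a minimum means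
    that \<phi> raises weights by at least s.\<close>
  define ge where "ge c j y \<longleftrightarrow> y = 0 \<or> c \<le> int r * fls_subdegree y + s * int j" for c :: int and j and y :: "'k fls"
  define eqv where "eqv c j y \<longleftrightarrow> y \<noteq> 0 \<and> c = int r * fls_subdegree y + s * int j" for c :: int and j and y :: "'k fls"
  have ge_add: "ge c j (y + z)" if "ge c j y" "ge c j z" for c j y z
  proof (cases "y = 0 \<or> z = 0 \<or> y + z = 0")
    case True
    thus ?thesis using that by (auto simp: ge_def)
  next
    case False
    hence "min (fls_subdegree y) (fls_subdegree z) \<le> fls_subdegree (y + z)"
      by (intro fls_plus_subdegree) auto
    hence "fls_subdegree y \<le> fls_subdegree (y + z) \<or> fls_subdegree z \<le> fls_subdegree (y + z)" by linarith
    hence "int r * fls_subdegree y \<le> int r * fls_subdegree (y + z) \<or> int r * fls_subdegree z \<le> int r * fls_subdegree (y + z)"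
      by (auto intro: mult_left_mono)
    thus ?thesis using that False unfolding ge_def by linarith
  qed
  have eqv_add: "eqv c j (y + z)" if "eqv c j y" "ge (c + 1) j z" for c j y z
  proof (cases "z = 0")
    case False
    hence "int r * fls_subdegree y < int r * fls_subdegree z" using that unfolding ge_def eqv_def by linarith
    hence lt: "fls_subdegree y < fls_subdegree z" using r0 by (simp add: mult_less_cancel_left)
    hence "fls_subdegree (y + z) = fls_subdegree y" using that unfolding eqv_def
      by (intro fls_subdegree_add_eq1) auto
    moreover have "y + z \<noteq> 0"
    proof
      assume "y + z = 0"
      hence "z = - y" by (simp add: eq_neg_iff_add_eq_0 add.commute)
      thus False using lt by simp
    qed
    ultimately show ?thesis using that unfolding eqv_def by simp
  qed (use that in simp)
  have ge_strict: "ge (c + 1) j y" if "ge c j y" "\<not> eqv c j y" for c j y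
    using that unfolding ge_def eqv_def by linarith
  have ge_weak: "ge c j y" if "ge (c + 1) j y" for c j y using that unfolding ge_def by linarith
  have ge_sigma: "ge c j (\<sigma> y) \<longleftrightarrow> ge c j y" for c j y
    unfolding ge_def by (simp add: fls_frob_eq_0_iff[OF q] fls_subdegree_frob[OF q])
  have eqv_sigma: "eqv c j (\<sigma> y) \<longleftrightarrow> eqv c j y" for c j y
    unfolding eqv_def by (simp add: fls_frob_eq_0_iff[OF q] fls_subdegree_frob[OF q])
  have ge_Suc: "ge (c + s) (Suc j) y \<longleftrightarrow> ge c j y" for c j y unfolding ge_def by (auto simp: algebra_simps)
  have ge_Suc1: "ge (c + s + 1) (Suc j) y \<longleftrightarrow> ge (c + 1) j y" for c j y unfolding ge_def by (auto simp: algebra_simps)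
  have ge_zero: "ge c j 0" for c j unfolding ge_def by simp
  have eqv_Suc: "eqv (c + s) (Suc j) y \<longleftrightarrow> eqv c j y" for c j y unfolding eqv_def by (auto simp: algebra_simps)
  have split: "s * int (d - j) = s * int d - s * int j" "s * int (d - 1) = s * int d - s" if "j < d" for j
    using that d0 by (auto simp: of_nat_diff algebra_simps)
  have ge_mult: "ge (c + s) j (y * a j)" if "ge c (d - 1) y" "j < d" for c j y
    using that a_ge[of j] split[OF that(2)] unfolding ge_def by (cases "y = 0 \<or> a j = 0") (auto simp: algebra_simps)
  have ge_mult1: "ge (c + s + 1) j (y * a j)" if "ge c (d - 1) y" "j < i0" for c j y
    using that a_gt[of j] split[of j] i0d unfolding ge_def by (cases "y = 0 \<or> a j = 0") (auto simp: algebra_simps)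
  have eqv_mult: "eqv (c + s) i0 (y * a i0)" if "eqv c (d - 1) y" for c y
  proof -
    have "int r * s = s * int d - s * int i0" unfolding r_def using i0d by (simp add: of_nat_diff algebra_simps)
    thus ?thesis using that split[OF i0d(1)] i0d(2) unfolding eqv_def by (auto simp: algebra_simps s_def)
  qed
  define V where "V x = (\<Sum>i<d. scale (x i) (e i))" for x
  \<comment> \<open>The coordinates of \<phi> (V x): the twisted companion matrix of the relation
    for e d.\<close>
  define st where "st x j = (if j = 0 then 0 else \<sigma> (x (j - 1))) + \<sigma> (x (d - 1)) * a j" for x j
  have phiV: "\<phi> (V x) = V (st x)" for x
  proof -
    obtain d' where d': "d = Suc d'" using d0 by (cases d) auto
    have "\<phi> (V x) = (\<Sum>i<d. scale (\<sigma> (x i)) (e (Suc i)))" unfolding V_def e_def by (simp add: phi_sum phi_scale)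
    also have "\<dots> = (\<Sum>i<d'. scale (\<sigma> (x i)) (e (Suc i))) + scale (\<sigma> (x d')) (e d)" unfolding d' by simp
    also have "(\<Sum>i<d'. scale (\<sigma> (x i)) (e (Suc i))) = (\<Sum>j<d. scale (if j = 0 then 0 else \<sigma> (x (j - 1))) (e j))"
      unfolding d' sum.lessThan_Suc_shift by simp
    also have "scale (\<sigma> (x d')) (e d) = (\<Sum>j<d. scale (\<sigma> (x (d - 1)) * a j) (e j))"
      unfolding ed by (simp add: scale_sum_right scale_right_distrib d')
    finally show ?thesis unfolding V_def st_def by (simp add: sum.distrib scale_left_distrib)
  qed
  \<comment> \<open>An invariant that rules out cancellation: the least weight c is attained at some
    index from i0 on and at no index below. If index d - 1 attains it, a i0 carries it to i0, where
    the shifted term comes from below i0 and has larger weight; otherwise it moves up by one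
    place.\<close>
  define lead where "lead c x \<longleftrightarrow> (\<forall>i<d. ge c i (x i)) \<and> (\<exists>i. i0 \<le> i \<and> i < d \<and> eqv c i (x i)) \<and>
    (\<forall>i<i0. ge (c + 1) i (x i))" for c x
  have lead_st: "lead (c + s) (st x)" if L: "lead c x" for c x
    unfolding lead_def
  proof (intro conjI allI impI)
    have xg: "ge c i (x i)" if "i < d" for i using L that unfolding lead_def by blast
    have xg1: "ge (c + 1) i (x i)" if "i < i0" for i using L that unfolding lead_def by blast
    have xd: "ge c (d - 1) (\<sigma> (x (d - 1)))" using xg[of "d - 1"] d0 by (simp add: ge_sigma)
    have p1: "ge (c + s) j (if j = 0 then 0 else \<sigma> (x (j - 1)))" if "j < d" for j
      using xg[of "j - 1"] that by (cases j) (simp_all add: ge_sigma ge_Suc ge_zero)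
    have p2: "ge (c + s + 1) j (if j = 0 then 0 else \<sigma> (x (j - 1)))" if "j \<le> i0" for j
      using xg1[of "j - 1"] that by (cases j) (simp_all add: ge_sigma ge_Suc1 ge_zero)
    show "ge (c + s) i (st x i)" if "i < d" for i
      unfolding st_def by (rule ge_add[OF p1[OF that] ge_mult[OF xd that]])
    show "ge (c + s + 1) i (st x i)" if "i < i0" for i
      unfolding st_def using that by (intro ge_add p2 ge_mult1[OF xd]) auto
    show "\<exists>i. i0 \<le> i \<and> i < d \<and> eqv (c + s) i (st x i)"
    proof (cases "eqv c (d - 1) (x (d - 1))")
      case True
      hence "eqv (c + s) i0 (\<sigma> (x (d - 1)) * a i0)" by (intro eqv_mult) (simp add: eqv_sigma)
      from eqv_add[OF this p2[OF order_refl]] have "eqv (c + s) i0 (st x i0)" unfolding st_def by (simp add: add.commute)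
      thus ?thesis using i0d by blast
    next
      case False
      have xd1: "ge (c + 1) (d - 1) (\<sigma> (x (d - 1)))" using ge_strict[OF _ False] xg[of "d - 1"] d0 by (simp add: ge_sigma)
      obtain i where i: "i0 \<le> i" "i < d" "eqv c i (x i)" using L unfolding lead_def by blast
      have "i \<noteq> d - 1" using i False by auto
      hence Si: "Suc i < d" using i by simp
      have "eqv (c + s) (Suc i) (\<sigma> (x i))" using i by (simp add: eqv_Suc eqv_sigma)
      moreover have "ge (c + s + 1) (Suc i) (\<sigma> (x (d - 1)) * a (Suc i))"
        using ge_mult[OF xd1 Si] by (simp add: algebra_simps)
      ultimately have "eqv (c + s) (Suc i) (st x (Suc i))" unfolding st_def using eqv_add by simp
      thus ?thesis using Si i by (intro exI[of _ "Suc i"]) auto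
    qed
  qed
  \<comment> \<open>The invariant holds for e i0 but need not hold for b = e 0; the two orbits are
    compared through \<phi>^i0 and its bounded inverse.\<close>
  define u where "u = e i0"
  have orbit: "\<exists>x. (\<phi> ^^ n) u = V x \<and> lead (s * int i0 + s * int n) x" for n
  proof (induction n)
    case 0
    define x where "x i = (if i = i0 then 1 else 0 :: 'k fls)" for i
    have "V x = (\<Sum>i<d. if i = i0 then e i else 0)" unfolding V_def x_def by (intro sum.cong) auto
    also have "\<dots> = u" using i0d unfolding u_def by simp
    finally have "V x = u" .
    moreover have "lead (s * int i0) x" unfolding lead_def x_def ge_def eqv_def using i0d by auto
    ultimately show ?case by (intro exI[of _ x]) auto
  next
    case (Suc n)
    then obtain x where x: "(\<phi> ^^ n) u = V x" "lead (s * int i0 + s * int n) x" by blast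
    have "(\<phi> ^^ Suc n) u = V (st x)" using x phiV by simp
    moreover have "lead (s * int i0 + s * int (Suc n)) (st x)" using lead_st[OF x(2)] by (simp add: algebra_simps)
    ultimately show ?case by blast
  qed
  define C where "C = e ` {..<d}"
  have inj: "inj_on e {..<d}"
  proof (rule inj_onI, rule ccontr)
    fix i j assume ij: "i \<in> {..<d}" "j \<in> {..<d}" "e i = e j" "i \<noteq> j"
    define c where "c l = (if l = i then 1 else if l = j then - 1 else 0 :: 'k fls)" for l
    have "(\<Sum>l<d. scale (c l) (e l)) = (\<Sum>l<d. (if l = i then e l else 0) - (if l = j then e l else 0))"
      unfolding c_def using ij by (intro sum.cong) auto
    also have "\<dots> = 0" using ij by (simp add: sum_subtractf)
    finally have "c i = 0" using indep[of c i] ij by simp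
    thus False unfolding c_def by simp
  qed
  have fC: "finite C" unfolding C_def by simp
  have sumC: "(\<Sum>v\<in>C. scale (f v) v) = (\<Sum>i<d. scale (f (e i)) (e i))" for f
    unfolding C_def by (subst sum.reindex[OF inj]) simp
  have indC: "independent C"
  proof
    assume "dependent C"
    then obtain f v where f: "v \<in> C" "f v \<noteq> 0" "(\<Sum>v\<in>C. scale (f v) v) = 0"
      using dependent_finite[OF fC] by blast
    then obtain i where "i < d" "v = e i" unfolding C_def by blast
    thus False using indep[of "\<lambda>i. f (e i)" i] f unfolding sumC by simp
  qed
  have VC: "V x \<in> span C" for x
    unfolding V_def C_def by (intro span_sum span_scale span_base) auto
  have repV: "representation C (V x) (e i) = x i" if "i < d" for x i
  proof -
    have "V x = (\<Sum>i<d. scale (representation C (V x) (e i)) (e i))"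
      using representation_sum_eq[OF fC indC VC[of x]] unfolding sumC .
    hence "(\<Sum>i<d. scale (representation C (V x) (e i) - x i) (e i)) = 0"
      by (simp add: scale_left_diff_distrib sum_subtractf V_def[of x, symmetric])
    thus ?thesis using indep[of "\<lambda>i. representation C (V x) (e i) - x i" i] that by simp
  qed
  obtain c where c: "\<And>n v b. v \<in> Fil n \<Longrightarrow> v \<in> span C \<Longrightarrow> b \<in> C \<Longrightarrow> fls_ge (n - c) (representation C v b)"
    using representation_bounded[OF fC indC] by blast
  obtain f0 where f0: "C \<subseteq> Fil f0" using Fil_exhaust_finite[OF fC] by blast
  define D where "D = \<bar>s\<bar> * int d"
  have Dge: "s * (int i0 - int i) \<le> D" "- D \<le> s * (int i0 - int i)" if "i < d" for i
  proof -
    have "\<bar>s * (int i0 - int i)\<bar> \<le> \<bar>s\<bar> * int d"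
      unfolding abs_mult using that i0d by (intro mult_left_mono) auto
    thus "s * (int i0 - int i) \<le> D" "- D \<le> s * (int i0 - int i)" unfolding D_def by linarith+
  qed
  have scale_r: "int r * t \<ge> - D \<Longrightarrow> t \<ge> - D" "int r * t \<le> D \<Longrightarrow> t \<le> D" for t
  proof -
    have D0: "D \<ge> 0" unfolding D_def by simp
    have r1: "int r \<ge> 1" using r0 by simp
    show "t \<ge> - D" if "int r * t \<ge> - D"
    proof (cases "t \<ge> 0")
      case False
      hence "int r * t \<le> 1 * t" using r1 by (intro mult_right_mono_neg) auto
      thus ?thesis using that by simp
    qed (use D0 in simp)
    show "t \<le> D" if "int r * t \<le> D"
    proof (cases "t \<ge> 0")
      case True
      hence "1 * t \<le> int r * t" using r1 by (intro mult_right_mono) auto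
      thus ?thesis using that by simp
    qed (use D0 in simp)
  qed
  have up: "(\<phi> ^^ (r * n)) u \<in> Fil (s * int n - D + f0)" for n
  proof -
    obtain x where x: "(\<phi> ^^ (r * n)) u = V x" "lead (s * int i0 + s * int (r * n)) x" using orbit by blast
    have "scale (x i) (e i) \<in> Fil (f0 + (s * int n - D))" if i: "i < d" for i
    proof (rule Fil_mult)
      have "ge (s * int i0 + s * int (r * n)) i (x i)" using x i unfolding lead_def by blast
      hence "x i = 0 \<or> s * (int i0 - int i) \<le> int r * (fls_subdegree (x i) - s * int n)"
        unfolding ge_def by (auto simp: algebra_simps)
      hence "x i = 0 \<or> - D \<le> int r * (fls_subdegree (x i) - s * int n)" using Dge[OF i] by linarith
      hence "x i = 0 \<or> - D \<le> fls_subdegree (x i) - s * int n" using scale_r by blast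
      thus "fls_ge (s * int n - D) (x i)" unfolding fls_ge_iff_subdegree by linarith
      show "e i \<in> Fil f0" using f0 i unfolding C_def by blast
    qed
    hence "V x \<in> Fil (f0 + (s * int n - D))" unfolding V_def by (intro Fil_sum) auto
    thus ?thesis using x by (simp add: algebra_simps)
  qed
  have low: "(\<phi> ^^ (r * n)) u \<notin> Fil (s * int n + (c + D + 1))" for n
  proof
    assume A: "(\<phi> ^^ (r * n)) u \<in> Fil (s * int n + (c + D + 1))"
    obtain x where x: "(\<phi> ^^ (r * n)) u = V x" "lead (s * int i0 + s * int (r * n)) x" using orbit by blast
    obtain i where i: "i < d" "eqv (s * int i0 + s * int (r * n)) i (x i)" using x unfolding lead_def by blast
    have "e i \<in> C" using i unfolding C_def by blast
    from c[OF A[unfolded x(1)] VC this] have "fls_ge (s * int n + D + 1) (x i)"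
      unfolding repV[OF i(1)] by (simp add: algebra_simps)
    hence "s * int n + D + 1 \<le> fls_subdegree (x i)" using i unfolding fls_ge_iff_subdegree eqv_def by blast
    moreover have "int r * (fls_subdegree (x i) - s * int n) = s * (int i0 - int i)"
      using i unfolding eqv_def by (auto simp: algebra_simps)
    hence "int r * (fls_subdegree (x i) - s * int n) \<le> D" using Dge[OF i(1)] by simp
    hence "fls_subdegree (x i) - s * int n \<le> D" by (rule scale_r(2))
    ultimately show False by simp
  qed
  obtain c' where c': "\<forall>n. (\<phi>' ^^ i0) ` Fil n \<subseteq> Fil (n - c')" using phi'_bounded by blast
  have comm: "(\<phi> ^^ (r * n)) u = (\<phi> ^^ i0) ((\<phi> ^^ (r * n)) b)" for n
    unfolding u_def e_def by (metis funpow_add comp_apply add.commute)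
  have "(\<phi> ^^ (r * n)) b \<in> Fil (s * int n - (D - f0 + c'))" for n
  proof -
    have "(\<phi>' ^^ i0) ((\<phi> ^^ (r * n)) u) \<in> Fil (s * int n - D + f0 - c')" using up c' by blast
    thus ?thesis unfolding comm by (simp add: algebra_simps)
  qed
  moreover have "(\<phi> ^^ (r * n)) b \<notin> Fil (s * int n + (c + D + 1))" for n
    using low[of n] phi_pow_Fil unfolding comm by blast
  ultimately show ?thesis using r0 by blast
qed

end

lemma image_sum_set:
  assumes "\<And>x y. f (x + y) = f x + f y"
  shows "f ` {x + y |x y. x \<in> A \<and> y \<in> B} = {x + y |x y. x \<in> f ` A \<and> y \<in> f ` B}"
proof (intro equalityI subsetI)
  fix v assume "v \<in> f ` {x + y |x y. x \<in> A \<and> y \<in> B}"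
  then obtain x y where "x \<in> A" "y \<in> B" "v = f x + f y" using assms by auto
  thus "v \<in> {x + y |x y. x \<in> f ` A \<and> y \<in> f ` B}" by blast
next
  fix v assume "v \<in> {x + y |x y. x \<in> f ` A \<and> y \<in> f ` B}"
  then obtain x y where "x \<in> A" "y \<in> B" "v = f (x + y)" using assms by auto
  thus "v \<in> f ` {x + y |x y. x \<in> A \<and> y \<in> B}" by blast
qed

section \<open>Splitting off isoclinic parts\<close>

context crystal
begin

text \<open>Dividing \<phi>^R by \<epsilon>^S, where S/R is the least slope among the basis vectors,
  gives a map with bounded orbits. Its Fitting part with bounded backward orbits is isoclinic of
  slope S/R; the nilpotent part is proper because it misses the basis vector b0 of that
  slope.\<close>

lemma fitting_split:
  assumes W: "subspace W" and phiW: "\<And>x. \<phi> x \<in> W \<longleftrightarrow> x \<in> W" and ne: "W \<noteq> {0}"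
  obtains l Wu Wn where "subspace Wu" "subspace Wn" "Wu \<subseteq> W" "Wn \<subset> W" "\<phi> ` Wu \<subseteq> Wu"
    "\<And>x. \<phi> x \<in> Wn \<longleftrightarrow> x \<in> Wn" "\<And>w. w \<in> W \<Longrightarrow> \<exists>u\<in>Wu. w - u \<in> Wn"
    "\<And>w. w \<in> Wu \<Longrightarrow> w \<in> Wn \<Longrightarrow> w = 0" "isoclinic \<phi> l Wu"
proof -
  obtain C where C: "finite C" "independent C" "span C = W" by (rule subspace_finite_basis[OF W])
  have Cne: "C \<noteq> {}" using C ne by auto
  have "\<forall>b\<in>C. \<exists>r s c1 c2. r > 0 \<and> (\<forall>n. (\<phi> ^^ (r * n)) b \<in> Fil (s * int n - c1) \<and>
    (\<phi> ^^ (r * n)) b \<notin> Fil (s * int n + c2))"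
  proof
    fix b assume "b \<in> C"
    hence "b \<noteq> 0" using C dependent_zero by blast
    thus "\<exists>r s c1 c2. r > 0 \<and> (\<forall>n. (\<phi> ^^ (r * n)) b \<in> Fil (s * int n - c1) \<and>
      (\<phi> ^^ (r * n)) b \<notin> Fil (s * int n + c2))" by (rule newton_slope)
  qed
  from bchoice[OF this] obtain r where r1: "\<forall>b\<in>C. \<exists>s c1 c2. r b > 0 \<and> (\<forall>n. (\<phi> ^^ (r b * n)) b \<in> Fil (s * int n - c1) \<and>
    (\<phi> ^^ (r b * n)) b \<notin> Fil (s * int n + c2))" by (elim exE)
  from bchoice[OF r1] obtain s where s1: "\<forall>b\<in>C. \<exists>c1 c2. r b > 0 \<and> (\<forall>n. (\<phi> ^^ (r b * n)) b \<in> Fil (s b * int n - c1) \<and>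
    (\<phi> ^^ (r b * n)) b \<notin> Fil (s b * int n + c2))" by (elim exE)
  from bchoice[OF s1] obtain c1 where c1: "\<forall>b\<in>C. \<exists>c2. r b > 0 \<and> (\<forall>n. (\<phi> ^^ (r b * n)) b \<in> Fil (s b * int n - c1 b) \<and>
    (\<phi> ^^ (r b * n)) b \<notin> Fil (s b * int n + c2))" by (elim exE)
  from bchoice[OF c1] obtain c2 where c2: "\<forall>b\<in>C. r b > 0 \<and> (\<forall>n. (\<phi> ^^ (r b * n)) b \<in> Fil (s b * int n - c1 b) \<and>
    (\<phi> ^^ (r b * n)) b \<notin> Fil (s b * int n + c2 b))" by (elim exE)
  define l :: "'v \<Rightarrow> rat" where "l b = of_int (s b) / of_nat (r b)" for b
  define b0 where "b0 = arg_min_on l C"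
  have b0: "b0 \<in> C" unfolding b0_def using arg_min_if_finite(1)[OF C(1) Cne] .
  have l0: "l b0 \<le> l b" if "b \<in> C" for b unfolding b0_def using arg_min_least[OF C(1) Cne that] .
  \<comment> \<open>A common exponent for all basis vectors, so that their slopes are compared
    through the integers s b * k b over the denominator R.\<close>
  define R where "R = (\<Prod>b\<in>C. r b)"
  define k where "k b = R div r b" for b
  have Rk: "R = r b * k b" if "b \<in> C" for b
    unfolding k_def R_def using dvd_prodI[OF C(1) that, of r] by simp
  have R0: "R > 0" unfolding R_def using c2 by (intro prod_pos) auto
  define S where "S = s b0 * int (k b0)"
  have Sl: "of_int (s b * int (k b)) = of_nat R * l b" if "b \<in> C" for b
  proof -
    have "(of_nat (r b) :: rat) \<noteq> 0" using c2 that by auto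
    thus ?thesis unfolding Rk[OF that] l_def by simp
  qed
  have Sle: "S \<le> s b * int (k b)" if "b \<in> C" for b
  proof -
    have "(of_int S :: rat) \<le> of_int (s b * int (k b))"
      unfolding S_def Sl[OF b0] Sl[OF that] using l0[OF that] by (intro mult_left_mono) auto
    thus ?thesis by (simp only: of_int_le_iff)
  qed
  define \<psi> where "\<psi> x = sh (- S) ((\<phi> ^^ R) x)" for x
  define \<tau> where "\<tau> = \<sigma> ^^ R"
  have psi_phi: "\<psi> (\<phi> x) = \<phi> (\<psi> x)" for x unfolding \<psi>_def phi_sh by (simp add: funpow_swap1)
  have psi_pow: "(\<psi> ^^ n) x = sh (- S * int n) ((\<phi> ^^ (R * n)) x)" for n x
  proof (induction n)
    case (Suc n)
    have "(\<psi> ^^ Suc n) x = \<psi> (sh (- S * int n) ((\<phi> ^^ (R * n)) x))" unfolding Suc[symmetric] by simp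
    also have "\<dots> = sh (- S) ((\<phi> ^^ R) (sh (- S * int n) ((\<phi> ^^ (R * n)) x)))" by (rule \<psi>_def)
    also have "\<dots> = sh (- S * int (Suc n)) ((\<phi> ^^ R) ((\<phi> ^^ (R * n)) x))"
      by (simp add: phi_pow_sh algebra_simps)
    also have "(\<phi> ^^ R) ((\<phi> ^^ (R * n)) x) = (\<phi> ^^ (R * Suc n)) x" by (simp add: funpow_add)
    finally show ?case .
  qed simp
  have psiC: "(\<psi> ^^ n) b = sh (- S * int n) ((\<phi> ^^ (r b * (k b * n))) b)" if "b \<in> C" for b n
    unfolding psi_pow by (subst Rk[OF that]) (simp add: mult.assoc)
  have psi_add: "\<psi> (x + y) = \<psi> x + \<psi> y" for x y unfolding \<psi>_def phi_pow_add sh_add ..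
  have psi_scale: "\<psi> (scale c x) = scale (\<tau> c) (\<psi> x)" for c x unfolding \<psi>_def \<tau>_def phi_pow_scale sh_scale ..
  have tau_ge: "fls_ge n (\<tau> c) \<longleftrightarrow> fls_ge n c" for n c unfolding \<tau>_def by (rule sigma_pow_ge)
  have psi_pow_add: "(\<psi> ^^ n) (x + y) = (\<psi> ^^ n) x + (\<psi> ^^ n) y" for n x y
    by (induction n) (auto simp: psi_add)
  have psi_pow_scale: "(\<psi> ^^ n) (scale c x) = scale ((\<tau> ^^ n) c) ((\<psi> ^^ n) x)" for n c x
    by (induction n) (auto simp: psi_scale)
  have tau_pow_ge: "fls_ge m ((\<tau> ^^ n) c) \<longleftrightarrow> fls_ge m c" for m n c
    by (induction n) (auto simp: tau_ge)
  have orbits: "\<exists>c. \<forall>n. (\<psi> ^^ n) x \<in> Fil c" if "x \<in> W" for x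
    using that unfolding C(3)[symmetric]
  proof (induction rule: span_induct_alt)
    case base
    have "(\<psi> ^^ n) 0 = 0" for n using psi_pow_add[of n 0 0] by simp
    thus ?case by simp
  next
    case (step a b y)
    then obtain c where c: "\<forall>n. (\<psi> ^^ n) y \<in> Fil c" by blast
    obtain m where m: "fls_ge m a" using fls_ge_ex by blast
    define e where "e = min c (- c1 b + m)"
    have b: "(\<psi> ^^ n) b \<in> Fil (- c1 b)" for n
    proof -
      have "(\<phi> ^^ (r b * (k b * n))) b \<in> Fil (s b * int (k b * n) - c1 b)" using c2 step(1) by blast
      moreover have "S * int n \<le> s b * int (k b * n)"
        using mult_right_mono[OF Sle[OF step(1)], of "int n"] by (simp add: mult.assoc)
      ultimately have "(\<phi> ^^ (r b * (k b * n))) b \<in> Fil (S * int n - c1 b)" by (elim Fil_monoD) simp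
      thus ?thesis unfolding psiC[OF step(1)] Fil_shift_iff by (simp add: algebra_simps)
    qed
    have "(\<psi> ^^ n) (scale a b + y) \<in> Fil e" for n
      unfolding psi_pow_add psi_pow_scale
    proof (rule Fil_add)
      have "scale ((\<tau> ^^ n) a) ((\<psi> ^^ n) b) \<in> Fil (- c1 b + m)"
        by (rule Fil_mult) (use m b tau_pow_ge in auto)
      thus "scale ((\<tau> ^^ n) a) ((\<psi> ^^ n) b) \<in> Fil e" by (rule Fil_monoD) (simp add: e_def)
      show "(\<psi> ^^ n) y \<in> Fil e" by (rule Fil_monoD[OF c[rule_format]]) (simp add: e_def)
    qed
    thus ?case by blast
  qed
  have bij_psi: "bij \<psi>"
  proof (rule bijI')
    fix x y show "\<psi> x = \<psi> y \<longleftrightarrow> x = y"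
    proof
      assume "\<psi> x = \<psi> y"
      hence "sh S (\<psi> x) = sh S (\<psi> y)" by simp
      hence "(\<phi> ^^ R) x = (\<phi> ^^ R) y" unfolding \<psi>_def by simp
      thus "x = y" by (metis phi'_pow_phi)
    qed simp
  next
    fix y
    have "y = \<psi> ((\<phi>' ^^ R) (sh S y))" unfolding \<psi>_def by simp
    thus "\<exists>x. y = \<psi> x" by blast
  qed
  have phi_pow_W: "(\<phi> ^^ n) x \<in> W \<longleftrightarrow> x \<in> W" for n x by (induction n) (auto simp: phiW)
  interpret P: bounded_semilinear scale B \<psi> \<tau> W
  proof
    show "bij \<tau>" unfolding \<tau>_def by (rule bij_fn[OF sigma_bij])
    show "\<psi> (sh n x) = sh n (\<psi> x)" for n x unfolding \<psi>_def phi_pow_sh by (simp add: add.commute)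
    show "x \<in> W \<longleftrightarrow> \<psi> x \<in> W" for x
    proof
      assume "x \<in> W"
      thus "\<psi> x \<in> W" unfolding \<psi>_def sh_def using subspace_scale[OF W] phi_pow_W by blast
    next
      assume "\<psi> x \<in> W"
      hence "sh S (\<psi> x) \<in> W" unfolding sh_def using subspace_scale[OF W] by blast
      thus "x \<in> W" unfolding \<psi>_def by (simp add: phi_pow_W)
    qed
  qed (use psi_add psi_scale tau_ge bij_psi W orbits in auto)
  have b0W: "b0 \<in> W" using b0 C span_base by blast
  have b0n: "b0 \<notin> P.Wn"
  proof
    assume "b0 \<in> P.Wn"
    then obtain j where "(\<psi> ^^ j) b0 \<in> Fil (c2 b0)" unfolding P.Wn_def by blast
    hence "(\<phi> ^^ (r b0 * (k b0 * j))) b0 \<in> Fil (s b0 * int (k b0 * j) + c2 b0)"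
      unfolding psiC[OF b0] Fil_shift_iff S_def by (simp add: algebra_simps)
    thus False using c2 b0 by blast
  qed
  obtain cp where cp: "\<forall>n. (\<phi>' ^^ 1) ` Fil n \<subseteq> Fil (n - cp)" using phi'_bounded[of 1] by blast
  have psi_pow_phi: "(\<psi> ^^ n) (\<phi> x) = \<phi> ((\<psi> ^^ n) x)" for n x by (induction n) (auto simp: psi_phi)
  have psi'_phi: "P.\<psi>' (\<phi> x) = \<phi> (P.\<psi>' x)" for x
  proof -
    have "\<psi> (\<phi> (P.\<psi>' x)) = \<phi> x" by (simp add: psi_phi)
    thus ?thesis by (metis P.psi_inv(2))
  qed
  have psi'_pow_phi: "(P.\<psi>' ^^ n) (\<phi> x) = \<phi> ((P.\<psi>' ^^ n) x)" for n x by (induction n) (auto simp: psi'_phi)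
  show thesis
  proof (rule that[of P.Wu P.Wn "of_int S / of_nat R"])
    show "subspace P.Wu" "subspace P.Wn" by (rule P.Wu_sub, rule P.Wn_sub)
    show "P.Wu \<subseteq> W" unfolding P.Wu_def by blast
    have "P.Wn \<subseteq> W" unfolding P.Wn_def by blast
    thus "P.Wn \<subset> W" using b0W b0n by blast
    show "\<phi> ` P.Wu \<subseteq> P.Wu"
    proof
      fix y assume "y \<in> \<phi> ` P.Wu"
      then obtain x where x: "y = \<phi> x" "x \<in> P.Wu" by blast
      then obtain c where "\<forall>j. (P.\<psi>' ^^ j) x \<in> Fil c" unfolding P.Wu_def by blast
      hence "\<forall>j. (P.\<psi>' ^^ j) (\<phi> x) \<in> Fil c" unfolding psi'_pow_phi using phi_Fil by blast
      moreover have "\<phi> x \<in> W" using x phiW unfolding P.Wu_def by blast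
      ultimately show "y \<in> P.Wu" unfolding x P.Wu_def by blast
    qed
    show "\<phi> x \<in> P.Wn \<longleftrightarrow> x \<in> P.Wn" for x
    proof
      assume x: "x \<in> P.Wn"
      have "\<exists>j0. \<forall>j\<ge>j0. (\<psi> ^^ j) (\<phi> x) \<in> Fil N" for N
      proof -
        obtain j0 where "\<forall>j\<ge>j0. (\<psi> ^^ j) x \<in> Fil N" using x unfolding P.Wn_def by blast
        hence "\<forall>j\<ge>j0. (\<psi> ^^ j) (\<phi> x) \<in> Fil N" unfolding psi_pow_phi using phi_Fil by blast
        thus ?thesis by blast
      qed
      moreover have "\<phi> x \<in> W" using x phiW unfolding P.Wn_def by blast
      ultimately show "\<phi> x \<in> P.Wn" unfolding P.Wn_def by blast
    next
      assume x: "\<phi> x \<in> P.Wn"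
      have "\<exists>j0. \<forall>j\<ge>j0. (\<psi> ^^ j) x \<in> Fil N" for N
      proof -
        obtain j0 where j0: "\<forall>j\<ge>j0. (\<psi> ^^ j) (\<phi> x) \<in> Fil (N + cp)" using x unfolding P.Wn_def by blast
        have "(\<psi> ^^ j) x \<in> Fil N" if "j \<ge> j0" for j
        proof -
          have "\<phi> ((\<psi> ^^ j) x) \<in> Fil (N + cp)"
            using j0[rule_format, OF that] unfolding psi_pow_phi .
          hence "(\<phi>' ^^ 1) (\<phi> ((\<psi> ^^ j) x)) \<in> Fil (N + cp - cp)" using cp by blast
          thus ?thesis by simp
        qed
        thus ?thesis by blast
      qed
      thus "x \<in> P.Wn" using x phiW unfolding P.Wn_def by blast
    qed
    show "\<exists>u\<in>P.Wu. w - u \<in> P.Wn" if "w \<in> W" for w by (rule P.fitting[OF that])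
    show "w = 0" if "w \<in> P.Wu" "w \<in> P.Wn" for w by (rule P.Wu_Wn_0[OF that])
    have "(\<phi> ^^ R) ` P.Lu = sh S ` P.Lu"
    proof -
      have "(\<phi> ^^ R) x = sh S (\<psi> x)" for x unfolding \<psi>_def by simp
      hence "(\<phi> ^^ R) ` P.Lu = sh S ` (\<psi> ` P.Lu)" by (simp add: image_image)
      thus ?thesis unfolding P.psi_Lu .
    qed
    hence "(\<phi> ^^ R) ` P.Lu = scale (fls_X_intpow S) ` P.Lu" by (simp add: sh_def[abs_def])
    thus "isoclinic \<phi> (of_int S / of_nat R) P.Wu"
      unfolding isoclinic_def using P.Lu_lattice R0 by blast
  qed
qed

lemma lattice_of_sum:
  assumes A: "lattice_of A L" and B': "lattice_of A' L'" and int: "A \<inter> A' \<subseteq> {0}"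
  shows "lattice_of {x + y |x y. x \<in> A \<and> y \<in> A'} {x + y |x y. x \<in> L \<and> y \<in> L'}"
proof -
  obtain C where C: "finite C" "independent C" "span C = A" "L = int.span C" using A unfolding lattice_of_def by blast
  obtain C' where C': "finite C'" "independent C'" "span C' = A'" "L' = int.span C'" using B' unfolding lattice_of_def by blast
  have disj: "C \<inter> C' = {}"
  proof (rule ccontr)
    assume "C \<inter> C' \<noteq> {}"
    then obtain b where b: "b \<in> C" "b \<in> C'" by blast
    hence "b \<in> A \<inter> A'" using C C' span_base by blast
    hence "b = 0" using int by blast
    thus False using b C dependent_zero by blast
  qed
  have "independent (C \<union> C')"
  proof
    assume "dependent (C \<union> C')"
    then obtain u v where u: "v \<in> C \<union> C'" "u v \<noteq> 0" "(\<Sum>v\<in>C \<union> C'. scale (u v) v) = 0"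
      using dependent_finite[of "C \<union> C'"] C C' by blast
    let ?s = "\<Sum>v\<in>C. scale (u v) v" and ?t = "\<Sum>v\<in>C'. scale (u v) v"
    have st: "?s + ?t = 0" using u(3) C C' disj by (simp add: sum.union_disjoint)
    have sA: "?s \<in> A" using C by (metis (no_types, lifting) span_sum span_scale span_base)
    have tA: "?t \<in> A'" using C' by (metis (no_types, lifting) span_sum span_scale span_base)
    have "?s = - ?t" using st by (simp add: eq_neg_iff_add_eq_0)
    moreover have "- ?t \<in> A'" using tA C' span_neg by blast
    ultimately have "?s \<in> A \<inter> A'" using sA by simp
    hence s0: "?s = 0" using int by blast
    hence t0: "?t = 0" using st by simp
    have "\<forall>v\<in>C. u v = 0" using C dependent_finite[OF C(1)] s0 by blast
    moreover have "\<forall>v\<in>C'. u v = 0" using C' dependent_finite[OF C'(1)] t0 by blast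
    ultimately show False using u by blast
  qed
  thus ?thesis unfolding lattice_of_def
    using C C' by (intro exI[of _ "C \<union> C'"]) (simp add: span_Un int.span_Un)
qed

lemma isoclinic_pow:
  assumes "(\<phi> ^^ r) ` L = sh s ` L"
  shows "(\<phi> ^^ (r * n)) ` L = sh (s * int n) ` L"
proof (induction n)
  case (Suc n)
  have "(\<phi> ^^ (r * Suc n)) ` L = (\<phi> ^^ r) ` ((\<phi> ^^ (r * n)) ` L)"
    by (simp add: image_image funpow_add)
  also have "\<dots> = (\<phi> ^^ r) ` (sh (s * int n) ` L)" unfolding Suc ..
  also have "\<dots> = sh (s * int n) ` ((\<phi> ^^ r) ` L)" by (simp add: image_image phi_pow_sh)
  also have "\<dots> = sh (s * int (Suc n)) ` L" unfolding assms by (simp add: image_image algebra_simps)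
  finally show ?case .
qed simp

lemma isoclinic_iff:
  "isoclinic \<phi> l W \<longleftrightarrow> (\<exists>L (r::nat) (s::int). lattice_of W L \<and> r > 0 \<and> l = of_int s / of_nat r \<and>
     (\<phi> ^^ r) ` L = sh s ` L)"
  unfolding isoclinic_def sh_def[abs_def] ..

lemma isoclinic_sum:
  assumes A: "isoclinic \<phi> l A" and B': "isoclinic \<phi> l A'" and int: "A \<inter> A' \<subseteq> {0}"
  shows "isoclinic \<phi> l {x + y |x y. x \<in> A \<and> y \<in> A'}"
proof -
  obtain L r s where L: "lattice_of A L" "r > 0" "l = of_int s / of_nat r" "(\<phi> ^^ r) ` L = sh s ` L"
    using A unfolding isoclinic_iff by blast
  obtain L' r' s' where L': "lattice_of A' L'" "r' > 0" "l = of_int s' / of_nat r'" "(\<phi> ^^ r') ` L' = sh s' ` L'"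
    using B' unfolding isoclinic_iff by blast
  define M where "M = {x + y |x y. x \<in> L \<and> y \<in> L'}"
  define R where "R = r * r'"
  define S where "S = s * int r'"
  have "(of_int s :: rat) / of_nat r = of_int s' / of_nat r'" using L L' by simp
  hence "(of_int s :: rat) * of_nat r' = of_int s' * of_nat r" using L L' by (simp add: frac_eq_eq)
  hence "(of_int (s * int r') :: rat) = of_int (s' * int r)" by simp
  hence S': "S = s' * int r" unfolding S_def by (simp only: of_int_eq_iff)
  have 1: "(\<phi> ^^ R) ` L = sh S ` L" unfolding R_def S_def by (rule isoclinic_pow[OF L(4)])
  have 2: "(\<phi> ^^ R) ` L' = sh S ` L'" unfolding R_def S' using isoclinic_pow[OF L'(4), of r] by (simp add: mult.commute)
  have "(\<phi> ^^ R) ` M = {x + y |x y. x \<in> (\<phi> ^^ R) ` L \<and> y \<in> (\<phi> ^^ R) ` L'}"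
    unfolding M_def by (rule image_sum_set) (rule phi_pow_add)
  also have "\<dots> = sh S ` M" unfolding 1 2 M_def by (rule image_sum_set[symmetric]) (rule sh_add)
  finally have "(\<phi> ^^ R) ` M = sh S ` M" .
  moreover have "R > 0" unfolding R_def using L L' by simp
  moreover have "l = of_int S / of_nat R" unfolding S_def R_def using L L' by simp
  ultimately show ?thesis unfolding isoclinic_iff using lattice_of_sum[OF L(1) L'(1) int] unfolding M_def by blast
qed

text \<open>The decomposition is indexed by all rationals, so the zero space has to count as
  isoclinic of every slope.\<close>

lemma isoclinic_zero: "isoclinic \<phi> l {0}"
proof -
  obtain a b where ab: "quotient_of l = (a, b)" by force
  have b: "b > 0" using quotient_of_denom_pos[OF ab] .
  have l: "l = of_int a / of_nat (nat b)" using quotient_of_div[OF ab] b by simp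
  have "lattice_of {0} {0}" unfolding lattice_of_def by (intro exI[of _ "{}"]) (simp add: independent_empty)
  moreover have "(\<phi> ^^ nat b) ` {0} = sh a ` {0}" by (simp add: sh_def)
  ultimately show ?thesis unfolding isoclinic_iff using l b by (intro exI[of _ "{0}"] exI[of _ "nat b"] exI[of _ a]) auto
qed

text \<open>\<open>slope_decomposition\<close> relative to a subspace W, with existence and
  uniqueness separated and with sums over any finite set containing the support; this form passes
  through the induction on dimension.\<close>

definition slope_split :: "'v set \<Rightarrow> (rat \<Rightarrow> 'v set) \<Rightarrow> bool" where
  "slope_split W D \<longleftrightarrow> (\<forall>l. subspace (D l) \<and> \<phi> ` D l \<subseteq> D l \<and> isoclinic \<phi> l (D l) \<and> D l \<subseteq> W) \<and>
     (\<forall>v\<in>W. \<exists>F c. finite F \<and> (\<forall>l. c l \<in> D l) \<and> (\<forall>l. l \<notin> F \<longrightarrow> c l = 0) \<and> v = (\<Sum>l\<in>F. c l)) \<and>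
     (\<forall>F c. finite F \<and> (\<forall>l. c l \<in> D l) \<and> (\<forall>l. l \<notin> F \<longrightarrow> c l = 0) \<and> (\<Sum>l\<in>F. c l) = 0 \<longrightarrow> (\<forall>l. c l = 0))"

lemma slope_split_exists:
  assumes "subspace W" "\<And>x. \<phi> x \<in> W \<longleftrightarrow> x \<in> W"
  shows "\<exists>D. slope_split W D"
  using assms
proof (induction "dim W" arbitrary: W rule: less_induct)
  case less
  show ?case
  proof (cases "W = {0}")
    case True
    have "slope_split W (\<lambda>l. {0})"
      unfolding slope_split_def True
      by (auto simp: isoclinic_zero intro!: exI[of _ "{}"] exI[of _ "\<lambda>_. 0"])
    thus ?thesis by blast
  next
    case False
    obtain l Wu Wn where F: "subspace Wu" "subspace Wn" "Wu \<subseteq> W" "Wn \<subset> W" "\<phi> ` Wu \<subseteq> Wu"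
      "\<And>x. \<phi> x \<in> Wn \<longleftrightarrow> x \<in> Wn" "\<And>w. w \<in> W \<Longrightarrow> \<exists>u\<in>Wu. w - u \<in> Wn"
      "\<And>w. w \<in> Wu \<Longrightarrow> w \<in> Wn \<Longrightarrow> w = 0" "isoclinic \<phi> l Wu"
      by (rule fitting_split[OF less.prems False]) (rule that)
    have "span Wn \<subset> span W" using F less.prems span_eq_iff by metis
    hence "dim Wn < dim W" by (rule dim_psubset)
    from less.hyps[OF this F(2) F(6)] obtain D where D: "slope_split Wn D" by blast
    note D' = D[unfolded slope_split_def]
    note P1 = conjunct1[OF D'] and P2 = conjunct1[OF conjunct2[OF D']] and P3 = conjunct2[OF conjunct2[OF D']]
    have D1: "subspace (D l)" "\<phi> ` D l \<subseteq> D l" "isoclinic \<phi> l (D l)" "D l \<subseteq> Wn" for l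
      using P1[THEN spec, of l] by simp_all
    have D2: "\<exists>F c. finite F \<and> (\<forall>l. c l \<in> D l) \<and> (\<forall>l. l \<notin> F \<longrightarrow> c l = 0) \<and> v = (\<Sum>l\<in>F. c l)" if "v \<in> Wn" for v
      by (rule bspec[OF P2 that])
    have D3: "\<forall>l. c l = 0" if "finite F" "\<forall>l. c l \<in> D l" "\<forall>l. l \<notin> F \<longrightarrow> c l = 0" "(\<Sum>l\<in>F. c l) = 0" for F c
      by (rule P3[THEN spec, of F, THEN spec, of c, THEN mp]) (intro conjI that)
    \<comment> \<open>The induction hypothesis does not exclude slope l from Wn, so Wu is added to D
      l instead of replacing it.\<close>
    define E where "E m = (if m = l then {x + y |x y. x \<in> Wu \<and> y \<in> D l} else D m)" for m
    have int: "Wu \<inter> D l \<subseteq> {0}" using F(8) D1(4)[of l] by blast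
    have E1: "subspace (E m) \<and> \<phi> ` E m \<subseteq> E m \<and> isoclinic \<phi> m (E m) \<and> E m \<subseteq> W" for m
    proof (cases "m = l")
      case True
      have "\<phi> ` {x + y |x y. x \<in> Wu \<and> y \<in> D l} \<subseteq> {x + y |x y. x \<in> Wu \<and> y \<in> D l}"
        unfolding image_sum_set[of \<phi>, OF phi_add] using F(5) D1(2)[of l] by blast
      moreover have "{x + y |x y. x \<in> Wu \<and> y \<in> D l} \<subseteq> W"
        using F(3,4) D1(4)[of l] subspace_add[OF less.prems(1)] by blast
      ultimately show ?thesis unfolding E_def
        using True subspace_sums[OF F(1) D1(1)] isoclinic_sum[OF F(9) D1(3) int] by simp
    next
      case False
      thus ?thesis unfolding E_def using D1[of m] F(4) by auto
    qed
    have E2: "\<exists>F c. finite F \<and> (\<forall>m. c m \<in> E m) \<and> (\<forall>m. m \<notin> F \<longrightarrow> c m = 0) \<and> v = (\<Sum>m\<in>F. c m)" if v: "v \<in> W" for v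
    proof -
      obtain u where u: "u \<in> Wu" "v - u \<in> Wn" using F(7)[OF v] by blast
      obtain G c where c: "finite G" "\<forall>l. c l \<in> D l" "\<forall>l. l \<notin> G \<longrightarrow> c l = 0" "v - u = (\<Sum>l\<in>G. c l)"
        using D2[OF u(2)] by blast
      define c' where "c' m = (if m = l then u + c l else c m)" for m
      have "c' m \<in> E m" for m unfolding c'_def E_def using u c(2) by auto
      moreover have "c' m = 0" if "m \<notin> insert l G" for m unfolding c'_def using that c(3) by auto
      moreover have "(\<Sum>m\<in>insert l G. c' m) = v"
      proof -
        have "(\<Sum>m\<in>insert l G. c' m) = (\<Sum>m\<in>insert l G. (if m = l then u else 0) + c m)"
          unfolding c'_def by (intro sum.cong) auto
        also have "\<dots> = u + (\<Sum>m\<in>insert l G. c m)" using c(1) by (simp add: sum.distrib)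
        also have "(\<Sum>m\<in>insert l G. c m) = (\<Sum>m\<in>G. c m)"
          using c(1,3) by (intro sum.mono_neutral_right) auto
        finally show ?thesis using c(4) by (simp add: algebra_simps)
      qed
      ultimately show ?thesis using c(1) by (intro exI[of _ "insert l G"] exI[of _ c']) auto
    qed
    have E3: "\<forall>m. c m = 0" if c: "finite G" "\<forall>m. c m \<in> E m" "\<forall>m. m \<notin> G \<longrightarrow> c m = 0" "(\<Sum>m\<in>G. c m) = 0" for G c
    proof -
      have "c l \<in> {x + y |x y. x \<in> Wu \<and> y \<in> D l}" using c(2) unfolding E_def by metis
      then obtain x y where xy: "c l = x + y" "x \<in> Wu" "y \<in> D l" by blast
      define c' where "c' m = (if m = l then y else c m)" for m
      have c'D: "\<forall>m. c' m \<in> D m" unfolding c'_def using xy c(2) unfolding E_def by metis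
      have c'0: "\<forall>m. m \<notin> insert l G \<longrightarrow> c' m = 0" unfolding c'_def using c(3) by auto
      have "(\<Sum>m\<in>G. c m) = (\<Sum>m\<in>insert l G. c m)"
        using c(1,3) by (intro sum.mono_neutral_left) auto
      also have "\<dots> = (\<Sum>m\<in>insert l G. (if m = l then x else 0) + c' m)"
        unfolding c'_def using xy by (intro sum.cong) auto
      also have "\<dots> = x + (\<Sum>m\<in>insert l G. c' m)" using c(1) by (simp add: sum.distrib)
      finally have s: "x + (\<Sum>m\<in>insert l G. c' m) = 0" using c(4) by simp
      have "(\<Sum>m\<in>insert l G. c' m) \<in> Wn" using c'D D1(4) by (intro subspace_sum[OF F(2)]) blast
      moreover have "x = - (\<Sum>m\<in>insert l G. c' m)" using s by (simp add: eq_neg_iff_add_eq_0)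
      ultimately have "x \<in> Wn" using subspace_neg[OF F(2)] by simp
      hence x0: "x = 0" using F(8) xy by blast
      hence "(\<Sum>m\<in>insert l G. c' m) = 0" using s by simp
      hence "\<forall>m. c' m = 0" using D3[OF _ c'D c'0] c(1) by simp
      hence c'z: "c' m = 0" for m by blast
      show ?thesis
      proof
        fix m show "c m = 0"
          using c'z[of m] c'z[of l] xy x0 unfolding c'_def by (cases "m = l") simp_all
      qed
    qed
    have "slope_split W E" unfolding slope_split_def
    proof (rule conjI[OF allI[OF E1] conjI[OF ballI[OF E2]]], assumption, intro allI impI, elim conjE)
      fix F c m
      assume "finite F" "\<forall>l. c l \<in> E l" "\<forall>l. l \<notin> F \<longrightarrow> c l = 0" "(\<Sum>l\<in>F. c l) = 0"
      from E3[OF this] show "c m = 0" by (rule spec)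
    qed
    thus ?thesis by blast
  qed
qed

text \<open>The Dieudonne-Manin decomposition in the form required here; it turns the choice in
  \<open>slope_component\<close> into an actual decomposition.\<close>

lemma slope_decomposition_exists: "\<exists>D. slope_decomposition \<phi> D"
proof -
  obtain D where D: "slope_split UNIV D" using slope_split_exists[of UNIV] by auto
  note D' = D[unfolded slope_split_def]
  note P1 = conjunct1[OF D'] and P2 = conjunct1[OF conjunct2[OF D']] and P3 = conjunct2[OF conjunct2[OF D']]
  have D1: "\<forall>l. subspace (D l) \<and> \<phi> ` D l \<subseteq> D l \<and> isoclinic \<phi> l (D l)"
    using P1 by simp
  have sub: "subspace (D l)" for l using D1 by blast
  have "\<exists>!c. finite {l. c l \<noteq> 0} \<and> (\<forall>l. c l \<in> D l) \<and> v = (\<Sum>l | c l \<noteq> 0. c l)" for v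
  proof (rule ex_ex1I)
    obtain F c where c: "finite F" "\<forall>l. c l \<in> D l" "\<forall>l. l \<notin> F \<longrightarrow> c l = 0" "v = (\<Sum>l\<in>F. c l)"
      using bspec[OF P2 UNIV_I, of v] by (elim exE conjE)
    have sub: "{l. c l \<noteq> 0} \<subseteq> F" using c(3) by blast
    have "(\<Sum>l | c l \<noteq> 0. c l) = (\<Sum>l\<in>F. c l)"
      by (rule sum.mono_neutral_left[OF c(1) sub]) auto
    thus "\<exists>c. finite {l. c l \<noteq> 0} \<and> (\<forall>l. c l \<in> D l) \<and> v = (\<Sum>l | c l \<noteq> 0. c l)"
      using c finite_subset[OF sub] by (intro exI[of _ c]) auto
  next
    fix c c'
    assume c: "finite {l. c l \<noteq> 0} \<and> (\<forall>l. c l \<in> D l) \<and> v = (\<Sum>l | c l \<noteq> 0. c l)"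
      and c': "finite {l. c' l \<noteq> 0} \<and> (\<forall>l. c' l \<in> D l) \<and> v = (\<Sum>l | c' l \<noteq> 0. c' l)"
    define F where "F = {l. c l \<noteq> 0} \<union> {l. c' l \<noteq> 0}"
    have fF: "finite F" unfolding F_def using c c' by blast
    have "(\<Sum>l | c l \<noteq> 0. c l) = (\<Sum>l\<in>F. c l)" by (rule sum.mono_neutral_left[OF fF]) (auto simp: F_def)
    moreover have "(\<Sum>l | c' l \<noteq> 0. c' l) = (\<Sum>l\<in>F. c' l)" by (rule sum.mono_neutral_left[OF fF]) (auto simp: F_def)
    ultimately have s0: "(\<Sum>l\<in>F. c l - c' l) = 0" using c c' by (simp add: sum_subtractf)
    have m: "\<forall>l. c l - c' l \<in> D l" using c c' subspace_diff[OF sub] by blast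
    have z: "\<forall>l. l \<notin> F \<longrightarrow> c l - c' l = 0" unfolding F_def by simp
    have "\<forall>l. c l - c' l = 0"
      by (rule P3[THEN spec, of F, THEN spec, of "\<lambda>l. c l - c' l", THEN mp]) (intro conjI fF m z s0)
    thus "c = c'" by (intro ext) simp
  qed
  hence "slope_decomposition \<phi> D" unfolding slope_decomposition_def using D1 by (intro conjI allI) simp_all
  thus ?thesis by blast
qed

end

section \<open>The filtration of the endomorphism algebra\<close>

lemma sum_fun_apply: "(\<Sum>i\<in>A. F i) v = (\<Sum>i\<in>A. F i v)" for F :: "'i \<Rightarrow> 'a \<Rightarrow> 'b::ab_group_add"
  by (induction A rule: infinite_finite_induct) auto

context fls_vector_space
begin

lemma End_I: "(\<And>x y. f (x + y) = f x + f y) \<Longrightarrow> (\<And>c x. f (scale c x) = scale c (f x)) \<Longrightarrow> f \<in> End_space"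
  unfolding End_space_def Vector_Spaces.linear_iff by (simp add: vector_space_axioms)

lemma End_add_apply: "f \<in> End_space \<Longrightarrow> f (x + y) = f x + f y"
  and End_scale_apply: "f \<in> End_space \<Longrightarrow> f (scale c x) = scale c (f x)"
  unfolding End_space_def Vector_Spaces.linear_iff by auto

lemma End_0_apply: "f \<in> End_space \<Longrightarrow> f 0 = 0" using End_add_apply[of f 0 0] by simp

lemma End_diff_apply: "f \<in> End_space \<Longrightarrow> f (x - y) = f x - f y"
  using End_add_apply[of f "x - y" y] by simp

lemma End_sum_apply: "f \<in> End_space \<Longrightarrow> f (\<Sum>i\<in>A. g i) = (\<Sum>i\<in>A. f (g i))"
  by (induction A rule: infinite_finite_induct) (auto simp: End_add_apply End_0_apply)

lemma End_sh_apply: "f \<in> End_space \<Longrightarrow> f (sh n x) = sh n (f x)" by (simp add: sh_def End_scale_apply)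

lemma End_subspace: "endo.subspace End_space"
  unfolding endo.subspace_def
proof (intro conjI ballI allI)
  show "0 \<in> End_space" by (rule End_I) auto
  fix f g assume "f \<in> End_space" "g \<in> End_space"
  thus "f + g \<in> End_space"
    by (intro End_I) (auto simp: End_add_apply End_scale_apply scale_right_distrib)
next
  fix c f assume "f \<in> End_space"
  thus "end_scale c f \<in> End_space"
    by (intro End_I) (auto simp: end_scale_def End_add_apply End_scale_apply scale_right_distrib mult.commute)
qed

lemma End_add: "f \<in> End_space \<Longrightarrow> g \<in> End_space \<Longrightarrow> f + g \<in> End_space"
  and End_diff: "f \<in> End_space \<Longrightarrow> g \<in> End_space \<Longrightarrow> f - g \<in> End_space"
  and End_zero: "0 \<in> End_space"
  and End_end_scale: "f \<in> End_space \<Longrightarrow> end_scale c f \<in> End_space"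
  using endo.subspace_add[OF End_subspace] endo.subspace_diff[OF End_subspace]
    endo.subspace_0[OF End_subspace]
    endo.subspace_scale[OF End_subspace] by auto

lemma End_sum: "(\<And>i. i \<in> A \<Longrightarrow> F i \<in> End_space) \<Longrightarrow> (\<Sum>i\<in>A. F i) \<in> End_space"
  by (rule endo.subspace_sum[OF End_subspace])

lemma End_id: "id \<in> End_space" by (rule End_I) auto

lemma End_comp: "f \<in> End_space \<Longrightarrow> g \<in> End_space \<Longrightarrow> f \<circ> g \<in> End_space"
  by (intro End_I) (auto simp: End_add_apply End_scale_apply)

lemma End_funpow: "f \<in> End_space \<Longrightarrow> f ^^ n \<in> End_space"
  by (induction n) (auto intro: End_comp End_id)

lemma comp_add: "f \<in> End_space \<Longrightarrow> f \<circ> (g + h) = (f \<circ> g) + (f \<circ> h)"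
  by (auto simp: fun_eq_iff End_add_apply)
lemma comp_diff: "f \<in> End_space \<Longrightarrow> f \<circ> (g - h) = (f \<circ> g) - (f \<circ> h)"
  by (auto simp: fun_eq_iff End_diff_apply)
lemma comp_zero: "f \<in> End_space \<Longrightarrow> f \<circ> 0 = 0"
  by (auto simp: fun_eq_iff End_0_apply)
lemma add_comp: "(f + g) \<circ> h = (f \<circ> h) + (g \<circ> h)" and diff_comp: "(f - g) \<circ> h = (f \<circ> h) - (g \<circ> h)"
  and minus_comp: "(- f) \<circ> h = - (f \<circ> h)" and zero_comp: "0 \<circ> h = 0"
  for f g :: "'v \<Rightarrow> 'v" and h :: "'v \<Rightarrow> 'v"
  by (auto simp: fun_eq_iff)

end

section \<open>Integral endomorphisms and their units\<close>

context based_space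
begin

definition FilE :: "int \<Rightarrow> ('v \<Rightarrow> 'v) set" where
  "FilE n = {f \<in> End_space. f ` Fil 0 \<subseteq> Fil n}"

lemma FilE_End: "f \<in> FilE n \<Longrightarrow> f \<in> End_space" by (simp add: FilE_def)

lemma FilE_apply: "f \<in> FilE n \<Longrightarrow> x \<in> Fil m \<Longrightarrow> f x \<in> Fil (m + n)"
proof -
  assume f: "f \<in> FilE n" and x: "x \<in> Fil m"
  have "sh (- m) x \<in> Fil 0" using x by (simp add: Fil_shift_iff)
  hence "f (sh (- m) x) \<in> Fil n" using f unfolding FilE_def by blast
  thus ?thesis using f by (simp add: End_sh_apply FilE_End Fil_shift_iff add.commute)
qed

lemma FilE_I: "f \<in> End_space \<Longrightarrow> (\<And>x. x \<in> Fil 0 \<Longrightarrow> f x \<in> Fil n) \<Longrightarrow> f \<in> FilE n"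
  unfolding FilE_def by blast

lemma FilE_comp: "f \<in> FilE m \<Longrightarrow> g \<in> FilE n \<Longrightarrow> f \<circ> g \<in> FilE (m + n)"
proof (rule FilE_I)
  assume f: "f \<in> FilE m" and g: "g \<in> FilE n"
  show "f \<circ> g \<in> End_space" by (intro End_comp FilE_End[OF f] FilE_End[OF g])
  fix x assume "x \<in> Fil 0"
  from FilE_apply[OF f FilE_apply[OF g this]] show "(f \<circ> g) x \<in> Fil (m + n)" by (simp add: add.commute)
qed

lemma FilE_comp0: "f \<in> FilE 0 \<Longrightarrow> g \<in> FilE n \<Longrightarrow> f \<circ> g \<in> FilE n"
  and FilE_comp0': "f \<in> FilE n \<Longrightarrow> g \<in> FilE 0 \<Longrightarrow> f \<circ> g \<in> FilE n"
  using FilE_comp[of f 0 g n] FilE_comp[of f n g 0] by simp_all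

lemma FilE_id: "id \<in> FilE 0" by (rule FilE_I) (auto simp: End_id)

definition unitE :: "'v \<Rightarrow> 'v \<Rightarrow> 'v \<Rightarrow> 'v" where "unitE b b' = (\<lambda>v. scale (cf v b) b')"

lemma unitE_End: "unitE b b' \<in> End_space"
  by (rule End_I) (auto simp: unitE_def cf_add cf_scale scale_left_distrib)

lemma End_expand: "f \<in> End_space \<Longrightarrow> f v = (\<Sum>b\<in>B. scale (cf v b) (f b))"
  by (subst cf_expand[of v]) (simp only: End_sum_apply End_scale_apply)

lemma basis_Fil: "b \<in> B \<Longrightarrow> b \<in> Fil 0" unfolding Fil_0_eq by (rule int.span_base)

lemma FilE_basis: "f \<in> End_space \<Longrightarrow> (\<And>b. b \<in> B \<Longrightarrow> f b \<in> Fil n) \<Longrightarrow> f \<in> FilE n"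
proof (rule FilE_I)
  fix x assume f: "f \<in> End_space" "\<And>b. b \<in> B \<Longrightarrow> f b \<in> Fil n" and x: "x \<in> Fil 0"
  have "scale (cf x b) (f b) \<in> Fil (n + 0)" if "b \<in> B" for b
    by (rule Fil_mult) (use f x that in \<open>auto simp: Fil_def\<close>)
  thus "f x \<in> Fil n" unfolding End_expand[OF f(1), of x] by (intro Fil_sum) simp
qed

sublocale E: fls_vector_space end_scale by unfold_locales

lemma E_sh: "E.sh n f = (\<lambda>v. sh n (f v))" by (simp add: E.sh_def sh_def end_scale_def)
lemma E_ks: "E.ks a f = (\<lambda>v. ks a (f v))" by (simp add: E.ks_def ks_def end_scale_def)
lemma E_int_scale: "E.int_scale = end_int_scale"
  by (auto simp: fun_eq_iff E.int_scale_def end_int_scale_def)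

lemma FilE_end_int: "end_int.subspace (FilE n)"
  unfolding end_int.subspace_def
proof (intro conjI ballI allI)
  show "0 \<in> FilE n" by (rule FilE_I) (auto simp: End_zero)
  fix f g assume "f \<in> FilE n" "g \<in> FilE n"
  thus "f + g \<in> FilE n" by (intro FilE_I End_add) (auto intro!: Fil_add simp: FilE_def)
next
  fix a f assume f: "f \<in> FilE n"
  show "end_int_scale a f \<in> FilE n"
  proof (rule FilE_I)
    show "end_int_scale a f \<in> End_space" using f by (simp add: end_int_scale_def End_end_scale FilE_End)
    fix x assume "x \<in> Fil 0"
    hence "int_scale a (f x) \<in> Fil n" using f int.subspace_scale[OF Fil_int] unfolding FilE_def by blast
    thus "end_int_scale a f x \<in> Fil n" by (simp add: end_int_scale_def end_scale_def int_scale_def)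
  qed
qed

lemma FilE_complete:
  assumes "\<And>n. u (Suc n) - u n \<in> FilE (int n)"
  shows "\<exists>w. \<forall>n. w - u n \<in> FilE (int n)"
proof -
  \<comment> \<open>The u n are arbitrary functions; only their differences are known to be
    linear.\<close>
  define g where "g n = u n - u 0" for n
  have gS: "g (Suc n) - g n \<in> FilE (int n)" for n unfolding g_def using assms by simp
  have gE: "g n \<in> End_space" for n
  proof (induction n)
    case (Suc n)
    have "(g (Suc n) - g n) + g n \<in> End_space" using gS Suc by (intro End_add) (auto intro: FilE_End)
    thus ?case by simp
  next
    case 0
    show ?case unfolding g_def diff_self by (rule End_zero)
  qed
  have "\<exists>y. \<forall>n. y - g n b \<in> Fil (int n)" if "b \<in> B" for b
  proof (rule Fil_complete)
    fix n
    show "g (Suc n) b - g n b \<in> Fil (int n)" using FilE_apply[OF gS basis_Fil[OF that], of n] by simp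
  qed
  hence "\<forall>b\<in>B. \<exists>y. \<forall>n. y - g n b \<in> Fil (int n)" by (rule ballI)
  from bchoice[OF this] obtain y where y: "\<forall>b\<in>B. \<forall>n. y b - g n b \<in> Fil (int n)" by (elim exE)
  define w0 where "w0 = (\<lambda>v. \<Sum>b\<in>B. scale (cf v b) (y b))"
  have w0E: "w0 \<in> End_space" unfolding w0_def
    by (rule End_I) (simp_all add: cf_add cf_scale scale_left_distrib sum.distrib scale_sum_right)
  have w0b: "w0 b = y b" if "b \<in> B" for b
  proof -
    have "w0 b = (\<Sum>b'\<in>B. if b' = b then y b' else 0)"
      unfolding w0_def by (intro sum.cong refl) (use that in \<open>simp add: cf_basis\<close>)
    thus ?thesis using that fin_B by simp
  qed
  have "w0 - g n \<in> FilE (int n)" for n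
    by (rule FilE_basis) (use y w0b gE w0E in \<open>auto intro: End_diff\<close>)
  hence "(u 0 + w0) - u n \<in> FilE (int n)" for n unfolding g_def by (simp add: algebra_simps)
  thus ?thesis by blast
qed

lemma FilE_finite: "\<exists>G. finite G \<and> (\<forall>v\<in>FilE 0. \<exists>w\<in>E.k.span G. v - w \<in> FilE 1)"
proof (intro exI[of _ "(\<lambda>(b, b'). unitE b b') ` (B \<times> B)"] conjI ballI)
  show "finite ((\<lambda>(b, b'). unitE b b') ` (B \<times> B))" using fin_B by simp
  fix f assume f: "f \<in> FilE 0"
  define w where "w = (\<Sum>b\<in>B. \<Sum>b'\<in>B. E.ks (fls_nth (cf (f b) b') 0) (unitE b b'))"
  have "w \<in> E.k.span ((\<lambda>(b, b'). unitE b b') ` (B \<times> B))"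
    unfolding w_def by (intro E.k.span_sum E.k.span_scale E.k.span_base) auto
  moreover have "f - w \<in> FilE 1"
  proof (rule FilE_basis)
    have "w \<in> End_space" unfolding w_def E.ks_def by (intro End_sum End_end_scale unitE_End)
    thus "f - w \<in> End_space" using f by (intro End_diff) (auto intro: FilE_End)
    fix b assume b: "b \<in> B"
    have "w b = (\<Sum>c\<in>B. if c = b then \<Sum>b'\<in>B. ks (fls_nth (cf (f c) b') 0) b' else 0)"
      unfolding w_def sum_fun_apply E_ks unitE_def
      by (intro sum.cong refl) (use b in \<open>simp add: cf_basis\<close>)
    hence wb: "w b = (\<Sum>b'\<in>B. scale (fls_const (fls_nth (cf (f b) b') 0)) b')" using b fin_B by (simp add: ks_def)
    have "f b \<in> Fil 0" using FilE_apply[OF f basis_Fil[OF b]] by simp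
    thus "(f - w) b \<in> Fil 1"
      unfolding Fil_def by (auto simp: wb cf_diff cf_combination fls_ge_def)
  qed
  ultimately show "\<exists>w\<in>E.k.span ((\<lambda>(b, b'). unitE b b') ` (B \<times> B)). f - w \<in> FilE 1" by blast
qed

sublocale E: filtered_space end_scale FilE
proof
  show "E.int.subspace (FilE n)" for n unfolding E_int_scale by (rule FilE_end_int)
  show "E.sh m f \<in> FilE (n + m)" if "f \<in> FilE n" for f n m
  proof -
    have "f x \<in> Fil n" if "x \<in> Fil 0" for x using that \<open>f \<in> FilE n\<close> unfolding FilE_def by blast
    moreover have "E.sh m f \<in> End_space" using that by (simp add: E.sh_def End_end_scale FilE_End)
    ultimately show ?thesis by (intro FilE_I) (auto simp: E_sh intro: Fil_shift)
  qed
  show "f = 0" if "\<And>n. f \<in> FilE n" for f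
  proof
    fix x
    obtain m where m: "x \<in> Fil m" using Fil_exhaust by blast
    have "f x \<in> Fil n" for n using FilE_apply[OF that[of "n - m"] m] by simp
    thus "f x = 0 x" using Fil_sep[of "f x"] by simp
  qed
  show "\<exists>w. \<forall>n. w - u n \<in> FilE (int n)" if "\<And>n. u (Suc n) - u n \<in> FilE (int n)" for u
    by (rule FilE_complete[OF that])
  show "\<exists>G. finite G \<and> (\<forall>v\<in>FilE 0. \<exists>w\<in>E.k.span G. v - w \<in> FilE 1)" by (rule FilE_finite)
qed

lemma E_int_subspace: "E.int.subspace = end_int.subspace"
  unfolding E_int_scale ..

lemma FilE_exhaust: "f \<in> End_space \<Longrightarrow> \<exists>n. f \<in> FilE n"
proof -
  assume f: "f \<in> End_space"
  obtain n where "f ` B \<subseteq> Fil n" using Fil_exhaust_finite[of "f ` B"] fin_B by blast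
  thus ?thesis using FilE_basis[OF f] by blast
qed

lemma End_lattice_eq: "End_lattice (Fil 0) = FilE 0"
  unfolding End_lattice_def FilE_def ..

lemma eps_mult_eq: "eps_mult n (FilE 0) = FilE (int n)"
proof -
  have X: "(fls_X ^ n :: 'k fls) = fls_X_intpow (int n)" by (simp add: fls_X_power_conv_shift_1)
  show ?thesis
  proof (intro equalityI subsetI)
    fix f assume "f \<in> eps_mult n (FilE 0)"
    then obtain g where "g \<in> FilE 0" "f = E.sh (int n) g" unfolding eps_mult_def X E.sh_def by blast
    thus "f \<in> FilE (int n)" using E.Fil_shift[of g 0 "int n"] by simp
  next
    fix f assume "f \<in> FilE (int n)"
    hence "E.sh (- int n) f \<in> FilE 0" by (simp add: E.Fil_shift_iff)
    moreover have "f = E.sh (int n) (E.sh (- int n) f)" by simp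
    ultimately show "f \<in> eps_mult n (FilE 0)" unfolding eps_mult_def X E.sh_def[of "int n"] by blast
  qed
qed

text \<open>The unit group of the ring \<open>FilE 0\<close>; by \<open>GL_lattice_eq\<close> it is
  GL(M).\<close>

definition GLM :: "('v \<Rightarrow> 'v) set" where
  "GLM = {g \<in> FilE 0. \<exists>g'\<in>FilE 0. g \<circ> g' = id \<and> g' \<circ> g = id}"

lemma GL_lattice_eq: "GL_lattice (Fil 0) = GLM"
proof (intro equalityI subsetI)
  fix g assume "g \<in> GL_lattice (Fil 0)"
  hence g: "g \<in> End_space" "bij g" "g ` Fil 0 = Fil 0" unfolding GL_lattice_def by auto
  have inv: "g \<circ> inv g = id" "inv g \<circ> g = id"
    using g(2) by (simp_all add: fun_eq_iff bij_is_surj surj_f_inv_f bij_is_inj)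
  have gi: "g (inv g x) = x" "inv g (g x) = x" for x using inv by (auto simp: fun_eq_iff)
  have "inv g \<in> End_space"
  proof (rule End_I)
    fix x y c
    have "inv g (x + y) = inv g (g (inv g x + inv g y))" by (simp add: End_add_apply[OF g(1)] gi(1))
    thus "inv g (x + y) = inv g x + inv g y" by (simp only: gi(2))
    have "inv g (scale c x) = inv g (g (scale c (inv g x)))" by (simp add: End_scale_apply[OF g(1)] gi(1))
    thus "inv g (scale c x) = scale c (inv g x)" by (simp only: gi(2))
  qed
  moreover have "inv g x \<in> Fil 0" if "x \<in> Fil 0" for x
  proof -
    have "x \<in> g ` Fil 0" unfolding g(3) by (rule that)
    then obtain y where "y \<in> Fil 0" "x = g y" by blast
    thus ?thesis by (simp add: gi)
  qed
  ultimately have "inv g \<in> FilE 0" by (intro FilE_I)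
  moreover have "g \<in> FilE 0" using g(1,3) unfolding FilE_def by simp
  ultimately show "g \<in> GLM" unfolding GLM_def using inv by blast
next
  fix g assume "g \<in> GLM"
  then obtain g' where g: "g \<in> FilE 0" "g' \<in> FilE 0" "g \<circ> g' = id" "g' \<circ> g = id" unfolding GLM_def by blast
  have "bij g" using g(3,4) o_bij by blast
  moreover have "Fil 0 \<subseteq> g ` Fil 0"
  proof
    fix x assume "x \<in> Fil 0"
    hence "g' x \<in> Fil 0" using g(2) unfolding FilE_def by blast
    moreover have "x = g (g' x)" using g(3) by (auto simp: fun_eq_iff)
    ultimately show "x \<in> g ` Fil 0" by blast
  qed
  ultimately show "g \<in> GL_lattice (Fil 0)" unfolding GL_lattice_def using g(1) unfolding FilE_def by auto
qed

lemma GLM_FilE: "g \<in> GLM \<Longrightarrow> g \<in> FilE 0" unfolding GLM_def by blast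

lemma GLM_inv:
  assumes "g \<in> GLM" obtains g' where "g' \<in> GLM" "g \<circ> g' = id" "g' \<circ> g = id"
proof -
  obtain g' where g: "g \<in> FilE 0" "g' \<in> FilE 0" "g \<circ> g' = id" "g' \<circ> g = id"
    using assms unfolding GLM_def by blast
  hence "g' \<in> GLM" unfolding GLM_def by blast
  thus thesis using g(3,4) by (rule that)
qed

lemma GLM_id: "id \<in> GLM" unfolding GLM_def using FilE_id by auto

lemma GLM_comp: "g \<in> GLM \<Longrightarrow> h \<in> GLM \<Longrightarrow> g \<circ> h \<in> GLM"
proof -
  assume "g \<in> GLM" "h \<in> GLM"
  then obtain g' h' where *: "g \<in> FilE 0" "h \<in> FilE 0" "g' \<in> FilE 0" "h' \<in> FilE 0"
    "g \<circ> g' = id" "g' \<circ> g = id" "h \<circ> h' = id" "h' \<circ> h = id" unfolding GLM_def by blast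
  have "(g \<circ> h) \<circ> (h' \<circ> g') = id" "(h' \<circ> g') \<circ> (g \<circ> h) = id"
    using *(5-8) by (simp_all add: fun_eq_iff)
  thus ?thesis unfolding GLM_def using FilE_comp0[OF *(1,2)] FilE_comp0[OF *(4,3)] by blast
qed

text \<open>The unit a b gives a right inverse of a and the unit b a a left inverse; in a monoid
  these coincide.\<close>

lemma GLM_from_sides:
  assumes a: "a \<in> FilE 0" and b: "b \<in> FilE 0" and "a \<circ> b \<in> GLM" "b \<circ> a \<in> GLM"
  shows "a \<in> GLM"
proof -
  obtain u where u: "u \<in> GLM" "(a \<circ> b) \<circ> u = id" by (rule GLM_inv[OF assms(3)])
  obtain v where v: "v \<in> GLM" "v \<circ> (b \<circ> a) = id" by (rule GLM_inv[OF assms(4)])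
  have 1: "a \<circ> (b \<circ> u) = id" using u by (simp add: comp_assoc)
  have 2: "(v \<circ> b) \<circ> a = id" using v by (simp add: comp_assoc)
  have "v \<circ> b = (v \<circ> b) \<circ> (a \<circ> (b \<circ> u))" by (simp only: 1 comp_id)
  also have "\<dots> = ((v \<circ> b) \<circ> a) \<circ> (b \<circ> u)" by (simp only: comp_assoc)
  also have "\<dots> = b \<circ> u" by (simp only: 2 id_comp)
  finally have "v \<circ> b = b \<circ> u" .
  hence "(b \<circ> u) \<circ> a = id" using 2 by simp
  moreover have "b \<circ> u \<in> FilE 0" by (rule FilE_comp0[OF b GLM_FilE[OF u(1)]])
  ultimately show ?thesis unfolding GLM_def using a 1 by blast
qed

lemma FilE_funpow: "y \<in> FilE m \<Longrightarrow> y ^^ n \<in> FilE (int n * m)"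
proof (induction n)
  case (Suc n)
  have "y \<circ> y ^^ n \<in> FilE (m + int n * m)" by (rule FilE_comp[OF Suc.prems Suc.IH[OF Suc.prems]])
  moreover have "m + int n * m = int (Suc n) * m" by (simp add: algebra_simps)
  ultimately show ?case unfolding funpow.simps by (simp only:)
next
  case 0
  show ?case unfolding funpow.simps using FilE_id by (simp only: of_nat_0 mult_zero_left)
qed

lemma geometric_comp:
  assumes y: "y \<in> End_space"
  shows "(id - y) \<circ> (\<Sum>i<n. y ^^ i) = id - y ^^ n" "(\<Sum>i<n. y ^^ i) \<circ> (id - y) = id - y ^^ n"
proof -
  have c: "y ^^ n \<circ> y = y \<circ> y ^^ n" for n by (simp add: funpow_swap1 fun_eq_iff)
  show "(id - y) \<circ> (\<Sum>i<n. y ^^ i) = id - y ^^ n"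
  proof (induction n)
    case 0
    have "id - y \<in> End_space" using y End_id by (intro End_diff)
    from comp_zero[OF this] show ?case unfolding lessThan_0 sum.empty funpow.simps diff_self .
  next
    case (Suc n)
    have E: "id - y \<in> End_space" using y End_id by (intro End_diff)
    have "(id - y) \<circ> (\<Sum>i<Suc n. y ^^ i) = (id - y ^^ n) + ((id - y) \<circ> y ^^ n)"
      unfolding sum.lessThan_Suc comp_add[OF E] Suc ..
    also have "\<dots> = id - y ^^ Suc n" by (simp add: fun_eq_iff)
    finally show ?case .
  qed
  show "(\<Sum>i<n. y ^^ i) \<circ> (id - y) = id - y ^^ n"
  proof (induction n)
    case 0
    show ?case unfolding lessThan_0 sum.empty funpow.simps diff_self by (rule zero_comp)
  next
    case (Suc n)
    have "(\<Sum>i<Suc n. y ^^ i) \<circ> (id - y) = (id - y ^^ n) + (y ^^ n \<circ> (id - y))"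
      unfolding sum.lessThan_Suc add_comp Suc ..
    also have "y ^^ n \<circ> (id - y) = y ^^ n - (y ^^ n \<circ> y)"
      unfolding comp_diff[OF End_funpow[OF y]] comp_id ..
    finally show ?case unfolding c funpow.simps(2)[of n y, symmetric] by (simp add: fun_eq_iff)
  qed
qed

lemma GLM_one_minus:
  assumes y: "y \<in> FilE 1" shows "id - y \<in> GLM"
proof -
  have yE: "y \<in> End_space" and y0: "y \<in> FilE 0" using y E.Fil_monoD[OF y, of 0] by (auto intro: FilE_End)
  define u where "u n = (\<Sum>i<n. y ^^ i)" for n
  have yn: "y ^^ n \<in> FilE (int n)" for n using FilE_funpow[OF y, of n] by simp
  have "u (Suc n) - u n \<in> FilE (int n)" for n unfolding u_def using yn by simp
  then obtain w where w: "\<And>n. w - u n \<in> FilE (int n)" using E.Fil_complete[of u] by blast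
  have w0: "w \<in> FilE 0" using w[of 0] by (simp add: u_def)
  have i0: "id - y \<in> FilE 0" by (rule E.Fil_diff[OF FilE_id y0])
  have "((id - y) \<circ> w) - id = 0" 
  proof (rule E.Fil_sep)
    fix n
    have "((id - y) \<circ> (w - u (nat n))) - y ^^ (nat n) \<in> FilE (int (nat n))"
      by (rule E.Fil_diff[OF FilE_comp0[OF i0 w] yn])
    moreover have "((id - y) \<circ> (w - u (nat n))) - y ^^ (nat n) = ((id - y) \<circ> w) - id"
      using comp_diff[OF FilE_End[OF i0], of w "u (nat n)"] geometric_comp(1)[OF yE, of "nat n"]
      unfolding u_def by simp
    ultimately show "((id - y) \<circ> w) - id \<in> FilE n" using E.Fil_monoD[of _ "int (nat n)" n] by force
  qed
  moreover have "(w \<circ> (id - y)) - id = 0" 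
  proof (rule E.Fil_sep)
    fix n
    have "((w - u (nat n)) \<circ> (id - y)) - y ^^ (nat n) \<in> FilE (int (nat n))"
      by (rule E.Fil_diff[OF FilE_comp0'[OF w i0] yn])
    moreover have "((w - u (nat n)) \<circ> (id - y)) - y ^^ (nat n) = (w \<circ> (id - y)) - id"
      using diff_comp[of w "u (nat n)" "id - y"] geometric_comp(2)[OF yE, of "nat n"]
      unfolding u_def by simp
    ultimately show "(w \<circ> (id - y)) - id \<in> FilE n" using E.Fil_monoD[of _ "int (nat n)" n] by force
  qed
  ultimately show ?thesis unfolding GLM_def using i0 w0 by auto
qed

text \<open>The partial geometric sum of length N multiplies 1 - y from either side to 1 - y^N,
  which is a unit by the full geometric series.\<close>

lemma GLM_nilpotent:
  assumes y: "y \<in> FilE 0" and N: "y ^^ N \<in> FilE 1" shows "id - y \<in> GLM"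
proof (rule GLM_from_sides)
  have yE: "y \<in> End_space" by (rule FilE_End[OF y])
  show "id - y \<in> FilE 0" by (rule E.Fil_diff[OF FilE_id y])
  show "(\<Sum>i<N. y ^^ i) \<in> FilE 0" using FilE_funpow[OF y] by (intro E.Fil_sum) simp
  show "(id - y) \<circ> (\<Sum>i<N. y ^^ i) \<in> GLM" "(\<Sum>i<N. y ^^ i) \<circ> (id - y) \<in> GLM"
    unfolding geometric_comp[OF yE] by (rule GLM_one_minus[OF N])+
qed

end

section \<open>Slope components of endomorphisms\<close>

lemmas fun_applies = plus_fun_apply zero_fun_apply minus_apply uminus_apply

text \<open>Used as simplification rules these would replace sums of maps by abstractions.\<close>

declare fun_applies [simp del]

context crystal
begin

definition T :: "('v \<Rightarrow> 'v) \<Rightarrow> 'v \<Rightarrow> 'v" where "T = conj_map \<phi>"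
definition T' :: "('v \<Rightarrow> 'v) \<Rightarrow> 'v \<Rightarrow> 'v" where "T' = inv (conj_map \<phi>)"

lemma T_apply: "T f x = \<phi> (f (\<phi>' x))" by (simp add: T_def conj_map_def \<phi>'_def)

lemma T'_eq: "T' f = (\<lambda>x. \<phi>' (f (\<phi> x)))"
proof -
  have "T (\<lambda>x. \<phi>' (f (\<phi> x))) = f" by (simp add: fun_eq_iff T_apply)
  moreover have "inj T" by (rule injI) (metis T_apply phi_inv(2) ext)
  ultimately show ?thesis unfolding T'_def T_def[symmetric] by (metis inv_f_f)
qed

lemma T'_apply: "T' f x = \<phi>' (f (\<phi> x))" by (simp add: T'_eq)

lemma T_T' [simp]: "T (T' f) = f" and T'_T [simp]: "T' (T f) = f"
  by (simp_all add: fun_eq_iff T_apply T'_apply)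

lemma T_pow_T'_pow [simp]: "(T ^^ n) ((T' ^^ n) f) = f"
  by (induction n arbitrary: f) (simp_all add: funpow_swap1)
lemma T'_pow_T_pow [simp]: "(T' ^^ n) ((T ^^ n) f) = f"
  by (induction n arbitrary: f) (simp_all add: funpow_swap1)

lemma T_add: "T (f + g) = T f + T g" and T'_add: "T' (f + g) = T' f + T' g"
  by (auto simp: fun_eq_iff fun_applies T_apply T'_apply phi_add phi'_add)
lemma T_0 [simp]: "T 0 = 0" and T'_0 [simp]: "T' 0 = 0"
  by (auto simp: fun_eq_iff fun_applies T_apply T'_apply)
lemma T_diff: "T (f - g) = T f - T g" using T_add[of "f - g" g] by simp
lemma T'_diff: "T' (f - g) = T' f - T' g" using T'_add[of "f - g" g] by simp
lemma T_minus: "T (- f) = - T f" using T_diff[of 0 f] by simp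
lemma T_id [simp]: "T id = id" by (simp add: fun_eq_iff T_apply)
lemma T_comp: "T (f \<circ> g) = T f \<circ> T g" by (simp add: fun_eq_iff T_apply)

lemma T_end_scale: "T (end_scale c f) = end_scale (\<sigma> c) (T f)"
  and T'_end_scale: "T' (end_scale c f) = end_scale (inv \<sigma> c) (T' f)"
  by (simp_all add: fun_eq_iff T_apply T'_apply end_scale_def phi_scale phi'_scale)

lemma T_ks: "T (E.ks a f) = E.ks (a ^ q) (T f)"
  by (simp add: E.ks_def T_end_scale fls_frob_const[OF q])
lemma T_sh: "T (E.sh n f) = E.sh n (T f)"
  by (simp add: E.sh_def T_end_scale fls_frob_intpow[OF q])
lemma T'_sh: "T' (E.sh n f) = E.sh n (T' f)"
  by (metis T'_T T_T' T_sh)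

lemma T_End: "f \<in> End_space \<Longrightarrow> T f \<in> End_space"
  by (rule End_I) (simp_all add: T_apply phi'_add phi_add phi'_scale phi_scale End_add_apply End_scale_apply)
lemma T'_End: "f \<in> End_space \<Longrightarrow> T' f \<in> End_space"
  by (rule End_I) (simp_all add: T'_apply phi'_add phi_add phi'_scale phi_scale End_add_apply End_scale_apply)

text \<open>\<phi> preserves M but its inverse need not: cT bounds the denominators, and hence the
  loss in the filtration under both T and T'.\<close>

definition cT :: int where "cT = (SOME c. c \<ge> 0 \<and> (\<forall>n. \<phi>' ` Fil n \<subseteq> Fil (n - c)))"

lemma cT: "cT \<ge> 0" "x \<in> Fil n \<Longrightarrow> \<phi>' x \<in> Fil (n - cT)"
proof -
  have "\<exists>c. c \<ge> 0 \<and> (\<forall>n. \<phi>' ` Fil n \<subseteq> Fil (n - c))" using phi'_bounded[of 1] by simp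
  hence "cT \<ge> 0 \<and> (\<forall>n. \<phi>' ` Fil n \<subseteq> Fil (n - cT))" unfolding cT_def by (rule someI_ex)
  thus "cT \<ge> 0" "x \<in> Fil n \<Longrightarrow> \<phi>' x \<in> Fil (n - cT)" by blast+
qed

lemma T_FilE: "f \<in> FilE n \<Longrightarrow> T f \<in> FilE (n - cT)"
proof (rule FilE_I)
  assume f: "f \<in> FilE n"
  show "T f \<in> End_space" by (rule T_End[OF FilE_End[OF f]])
  fix x assume "x \<in> Fil 0"
  from phi_Fil[OF FilE_apply[OF f cT(2)[OF this]]] show "T f x \<in> Fil (n - cT)" by (simp add: T_apply)
qed

lemma T'_FilE: "f \<in> FilE n \<Longrightarrow> T' f \<in> FilE (n - cT)"
proof (rule FilE_I)
  assume f: "f \<in> FilE n"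
  show "T' f \<in> End_space" by (rule T'_End[OF FilE_End[OF f]])
  fix x assume "x \<in> Fil 0"
  from cT(2)[OF FilE_apply[OF f phi_Fil[OF this]]] show "T' f x \<in> Fil (n - cT)" by (simp add: T'_apply)
qed

lemma T_pow_FilE: "f \<in> FilE n \<Longrightarrow> (T ^^ i) f \<in> FilE (n - int i * cT)"
proof (induction i)
  case (Suc i)
  from T_FilE[OF Suc.IH[OF Suc.prems]] show ?case by (simp add: algebra_simps)
qed simp

lemma T'_pow_FilE: "f \<in> FilE n \<Longrightarrow> (T' ^^ i) f \<in> FilE (n - int i * cT)"
proof (induction i)
  case (Suc i)
  from T'_FilE[OF Suc.IH[OF Suc.prems]] show ?case by (simp add: algebra_simps)
qed simp

lemma T_pow_add: "(T ^^ i) (f + g) = (T ^^ i) f + (T ^^ i) g" by (induction i) (auto simp: T_add)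
lemma T'_pow_add: "(T' ^^ i) (f + g) = (T' ^^ i) f + (T' ^^ i) g" by (induction i) (auto simp: T'_add)
lemma T_pow_0 [simp]: "(T ^^ i) 0 = 0" by (induction i) simp_all
lemma T'_pow_0 [simp]: "(T' ^^ i) 0 = 0" by (induction i) simp_all
lemma T_pow_sh: "(T ^^ i) (E.sh n f) = E.sh n ((T ^^ i) f)" by (induction i) (simp_all add: T_sh)
lemma T'_pow_sh: "(T' ^^ i) (E.sh n f) = E.sh n ((T' ^^ i) f)" by (induction i) (simp_all add: T'_sh)
lemma T_pow_End: "f \<in> End_space \<Longrightarrow> (T ^^ i) f \<in> End_space" by (induction i) (auto intro: T_End)
lemma T'_pow_End: "f \<in> End_space \<Longrightarrow> (T' ^^ i) f \<in> End_space" by (induction i) (auto intro: T'_End)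

sublocale FT: frobenius_map E.ks q T
  by unfold_locales (rule q, rule T_add, rule T_ks)

definition D :: "rat \<Rightarrow> 'v set" where "D = slope_component \<phi>"

lemma D_decomposition: "slope_decomposition \<phi> D"
  unfolding D_def slope_component_def by (rule someI_ex[OF slope_decomposition_exists])

lemma D_sub: "subspace (D l)" and D_phi: "\<phi> ` D l \<subseteq> D l" and D_iso: "isoclinic \<phi> l (D l)"
  using D_decomposition unfolding slope_decomposition_def by simp_all

lemma D_ex1: "\<exists>!c. finite {l. c l \<noteq> 0} \<and> (\<forall>l. c l \<in> D l) \<and> v = (\<Sum>l | c l \<noteq> 0. c l)"
  using conjunct2[OF D_decomposition[unfolded slope_decomposition_def]] by (rule spec)

definition pr :: "rat \<Rightarrow> 'v \<Rightarrow> 'v" where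
  "pr l v = (THE c. finite {l. c l \<noteq> 0} \<and> (\<forall>l. c l \<in> D l) \<and> v = (\<Sum>l | c l \<noteq> 0. c l)) l"

lemma pr_props: "finite {l. pr l v \<noteq> 0}" "pr l v \<in> D l" "v = (\<Sum>l | pr l v \<noteq> 0. pr l v)"
proof -
  have P: "finite {l. pr l v \<noteq> 0} \<and> (\<forall>l. pr l v \<in> D l) \<and> v = (\<Sum>l | pr l v \<noteq> 0. pr l v)"
    unfolding pr_def by (rule theI'[OF D_ex1[of v]])
  show "finite {l. pr l v \<noteq> 0}" using P by (rule conjunct1)
  show "pr l v \<in> D l" using P by blast
  show "v = (\<Sum>l | pr l v \<noteq> 0. pr l v)" using P by (elim conjE)
qed

lemma pr_unique:
  assumes F: "finite F" "\<And>l. c l \<in> D l" "\<And>l. l \<notin> F \<Longrightarrow> c l = 0" "v = (\<Sum>l\<in>F. c l)"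
  shows "pr l v = c l"
proof -
  have sub: "{l. c l \<noteq> 0} \<subseteq> F" using F(3) by blast
  have "(\<Sum>l | c l \<noteq> 0. c l) = (\<Sum>l\<in>F. c l)" by (rule sum.mono_neutral_left[OF F(1) sub]) auto
  hence P: "finite {l. c l \<noteq> 0} \<and> (\<forall>l. c l \<in> D l) \<and> v = (\<Sum>l | c l \<noteq> 0. c l)"
    using F finite_subset[OF sub] by simp
  have "(THE c. finite {l. c l \<noteq> 0} \<and> (\<forall>l. c l \<in> D l) \<and> v = (\<Sum>l | c l \<noteq> 0. c l)) = c"
    by (rule the1_equality[OF D_ex1[of v]]) (rule P)
  thus ?thesis unfolding pr_def by (rule fun_cong)
qed

lemma pr_sum_superset:
  assumes "finite F" "{l. pr l v \<noteq> 0} \<subseteq> F" shows "v = (\<Sum>l\<in>F. pr l v)"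
proof -
  have "(\<Sum>l | pr l v \<noteq> 0. pr l v) = (\<Sum>l\<in>F. pr l v)" by (rule sum.mono_neutral_left[OF assms]) auto
  thus ?thesis using pr_props(3)[of v] by (simp only:)
qed

lemma pr_add: "pr l (u + v) = pr l u + pr l v"
proof -
  let ?F = "{l. pr l u \<noteq> 0} \<union> {l. pr l v \<noteq> 0}"
  have F: "finite ?F" using pr_props(1) by simp
  have "u = (\<Sum>l\<in>?F. pr l u)" "v = (\<Sum>l\<in>?F. pr l v)" by (rule pr_sum_superset[OF F], blast)+
  hence s: "u + v = (\<Sum>l\<in>?F. pr l u + pr l v)" unfolding sum.distrib by (rule arg_cong2)
  show ?thesis by (rule pr_unique[OF F _ _ s]) (auto intro: subspace_add[OF D_sub] pr_props(2))
qed

lemma pr_scale: "pr l (scale c v) = scale c (pr l v)"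
proof -
  let ?F = "{l. pr l v \<noteq> 0}"
  have "scale c v = scale c (\<Sum>l\<in>?F. pr l v)" by (rule arg_cong[OF pr_props(3)])
  hence s: "scale c v = (\<Sum>l\<in>?F. scale c (pr l v))" unfolding scale_sum_right .
  show ?thesis by (rule pr_unique[OF pr_props(1) _ _ s]) (auto intro: subspace_scale[OF D_sub] pr_props(2))
qed

lemma pr_phi: "pr l (\<phi> v) = \<phi> (pr l v)"
proof -
  let ?F = "{l. pr l v \<noteq> 0}"
  have "\<phi> v = \<phi> (\<Sum>l\<in>?F. pr l v)" by (rule arg_cong[OF pr_props(3)])
  hence s: "\<phi> v = (\<Sum>l\<in>?F. \<phi> (pr l v))" unfolding phi_sum .
  show ?thesis
    by (rule pr_unique[OF pr_props(1) _ _ s]) (use pr_props(2) D_phi in \<open>auto simp: image_subset_iff\<close>)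
qed

lemma pr_End: "pr l \<in> End_space" by (rule End_I) (auto simp: pr_add pr_scale)

lemma pr_phi': "pr l (\<phi>' v) = \<phi>' (pr l v)"
  by (metis pr_phi phi_inv)

lemma pr_phi_pow: "pr l ((\<phi> ^^ n) v) = (\<phi> ^^ n) (pr l v)" by (induction n) (auto simp: pr_phi)
lemma pr_phi'_pow: "pr l ((\<phi>' ^^ n) v) = (\<phi>' ^^ n) (pr l v)" by (induction n) (auto simp: pr_phi')

lemma pr_D: "v \<in> D l \<Longrightarrow> pr m v = (if m = l then v else 0)"
  by (rule pr_unique[of "{l}"]) (auto simp: subspace_0[OF D_sub])

lemma pr_pr: "pr m (pr l v) = (if m = l then pr l v else 0)"
  by (rule pr_D[OF pr_props(2)])

definition SL :: "rat set" where "SL = (\<Union>b\<in>B. {l. pr l b \<noteq> 0})"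

lemma SL_finite: "finite SL" unfolding SL_def using fin_B pr_props(1) by blast

lemma pr_notin_SL: "l \<notin> SL \<Longrightarrow> pr l v = 0"
proof -
  assume "l \<notin> SL"
  hence "scale (cf v b) (pr l b) = 0" if "b \<in> B" for b using that unfolding SL_def by auto
  thus ?thesis unfolding End_expand[OF pr_End, of l v] by (rule sum.neutral[OF ballI])
qed

lemma pr_sum: "v = (\<Sum>l\<in>SL. pr l v)"
  by (rule pr_sum_superset[OF SL_finite]) (use pr_notin_SL in blast)

lemma pr_bounded: "\<exists>c. \<forall>n. \<forall>l\<in>SL. \<forall>v\<in>Fil n. pr l v \<in> Fil (n - c)"
proof -
  have "\<forall>l\<in>SL. \<exists>c\<ge>0. \<forall>n. pr l ` Fil n \<subseteq> Fil (n - c)"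
    by (intro ballI semilinear_bounded[where \<sigma> = "\<lambda>x. x"]) (auto simp: pr_add pr_scale)
  from bchoice[OF this] obtain c where c: "\<forall>l\<in>SL. c l \<ge> 0 \<and> (\<forall>n. pr l ` Fil n \<subseteq> Fil (n - c l))" by (elim exE)
  obtain d where d: "\<forall>l\<in>SL. c l \<le> d" using finite_int_bound[OF SL_finite] by blast
  have "pr l v \<in> Fil (n - d)" if "l \<in> SL" "v \<in> Fil n" for l v n
  proof -
    have "pr l v \<in> Fil (n - c l)" using c that by blast
    thus ?thesis by (rule Fil_monoD) (use d that in auto)
  qed
  thus ?thesis by blast
qed

text \<open>Endomorphisms whose block from slope l to slope m vanishes unless R l m. Taking
  \<open>l < m\<close>, \<open>l = m\<close> and \<open>m < l\<close> treats V_+, V_0 and V_- by the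
  same lemmas.\<close>

definition VR :: "(rat \<Rightarrow> rat \<Rightarrow> bool) \<Rightarrow> ('v \<Rightarrow> 'v) set" where
  "VR R = {f \<in> End_space. \<forall>l m v. \<not> R l m \<longrightarrow> pr m (f (pr l v)) = 0}"

definition comp_lm :: "rat \<Rightarrow> rat \<Rightarrow> ('v \<Rightarrow> 'v) \<Rightarrow> 'v \<Rightarrow> 'v" where
  "comp_lm l m f = pr m \<circ> f \<circ> pr l"

definition PR :: "(rat \<Rightarrow> rat \<Rightarrow> bool) \<Rightarrow> ('v \<Rightarrow> 'v) \<Rightarrow> 'v \<Rightarrow> 'v" where
  "PR R f = (\<Sum>l\<in>SL. \<Sum>m\<in>{m\<in>SL. R l m}. comp_lm l m f)"

lemma comp_lm_End: "f \<in> End_space \<Longrightarrow> comp_lm l m f \<in> End_space"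
  unfolding comp_lm_def by (intro End_comp pr_End)

lemma PR_End: "f \<in> End_space \<Longrightarrow> PR R f \<in> End_space"
  unfolding PR_def by (intro End_sum comp_lm_End)

lemma PR_add: "PR R (f + g) = PR R f + PR R g"
proof -
  have "comp_lm l m (f + g) = comp_lm l m f + comp_lm l m g" for l m
    by (simp add: comp_lm_def fun_eq_iff fun_applies pr_add)
  thus ?thesis unfolding PR_def by (simp only: sum.distrib)
qed

lemma PR_diff: "PR R (f - g) = PR R f - PR R g" using PR_add[of R "f - g" g] by simp

lemma PR_T: "PR R (T f) = T (PR R f)"
proof -
  have "comp_lm l m (T f) = T (comp_lm l m f)" for l m
    by (simp add: comp_lm_def fun_eq_iff T_apply pr_phi pr_phi')
  thus ?thesis unfolding PR_def by (simp only: FT.T_sum)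
qed

lemma PR_T': "PR R (T' f) = T' (PR R f)" by (metis PR_T T'_T T_T')

lemma PR_pr: "f \<in> End_space \<Longrightarrow> pr m (PR R f (pr l v)) = (if l \<in> SL \<and> m \<in> SL \<and> R l m then pr m (f (pr l v)) else 0)"
proof -
  assume f: "f \<in> End_space"
  note E0 = End_0_apply[OF f] End_0_apply[OF pr_End]
  have "pr m (PR R f (pr l v)) = (\<Sum>l'\<in>SL. \<Sum>m'\<in>{m'\<in>SL. R l' m'}. pr m (pr m' (f (pr l' (pr l v)))))"
    unfolding PR_def sum_fun_apply comp_lm_def by (simp add: End_sum_apply[OF pr_End])
  also have "\<dots> = (\<Sum>l'\<in>SL. if l' = l then \<Sum>m'\<in>{m'\<in>SL. R l m'}. pr m (pr m' (f (pr l v))) else 0)"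
    by (intro sum.cong refl) (simp add: pr_pr E0 cong: if_cong)
  also have "\<dots> = (if l \<in> SL then \<Sum>m'\<in>{m'\<in>SL. R l m'}. pr m (pr m' (f (pr l v))) else 0)"
    using SL_finite by simp
  also have "(\<Sum>m'\<in>{m'\<in>SL. R l m'}. pr m (pr m' (f (pr l v)))) = (\<Sum>m'\<in>{m'\<in>SL. R l m'}. if m' = m then pr m (f (pr l v)) else 0)"
    by (intro sum.cong refl) (auto simp: pr_pr)
  also have "\<dots> = (if m \<in> SL \<and> R l m then pr m (f (pr l v)) else 0)" using SL_finite by simp
  finally show ?thesis by simp
qed

lemma PR_VR: "f \<in> End_space \<Longrightarrow> PR R f \<in> VR R"
  unfolding VR_def by (simp add: PR_pr PR_End)

lemma End_eqI_pr:
  assumes "f \<in> End_space" "g \<in> End_space" "\<And>l m v. pr m (f (pr l v)) = pr m (g (pr l v))"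
  shows "f = g"
proof
  fix v
  have e: "h v = (\<Sum>l\<in>SL. \<Sum>m\<in>SL. pr m (h (pr l v)))" if h: "h \<in> End_space" for h
  proof -
    have "h v = h (\<Sum>l\<in>SL. pr l v)" by (rule arg_cong[OF pr_sum])
    also have "\<dots> = (\<Sum>l\<in>SL. h (pr l v))" by (rule End_sum_apply[OF h])
    also have "\<dots> = (\<Sum>l\<in>SL. \<Sum>m\<in>SL. pr m (h (pr l v)))" by (rule sum.cong[OF refl pr_sum])
    finally show ?thesis .
  qed
  show "f v = g v" unfolding e[OF assms(1)] e[OF assms(2)] assms(3) ..
qed

lemma VR_PR: "f \<in> VR R \<Longrightarrow> PR R f = f"
proof -
  assume f: "f \<in> VR R"
  hence E: "f \<in> End_space" unfolding VR_def by blast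
  show ?thesis
  proof (rule End_eqI_pr[OF PR_End[OF E] E])
    fix l m v
    show "pr m (PR R f (pr l v)) = pr m (f (pr l v))"
      using f pr_notin_SL End_0_apply[OF E] End_0_apply[OF pr_End] unfolding PR_pr[OF E] VR_def by auto
  qed
qed

lemma VR_subspace: "endo.subspace (VR R)"
  unfolding endo.subspace_def
proof (intro conjI ballI allI)
  show "0 \<in> VR R" unfolding VR_def using End_zero by (simp add: fun_applies End_0_apply[OF pr_End])
  fix f g assume "f \<in> VR R" "g \<in> VR R"
  thus "f + g \<in> VR R" unfolding VR_def by (simp add: End_add fun_applies pr_add)
next
  fix c f assume f: "f \<in> VR R"
  hence "end_scale c f \<in> End_space" unfolding VR_def by (simp add: End_end_scale)
  moreover have "pr m (end_scale c f (pr l v)) = 0" if "\<not> R l m" for l m v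
    using f that unfolding VR_def by (simp add: end_scale_def pr_scale)
  ultimately show "end_scale c f \<in> VR R" unfolding VR_def by blast
qed

lemma VR_End: "f \<in> VR R \<Longrightarrow> f \<in> End_space" unfolding VR_def by blast

lemma VR_T: "f \<in> VR R \<Longrightarrow> T f \<in> VR R" by (metis PR_T VR_PR PR_VR VR_End T_End)
lemma VR_T': "f \<in> VR R \<Longrightarrow> T' f \<in> VR R" by (metis PR_T' VR_PR PR_VR VR_End T'_End)

lemma VR_comp:
  assumes f: "f \<in> VR R" and g: "g \<in> VR S" and RS: "\<And>l m n. S l m \<Longrightarrow> R m n \<Longrightarrow> Q l n"
  shows "f \<circ> g \<in> VR Q"
proof -
  have fE: "f \<in> End_space" and gE: "g \<in> End_space" using f g by (auto intro: VR_End)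
  have "pr n (f (g (pr l v))) = 0" if nQ: "\<not> Q l n" for l n v
  proof -
    have "f (g (pr l v)) = f (\<Sum>m\<in>SL. pr m (g (pr l v)))" by (rule arg_cong[OF pr_sum])
    hence "pr n (f (g (pr l v))) = (\<Sum>m\<in>SL. pr n (f (pr m (g (pr l v)))))"
      by (simp only: End_sum_apply[OF fE] End_sum_apply[OF pr_End])
    also have "\<dots> = 0"
    proof (rule sum.neutral[OF ballI])
      fix m
      show "pr n (f (pr m (g (pr l v)))) = 0"
      proof (cases "S l m")
        case True
        hence "\<not> R m n" using RS nQ by blast
        thus ?thesis using f unfolding VR_def by blast
      next
        case False
        hence "pr m (g (pr l v)) = 0" using g unfolding VR_def by blast
        thus ?thesis by (simp add: End_0_apply[OF fE] End_0_apply[OF pr_End])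
      qed
    qed
    finally show ?thesis .
  qed
  thus ?thesis unfolding VR_def using End_comp[OF fE gE] by simp
qed

lemma span_Hom_slope:
  "endo.span (\<Union>{Hom_slope \<phi> l m |l m. R l m}) = VR R"
proof (intro equalityI)
  have "\<Union>{Hom_slope \<phi> l m |l m. R l m} \<subseteq> VR R"
  proof
    fix f assume "f \<in> \<Union>{Hom_slope \<phi> l m |l m. R l m}"
    then obtain l m where R: "R l m" and f: "f \<in> Hom_slope \<phi> l m" by blast
    have fE: "f \<in> End_space" using f unfolding Hom_slope_def by blast
    have fl: "f x \<in> D m" if "x \<in> D l" for x using f that unfolding Hom_slope_def D_def by blast
    have fl': "f x = 0" if "l' \<noteq> l" "x \<in> D l'" for l' x using f that unfolding Hom_slope_def D_def by blast
    have "pr m' (f (pr l' v)) = 0" if "\<not> R l' m'" for l' m' v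
    proof (cases "l' = l")
      case True
      hence "m' \<noteq> m" using that R by blast
      moreover have "f (pr l' v) \<in> D m" using fl pr_props(2) True by blast
      ultimately show ?thesis using pr_D by simp
    next
      case False
      thus ?thesis using fl'[OF False pr_props(2)] by (simp add: End_0_apply[OF pr_End])
    qed
    thus "f \<in> VR R" unfolding VR_def using fE by blast
  qed
  thus "endo.span (\<Union>{Hom_slope \<phi> l m |l m. R l m}) \<subseteq> VR R" by (rule endo.span_minimal[OF _ VR_subspace])
  show "VR R \<subseteq> endo.span (\<Union>{Hom_slope \<phi> l m |l m. R l m})"
  proof
    fix f assume f: "f \<in> VR R"
    have "comp_lm l m f \<in> Hom_slope \<phi> l m" for l m
    proof -
      have "comp_lm l m f x \<in> D m" for x unfolding comp_lm_def by (simp add: pr_props(2))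
      moreover have "comp_lm l m f x = 0" if "l' \<noteq> l" "x \<in> D l'" for l' x
        using pr_D[OF that(2), of l] that(1) unfolding comp_lm_def
        by (simp add: End_0_apply[OF pr_End] End_0_apply[OF VR_End[OF f]])
      ultimately show ?thesis unfolding Hom_slope_def D_def using comp_lm_End[OF VR_End[OF f]] by blast
    qed
    hence "PR R f \<in> endo.span (\<Union>{Hom_slope \<phi> l m |l m. R l m})"
      unfolding PR_def by (intro endo.span_sum endo.span_base) blast
    thus "f \<in> endo.span (\<Union>{Hom_slope \<phi> l m |l m. R l m})" unfolding VR_PR[OF f] .
  qed
qed

abbreviation "VP \<equiv> VR (\<lambda>l m. l < m)"
abbreviation "VZ \<equiv> VR (\<lambda>l m. l = m)"
abbreviation "VM \<equiv> VR (\<lambda>l m. m < l)"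
abbreviation "PP \<equiv> PR (\<lambda>l m. l < m)"
abbreviation "PZ \<equiv> PR (\<lambda>l m. l = m)"
abbreviation "PM \<equiv> PR (\<lambda>l m. m < l)"

lemma V_plus_eq: "V_plus \<phi> = VP" unfolding V_plus_def by (rule span_Hom_slope)
lemma V_zero_eq: "V_zero \<phi> = VZ"
proof -
  have "{Hom_slope \<phi> l l |l. True} = {Hom_slope \<phi> l m |l m. l = m}" by blast
  thus ?thesis unfolding V_zero_def using span_Hom_slope[of "\<lambda>l m. l = m"] by simp
qed
lemma V_minus_eq: "V_minus \<phi> = VM"
proof -
  have "{Hom_slope \<phi> l2 l1 |l1 l2. l1 < l2} = {Hom_slope \<phi> l m |l m. m < l}" by blast
  thus ?thesis unfolding V_minus_def using span_Hom_slope[of "\<lambda>l m. m < l"] by simp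
qed

lemma P_sum: "f \<in> End_space \<Longrightarrow> f = PP f + PZ f + PM f"
proof (rule End_eqI_pr)
  assume f: "f \<in> End_space"
  show "PP f + PZ f + PM f \<in> End_space" by (intro End_add PR_End f)
  fix l m v
  have "pr m (f (pr l v)) = 0" if "l \<notin> SL \<or> m \<notin> SL"
    using that pr_notin_SL[of l] pr_notin_SL[of m] End_0_apply[OF f] End_0_apply[OF pr_End] by auto
  thus "pr m (f (pr l v)) = pr m ((PP f + PZ f + PM f) (pr l v))"
    by (cases "l < m"; cases "l = m") (auto simp: fun_applies pr_add PR_pr[OF f])
qed

end

section \<open>Growth of the slope components under iteration\<close>

context crystal
begin

lemma T_pow_apply: "(T ^^ i) f x = (\<phi> ^^ i) (f ((\<phi>' ^^ i) x))"
proof (induction i arbitrary: x)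
  case (Suc i)
  have "(T ^^ Suc i) f x = T ((T ^^ i) f) x" by simp
  also have "\<dots> = \<phi> ((T ^^ i) f (\<phi>' x))" by (rule T_apply)
  finally show ?case unfolding Suc by (simp add: funpow_swap1)
qed simp
lemma T'_pow_apply: "(T' ^^ i) f x = (\<phi>' ^^ i) (f ((\<phi> ^^ i) x))"
proof (induction i arbitrary: x)
  case (Suc i)
  have "(T' ^^ Suc i) f x = T' ((T' ^^ i) f) x" by simp
  also have "\<dots> = \<phi>' ((T' ^^ i) f (\<phi> x))" by (rule T'_apply)
  finally show ?case unfolding Suc by (simp add: funpow_swap1)
qed simp

lemma T_pow_end_scale: "(T ^^ i) (end_scale c f) = end_scale ((\<sigma> ^^ i) c) ((T ^^ i) f)"
  by (induction i) (simp_all add: T_end_scale)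
lemma T'_pow_end_scale: "(T' ^^ i) (end_scale c f) = end_scale ((inv \<sigma> ^^ i) c) ((T' ^^ i) f)"
  by (induction i) (simp_all add: T'_end_scale)

text \<open>The isoclinic parts come with different exponents; the product r of these is common to
  all, and t l = r l is then an integer for every occurring slope.\<close>

lemma common_lattices:
  obtains r t L where "r > 0"
    "\<And>l. l \<in> SL \<Longrightarrow> lattice_of (D l) (L l)" "\<And>l. l \<in> SL \<Longrightarrow> of_int (t l) = of_nat r * l"
    "\<And>l n. l \<in> SL \<Longrightarrow> (\<phi> ^^ (r * n)) ` L l = sh (t l * int n) ` L l"
proof -
  have "\<forall>l\<in>SL. \<exists>L r s. lattice_of (D l) L \<and> r > (0::nat) \<and> l = of_int s / of_nat r \<and> (\<phi> ^^ r) ` L = sh s ` L"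
    using D_iso unfolding isoclinic_iff by blast
  from bchoice[OF this] obtain L where "\<forall>l\<in>SL. \<exists>r s. lattice_of (D l) (L l) \<and> r > (0::nat) \<and> l = of_int s / of_nat r \<and> (\<phi> ^^ r) ` L l = sh s ` L l"
    by (elim exE)
  from bchoice[OF this] obtain r where "\<forall>l\<in>SL. \<exists>s. lattice_of (D l) (L l) \<and> r l > (0::nat) \<and> l = of_int s / of_nat (r l) \<and> (\<phi> ^^ (r l)) ` L l = sh s ` L l"
    by (elim exE)
  from bchoice[OF this] obtain s where s: "\<forall>l\<in>SL. lattice_of (D l) (L l) \<and> r l > (0::nat) \<and> l = of_int (s l) / of_nat (r l) \<and> (\<phi> ^^ (r l)) ` L l = sh (s l) ` L l"
    by (elim exE)
  define R where "R = (\<Prod>l\<in>SL. r l)"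
  define k where "k l = R div r l" for l
  have Rk: "R = r l * k l" if "l \<in> SL" for l
    unfolding k_def R_def using dvd_prodI[OF SL_finite that, of r] by simp
  have "R > 0" unfolding R_def using s by (intro prod_pos) auto
  moreover have "lattice_of (D l) (L l)" if "l \<in> SL" for l using s that by blast
  moreover have "of_int (s l * int (k l)) = of_nat R * l" if "l \<in> SL" for l
  proof -
    have "(of_nat (r l) :: rat) \<noteq> 0" "l = of_int (s l) / of_nat (r l)" using s that by auto
    hence "of_int (s l) = l * of_nat (r l)" by (simp add: field_simps)
    thus ?thesis unfolding Rk[OF that] by simp
  qed
  moreover have "(\<phi> ^^ (R * n)) ` L l = sh (s l * int (k l) * int n) ` L l" if "l \<in> SL" for l n
  proof -
    have "(\<phi> ^^ (r l * (k l * n))) ` L l = sh (s l * int (k l * n)) ` L l"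
      by (rule isoclinic_pow) (use s that in blast)
    thus ?thesis unfolding Rk[OF that] by (simp add: mult.assoc)
  qed
  ultimately show thesis by (rule that)
qed

text \<open>\<alpha> stands before f and \<beta> after it; powers of \<phi>' and \<phi> in these
  places give T, the reverse gives T'. On the isoclinic lattices the scaling is exact. For each of l
  and m, the projection costs c once and the comparison with Fil costs cl or cm twice.\<close>

lemma comp_growth_aux:
  assumes Ll: "L \<subseteq> Fil (- cl)" "\<And>n. Fil n \<inter> D l \<subseteq> sh (n - cl) ` L"
    and Lm: "L' \<subseteq> Fil (- cm)" "\<And>n. Fil n \<inter> D m \<subseteq> sh (n - cm) ` L'"
    and pl: "\<And>n v. v \<in> Fil n \<Longrightarrow> pr l v \<in> Fil (n - c)" and pm: "\<And>n v. v \<in> Fil n \<Longrightarrow> pr m v \<in> Fil (n - c)"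
    and \<alpha>: "\<And>y. y \<in> L \<Longrightarrow> \<exists>y1\<in>L. \<alpha> y = sh a y1" "\<And>n y. \<alpha> (sh n y) = sh n (\<alpha> y)" "\<And>v. pr l (\<alpha> v) = \<alpha> (pr l v)"
    and \<beta>: "\<And>y. y \<in> L' \<Longrightarrow> \<exists>y1\<in>L'. \<beta> y = sh b y1" "\<And>n y. \<beta> (sh n y) = sh n (\<beta> y)"
    and f: "f \<in> FilE n" and x: "x \<in> Fil 0"
  shows "\<beta> (pr m (f (pr l (\<alpha> x)))) \<in> Fil (n + a + b - (2 * c + 2 * cl + 2 * cm))"
proof -
  have "pr l x \<in> Fil (- c) \<inter> D l" using pl[OF x] pr_props(2) by simp
  then obtain y where y: "y \<in> L" "pr l x = sh (- c - cl) y" using Ll(2)[of "- c"] by blast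
  obtain y1 where y1: "y1 \<in> L" "\<alpha> y = sh a y1" using \<alpha>(1)[OF y(1)] by blast
  have "\<alpha> (pr l x) = sh (- c - cl + a) y1" unfolding y(2) \<alpha>(2) y1(2) by simp
  moreover have "y1 \<in> Fil (- cl)" using y1 Ll by blast
  ultimately have "\<alpha> (pr l x) \<in> Fil (a - c - 2 * cl)" using Fil_shift[of y1 "- cl" "- c - cl + a"] by (simp add: algebra_simps)
  hence "f (\<alpha> (pr l x)) \<in> Fil (a - c - 2 * cl + n)" by (rule FilE_apply[OF f])
  hence "pr m (f (\<alpha> (pr l x))) \<in> Fil (a - c - 2 * cl + n - c) \<inter> D m" using pm pr_props(2) by blast
  then obtain w where w: "w \<in> L'" "pr m (f (\<alpha> (pr l x))) = sh (a - c - 2 * cl + n - c - cm) w" using Lm(2) by blast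
  obtain w1 where w1: "w1 \<in> L'" "\<beta> w = sh b w1" using \<beta>(1)[OF w(1)] by blast
  have "\<beta> (pr m (f (\<alpha> (pr l x)))) = sh (a - c - 2 * cl + n - c - cm + b) w1" unfolding w(2) \<beta>(2) w1(2) by simp
  moreover have "w1 \<in> Fil (- cm)" using w1 Lm by blast
  ultimately show ?thesis unfolding \<alpha>(3)
    using Fil_shift[of w1 "- cm" "a - c - 2 * cl + n - c - cm + b"] by (simp add: algebra_simps)
qed

lemma comp_growth:
  obtains r t c where "r > (0::nat)" "\<And>l m. l \<in> SL \<Longrightarrow> m \<in> SL \<Longrightarrow> l < m \<Longrightarrow> (t l :: int) < t m" "c \<ge> 0"
    "\<And>l m j f. l \<in> SL \<Longrightarrow> m \<in> SL \<Longrightarrow> f \<in> FilE 0 \<Longrightarrow> (T ^^ (r * j)) (comp_lm l m f) \<in> FilE ((t m - t l) * int j - c)"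
    "\<And>l m j f. l \<in> SL \<Longrightarrow> m \<in> SL \<Longrightarrow> f \<in> FilE 0 \<Longrightarrow> (T' ^^ (r * j)) (comp_lm l m f) \<in> FilE ((t l - t m) * int j - c)"
proof -
  obtain r t L where r: "r > 0"
    and lat: "\<And>l. l \<in> SL \<Longrightarrow> lattice_of (D l) (L l)" and tl: "\<And>l. l \<in> SL \<Longrightarrow> of_int (t l) = of_nat r * l"
    and img: "\<And>l n. l \<in> SL \<Longrightarrow> (\<phi> ^^ (r * n)) ` L l = sh (t l * int n) ` L l" by (rule common_lattices) (rule that)
  have "\<forall>l\<in>SL. \<exists>c. L l \<subseteq> Fil (- c) \<and> (\<forall>n. Fil n \<inter> D l \<subseteq> sh (n - c) ` L l)"
  proof
    fix l assume "l \<in> SL"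
    from lattice_of_Fil[OF lat[OF this]] show "\<exists>c. L l \<subseteq> Fil (- c) \<and> (\<forall>n. Fil n \<inter> D l \<subseteq> sh (n - c) ` L l)" by metis
  qed
  from bchoice[OF this] obtain c where c: "\<forall>l\<in>SL. L l \<subseteq> Fil (- c l) \<and> (\<forall>n. Fil n \<inter> D l \<subseteq> sh (n - c l) ` L l)" by (elim exE)
  obtain c0 where c0: "\<forall>n. \<forall>l\<in>SL. \<forall>v\<in>Fil n. pr l v \<in> Fil (n - c0)" using pr_bounded by blast
  obtain d where d: "\<forall>l\<in>SL. c l \<le> d" using finite_int_bound[OF SL_finite] by blast
  define e where "e = max 0 (2 * c0 + 2 * d + 2 * d)"
  have fwd: "\<exists>y1\<in>L l. (\<phi> ^^ (r * j)) y = sh (t l * int j) y1" if "l \<in> SL" "y \<in> L l" for l y j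
    using img[OF that(1), of j] that(2) by blast
  have bwd: "\<exists>y1\<in>L l. (\<phi>' ^^ (r * j)) y = sh (- (t l * int j)) y1" if "l \<in> SL" "y \<in> L l" for l y j
  proof -
    have "sh (t l * int j) y \<in> (\<phi> ^^ (r * j)) ` L l" unfolding img[OF that(1)] using that(2) by blast
    then obtain y1 where y1: "y1 \<in> L l" "sh (t l * int j) y = (\<phi> ^^ (r * j)) y1" by blast
    have "(\<phi>' ^^ (r * j)) (sh (t l * int j) y) = y1" unfolding y1(2) by simp
    hence "sh (- (t l * int j)) (sh (t l * int j) ((\<phi>' ^^ (r * j)) y)) = sh (- (t l * int j)) y1"
      unfolding phi'_pow_sh by simp
    thus ?thesis using y1(1) by auto
  qed
  show thesis
  proof (rule that[OF r])
    show "e \<ge> 0" unfolding e_def by simp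
    fix l m assume lm: "l \<in> SL" "m \<in> SL" 
    {
      assume "l < m"
      hence "of_nat r * l < of_nat r * m" using r by simp
      hence "(of_int (t l) :: rat) < of_int (t m)" unfolding tl[OF lm(1)] tl[OF lm(2)] .
      thus "t l < t m" by simp
    }
    fix j f assume f: "f \<in> FilE 0"
    have Ll: "L l \<subseteq> Fil (- c l)" "\<And>n. Fil n \<inter> D l \<subseteq> sh (n - c l) ` L l" using c lm by blast+
    have Lm: "L m \<subseteq> Fil (- c m)" "\<And>n. Fil n \<inter> D m \<subseteq> sh (n - c m) ` L m" using c lm by blast+
    have pl: "pr l v \<in> Fil (n - c0)" "pr m v \<in> Fil (n - c0)" if "v \<in> Fil n" for n v using c0 lm that by blast+
    have cE: "comp_lm l m f \<in> End_space" by (rule comp_lm_End[OF FilE_End[OF f]])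
    have le: "2 * c0 + 2 * c l + 2 * c m \<le> e" using d[rule_format, OF lm(1)] d[rule_format, OF lm(2)] unfolding e_def by linarith
    show "(T ^^ (r * j)) (comp_lm l m f) \<in> FilE ((t m - t l) * int j - e)"
    proof (rule FilE_I[OF T_pow_End[OF cE]])
      fix x assume x: "x \<in> Fil 0"
      have "(\<phi> ^^ (r * j)) (pr m (f (pr l ((\<phi>' ^^ (r * j)) x)))) \<in>
        Fil (0 + (- (t l * int j)) + t m * int j - (2 * c0 + 2 * c l + 2 * c m))"
        by (rule comp_growth_aux[OF Ll Lm pl bwd[OF lm(1)] phi'_pow_sh pr_phi'_pow fwd[OF lm(2)] phi_pow_sh f x])
      hence "(\<phi> ^^ (r * j)) (pr m (f (pr l ((\<phi>' ^^ (r * j)) x)))) \<in> Fil ((t m - t l) * int j - e)"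
        by (rule Fil_monoD) (use le in \<open>simp add: algebra_simps\<close>)
      thus "(T ^^ (r * j)) (comp_lm l m f) x \<in> Fil ((t m - t l) * int j - e)" by (simp add: T_pow_apply comp_lm_def)
    qed
    show "(T' ^^ (r * j)) (comp_lm l m f) \<in> FilE ((t l - t m) * int j - e)"
    proof (rule FilE_I[OF T'_pow_End[OF cE]])
      fix x assume x: "x \<in> Fil 0"
      have "(\<phi>' ^^ (r * j)) (pr m (f (pr l ((\<phi> ^^ (r * j)) x)))) \<in>
        Fil (0 + t l * int j + (- (t m * int j)) - (2 * c0 + 2 * c l + 2 * c m))"
        by (rule comp_growth_aux[OF Ll Lm pl fwd[OF lm(1)] phi_pow_sh pr_phi_pow bwd[OF lm(2)] phi'_pow_sh f x])
      hence "(\<phi>' ^^ (r * j)) (pr m (f (pr l ((\<phi> ^^ (r * j)) x)))) \<in> Fil ((t l - t m) * int j - e)"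
        by (rule Fil_monoD) (use le in \<open>simp add: algebra_simps\<close>)
      thus "(T' ^^ (r * j)) (comp_lm l m f) x \<in> Fil ((t l - t m) * int j - e)" by (simp add: T'_pow_apply comp_lm_def)
    qed
  qed
qed

lemma T_pow_sum: "(T ^^ i) (\<Sum>a\<in>A. F a) = (\<Sum>a\<in>A. (T ^^ i) (F a))"
  by (induction A rule: infinite_finite_induct) (simp_all add: T_pow_add)
lemma T'_pow_sum: "(T' ^^ i) (\<Sum>a\<in>A. F a) = (\<Sum>a\<in>A. (T' ^^ i) (F a))"
  by (induction A rule: infinite_finite_induct) (simp_all add: T'_pow_add)

lemma PR_FilE_pow:
  assumes "\<And>l m. l \<in> SL \<Longrightarrow> m \<in> SL \<Longrightarrow> R l m \<Longrightarrow> (T ^^ i) (comp_lm l m f) \<in> FilE n"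
  shows "(T ^^ i) (PR R f) \<in> FilE n"
  unfolding PR_def T_pow_sum by (intro E.Fil_sum) (use assms in auto)
lemma PR_FilE_pow':
  assumes "\<And>l m. l \<in> SL \<Longrightarrow> m \<in> SL \<Longrightarrow> R l m \<Longrightarrow> (T' ^^ i) (comp_lm l m f) \<in> FilE n"
  shows "(T' ^^ i) (PR R f) \<in> FilE n"
  unfolding PR_def T'_pow_sum by (intro E.Fil_sum) (use assms in auto)

text \<open>In r steps the component from l to m gains t m - t l, up to a constant. For general i
  the remainder modulo r costs at most r cT, which explains the second summand of e.\<close>

lemma growth:
  obtains c where "c \<ge> 0"
    "\<And>i f. f \<in> FilE 0 \<Longrightarrow> (T ^^ i) (PP f) \<in> FilE (- c)" "\<And>i f. f \<in> FilE 0 \<Longrightarrow> (T ^^ i) (PZ f) \<in> FilE (- c)"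
    "\<And>i f. f \<in> FilE 0 \<Longrightarrow> (T' ^^ i) (PZ f) \<in> FilE (- c)" "\<And>i f. f \<in> FilE 0 \<Longrightarrow> (T' ^^ i) (PM f) \<in> FilE (- c)"
    "\<And>N. \<exists>I. \<forall>i\<ge>I. \<forall>f\<in>FilE 0. (T ^^ i) (PP f) \<in> FilE N"
    "\<And>N. \<exists>I. \<forall>i\<ge>I. \<forall>f\<in>FilE 0. (T' ^^ i) (PM f) \<in> FilE N"
proof -
  obtain r t c where r: "r > (0::nat)" and t: "\<And>l m. l \<in> SL \<Longrightarrow> m \<in> SL \<Longrightarrow> l < m \<Longrightarrow> (t l :: int) < t m" and c: "c \<ge> 0"
    and G: "\<And>l m j f. l \<in> SL \<Longrightarrow> m \<in> SL \<Longrightarrow> f \<in> FilE 0 \<Longrightarrow> (T ^^ (r * j)) (comp_lm l m f) \<in> FilE ((t m - t l) * int j - c)"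
    and G': "\<And>l m j f. l \<in> SL \<Longrightarrow> m \<in> SL \<Longrightarrow> f \<in> FilE 0 \<Longrightarrow> (T' ^^ (r * j)) (comp_lm l m f) \<in> FilE ((t l - t m) * int j - c)"
    by (rule comp_growth) (rule that)
  define e where "e = c + int r * cT"
  have e0: "e \<ge> 0" unfolding e_def using c cT by simp
  have mod: "int (i mod r) * cT \<le> int r * cT" for i
    using r cT by (intro mult_right_mono) auto
  have H: "(T ^^ i) (comp_lm l m f) \<in> FilE ((t m - t l) * int (i div r) - e)"
    if "l \<in> SL" "m \<in> SL" "f \<in> FilE 0" for l m i f
  proof -
    have "(T ^^ i) g = (T ^^ (i mod r)) ((T ^^ (r * (i div r))) g)" for g
      by (metis comp_apply funpow_add mod_mult_div_eq)
    moreover have "(T ^^ (i mod r)) ((T ^^ (r * (i div r))) (comp_lm l m f)) \<in>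
        FilE ((t m - t l) * int (i div r) - c - int (i mod r) * cT)" by (rule T_pow_FilE[OF G[OF that]])
    ultimately have "(T ^^ i) (comp_lm l m f) \<in> FilE ((t m - t l) * int (i div r) - c - int (i mod r) * cT)" by simp
    thus ?thesis by (rule E.Fil_monoD) (use mod[of i] in \<open>simp add: e_def\<close>)
  qed
  have H': "(T' ^^ i) (comp_lm l m f) \<in> FilE ((t l - t m) * int (i div r) - e)"
    if "l \<in> SL" "m \<in> SL" "f \<in> FilE 0" for l m i f
  proof -
    have "(T' ^^ i) g = (T' ^^ (i mod r)) ((T' ^^ (r * (i div r))) g)" for g
      by (metis comp_apply funpow_add mod_mult_div_eq)
    moreover have "(T' ^^ (i mod r)) ((T' ^^ (r * (i div r))) (comp_lm l m f)) \<in>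
        FilE ((t l - t m) * int (i div r) - c - int (i mod r) * cT)" by (rule T'_pow_FilE[OF G'[OF that]])
    ultimately have "(T' ^^ i) (comp_lm l m f) \<in> FilE ((t l - t m) * int (i div r) - c - int (i mod r) * cT)" by simp
    thus ?thesis by (rule E.Fil_monoD) (use mod[of i] in \<open>simp add: e_def\<close>)
  qed
  have pos: "int j \<le> (t m - t l) * int j" if "l \<in> SL" "m \<in> SL" "l < m" for l m j
    using mult_right_mono[of 1 "t m - t l" "int j"] t[OF that] by simp
  have pos0: "0 \<le> (t m - t l) * int j" if "l \<in> SL" "m \<in> SL" "l < m" for l m j
    using pos[OF that, of j] by linarith
  have big: "i div r \<ge> J" if "i \<ge> r * J" for i J using that r
    by (metis div_le_mono nonzero_mult_div_cancel_left not_gr_zero)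
  show thesis
  proof (rule that[OF e0])
    fix i f assume f: "f \<in> FilE 0"
    show "(T ^^ i) (PP f) \<in> FilE (- e)"
      by (rule PR_FilE_pow, rule E.Fil_monoD, rule H) (use f pos0 in auto)
    show "(T ^^ i) (PZ f) \<in> FilE (- e)"
      by (rule PR_FilE_pow, rule E.Fil_monoD, rule H) (use f in auto)
    show "(T' ^^ i) (PZ f) \<in> FilE (- e)"
      by (rule PR_FilE_pow', rule E.Fil_monoD, rule H') (use f in auto)
    show "(T' ^^ i) (PM f) \<in> FilE (- e)"
      by (rule PR_FilE_pow', rule E.Fil_monoD, rule H') (use f pos0 in auto)
  next
    fix N
    define J where "J = nat (N + e)"
    have J: "N \<le> int j - e" if "j \<ge> J" for j using that unfolding J_def by linarith
    have "(T ^^ i) (PP f) \<in> FilE N" if "i \<ge> r * J" "f \<in> FilE 0" for i f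
    proof (rule PR_FilE_pow)
      fix l m assume lm: "l \<in> SL" "m \<in> SL" "l < m"
      have "N \<le> (t m - t l) * int (i div r) - e"
        using J[OF big[OF that(1)]] pos[OF lm, of "i div r"] by linarith
      thus "(T ^^ i) (comp_lm l m f) \<in> FilE N" by (rule E.Fil_monoD[OF H[OF lm(1,2) that(2)]])
    qed
    thus "\<exists>I. \<forall>i\<ge>I. \<forall>f\<in>FilE 0. (T ^^ i) (PP f) \<in> FilE N" by blast
    have "(T' ^^ i) (PM f) \<in> FilE N" if "i \<ge> r * J" "f \<in> FilE 0" for i f
    proof (rule PR_FilE_pow')
      fix l m assume lm: "l \<in> SL" "m \<in> SL" "m < l"
      have "N \<le> (t l - t m) * int (i div r) - e"
        using J[OF big[OF that(1)]] pos[OF lm(2,1,3), of "i div r"] by linarith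
      thus "(T' ^^ i) (comp_lm l m f) \<in> FilE N" by (rule E.Fil_monoD[OF H'[OF lm(1,2) that(2)]])
    qed
    thus "\<exists>I. \<forall>i\<ge>I. \<forall>f\<in>FilE 0. (T' ^^ i) (PM f) \<in> FilE N" by blast
  qed
qed

lemma PR_end_scale: "PR R (end_scale c f) = end_scale c (PR R f)"
proof -
  have "comp_lm l m (end_scale c f) = end_scale c (comp_lm l m f)" for l m
    by (simp add: comp_lm_def fun_eq_iff end_scale_def pr_scale)
  thus ?thesis unfolding PR_def by (simp only: endo.scale_sum_right)
qed

lemma PR_sh: "PR R (E.sh n f) = E.sh n (PR R f)" unfolding E.sh_def by (rule PR_end_scale)

lemma PR_VR_disjoint: "f \<in> VR S \<Longrightarrow> (\<And>l m. \<not> (R l m \<and> S l m)) \<Longrightarrow> PR R f = 0"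
proof (rule End_eqI_pr)
  assume f: "f \<in> VR S" and RS: "\<And>l m. \<not> (R l m \<and> S l m)"
  have E: "f \<in> End_space" by (rule VR_End[OF f])
  show "PR R f \<in> End_space" by (rule PR_End[OF E])
  show "0 \<in> End_space" by (rule End_zero)
  fix l m v
  have "pr m (f (pr l v)) = 0" if "R l m" using f RS that unfolding VR_def by blast
  thus "pr m (PR R f (pr l v)) = pr m (0 (pr l v))"
    unfolding PR_pr[OF E] by (simp add: fun_applies End_0_apply[OF pr_End])
qed

section \<open>The submodule O_H\<close>

definition OP where "OP = {f \<in> VP. \<forall>i. (T ^^ i) f \<in> FilE 0}"
text \<open>Slope zero takes both directions because \<open>O_zero\<close> asks for equality of the
  module with its image; the greatest such module consists of the elements with integral two-sided
  orbit.\<close>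

definition OZ where "OZ = {f \<in> VZ. \<forall>i. (T ^^ i) f \<in> FilE 0 \<and> (T' ^^ i) f \<in> FilE 0}"
definition OM where "OM = {f \<in> VM. \<forall>i. (T' ^^ i) f \<in> FilE 0}"
definition OH where "OH = {a + b + c |a b c. a \<in> OP \<and> b \<in> OZ \<and> c \<in> OM}"

lemma T_pow_int_scale_FilE: "(T ^^ i) f \<in> FilE n \<Longrightarrow> (T ^^ i) (end_int_scale a f) \<in> FilE n"
proof -
  assume f: "(T ^^ i) f \<in> FilE n"
  have "end_scale ((\<sigma> ^^ i) (fps_to_fls a)) ((T ^^ i) f) \<in> FilE (n + 0)"
    by (rule E.Fil_mult[OF _ f]) (simp add: sigma_pow_ge fls_ge_fps)
  thus ?thesis unfolding end_int_scale_def T_pow_end_scale by simp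
qed

lemma T'_pow_int_scale_FilE: "(T' ^^ i) f \<in> FilE n \<Longrightarrow> (T' ^^ i) (end_int_scale a f) \<in> FilE n"
proof -
  assume f: "(T' ^^ i) f \<in> FilE n"
  have "end_scale ((inv \<sigma> ^^ i) (fps_to_fls a)) ((T' ^^ i) f) \<in> FilE (n + 0)"
    by (rule E.Fil_mult[OF _ f]) (simp add: sigma'_pow_ge fls_ge_fps)
  thus ?thesis unfolding end_int_scale_def T'_pow_end_scale by simp
qed

lemma VR_int_scale: "f \<in> VR R \<Longrightarrow> end_int_scale a f \<in> VR R"
  unfolding end_int_scale_def by (rule endo.subspace_scale[OF VR_subspace])

lemma VR_add: "f \<in> VR R \<Longrightarrow> g \<in> VR R \<Longrightarrow> f + g \<in> VR R"
  by (rule endo.subspace_add[OF VR_subspace])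

lemma VR_0: "0 \<in> VR R" by (rule endo.subspace_0[OF VR_subspace])

lemma OP_int: "end_int.subspace OP"
  unfolding end_int.subspace_def OP_def
  by (simp add: VR_0 VR_add VR_int_scale T_pow_add T_pow_int_scale_FilE E.Fil_add)

lemma OM_int: "end_int.subspace OM"
  unfolding end_int.subspace_def OM_def
  by (simp add: VR_0 VR_add VR_int_scale T'_pow_add T'_pow_int_scale_FilE E.Fil_add)

lemma OZ_int: "end_int.subspace OZ"
  unfolding end_int.subspace_def OZ_def
  by (simp add: VR_0 VR_add VR_int_scale T_pow_add T'_pow_add T_pow_int_scale_FilE T'_pow_int_scale_FilE E.Fil_add)

lemma T_OP: "f \<in> OP \<Longrightarrow> T f \<in> OP"
proof -
  assume f: "f \<in> OP"
  hence "(T ^^ Suc i) f \<in> FilE 0" for i unfolding OP_def by blast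
  hence "(T ^^ i) (T f) \<in> FilE 0" for i by (simp add: funpow_swap1)
  thus ?thesis using f VR_T unfolding OP_def by blast
qed

lemma T'_OM: "f \<in> OM \<Longrightarrow> T' f \<in> OM"
proof -
  assume f: "f \<in> OM"
  hence "(T' ^^ Suc i) f \<in> FilE 0" for i unfolding OM_def by blast
  hence "(T' ^^ i) (T' f) \<in> FilE 0" for i by (simp add: funpow_swap1)
  thus ?thesis using f VR_T' unfolding OM_def by blast
qed

lemma T_OZ: "f \<in> OZ \<Longrightarrow> T f \<in> OZ" and T'_OZ: "f \<in> OZ \<Longrightarrow> T' f \<in> OZ"
proof -
  assume f: "f \<in> OZ"
  hence p: "(T ^^ i) f \<in> FilE 0" "(T' ^^ i) f \<in> FilE 0" for i unfolding OZ_def by blast+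
  have 1: "(T ^^ i) (T f) \<in> FilE 0" for i using p(1)[of "Suc i"] by (simp add: funpow_swap1)
  have 2: "(T' ^^ i) (T f) \<in> FilE 0" for i
  proof (cases i)
    case 0 thus ?thesis using p(1)[of 1] by simp
  next
    case (Suc j) thus ?thesis using p(2)[of j] by (simp add: funpow_swap1)
  qed
  have 3: "(T' ^^ i) (T' f) \<in> FilE 0" for i using p(2)[of "Suc i"] by (simp add: funpow_swap1)
  have 4: "(T ^^ i) (T' f) \<in> FilE 0" for i
  proof (cases i)
    case 0 thus ?thesis using p(2)[of 1] by simp
  next
    case (Suc j) thus ?thesis using p(1)[of j] by (simp add: funpow_swap1)
  qed
  show "T f \<in> OZ" "T' f \<in> OZ" using f 1 2 3 4 VR_T VR_T' unfolding OZ_def by blast+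
qed

lemma O_plus_eq: "O_plus \<phi> (FilE 0) = OP"
  unfolding O_plus_def V_plus_eq T_def[symmetric]
proof (rule Greatest_equality)
  have "OP \<subseteq> VP \<inter> FilE 0"
  proof
    fix f assume f: "f \<in> OP"
    hence "(T ^^ 0) f \<in> FilE 0" unfolding OP_def by blast
    thus "f \<in> VP \<inter> FilE 0" using f unfolding OP_def by simp
  qed
  thus "end_int.subspace OP \<and> OP \<subseteq> VP \<inter> FilE 0 \<and> T ` OP \<subseteq> OP" using OP_int T_OP by blast
next
  fix N assume N: "end_int.subspace N \<and> N \<subseteq> VP \<inter> FilE 0 \<and> T ` N \<subseteq> N"
  show "N \<le> OP"
  proof
    fix f assume f: "f \<in> N"
    have "(T ^^ i) f \<in> N" for i using f N by (induction i) auto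
    thus "f \<in> OP" using N f unfolding OP_def by blast
  qed
qed

lemma O_minus_eq: "O_minus \<phi> (FilE 0) = OM"
  unfolding O_minus_def V_minus_eq T'_def[symmetric]
proof (rule Greatest_equality)
  have "OM \<subseteq> VM \<inter> FilE 0"
  proof
    fix f assume f: "f \<in> OM"
    hence "(T' ^^ 0) f \<in> FilE 0" unfolding OM_def by blast
    thus "f \<in> VM \<inter> FilE 0" using f unfolding OM_def by simp
  qed
  thus "end_int.subspace OM \<and> OM \<subseteq> VM \<inter> FilE 0 \<and> T' ` OM \<subseteq> OM" using OM_int T'_OM by blast
next
  fix N assume N: "end_int.subspace N \<and> N \<subseteq> VM \<inter> FilE 0 \<and> T' ` N \<subseteq> N"
  show "N \<le> OM"
  proof
    fix f assume f: "f \<in> N"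
    have "(T' ^^ i) f \<in> N" for i using f N by (induction i) auto
    thus "f \<in> OM" using N f unfolding OM_def by blast
  qed
qed

lemma O_zero_eq: "O_zero \<phi> (FilE 0) = OZ"
  unfolding O_zero_def V_zero_eq T_def[symmetric]
proof (rule Greatest_equality)
  have "OZ \<subseteq> VZ \<inter> FilE 0"
  proof
    fix f assume f: "f \<in> OZ"
    hence "(T ^^ 0) f \<in> FilE 0" unfolding OZ_def by blast
    thus "f \<in> VZ \<inter> FilE 0" using f unfolding OZ_def by simp
  qed
  moreover have "OZ \<subseteq> T ` OZ"
  proof
    fix f assume "f \<in> OZ"
    hence "T (T' f) \<in> T ` OZ" using T'_OZ by blast
    thus "f \<in> T ` OZ" by simp
  qed
  ultimately show "end_int.subspace OZ \<and> OZ \<subseteq> VZ \<inter> FilE 0 \<and> T ` OZ = OZ" using OZ_int T_OZ by blast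
next
  fix N assume N: "end_int.subspace N \<and> N \<subseteq> VZ \<inter> FilE 0 \<and> T ` N = N"
  have TN: "T f \<in> N" if "f \<in> N" for f
  proof -
    have "T f \<in> T ` N" using that by (rule imageI)
    thus ?thesis using N by simp
  qed
  have T'N: "T' f \<in> N" if "f \<in> N" for f
  proof -
    have "f \<in> T ` N" using that N by simp
    then obtain g where "g \<in> N" "f = T g" by (elim imageE)
    thus ?thesis by simp
  qed
  show "N \<le> OZ"
  proof
    fix f assume f: "f \<in> N"
    have "(T ^^ i) f \<in> N" "(T' ^^ i) f \<in> N" for i using f TN T'N by (induction i) auto
    thus "f \<in> OZ" using N f unfolding OZ_def by blast
  qed
qed

lemma O_level_eq: "O_level \<phi> (FilE 0) = OH"
  unfolding O_level_def OH_def O_plus_eq O_zero_eq O_minus_eq ..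

lemma OP_D: "f \<in> OP \<Longrightarrow> f \<in> VP" "f \<in> OP \<Longrightarrow> f \<in> FilE 0"
  and OZ_D: "f \<in> OZ \<Longrightarrow> f \<in> VZ" "f \<in> OZ \<Longrightarrow> f \<in> FilE 0"
  and OM_D: "f \<in> OM \<Longrightarrow> f \<in> VM" "f \<in> OM \<Longrightarrow> f \<in> FilE 0"
  unfolding OP_def OZ_def OM_def by (auto dest: spec[of _ 0])

lemma P_components:
  assumes "a \<in> VP" "b \<in> VZ" "c \<in> VM"
  shows "PP (a + b + c) = a" "PZ (a + b + c) = b" "PM (a + b + c) = c"
proof -
  have "PP b = 0" "PP c = 0" "PZ a = 0" "PZ c = 0" "PM a = 0" "PM b = 0"
    by (rule PR_VR_disjoint, rule assms, force)+
  thus "PP (a + b + c) = a" "PZ (a + b + c) = b" "PM (a + b + c) = c"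
    unfolding PR_add VR_PR[OF assms(1)] VR_PR[OF assms(2)] VR_PR[OF assms(3)] by simp_all
qed

lemma OH_iff: "f \<in> OH \<longleftrightarrow> f \<in> End_space \<and> PP f \<in> OP \<and> PZ f \<in> OZ \<and> PM f \<in> OM"
proof
  assume "f \<in> OH"
  then obtain a b c where f: "f = a + b + c" "a \<in> OP" "b \<in> OZ" "c \<in> OM" unfolding OH_def by blast
  have "f \<in> End_space" unfolding f(1)
    by (intro End_add VR_End[OF OP_D(1)] VR_End[OF OZ_D(1)] VR_End[OF OM_D(1)] f)
  thus "f \<in> End_space \<and> PP f \<in> OP \<and> PZ f \<in> OZ \<and> PM f \<in> OM"
    using P_components[OF OP_D(1)[OF f(2)] OZ_D(1)[OF f(3)] OM_D(1)[OF f(4)]] f by simp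
next
  assume f: "f \<in> End_space \<and> PP f \<in> OP \<and> PZ f \<in> OZ \<and> PM f \<in> OM"
  hence "f = PP f + PZ f + PM f" using P_sum by blast
  thus "f \<in> OH" unfolding OH_def using f by blast
qed

lemma OH_FilE: "f \<in> OH \<Longrightarrow> f \<in> FilE 0"
proof -
  assume "f \<in> OH"
  then obtain a b c where f: "f = a + b + c" "a \<in> OP" "b \<in> OZ" "c \<in> OM" unfolding OH_def by blast
  show ?thesis unfolding f(1) by (intro E.Fil_add OP_D(2) OZ_D(2) OM_D(2) f)
qed

text \<open>Multiplication by the \<epsilon>^c of \<open>growth\<close> makes all relevant orbits
  integral. This is where the descending induction in \<open>iso_prop_iff_level\<close>
  starts.\<close>

lemma OH_contains: "\<exists>N. FilE (int N) \<subseteq> OH"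
proof -
  obtain c where c: "c \<ge> 0"
    "\<And>i f. f \<in> FilE 0 \<Longrightarrow> (T ^^ i) (PP f) \<in> FilE (- c)" "\<And>i f. f \<in> FilE 0 \<Longrightarrow> (T ^^ i) (PZ f) \<in> FilE (- c)"
    "\<And>i f. f \<in> FilE 0 \<Longrightarrow> (T' ^^ i) (PZ f) \<in> FilE (- c)" "\<And>i f. f \<in> FilE 0 \<Longrightarrow> (T' ^^ i) (PM f) \<in> FilE (- c)"
    by (rule growth) (rule that)
  have "f \<in> OH" if f: "f \<in> FilE c" for f
  proof -
    have E: "f \<in> End_space" by (rule FilE_End[OF f])
    define g where "g = E.sh (- c) f"
    have g: "g \<in> FilE 0" unfolding g_def using f by (simp add: E.Fil_shift_iff)
    have fg: "f = E.sh c g" unfolding g_def by simp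
    have "(T ^^ i) (PP f) \<in> FilE 0" "(T ^^ i) (PZ f) \<in> FilE 0" "(T' ^^ i) (PZ f) \<in> FilE 0" "(T' ^^ i) (PM f) \<in> FilE 0" for i
      unfolding fg PR_sh T_pow_sh T'_pow_sh E.Fil_shift_iff using c(2-5)[OF g, of i] by simp_all
    thus ?thesis unfolding OH_iff OP_def OZ_def OM_def using E PR_VR[OF E] by blast
  qed
  thus ?thesis using c(1) by (intro exI[of _ "nat c"]) auto
qed

end

section \<open>Sufficiency of the level torsion\<close>

declare comp_apply [simp del]

lemma (in crystal) growth_minus: "\<exists>I. \<forall>i\<ge>I. \<forall>f\<in>FilE 0. (T' ^^ i) (PM f) \<in> FilE N"
  by (rule growth) blast

section \<open>Products of several endomorphisms\<close>

context based_space
begin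

primrec pw :: "('v \<Rightarrow> 'v) set \<Rightarrow> nat \<Rightarrow> ('v \<Rightarrow> 'v) set" where
  "pw A 0 = {id}"
| "pw A (Suc n) = {a \<circ> b |a b. a \<in> A \<and> b \<in> pw A n}"

lemma pw_SucI: "a \<in> A \<Longrightarrow> b \<in> pw A n \<Longrightarrow> a \<circ> b \<in> pw A (Suc n)" by auto

lemma pw_SucE: assumes "x \<in> pw A (Suc n)" obtains a b where "x = a \<circ> b" "a \<in> A" "b \<in> pw A n"
  using assms by auto

lemma pw_add: "x \<in> pw A i \<Longrightarrow> y \<in> pw A j \<Longrightarrow> x \<circ> y \<in> pw A (i + j)"
proof (induction i arbitrary: x)
  case (Suc i)
  from Suc.prems(1) obtain a b where ab: "x = a \<circ> b" "a \<in> A" "b \<in> pw A i" by (rule pw_SucE)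
  have "a \<circ> (b \<circ> y) \<in> pw A (Suc (i + j))" by (rule pw_SucI[OF ab(2) Suc.IH[OF ab(3) Suc.prems(2)]])
  thus ?case unfolding ab(1) comp_assoc add_Suc .
qed simp

lemma pw_split: "x \<in> pw A (i + j) \<Longrightarrow> \<exists>a\<in>pw A i. \<exists>b\<in>pw A j. x = a \<circ> b"
proof (induction i arbitrary: x)
  case (Suc i)
  from Suc.prems obtain a b where ab: "x = a \<circ> b" "a \<in> A" "b \<in> pw A (i + j)" by (auto elim: pw_SucE)
  from Suc.IH[OF ab(3)] obtain c d where cd: "c \<in> pw A i" "d \<in> pw A j" "b = c \<circ> d" by blast
  have "x = (a \<circ> c) \<circ> d" using ab cd by (simp add: comp_assoc)
  with pw_SucI[OF ab(2) cd(1)] cd(2) show ?case by blast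
qed simp

lemma pw_FilE0: "A \<subseteq> FilE 0 \<Longrightarrow> pw A n \<subseteq> FilE 0"
proof (induction n)
  case 0 show ?case using FilE_id by simp
next
  case (Suc n)
  show ?case
  proof
    fix x assume "x \<in> pw A (Suc n)"
    then obtain a b where "x = a \<circ> b" "a \<in> A" "b \<in> pw A n" by (rule pw_SucE)
    thus "x \<in> FilE 0" using FilE_comp0[of a b 0] Suc by blast
  qed
qed

lemma pw_mult:
  assumes "pw A N \<subseteq> FilE 1" shows "pw A (N * K) \<subseteq> FilE (int K)"
proof (induction K)
  case 0 show ?case using FilE_id by simp
next
  case (Suc K)
  show ?case
  proof
    fix x assume "x \<in> pw A (N * Suc K)"
    hence "x \<in> pw A (N + N * K)" by simp
    from pw_split[OF this] obtain a b where ab: "a \<in> pw A N" "b \<in> pw A (N * K)" "x = a \<circ> b" by blast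
    have "a \<circ> b \<in> FilE (1 + int K)" by (rule FilE_comp) (use ab assms Suc in blast)+
    thus "x \<in> FilE (int (Suc K))" unfolding ab(3) by simp
  qed
qed

lemma pw_eventually:
  assumes "A \<subseteq> FilE 0" "pw A N \<subseteq> FilE K" "N \<le> n" shows "pw A n \<subseteq> FilE K"
proof
  fix x assume "x \<in> pw A n"
  hence "x \<in> pw A (N + (n - N))" using assms(3) by simp
  from pw_split[OF this] obtain a b where ab: "a \<in> pw A N" "b \<in> pw A (n - N)" "x = a \<circ> b" by blast
  have "a \<circ> b \<in> FilE (K + 0)" by (rule FilE_comp) (use ab assms pw_FilE0[OF assms(1)] in blast)+
  thus "x \<in> FilE K" unfolding ab(3) by simp
qed

lemma pw_funpow: "a \<in> A \<Longrightarrow> a ^^ n \<in> pw A n"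
proof (induction n)
  case (Suc n)
  show ?case unfolding funpow.simps by (rule pw_SucI[OF Suc.prems Suc.IH[OF Suc.prems]])
qed (simp add: id_def)

lemma GLM_End: "g \<in> GLM \<Longrightarrow> g \<in> End_space" by (rule FilE_End[OF GLM_FilE])

end

section \<open>Integral solutions of the linear equation modulo \<open>FilE (m + 1)\<close>\<close>

context crystal
begin

text \<open>\<open>RI m\<close> consists of the integral endomorphisms obtained from \<open>FilE m\<close> by repeatedly applying \<open>T\<close>
  modulo \<open>FilE m\<close>. A product of such elements is congruent to \<open>T\<close> of the product of their
  predecessors, which makes \<open>RI m\<close> topologically nilpotent.\<close>

primrec Rc :: "int \<Rightarrow> nat \<Rightarrow> ('v \<Rightarrow> 'v) set" where
  "Rc m 0 = FilE m"
| "Rc m (Suc i) = {v \<in> FilE 0. \<exists>w\<in>Rc m i. v - T w \<in> FilE m}"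

definition RI :: "int \<Rightarrow> ('v \<Rightarrow> 'v) set" where "RI m = (\<Union>i. Rc m i)"
text \<open>The integral endomorphisms fixed by T modulo \<open>FilE m\<close>. Every g in GL(M)
  with T g = g (1 + z), z in \<open>FilE m\<close>, is of this kind, which is why these are the
  elements to be counted later.\<close>

definition DD :: "int \<Rightarrow> ('v \<Rightarrow> 'v) set" where "DD m = {y \<in> FilE 0. T y - y \<in> FilE m}"

context
  fixes m :: int
  assumes m: "m \<ge> 1"
begin

lemma FilEm_0: "f \<in> FilE m \<Longrightarrow> f \<in> FilE 0" and FilEm_1: "f \<in> FilE m \<Longrightarrow> f \<in> FilE 1"
  using m by (auto elim: E.Fil_monoD)

lemma Rc_FilE: "Rc m i \<subseteq> FilE 0" by (cases i) (auto intro: FilEm_0)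

lemma Rc_contains: "FilE m \<subseteq> Rc m i"
proof (induction i)
  case (Suc i)
  show ?case
  proof
    fix f assume f: "f \<in> FilE m"
    have "0 \<in> Rc m i" using Suc by auto
    thus "f \<in> Rc m (Suc i)" using f FilEm_0[OF f] by (auto intro!: bexI[of _ 0])
  qed
qed simp

lemma Rc_Suc: "Rc m i \<subseteq> Rc m (Suc i)"
proof (induction i)
  case 0 show ?case using Rc_contains[of "Suc 0"] by simp
next
  case (Suc i) thus ?case by auto
qed

lemma Rc_subspace: "E.k.subspace (Rc m i)"
proof (induction i)
  case 0 show ?case by (simp add: E.Fil_k)
next
  case (Suc i)
  show ?case
  proof (rule E.k.subspaceI)
    show "0 \<in> Rc m (Suc i)" by (rule subsetD[OF Rc_contains E.Fil_0])
  next
    fix x y assume "x \<in> Rc m (Suc i)" "y \<in> Rc m (Suc i)"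
    then obtain v w where vw: "x \<in> FilE 0" "y \<in> FilE 0" "v \<in> Rc m i" "w \<in> Rc m i" "x - T v \<in> FilE m" "y - T w \<in> FilE m" by auto
    have "(x - T v) + (y - T w) \<in> FilE m" by (rule E.Fil_add[OF vw(5,6)])
    hence "x + y - T (v + w) \<in> FilE m" by (simp add: T_add algebra_simps)
    moreover have "v + w \<in> Rc m i" by (rule E.k.subspace_add[OF Suc vw(3,4)])
    ultimately show "x + y \<in> Rc m (Suc i)" using E.Fil_add[OF vw(1,2)] by auto
  next
    fix a :: 'k and x assume "x \<in> Rc m (Suc i)"
    then obtain v where v: "x \<in> FilE 0" "v \<in> Rc m i" "x - T v \<in> FilE m" by auto
    obtain b where b: "b ^ q = a" using frob_root[OF q] by blast
    have "E.ks a (x - T v) \<in> FilE m" by (rule E.Fil_ks[OF v(3)])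
    hence "E.ks a x - T (E.ks b v) \<in> FilE m" by (simp add: T_ks b E.k.scale_right_diff_distrib)
    moreover have "E.ks b v \<in> Rc m i" by (rule E.k.subspace_scale[OF Suc v(2)])
    ultimately show "E.ks a x \<in> Rc m (Suc i)" using E.Fil_ks[OF v(1)] by auto
  qed
qed

lemma RI_eq: "\<exists>n0. RI m = Rc m n0 \<and> Rc m (Suc n0) = Rc m n0"
proof -
  have "\<exists>n0. \<forall>n\<ge>n0. Rc m n = Rc m n0"
    by (rule E.k.artinian_increasing[OF E.Fil_artinian[of 0 m]])
      (use m Rc_subspace Rc_contains Rc_FilE Rc_Suc in auto)
  then obtain n0 where n0: "\<forall>n\<ge>n0. Rc m n = Rc m n0" ..
  have mono: "Rc m i \<subseteq> Rc m j" if "i \<le> j" for i j using Rc_Suc lift_Suc_mono_le that by metis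
  have "Rc m i \<subseteq> Rc m n0" for i using mono[of i "max i n0"] n0[rule_format, of "max i n0"] by simp
  hence "RI m = Rc m n0" unfolding RI_def by blast
  moreover have "Rc m (Suc n0) = Rc m n0" by (rule n0[rule_format]) simp
  ultimately show ?thesis by blast
qed

lemma RI_subspace: "E.k.subspace (RI m)" using RI_eq Rc_subspace by metis
lemma RI_FilE: "RI m \<subseteq> FilE 0" unfolding RI_def using Rc_FilE by blast
lemma RI_contains: "FilE m \<subseteq> RI m" unfolding RI_def using Rc_contains by blast
lemma RI_intro: "w \<in> RI m \<Longrightarrow> v \<in> FilE 0 \<Longrightarrow> v - T w \<in> FilE m \<Longrightarrow> v \<in> RI m"
proof -
  assume w: "w \<in> RI m" and v: "v \<in> FilE 0" "v - T w \<in> FilE m"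
  obtain i where "w \<in> Rc m i" using w unfolding RI_def by blast
  hence "v \<in> Rc m (Suc i)" using v by auto
  thus ?thesis unfolding RI_def by blast
qed
lemma RI_T: "w \<in> RI m \<Longrightarrow> T w \<in> FilE 0 \<Longrightarrow> T w \<in> RI m" by (rule RI_intro) auto

lemma RI_artinian: "E.k.artinian_between (RI m) (FilE 0)"
  by (rule E.k.artinian_mono[OF E.Fil_artinian[of 0 m] RI_contains]) (use m in auto)

lemma Rc_pw:
  assumes "x \<in> pw (Rc m (Suc i)) n" shows "\<exists>w\<in>pw (Rc m i) n. x - T w \<in> FilE m"
  using assms
proof (induction n arbitrary: x)
  case (Suc n)
  from Suc.prems obtain a b where ab: "x = a \<circ> b" "a \<in> Rc m (Suc i)" "b \<in> pw (Rc m (Suc i)) n" by (rule pw_SucE)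
  from Suc.IH[OF ab(3)] obtain w where w: "w \<in> pw (Rc m i) n" "b - T w \<in> FilE m" by blast
  from ab(2) obtain v where v: "a \<in> FilE 0" "v \<in> Rc m i" "a - T v \<in> FilE m" by auto
  have b0: "b \<in> FilE 0" using ab(3) pw_FilE0[OF Rc_FilE] by blast
  have Tv: "T v \<in> FilE 0" using E.Fil_diff[OF v(1) FilEm_0[OF v(3)]] by simp
  have "(a - T v) \<circ> b \<in> FilE m" by (rule FilE_comp0'[OF v(3) b0])
  moreover have "T v \<circ> (b - T w) \<in> FilE m" by (rule FilE_comp0[OF Tv w(2)])
  ultimately have "((a - T v) \<circ> b) + (T v \<circ> (b - T w)) \<in> FilE m" by (rule E.Fil_add)
  moreover have "((a - T v) \<circ> b) + (T v \<circ> (b - T w)) = x - T (v \<circ> w)"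
    unfolding ab(1) T_comp diff_comp comp_diff[OF FilE_End[OF Tv]] by simp
  ultimately show ?case using pw_SucI[OF v(2) w(1)] by auto
qed simp

lemma Rc_nilpotent: "\<exists>N. pw (Rc m i) N \<subseteq> FilE 1"
proof (induction i)
  case 0
  have "pw (FilE m) 1 \<subseteq> FilE 1" by (auto intro: FilEm_1)
  thus ?case unfolding Rc.simps(1) by (rule exI)
next
  case (Suc i)
  then obtain N where N: "pw (Rc m i) N \<subseteq> FilE 1" ..
  \<comment> \<open>T may lose cT, so the product of predecessors has to reach
    \<open>FilE (1 + cT)\<close>, which takes 1 + cT blocks of N factors.\<close>
  define K where "K = nat (1 + cT)"
  have K: "int K = 1 + cT" unfolding K_def using cT(1) by simp
  have "pw (Rc m (Suc i)) (N * K) \<subseteq> FilE 1"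
  proof
    fix x assume "x \<in> pw (Rc m (Suc i)) (N * K)"
    from Rc_pw[OF this] obtain w where w: "w \<in> pw (Rc m i) (N * K)" "x - T w \<in> FilE m" by blast
    have "w \<in> FilE (1 + cT)" using w(1) pw_mult[OF N, of K] K by auto
    hence "T w \<in> FilE (1 + cT - cT)" by (rule T_FilE)
    hence "(x - T w) + T w \<in> FilE 1" using FilEm_1[OF w(2)] by (intro E.Fil_add) simp_all
    thus "x \<in> FilE 1" by simp
  qed
  thus ?case by blast
qed

lemma RI_nilpotent: "\<exists>N. pw (RI m) N \<subseteq> FilE 1" using RI_eq Rc_nilpotent by metis

lemma RI_GLM: "y \<in> RI m \<Longrightarrow> id + y \<in> GLM"
proof -
  assume y: "y \<in> RI m"
  have y': "- y \<in> RI m" using y by (rule E.k.subspace_neg[OF RI_subspace])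
  obtain N where "pw (RI m) N \<subseteq> FilE 1" using RI_nilpotent by blast
  hence "(- y) ^^ N \<in> FilE 1" using pw_funpow[OF y'] by blast
  hence "id - (- y) \<in> GLM" using y' RI_FilE by (intro GLM_nilpotent) auto
  thus ?thesis by simp
qed

text \<open>An element y of \<open>DD m\<close> is congruent to T y, so its product with an element
  close to T w is close to T of its product with w, and the level in \<open>Rc\<close> is
  kept.\<close>

lemma DD_RI:
  assumes y: "y \<in> DD m" and "v \<in> RI m" shows "y \<circ> v \<in> RI m" "v \<circ> y \<in> RI m"
proof -
  have y0: "y \<in> FilE 0" and ym: "T y - y \<in> FilE m" using y unfolding DD_def by auto
  have Ty: "T y \<in> FilE 0" using E.Fil_add[OF FilEm_0[OF ym] y0] by simp
  have ym': "y - T y \<in> FilE m" using E.Fil_neg[OF ym] by simp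
  have "y \<circ> v \<in> Rc m i \<and> v \<circ> y \<in> Rc m i" if "v \<in> Rc m i" for i v using that
  proof (induction i arbitrary: v)
    case 0 thus ?case using FilE_comp0[OF y0] FilE_comp0'[OF _ y0] by simp
  next
    case (Suc i)
    from Suc.prems obtain w where w: "v \<in> FilE 0" "w \<in> Rc m i" "v - T w \<in> FilE m" by auto
    have Tw: "T w \<in> FilE 0" using E.Fil_diff[OF w(1) FilEm_0[OF w(3)]] by simp
    have "((y - T y) \<circ> v) + (T y \<circ> (v - T w)) \<in> FilE m"
      by (intro E.Fil_add FilE_comp0'[OF ym' w(1)] FilE_comp0[OF Ty w(3)])
    hence 1: "(y \<circ> v) - T (y \<circ> w) \<in> FilE m" unfolding T_comp diff_comp comp_diff[OF FilE_End[OF Ty]] by simp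
    have "((v - T w) \<circ> y) + (T w \<circ> (y - T y)) \<in> FilE m"
      by (intro E.Fil_add FilE_comp0'[OF w(3) y0] FilE_comp0[OF Tw ym'])
    hence 2: "(v \<circ> y) - T (w \<circ> y) \<in> FilE m" unfolding T_comp diff_comp comp_diff[OF FilE_End[OF Tw]] by simp
    show ?case using 1 2 Suc.IH[OF w(2)] FilE_comp0[OF y0 w(1)] FilE_comp0[OF w(1) y0] by auto
  qed
  thus "y \<circ> v \<in> RI m" "v \<circ> y \<in> RI m" using assms(2) unfolding RI_def by blast+
qed

text \<open>The iterates of f under T' tend to zero, so f is reached from an element of
  \<open>FilE m\<close> by applying T, with all intermediate values integral. This puts into
  \<open>RI m\<close> even elements that grow under T.\<close>

lemma OM_RI: "OM \<subseteq> RI m"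
proof
  fix f assume f: "f \<in> OM"
  obtain I where "\<forall>i\<ge>I. \<forall>f\<in>FilE 0. (T' ^^ i) (PM f) \<in> FilE m" using growth_minus by blast
  hence "(T' ^^ I) (PM f) \<in> FilE m" using OM_D(2)[OF f] by blast
  hence I: "(T' ^^ I) f \<in> FilE m" unfolding VR_PR[OF OM_D(1)[OF f]] .
  have "(T' ^^ j) f \<in> RI m \<longrightarrow> f \<in> RI m" for j
  proof (induction j)
    case (Suc j)
    show ?case
    proof
      assume a: "(T' ^^ Suc j) f \<in> RI m"
      have "(T' ^^ j) f \<in> FilE 0" using f unfolding OM_def by blast
      hence "T ((T' ^^ Suc j) f) \<in> FilE 0" by (simp add: comp_apply)
      from RI_T[OF a this] show "f \<in> RI m" using Suc by (simp add: comp_apply)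
    qed
  qed simp
  thus "f \<in> RI m" using I RI_contains by blast
qed

text \<open>Both summands are T-stable, so Lang's theorem modulo \<open>FilE (m + 1)\<close> treats
  slopes positive and zero together, in place of the series on V_+.\<close>

definition OPZ where "OPZ = {a + b |a b. a \<in> OP \<and> b \<in> OZ}"

lemma OPZ_k: "E.k.subspace OPZ"
  unfolding OPZ_def
  by (intro E.k.subspace_sums E.int_subspace_k) (simp_all add: E_int_subspace OP_int OZ_int)

text \<open>The part in V_- is solved by the sum of the T'^i, cut off once the remainder lies in
  \<open>FilE (m + 1)\<close>; the rest by Lang's theorem on the T-stable space N. Having y in
  \<open>RI m\<close>, and not merely integral, makes 1 + y invertible and controls the quadratic
  error.\<close>

lemma additive_lang:
  assumes O: "FilE m \<subseteq> OH" and z: "z \<in> FilE m"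
  shows "\<exists>y\<in>RI m. T y - y - z \<in> FilE (m + 1)"
proof -
  have "z \<in> OH" using O z by blast
  hence zE: "z \<in> End_space" and zP: "PP z \<in> OP" and zZ: "PZ z \<in> OZ" and zM: "PM z \<in> OM" unfolding OH_iff by auto
  define N where "N = RI m \<inter> OPZ"
  define N1 where "N1 = N \<inter> FilE (m + 1)"
  define n where "n = PP z + PZ z"
  have zn: "z = n + PM z" unfolding n_def by (rule P_sum[OF zE])
  have "n = z - PM z" using zn by (metis add_diff_cancel_right')
  moreover have "z - PM z \<in> RI m" by (rule E.k.subspace_diff[OF RI_subspace]) (use z RI_contains OM_RI zM in blast)+
  ultimately have nN: "n \<in> N" unfolding N_def OPZ_def using zP zZ n_def by blast
  have Nk: "E.k.subspace N" unfolding N_def by (intro E.k.subspace_inter RI_subspace OPZ_k)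
  have N1k: "E.k.subspace N1" unfolding N1_def by (intro E.k.subspace_inter Nk E.Fil_k)
  have TN: "T ` N \<subseteq> N"
  proof (rule image_subsetI)
    fix f assume "f \<in> N"
    then obtain a b where f: "f \<in> RI m" "f = a + b" "a \<in> OP" "b \<in> OZ" unfolding N_def OPZ_def by blast
    have Tf: "T f = T a + T b" unfolding f(2) T_add ..
    have "T f \<in> FilE 0" unfolding Tf by (intro E.Fil_add OP_D(2) OZ_D(2) T_OP T_OZ f)
    hence "T f \<in> RI m" by (rule RI_T[OF f(1)])
    moreover have "T f \<in> OPZ" unfolding OPZ_def Tf using T_OP[OF f(3)] T_OZ[OF f(4)] by blast
    ultimately show "T f \<in> N" unfolding N_def by blast
  qed
  have art: "E.k.artinian_between N1 N"
  proof (rule E.k.artinian_restrict[OF E.Fil_artinian[of 0 "m + 1"] E.Fil_k E.Fil_k _ Nk])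
    show "N \<subseteq> FilE 0" unfolding N_def using RI_FilE by blast
    show "FilE (m + 1) \<subseteq> FilE 0" by (rule E.Fil_mono) (use m in simp)
    show "FilE (m + 1) \<inter> N \<subseteq> N1" unfolding N1_def by blast
  qed (use m in simp)
  obtain x where x: "x \<in> N" "T x - x - n \<in> N1"
    by (rule FT.lang_surjective[OF Nk N1k _ TN nN art]) (auto simp: N1_def)
  obtain I where "\<forall>i\<ge>I. \<forall>f\<in>FilE 0. (T' ^^ i) (PM f) \<in> FilE (m + 1)" using growth_minus by blast
  hence I: "(T' ^^ I) (PM z) \<in> FilE (m + 1)" using FilEm_0[OF z] by blast
  define y where "y = (\<Sum>i<I. (T' ^^ Suc i) (PM z))"
  have "(T' ^^ i) (PM z) \<in> OM" for i using zM by (induction i) (auto simp: comp_apply intro: T'_OM)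
  hence "(T' ^^ i) (PM z) \<in> RI m" for i using OM_RI by blast
  hence yR: "y \<in> RI m" unfolding y_def by (rule E.k.subspace_sum[OF RI_subspace])
  have "T y = (\<Sum>i<I. (T' ^^ i) (PM z))" unfolding y_def FT.T_sum by (simp add: comp_apply)
  hence "T y - y = (\<Sum>i<I. (T' ^^ i) (PM z) - (T' ^^ Suc i) (PM z))" unfolding y_def by (simp add: sum_subtractf)
  also have "\<dots> = PM z - (T' ^^ I) (PM z)" by (subst sum_lessThan_telescope') simp
  finally have Ty: "T y - y = PM z - (T' ^^ I) (PM z)" .
  have "T (x + y) - (x + y) - z = (T x - x - n) + ((T y - y) - PM z)"
    unfolding T_add by (subst zn) (simp add: algebra_simps)
  also have "\<dots> = (T x - x - n) - (T' ^^ I) (PM z)" unfolding Ty by simp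
  also have "\<dots> \<in> FilE (m + 1)" using x(2) unfolding N1_def by (intro E.Fil_diff[OF _ I]) blast
  finally show ?thesis using E.k.subspace_add[OF RI_subspace _ yR, of x] x(1) unfolding N_def by blast
qed

end

text \<open>h1 is g h (T g)^-1, what remains to be trivialised after g has been used; its distance
  from 1 is read off from g h - T g.\<close>

lemma gauge_step:
  assumes h: "h \<in> GLM" and g: "g \<in> GLM" and Tg: "T g \<in> GLM"
  obtains h1 u where "h1 \<in> GLM" "h1 \<circ> T g = g \<circ> h" "u \<in> GLM" "h1 - id = ((g \<circ> h) - T g) \<circ> u"
proof -
  obtain u where u: "u \<in> GLM" "T g \<circ> u = id" "u \<circ> T g = id" by (rule GLM_inv[OF Tg])
  show thesis
  proof (rule that[OF _ _ u(1)])
    show "(g \<circ> h) \<circ> u \<in> GLM" by (intro GLM_comp g h u)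
    show "g \<circ> h \<circ> u \<circ> T g = g \<circ> h" unfolding comp_assoc u(3) by simp
    show "((g \<circ> h) \<circ> u) - id = ((g \<circ> h) - T g) \<circ> u" unfolding diff_comp u(2) ..
  qed
qed

text \<open>Separates the quadratic term from the defect of the linear equation, the two errors to
  be made small.\<close>

lemma gauge_expand:
  assumes y: "y \<in> End_space"
  shows "((id + y) \<circ> (id + z)) - T (id + y) = (y \<circ> z) - (T y - y - z)"
  unfolding add_comp comp_add[OF y] T_add T_id by (simp add: algebra_simps)

lemma gauge_trans:
  assumes "h1 \<circ> T g = g \<circ> h" "h \<circ> T G = G \<circ> h0"
  shows "h1 \<circ> T (g \<circ> G) = (g \<circ> G) \<circ> h0"
proof -
  have "h1 \<circ> T (g \<circ> G) = (h1 \<circ> T g) \<circ> T G" by (simp add: T_comp comp_assoc)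
  also have "\<dots> = g \<circ> (h \<circ> T G)" unfolding assms(1) by (simp add: comp_assoc)
  finally show ?thesis unfolding assms(2) by (simp add: comp_assoc)
qed

text \<open>\<open>T g = g \<circ> h\<close> is the equation \<open>h \<phi> = g\<^sup>-\<^sup>1 \<phi> g\<close> without inverses.\<close>

definition iso_prop :: "int \<Rightarrow> bool" where
  "iso_prop m \<longleftrightarrow> (\<forall>h\<in>GLM. h - id \<in> FilE m \<longrightarrow> (\<exists>g\<in>GLM. T g = g \<circ> h))"

section \<open>Successive approximation of g\<close>

context
  fixes m :: int
  assumes m: "m \<ge> 1" and O: "FilE m \<subseteq> OH"
begin

text \<open>At level m the quadratic term y x stays in \<open>FilE m\<close> only, but y comes from
  \<open>RI m\<close>: each round puts one more such factor on the left of the error, up to terms in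
  \<open>FilE (m + 1)\<close>. Nilpotence of \<open>RI m\<close> then ends the process after
  finitely many rounds.\<close>

lemma gauge_first_aux:
  assumes h: "h \<in> GLM" and hm: "h - id \<in> FilE m"
  shows "\<exists>h1\<in>GLM. \<exists>g\<in>GLM. h1 \<circ> T g = g \<circ> h \<and>
    (\<exists>a\<in>pw (RI m) n. \<exists>z\<in>FilE m. \<exists>e\<in>FilE (m + 1). h1 - id = (a \<circ> z) + e)"
proof (induction n)
  case 0
  have 1: "h \<circ> T id = id \<circ> h" "h - id = (id \<circ> (h - id)) + 0" by simp_all
  show ?case
    by (rule bexI[OF _ h], rule bexI[OF _ GLM_id], rule conjI[OF 1(1)], rule bexI[of _ id],
      rule bexI[OF _ hm], rule bexI[of _ 0], rule 1(2)) simp_all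
next
  case (Suc n)
  then obtain h1 g a z e where h1: "h1 \<in> GLM" "g \<in> GLM" "h1 \<circ> T g = g \<circ> h" "a \<in> pw (RI m) n" "z \<in> FilE m"
    "e \<in> FilE (m + 1)" "h1 - id = (a \<circ> z) + e" by blast
  have a0: "a \<in> FilE 0" using h1(4) pw_FilE0[OF RI_FilE[OF m]] by blast
  have e0: "e \<in> FilE m" using h1(6) by (rule E.Fil_monoD) simp
  define x where "x = (a \<circ> z) + e"
  have x: "x \<in> FilE m" unfolding x_def by (intro E.Fil_add FilE_comp0[OF a0 h1(5)] e0)
  have h1x: "h1 = id + x" unfolding x_def h1(7)[symmetric] by simp
  obtain y where y: "y \<in> RI m" "T y - y - x \<in> FilE (m + 1)" using additive_lang[OF m O x] by blast
  have y0: "y \<in> FilE 0" using y(1) RI_FilE[OF m] by blast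
  have "T y = (T y - y - x) + (y + x)" by simp
  also have "\<dots> \<in> FilE 0"
    by (intro E.Fil_add y0 FilEm_0[OF m x] E.Fil_monoD[OF y(2)]) (use m in simp)
  finally have "T y \<in> RI m" by (rule RI_T[OF m y(1)])
  hence Tg: "T (id + y) \<in> GLM" unfolding T_add T_id by (rule RI_GLM[OF m])
  obtain h2 u where h2: "h2 \<in> GLM" "h2 \<circ> T (id + y) = (id + y) \<circ> h1" "u \<in> GLM"
    "h2 - id = (((id + y) \<circ> h1) - T (id + y)) \<circ> u"
    by (rule gauge_step[OF h1(1) RI_GLM[OF m y(1)] Tg])
  have u0: "u \<in> FilE 0" by (rule GLM_FilE[OF h2(3)])
  define e' where "e' = ((y \<circ> e) \<circ> u) - ((T y - y - x) \<circ> u)"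
  have "h2 - id = ((y \<circ> x) - (T y - y - x)) \<circ> u"
    unfolding h2(4) h1x gauge_expand[OF FilE_End[OF y0]] ..
  also have "\<dots> = ((y \<circ> a) \<circ> (z \<circ> u)) + e'"
    unfolding e'_def diff_comp by (simp add: x_def comp_add[OF FilE_End[OF y0]] add_comp comp_assoc)
  finally have eq: "h2 - id = ((y \<circ> a) \<circ> (z \<circ> u)) + e'" .
  have "e' \<in> FilE (m + 1)" unfolding e'_def
    by (intro E.Fil_diff FilE_comp0'[OF FilE_comp0[OF y0 h1(6)] u0] FilE_comp0'[OF y(2) u0])
  moreover have "z \<circ> u \<in> FilE m" by (rule FilE_comp0'[OF h1(5) u0])
  moreover have "y \<circ> a \<in> pw (RI m) (Suc n)" by (rule pw_SucI[OF y(1) h1(4)])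
  moreover have "(id + y) \<circ> g \<in> GLM" by (rule GLM_comp[OF RI_GLM[OF m y(1)] h1(2)])
  ultimately show ?case using eq h2(1) gauge_trans[OF h2(2) h1(3)] by blast
qed

lemma gauge_first:
  assumes h: "h \<in> GLM" and hm: "h - id \<in> FilE m"
  shows "\<exists>h1\<in>GLM. \<exists>g\<in>GLM. h1 \<circ> T g = g \<circ> h \<and> h1 - id \<in> FilE (m + 1)"
proof -
  obtain N where N: "pw (RI m) N \<subseteq> FilE 1" using RI_nilpotent[OF m] by blast
  from gauge_first_aux[OF assms, of N] obtain h1 g a z e where h1: "h1 \<in> GLM" "g \<in> GLM" "h1 \<circ> T g = g \<circ> h" "a \<in> pw (RI m) N" "z \<in> FilE m"
    "e \<in> FilE (m + 1)" "h1 - id = (a \<circ> z) + e" by blast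
  have "a \<circ> z \<in> FilE (1 + m)" by (rule FilE_comp) (use h1 N in auto)
  hence "h1 - id \<in> FilE (m + 1)" unfolding h1(7) by (intro E.Fil_add h1(6)) (simp add: add.commute)
  thus ?thesis using h1 by blast
qed

text \<open>Beyond level m the linear solution is shifted by \<epsilon>^j with j \<ge> 1. The
  quadratic term then lies in \<open>FilE (m + 2 * j)\<close>, so a single round suffices and g is
  close to 1, as convergence requires.\<close>

lemma gauge_next:
  assumes h: "h \<in> GLM" and hm: "h - id \<in> FilE (m + j)" and j: "j \<ge> 1"
  shows "\<exists>h1\<in>GLM. \<exists>g\<in>GLM. h1 \<circ> T g = g \<circ> h \<and> h1 - id \<in> FilE (m + j + 1) \<and> g - id \<in> FilE j"
proof -
  define x where "x = h - id"
  have x: "x \<in> FilE (m + j)" unfolding x_def by (rule hm)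
  have hx: "h = id + x" unfolding x_def by simp
  have "E.sh (- j) x \<in> FilE m" using x by (simp add: E.Fil_shift_iff)
  then obtain y' where y': "y' \<in> RI m" "T y' - y' - E.sh (- j) x \<in> FilE (m + 1)" using additive_lang[OF m O] by blast
  define y where "y = E.sh j y'"
  have y: "y \<in> FilE j" unfolding y_def E.Fil_shift_iff using y'(1) RI_FilE[OF m] by auto
  have "E.sh j (T y' - y' - E.sh (- j) x) \<in> FilE (m + 1 + j)" by (rule E.Fil_shift[OF y'(2)])
  hence Ty: "T y - y - x \<in> FilE (m + j + 1)" unfolding y_def T_sh E.sh_diff by (simp add: algebra_simps)
  have yE: "y \<in> End_space" by (rule FilE_End[OF y])
  have "T y = (T y - y - x) + (y + x)" by simp
  also have "\<dots> \<in> FilE j"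
    by (intro E.Fil_add y E.Fil_monoD[OF x] E.Fil_monoD[OF Ty]) (use m j in simp_all)
  finally have Tyj: "T y \<in> FilE j" .
  have one: "id + f \<in> GLM" if "f \<in> FilE j" for f
  proof -
    have "- f \<in> FilE 1" by (rule E.Fil_monoD[OF E.Fil_neg[OF that] j])
    from GLM_one_minus[OF this] show ?thesis by simp
  qed
  have Tg: "T (id + y) \<in> GLM" unfolding T_add T_id by (rule one[OF Tyj])
  obtain h2 u where h2: "h2 \<in> GLM" "h2 \<circ> T (id + y) = (id + y) \<circ> h" "u \<in> GLM"
    "h2 - id = (((id + y) \<circ> h) - T (id + y)) \<circ> u"
    by (rule gauge_step[OF h one[OF y] Tg])
  have u0: "u \<in> FilE 0" by (rule GLM_FilE[OF h2(3)])
  have yx: "y \<circ> x \<in> FilE (m + j + 1)" by (rule E.Fil_monoD[OF FilE_comp[OF y x]]) (use j in simp)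
  have "((y \<circ> x) - (T y - y - x)) \<circ> u \<in> FilE (m + j + 1)"
    by (intro FilE_comp0'[OF _ u0] E.Fil_diff yx Ty)
  hence "h2 - id \<in> FilE (m + j + 1)" unfolding h2(4) hx gauge_expand[OF yE] .
  moreover have "(id + y) - id \<in> FilE j" using y by simp
  ultimately show ?thesis using h2(1,2) one[OF y] by blast
qed

lemma level_implies_iso_prop: "iso_prop m"
  unfolding iso_prop_def
proof (intro ballI impI)
  fix h0 assume h0: "h0 \<in> GLM" "h0 - id \<in> FilE m"
  define P where "P n hG \<longleftrightarrow> fst hG \<in> GLM \<and> snd hG \<in> GLM \<and> fst hG \<circ> T (snd hG) = snd hG \<circ> h0 \<and>
    fst hG - id \<in> FilE (m + int n + 1)" for n :: nat and hG
  have "\<exists>f. \<forall>n. P n (f n) \<and> snd (f (Suc n)) - snd (f n) \<in> FilE (int n + 1)"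
  proof (rule dependent_nat_choice)
    from gauge_first[OF h0] obtain h1 g where "h1 \<in> GLM" "g \<in> GLM" "h1 \<circ> T g = g \<circ> h0" "h1 - id \<in> FilE (m + 1)" by blast
    hence "P 0 (h1, g)" unfolding P_def by simp
    thus "\<exists>hG. P 0 hG" ..
  next
    fix hG n assume "P n hG"
    hence hG: "fst hG \<in> GLM" "snd hG \<in> GLM" "fst hG \<circ> T (snd hG) = snd hG \<circ> h0" "fst hG - id \<in> FilE (m + (int n + 1))"
      unfolding P_def by (simp_all add: add.assoc)
    from gauge_next[OF hG(1,4)] obtain h1 g where g: "h1 \<in> GLM" "g \<in> GLM" "h1 \<circ> T g = g \<circ> fst hG"
      "h1 - id \<in> FilE (m + (int n + 1) + 1)" "g - id \<in> FilE (int n + 1)" by auto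
    have "P (Suc n) (h1, g \<circ> snd hG)" unfolding P_def
      using g(1,4) GLM_comp[OF g(2) hG(2)] gauge_trans[OF g(3) hG(3)] by (simp add: algebra_simps)
    moreover have "(g - id) \<circ> snd hG \<in> FilE (int n + 1)" by (rule FilE_comp0'[OF g(5) GLM_FilE[OF hG(2)]])
    hence "(g \<circ> snd hG) - snd hG \<in> FilE (int n + 1)" unfolding diff_comp by simp
    ultimately show "\<exists>hG'. P (Suc n) hG' \<and> snd hG' - snd hG \<in> FilE (int n + 1)" by (metis snd_conv)
  qed
  then obtain f where f: "\<forall>n. P n (f n) \<and> snd (f (Suc n)) - snd (f n) \<in> FilE (int n + 1)" ..
  define G where "G n = snd (f n)" for n
  define h where "h n = fst (f n)" for n
  have P: "h n \<in> GLM" "G n \<in> GLM" "h n \<circ> T (G n) = G n \<circ> h0" "h n - id \<in> FilE (m + int n + 1)" for n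
    using f unfolding P_def h_def G_def by blast+
  have "\<exists>w. \<forall>n. w - G (Suc n) \<in> FilE (int n)"
  proof (rule E.Fil_complete)
    fix n
    have "G (Suc (Suc n)) - G (Suc n) \<in> FilE (int (Suc n) + 1)" unfolding G_def using f by blast
    thus "G (Suc (Suc n)) - G (Suc n) \<in> FilE (int n)" by (rule E.Fil_monoD) simp
  qed
  then obtain w where w: "w - G (Suc n) \<in> FilE (int n)" for n by blast
  \<comment> \<open>Index 2 is where the limit is known up to \<open>FilE 1\<close>; this writes w
    as G 2 times the unit 1 - G' (G 2 - w).\<close>
  have wG: "w - G 2 \<in> FilE 1" using w[of 1] by (simp add: numeral_2_eq_2)
  have wE: "w \<in> FilE 0" using E.Fil_add[OF E.Fil_monoD[OF wG] GLM_FilE[OF P(2)[of 2]]] by simp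
  obtain G' where G': "G' \<in> GLM" "G 2 \<circ> G' = id" "G' \<circ> G 2 = id" by (rule GLM_inv[OF P(2)])
  have "G' \<circ> (G 2 - w) \<in> FilE 1" using E.Fil_neg[OF wG] by (intro FilE_comp0 GLM_FilE G') simp
  hence "id - (G' \<circ> (G 2 - w)) \<in> GLM" by (rule GLM_one_minus)
  hence "G 2 \<circ> (id - (G' \<circ> (G 2 - w))) \<in> GLM" by (rule GLM_comp[OF P(2)])
  moreover have "G 2 \<circ> (id - (G' \<circ> (G 2 - w))) = w"
    unfolding comp_diff[OF GLM_End[OF P(2)]] comp_assoc[symmetric] G'(2) by simp
  ultimately have wGL: "w \<in> GLM" by simp
  have "T w - (w \<circ> h0) \<in> FilE n" for n
  proof -
    \<comment> \<open>Leaves room for the loss cT of T in the error terms.\<close>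
    define k where "k = nat (n + cT)"
    have k: "n \<le> int k - cT" "int k \<ge> 0" unfolding k_def by simp_all
    let ?G = "G (Suc k)"
    have "T (w - ?G) \<in> FilE (int k - cT)" by (rule T_FilE[OF w])
    hence 1: "T (w - ?G) \<in> FilE n" by (rule E.Fil_monoD[OF _ k(1)])
    have kn: "n \<le> int k" using k(1) cT(1) by simp
    have 2: "(w - ?G) \<circ> h0 \<in> FilE n"
      by (rule E.Fil_monoD[OF FilE_comp0'[OF w GLM_FilE[OF h0(1)]] kn])
    have "T ?G \<in> FilE (0 - cT)" by (rule T_FilE[OF GLM_FilE[OF P(2)]])
    hence "(h (Suc k) - id) \<circ> T ?G \<in> FilE (m + int (Suc k) + 1 + (0 - cT))" by (rule FilE_comp[OF P(4)])
    hence 3: "(h (Suc k) - id) \<circ> T ?G \<in> FilE n" by (rule E.Fil_monoD) (use k m in simp)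
    have "T w - (w \<circ> h0) = T (w - ?G) - ((w - ?G) \<circ> h0) - ((h (Suc k) - id) \<circ> T ?G)"
      unfolding T_diff diff_comp P(3) by simp
    also have "\<dots> \<in> FilE n" by (intro E.Fil_diff 1 2 3)
    finally show ?thesis .
  qed
  hence "T w - (w \<circ> h0) = 0" by (rule E.Fil_sep)
  thus "\<exists>g\<in>GLM. T g = g \<circ> h0" using wGL by (intro bexI[of _ w]) simp_all
qed

end

end

section \<open>Necessity of the level torsion\<close>

lemma sum_lessThan_split: "(\<Sum>n<a + b. f n) = (\<Sum>n<a. f n) + (\<Sum>n<b. f (a + n))" for f :: "nat \<Rightarrow> 'a::comm_monoid_add"
  by (induction b) (simp_all add: add.assoc)

section \<open>Scalars under iteration, and coboundaries of slope zero\<close>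

context crystal
begin

lemma T_pow_ks: "(T ^^ i) (E.ks a f) = E.ks (a ^ (q ^ i)) ((T ^^ i) f)"
proof (induction i)
  case (Suc i)
  have "(T ^^ Suc i) (E.ks a f) = T ((T ^^ i) (E.ks a f))" by (simp add: comp_apply)
  also have "\<dots> = E.ks ((a ^ (q ^ i)) ^ q) (T ((T ^^ i) f))" unfolding Suc T_ks ..
  also have "(a ^ (q ^ i)) ^ q = a ^ (q ^ Suc i)" unfolding power_mult[symmetric] by (simp add: mult.commute)
  finally show ?case by (simp add: comp_apply)
qed simp

text \<open>T' takes q-th roots of scalars; starting from the exponent q ^ i, up to i roots can be
  taken while staying among powers of b.\<close>

lemma T'_pow_ks: "j \<le> i \<Longrightarrow> (T' ^^ j) (E.ks (b ^ (q ^ i)) f) = E.ks (b ^ (q ^ (i - j))) ((T' ^^ j) f)"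
proof -
  assume j: "j \<le> i"
  have "(b ^ (q ^ (i - j))) ^ (q ^ j) = b ^ (q ^ i)"
    unfolding power_mult[symmetric] power_add[symmetric] using j by simp
  hence "(T ^^ j) (E.ks (b ^ (q ^ (i - j))) ((T' ^^ j) f)) = E.ks (b ^ (q ^ i)) f" unfolding T_pow_ks by simp
  thus ?thesis by (metis T'_pow_T_pow)
qed

lemma PR_ks: "PR R (E.ks a f) = E.ks a (PR R f)" unfolding E.ks_def by (rule PR_end_scale)

lemma VR_k: "E.k.subspace (VR R)" by (rule E.subspace_k[OF VR_subspace])

lemma k_subspace_T_image:
  assumes "E.k.subspace Q" shows "E.k.subspace (T ` Q)"
proof (rule E.k.subspaceI)
  show "0 \<in> T ` Q" using E.k.subspace_0[OF assms] T_0 by (metis imageI)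
  fix x y assume "x \<in> T ` Q" "y \<in> T ` Q"
  then obtain u v where "u \<in> Q" "v \<in> Q" "x = T u" "y = T v" by blast
  thus "x + y \<in> T ` Q" using E.k.subspace_add[OF assms] T_add by (metis imageI)
next
  fix a :: 'k and x assume "x \<in> T ` Q"
  then obtain u where u: "u \<in> Q" "x = T u" by blast
  obtain b where "b ^ q = a" using frob_root[OF q] by blast
  hence "E.ks a x = T (E.ks b u)" unfolding u(2) T_ks by simp
  thus "E.ks a x \<in> T ` Q" using E.k.subspace_scale[OF assms u(1)] by (metis imageI)
qed

lemma k_subspace_T_pow_image:
  "E.k.subspace Q \<Longrightarrow> E.k.subspace ((T ^^ i) ` Q)"
proof (induction i)
  case (Suc i)
  have "(T ^^ Suc i) ` Q = T ` ((T ^^ i) ` Q)" by (simp add: image_comp)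
  thus ?case using k_subspace_T_image[OF Suc.IH[OF Suc.prems]] by simp
qed simp

definition QZ :: "nat \<Rightarrow> ('v \<Rightarrow> 'v) set" where "QZ i = {f \<in> VZ. \<forall>j\<le>i. (T ^^ j) f \<in> FilE 0}"

lemma QZ_subspace: "E.k.subspace (QZ i)"
proof (rule E.k.subspaceI)
  show "0 \<in> QZ i" unfolding QZ_def by (simp add: VR_0)
  fix x y assume "x \<in> QZ i" "y \<in> QZ i"
  thus "x + y \<in> QZ i" unfolding QZ_def by (simp add: VR_add T_pow_add E.Fil_add)
next
  fix a x assume "x \<in> QZ i"
  thus "E.ks a x \<in> QZ i" unfolding QZ_def
    by (simp add: E.k.subspace_scale[OF VR_k] T_pow_ks E.Fil_ks)
qed

lemma QZ_FilE: "f \<in> QZ i \<Longrightarrow> f \<in> FilE 0"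
proof -
  assume "f \<in> QZ i"
  hence "\<forall>j\<le>i. (T ^^ j) f \<in> FilE 0" unfolding QZ_def by blast
  from this[rule_format, of 0] show ?thesis by simp
qed

lemma QZ_VZ: "f \<in> QZ i \<Longrightarrow> f \<in> VZ" unfolding QZ_def by blast

lemma QZ_0I: "f \<in> FilE 0 \<Longrightarrow> f \<in> VZ \<Longrightarrow> f \<in> QZ 0" unfolding QZ_def by simp

lemma QZ_Suc: "f \<in> QZ i \<Longrightarrow> T f \<in> QZ i \<Longrightarrow> f \<in> QZ (Suc i)"
proof -
  assume f: "f \<in> QZ i" "T f \<in> QZ i"
  have "(T ^^ j) f \<in> FilE 0" if "j \<le> Suc i" for j
  proof (cases j)
    case 0 thus ?thesis using f(1) unfolding QZ_def by auto
  next
    case (Suc j')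
    hence "(T ^^ j') (T f) \<in> FilE 0" using f(2) that unfolding QZ_def by simp
    thus ?thesis unfolding Suc by (simp add: funpow_Suc_right comp_apply del: funpow.simps)
  qed
  thus ?thesis using f(1) unfolding QZ_def by blast
qed

text \<open>The decreasing QZ i become stationary, and the limit is T-stable. Its images under T^n
  become stationary too, and injectivity of T makes T surjective on the limit. Hence it is T'-stable
  as well and equals OZ.\<close>

lemma QZ_stable: "\<exists>n0. QZ n0 = OZ"
proof -
  obtain c where c: "c \<ge> 0"
    and cZ: "\<And>i f. f \<in> FilE 0 \<Longrightarrow> (T ^^ i) (PZ f) \<in> FilE (- c)" and cZ': "\<And>i f. f \<in> FilE 0 \<Longrightarrow> (T' ^^ i) (PZ f) \<in> FilE (- c)"
    by (rule growth) blast
  have sh: "(T ^^ i) f \<in> FilE (n - c)" "(T' ^^ i) f \<in> FilE (n - c)" if "f \<in> FilE n" "f \<in> VZ" for f i n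
  proof -
    define g where "g = E.sh (- n) f"
    have g: "g \<in> FilE 0" unfolding g_def using that by (simp add: E.Fil_shift_iff)
    have gV: "PZ g = g" unfolding g_def PR_sh VR_PR[OF that(2)] ..
    have f: "f = E.sh n g" unfolding g_def by simp
    show "(T ^^ i) f \<in> FilE (n - c)" "(T' ^^ i) f \<in> FilE (n - c)"
      unfolding f T_pow_sh T'_pow_sh E.Fil_shift_iff using cZ[OF g, of i] cZ'[OF g, of i] unfolding gV by simp_all
  qed
  \<comment> \<open>One c pays for going back by T'^n, the other for coming forward by T^j; this
    bounds both chains from below.\<close>
  have art: "E.k.artinian_between (FilE (2 * c) \<inter> VZ) (FilE 0 \<inter> VZ)"
    by (rule E.k.artinian_restrict[OF E.Fil_artinian[of 0 "2 * c"] E.Fil_k E.Fil_k])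
      (use c E.Fil_mono[of 0 "2 * c"] in \<open>auto intro: E.k.subspace_inter E.Fil_k VR_k\<close>)
  have "\<exists>n0. \<forall>n\<ge>n0. QZ n = QZ n0"
  proof (rule E.k.artinian_decreasing[OF art QZ_subspace])
    fix n
    show "FilE (2 * c) \<inter> VZ \<subseteq> QZ n"
    proof
      fix f assume f: "f \<in> FilE (2 * c) \<inter> VZ"
      have "(T ^^ j) f \<in> FilE 0" for j by (rule E.Fil_monoD[OF sh(1)[of f "2 * c"]]) (use f c in auto)
      thus "f \<in> QZ n" using f unfolding QZ_def by blast
    qed
    show "QZ n \<subseteq> FilE 0 \<inter> VZ" using QZ_FilE QZ_VZ by blast
    show "QZ (Suc n) \<subseteq> QZ n" unfolding QZ_def by auto
  qed
  then obtain n0 where n0: "\<forall>n\<ge>n0. QZ n = QZ n0" ..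
  have Qall: "(T ^^ j) f \<in> FilE 0" if "f \<in> QZ n0" for f j
  proof -
    have "f \<in> QZ (n0 + j)" using n0[rule_format, of "n0 + j"] that by simp
    thus ?thesis unfolding QZ_def by simp
  qed
  have QVZ: "f \<in> VZ" if "f \<in> QZ n0" for f using that unfolding QZ_def by blast
  have QI: "f \<in> QZ n0" if "f \<in> VZ" "\<And>j. (T ^^ j) f \<in> FilE 0" for f using that unfolding QZ_def by blast
  have TQ: "T f \<in> QZ n0" if f: "f \<in> QZ n0" for f
  proof (rule QI)
    show "T f \<in> VZ" by (rule VR_T[OF QVZ[OF f]])
    fix j
    show "(T ^^ j) (T f) \<in> FilE 0" using Qall[OF f, of "Suc j"] by (simp add: funpow_Suc_right comp_apply del: funpow.simps)
  qed
  have TQj: "(T ^^ j) f \<in> QZ n0" if f: "f \<in> QZ n0" for f j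
    using f by (induction j) (simp_all add: TQ comp_apply)
  have "\<exists>n1. \<forall>n\<ge>n1. (T ^^ n) ` QZ n0 = (T ^^ n1) ` QZ n0"
  proof (rule E.k.artinian_decreasing[OF art k_subspace_T_pow_image[OF QZ_subspace]])
    fix n
    show "FilE (2 * c) \<inter> VZ \<subseteq> (T ^^ n) ` QZ n0"
    proof
      fix f assume f: "f \<in> FilE (2 * c) \<inter> VZ"
      define g where "g = (T' ^^ n) f"
      have g: "g \<in> FilE c" unfolding g_def by (rule E.Fil_monoD[OF sh(2)[of f "2 * c"]]) (use f c in auto)
      have gV: "g \<in> VZ" unfolding g_def using f by (induction n) (auto simp: comp_apply intro: VR_T')
      have "(T ^^ j) g \<in> FilE 0" for j using sh(1)[OF g gV, of j] by simp
      hence "g \<in> QZ n0" by (rule QI[OF gV])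
      moreover have "f = (T ^^ n) g" unfolding g_def by simp
      ultimately show "f \<in> (T ^^ n) ` QZ n0" by blast
    qed
    show "(T ^^ n) ` QZ n0 \<subseteq> FilE 0 \<inter> VZ" using TQj Qall QVZ by blast
    show "(T ^^ Suc n) ` QZ n0 \<subseteq> (T ^^ n) ` QZ n0"
    proof (rule image_subsetI)
      fix f assume "f \<in> QZ n0"
      moreover have "(T ^^ Suc n) f = (T ^^ n) (T f)" by (simp add: funpow_Suc_right comp_apply del: funpow.simps)
      ultimately show "(T ^^ Suc n) f \<in> (T ^^ n) ` QZ n0" using TQ by auto
    qed
  qed
  then obtain n1 where "\<forall>n\<ge>n1. (T ^^ n) ` QZ n0 = (T ^^ n1) ` QZ n0" ..
  hence n1: "(T ^^ Suc n1) ` QZ n0 = (T ^^ n1) ` QZ n0" by (rule allE[of _ "Suc n1"]) simp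
  have T'Q: "T' f \<in> QZ n0" if f: "f \<in> QZ n0" for f
  proof -
    have "(T ^^ n1) f \<in> (T ^^ Suc n1) ` QZ n0" unfolding n1 using f by (rule imageI)
    then obtain g where g: "g \<in> QZ n0" "(T ^^ n1) f = (T ^^ Suc n1) g" by blast
    have "(T ^^ Suc n1) g = (T ^^ n1) (T g)" by (simp add: funpow_Suc_right comp_apply del: funpow.simps)
    hence "(T' ^^ n1) ((T ^^ n1) f) = (T' ^^ n1) ((T ^^ n1) (T g))" using g(2) by simp
    hence "f = T g" by simp
    thus ?thesis using g(1) by simp
  qed
  have "(T' ^^ j) f \<in> QZ n0" if "f \<in> QZ n0" for f j
    using that by (induction j) (simp_all add: T'Q comp_apply)
  hence "(T' ^^ j) f \<in> FilE 0" if "f \<in> QZ n0" for f j using Qall[of _ 0] that by simp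
  hence "QZ n0 \<subseteq> OZ" unfolding OZ_def using Qall QVZ by blast
  moreover have "OZ \<subseteq> QZ n0" unfolding OZ_def QZ_def by blast
  ultimately show ?thesis by blast
qed

lemma OZ_k: "E.k.subspace OZ" by (rule E.int_subspace_k) (simp add: E_int_subspace OZ_int)

lemma OZ_QZ: "OZ \<subseteq> QZ i" unfolding OZ_def QZ_def by blast

text \<open>The Vandermonde argument splits \<open>s n = T (A n) + B n\<close> with \<open>A n\<close>, \<open>B n\<close> in \<open>QZ i\<close>, and subtracting
  \<open>\<Sum> b ^ (q ^ n) A (n + 1)\<close> from \<open>h\<close> moves \<open>h\<close> into \<open>QZ (i + 1)\<close>. Each such step lowers indices by one,
  which is why \<open>s\<close> has to vanish below \<open>d\<close>.\<close>

lemma coboundary_lemma: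
  assumes "QZ n0 = OZ" "i + d = n0" and S: "infinite S"
    and "\<And>n. n < d \<or> n \<ge> K \<Longrightarrow> s n = 0"
    and "\<And>b. b \<in> S \<Longrightarrow> \<exists>h\<in>QZ i. T h - h - (\<Sum>n<K. E.ks (b ^ (q ^ n)) (s n)) \<in> OZ"
  shows "\<exists>t. (\<forall>n. t n \<in> QZ 0) \<and> (\<forall>n\<ge>K. t n = 0) \<and> s 0 + t 0 \<in> OZ \<and>
    (\<forall>n. s (Suc n) - (T (t n) - t (Suc n)) \<in> OZ)"
  using assms(2,4,5)
proof (induction d arbitrary: i s)
  case 0
  \<comment> \<open>At the bottom T h - h itself lies in OZ, so the Vandermonde argument puts every
    s n into OZ and t = 0 works.\<close>
  hence i: "QZ i = OZ" using assms(1) by simp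
  have "(\<Sum>n<K. E.ks (b ^ (q ^ n)) (s n)) \<in> OZ" if b: "b \<in> S" for b
  proof -
    obtain h where h: "h \<in> OZ" "T h - h - (\<Sum>n<K. E.ks (b ^ (q ^ n)) (s n)) \<in> OZ" using 0(3)[OF b] i by blast
    have "(T h - h) - (T h - h - (\<Sum>n<K. E.ks (b ^ (q ^ n)) (s n))) \<in> OZ"
      by (intro E.k.subspace_diff[OF OZ_k] T_OZ h)
    thus ?thesis by simp
  qed
  hence "s n \<in> OZ" if "n < K" for n by (rule E.k.vandermonde_frob_subspace[OF OZ_k S frob_q_gt_1[OF q] _ that])
  hence s: "s n \<in> OZ" for n using 0(2)[of n] E.k.subspace_0[OF OZ_k] by (cases "n < K") auto
  show ?case
    by (rule exI[of _ "\<lambda>_. 0"]) (simp add: s E.k.subspace_0[OF QZ_subspace])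
next
  case (Suc d)
  define U where "U = {x + y |x y. x \<in> T ` QZ i \<and> y \<in> QZ i}"
  have U: "E.k.subspace U" unfolding U_def by (intro E.k.subspace_sums k_subspace_T_image QZ_subspace)
  have "(\<Sum>n<K. E.ks (b ^ (q ^ n)) (s n)) \<in> U" if b: "b \<in> S" for b
  proof -
    obtain h where h: "h \<in> QZ i" "T h - h - (\<Sum>n<K. E.ks (b ^ (q ^ n)) (s n)) \<in> OZ" using Suc.prems(3)[OF b] by blast
    define e where "e = T h - h - (\<Sum>n<K. E.ks (b ^ (q ^ n)) (s n))"
    have "- h - e \<in> QZ i"
      by (intro E.k.subspace_diff[OF QZ_subspace] E.k.subspace_neg[OF QZ_subspace] h) (use h(2) e_def OZ_QZ in blast)
    moreover have "(\<Sum>n<K. E.ks (b ^ (q ^ n)) (s n)) = T h + (- h - e)" unfolding e_def by simp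
    ultimately show ?thesis unfolding U_def using h(1) by blast
  qed
  hence sU: "s n \<in> U" if "n < K" for n by (rule E.k.vandermonde_frob_subspace[OF U S frob_q_gt_1[OF q] _ that])
  have "\<forall>n. \<exists>a b. a \<in> QZ i \<and> b \<in> QZ i \<and> s n = T a + b \<and> (n < Suc d \<or> n \<ge> K \<longrightarrow> a = 0 \<and> b = 0)"
  proof
    fix n
    show "\<exists>a b. a \<in> QZ i \<and> b \<in> QZ i \<and> s n = T a + b \<and> (n < Suc d \<or> n \<ge> K \<longrightarrow> a = 0 \<and> b = 0)"
    proof (cases "n < Suc d \<or> n \<ge> K")
      case True
      thus ?thesis using Suc.prems(2)[OF True] E.k.subspace_0[OF QZ_subspace] by (intro exI[of _ 0]) simp
    next
      case False
      hence "s n \<in> U" by (intro sU) simp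
      thus ?thesis unfolding U_def using False by blast
    qed
  qed
  from choice[OF this] obtain A where "\<forall>n. \<exists>b. A n \<in> QZ i \<and> b \<in> QZ i \<and> s n = T (A n) + b \<and> (n < Suc d \<or> n \<ge> K \<longrightarrow> A n = 0 \<and> b = 0)" by (elim exE)
  from choice[OF this] obtain B where AB: "\<forall>n. A n \<in> QZ i \<and> B n \<in> QZ i \<and> s n = T (A n) + B n \<and> (n < Suc d \<or> n \<ge> K \<longrightarrow> A n = 0 \<and> B n = 0)" by (elim exE)
  have A: "A n \<in> QZ i" and B: "B n \<in> QZ i" and s: "s n = T (A n) + B n" for n using AB by blast+
  have AB0: "A n = 0" "B n = 0" if "n < Suc d \<or> n \<ge> K" for n using AB that by blast+
  define s' where "s' n = B n + A (Suc n)" for n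
  have s'Q: "s' n \<in> QZ i" for n unfolding s'_def by (intro E.k.subspace_add[OF QZ_subspace] A B)
  have "\<exists>t. (\<forall>n. t n \<in> QZ 0) \<and> (\<forall>n\<ge>K. t n = 0) \<and> s' 0 + t 0 \<in> OZ \<and>
    (\<forall>n. s' (Suc n) - (T (t n) - t (Suc n)) \<in> OZ)"
  proof (rule Suc.IH[of "Suc i"])
    show "Suc i + d = n0" using Suc.prems(1) by simp
    show "s' n = 0" if "n < d \<or> n \<ge> K" for n
      unfolding s'_def using AB0(2)[of n] AB0(1)[of "Suc n"] that by auto
    fix b assume b: "b \<in> S"
    obtain h where h: "h \<in> QZ i" "T h - h - (\<Sum>n<K. E.ks (b ^ (q ^ n)) (s n)) \<in> OZ" using Suc.prems(3)[OF b] by blast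
    define h' where "h' = h - (\<Sum>n<K. E.ks (b ^ (q ^ n)) (A (Suc n)))"
    have h'Q: "h' \<in> QZ i" unfolding h'_def
      by (intro E.k.subspace_diff[OF QZ_subspace] E.k.subspace_sum[OF QZ_subspace] E.k.subspace_scale[OF QZ_subspace] h A)
    have "T (\<Sum>n<K. E.ks (b ^ (q ^ n)) (A (Suc n))) = (\<Sum>n<K. E.ks (b ^ (q ^ Suc n)) (T (A (Suc n))))"
      unfolding FT.T_sum T_ks power_mult[symmetric] by (simp add: mult.commute)
    also have "\<dots> = (\<Sum>n<Suc K. E.ks (b ^ (q ^ n)) (T (A n)))"
      unfolding sum.lessThan_Suc_shift using AB0(1)[of 0] by simp
    also have "\<dots> = (\<Sum>n<K. E.ks (b ^ (q ^ n)) (T (A n)))" using AB0(1)[of K] by simp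
    finally have Th': "T h' = T h - (\<Sum>n<K. E.ks (b ^ (q ^ n)) (T (A n)))" unfolding h'_def T_diff by simp
    have "T h' - h' - (\<Sum>n<K. E.ks (b ^ (q ^ n)) (s' n)) = T h - h - (\<Sum>n<K. E.ks (b ^ (q ^ n)) (s n))"
      unfolding Th' unfolding h'_def s s'_def E.k.scale_right_distrib sum.distrib by (simp add: algebra_simps)
    hence e: "T h' - h' - (\<Sum>n<K. E.ks (b ^ (q ^ n)) (s' n)) \<in> OZ" using h(2) by simp
    \<comment> \<open>The equation now exhibits T h' as an element of QZ i, and integrality of one
      further iterate is what membership in QZ (i + 1) asks for.\<close>
    hence "T h' - h' - (\<Sum>n<K. E.ks (b ^ (q ^ n)) (s' n)) \<in> QZ i" using OZ_QZ by blast
    hence "(T h' - h' - (\<Sum>n<K. E.ks (b ^ (q ^ n)) (s' n))) + h' + (\<Sum>n<K. E.ks (b ^ (q ^ n)) (s' n)) \<in> QZ i"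
      by (intro E.k.subspace_add[OF QZ_subspace] h'Q E.k.subspace_sum[OF QZ_subspace] E.k.subspace_scale[OF QZ_subspace] s'Q)
    hence "T h' \<in> QZ i" by simp
    hence "h' \<in> QZ (Suc i)" by (rule QZ_Suc[OF h'Q])
    thus "\<exists>h\<in>QZ (Suc i). T h - h - (\<Sum>n<K. E.ks (b ^ (q ^ n)) (s' n)) \<in> OZ" using e by blast
  qed
  then obtain t where t: "\<And>n. t n \<in> QZ 0" "\<And>n. n \<ge> K \<Longrightarrow> t n = 0" "s' 0 + t 0 \<in> OZ"
    "\<And>n. s' (Suc n) - (T (t n) - t (Suc n)) \<in> OZ" by blast
  have A0: "A n \<in> QZ 0" for n by (rule QZ_0I[OF QZ_FilE[OF A] QZ_VZ[OF A]])
  have "s 0 + (t 0 + A (Suc 0)) \<in> OZ"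
    using t(3) AB0(1)[of 0] by (simp add: s s'_def algebra_simps)
  moreover have "s (Suc n) - (T (t n + A (Suc n)) - (t (Suc n) + A (Suc (Suc n)))) \<in> OZ" for n
  proof -
    have eq: "s (Suc n) - (T (t n + A (Suc n)) - (t (Suc n) + A (Suc (Suc n)))) = s' (Suc n) - (T (t n) - t (Suc n))"
      unfolding s s'_def T_add by (simp add: algebra_simps)
    show ?thesis unfolding eq by (rule t(4))
  qed
  moreover have "t n + A (Suc n) \<in> QZ 0" for n by (intro E.k.subspace_add[OF QZ_subspace] t A0)
  moreover have "t n + A (Suc n) = 0" if "n \<ge> K" for n using t(2) AB0(1)[of "Suc n"] that by simp
  ultimately show ?case by (intro exI[of _ "\<lambda>n. t n + A (Suc n)"] conjI allI impI)
qed

text \<open>Unrolling y = T y - x gives a partial sum of the formal solution and a remainder, which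
  becomes small on V_+.\<close>

lemma telescope_plus:
  assumes "T y - y = x" shows "y = (T ^^ J) y - (\<Sum>j<J. (T ^^ j) x)"
proof (induction J)
  case (Suc J)
  have Ty: "T y = x + y" using assms by (simp add: diff_eq_eq)
  have "(T ^^ Suc J) y = (T ^^ J) (T y)" unfolding funpow_Suc_right comp_apply ..
  also have "\<dots> = (T ^^ J) x + (T ^^ J) y" unfolding Ty by (rule T_pow_add)
  finally have "(T ^^ Suc J) y - (\<Sum>j<Suc J. (T ^^ j) x) = (T ^^ J) y - (\<Sum>j<J. (T ^^ j) x)" by simp
  from trans[OF Suc this[symmetric]] show ?case .
qed simp

lemma telescope_minus:
  assumes "T y - y = x" shows "y = (T' ^^ J) y + (\<Sum>j<J. (T' ^^ Suc j) x)"
proof (induction J)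
  case (Suc J)
  have "T' (T y - y) = y - T' y" unfolding T'_diff by simp
  hence y: "y = T' y + T' x" unfolding assms by simp
  have "(T' ^^ J) y = (T' ^^ J) (T' y + T' x)" using y by (rule arg_cong)
  also have "\<dots> = (T' ^^ Suc J) y + (T' ^^ Suc J) x" unfolding T'_pow_add funpow_Suc_right comp_apply ..
  finally have "(T' ^^ Suc J) y + (\<Sum>j<Suc J. (T' ^^ Suc j) x) = (T' ^^ J) y + (\<Sum>j<J. (T' ^^ Suc j) x)"
    by (simp add: add.commute add.left_commute del: funpow.simps)
  from trans[OF Suc this[symmetric]] show ?case .
qed simp

end

context linear_space
begin

text \<open>A greedy choice of a basis modulo R among the elements of X itself. X is an arbitrary
  subset because the application is to \<open>DD m\<close>, which is cut out by a condition that is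
  not k-linear.\<close>

lemma artinian_maximal_independent:
  assumes art: "artinian_between R F" and R: "subspace R" "R \<subseteq> F" and F: "subspace F" and X: "X \<subseteq> F"
  obtains d :: nat and y where "\<And>i. i < d \<Longrightarrow> y i \<in> X"
    "\<And>x. x \<in> X \<Longrightarrow> \<exists>c. x - (\<Sum>i<d. scale (c i) (y i)) \<in> R"
    "\<And>a i. (\<Sum>i<d. scale (a i) (y i)) \<in> R \<Longrightarrow> i < d \<Longrightarrow> a i = 0"
proof -
  define good where "good S x \<longleftrightarrow> x \<in> X \<and> (\<forall>w\<in>span S. x - w \<notin> R)" for S x
  \<comment> \<open>The value 0 when nothing is left to pick keeps the sequence total; independence
    of the first d terms shows that it does not occur among them.\<close>
  define pick where "pick S = (if \<exists>x. good S x then SOME x. good S x else 0)" for S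
  define Y where "Y = rec_nat {} (\<lambda>_ S. insert (pick S) S)"
  have Y: "Y 0 = {}" "Y (Suc n) = insert (pick (Y n)) (Y n)" for n unfolding Y_def by simp_all
  define y where "y n = pick (Y n)" for n
  have Yy: "Y n = y ` {..<n}" for n by (induction n) (simp_all add: Y y_def lessThan_Suc)
  have pick: "good S (pick S)" if "\<exists>x. good S x" for S unfolding pick_def using that someI_ex[OF that] by simp
  have yF: "y i \<in> F" for i
  proof (cases "\<exists>x. good (Y i) x")
    case True
    from pick[OF this] show ?thesis unfolding y_def good_def using X by blast
  next
    case False
    show ?thesis unfolding y_def pick_def if_not_P[OF False] by (rule subspace_0[OF F])
  qed
  obtain d c where dep: "y d - (\<Sum>i<d. scale (c i) (y i)) \<in> R"
    and ind: "\<And>a i. (\<Sum>i<d. scale (a i) (y i)) \<in> R \<Longrightarrow> i < d \<Longrightarrow> a i = 0"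
    by (rule artinian_dependence[OF art R F yF]) (rule that)
  have notgood: "\<not> (\<exists>x. good (Y d) x)"
  proof
    assume "\<exists>x. good (Y d) x"
    from pick[OF this] have "\<forall>w\<in>span (Y d). y d - w \<notin> R" unfolding good_def y_def by blast
    moreover have "(\<Sum>i<d. scale (c i) (y i)) \<in> span (Y d)" unfolding Yy by (intro span_sum span_scale span_base) auto
    ultimately show False using dep by blast
  qed
  show thesis
  proof (rule that[of d y])
    fix i assume i: "i < d"
    have "\<exists>x. good (Y i) x"
    proof (rule ccontr)
      assume no: "\<not> (\<exists>x. good (Y i) x)"
      have "y i = 0" unfolding y_def pick_def if_not_P[OF no] ..
      hence "(\<Sum>j<d. scale (if j = i then 1 else 0) (y j)) = 0" by (intro sum.neutral) auto
      hence "(\<Sum>j<d. scale (if j = i then 1 else 0) (y j)) \<in> R" using subspace_0[OF R(1)] by simp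
      from ind[OF this i] show False by simp
    qed
    from pick[OF this] show "y i \<in> X" unfolding y_def good_def by blast
  next
    fix x assume "x \<in> X"
    then obtain w where w: "w \<in> span (Y d)" "x - w \<in> R" using notgood unfolding good_def by blast
    obtain c where "w = (\<Sum>i<d. scale (c i) (y i))" using span_lessThan_sum[of w y d] w(1) unfolding Yy by blast
    thus "\<exists>c. x - (\<Sum>i<d. scale (c i) (y i)) \<in> R" using w(2) by blast
  next
    fix a i assume "(\<Sum>i<d. scale (a i) (y i)) \<in> R" "i < d"
    thus "a i = 0" by (rule ind)
  qed
qed

end

section \<open>Finiteness of the solutions, and the pigeonhole argument\<close>

context crystal
begin

lemma ks_comp: "(E.ks a f) \<circ> g = E.ks a (f \<circ> g)"
  by (simp add: E.ks_def end_scale_def fun_eq_iff comp_apply)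
lemma comp_ks: "f \<in> End_space \<Longrightarrow> f \<circ> (E.ks a g) = E.ks a (f \<circ> g)"
  by (simp add: E.ks_def end_scale_def fun_eq_iff comp_apply End_scale_apply)

context
  fixes m :: int
  assumes m: "m \<ge> 1"
begin

text \<open>T fixes x and the chosen y i modulo \<open>FilE m\<close> but raises coordinates to the
  q-th power. Independence modulo \<open>RI m\<close> therefore forces c^q = c, which leaves
  finitely many combinations.\<close>

lemma DD_finite: "\<exists>F. finite F \<and> (\<forall>y\<in>DD m. \<exists>f\<in>F. y - f \<in> RI m)"
proof -
  have X: "DD m \<subseteq> FilE 0" unfolding DD_def by blast
  obtain d :: nat and y where y: "\<And>i. i < d \<Longrightarrow> y i \<in> DD m"
    and sp: "\<And>x. x \<in> DD m \<Longrightarrow> \<exists>c. x - (\<Sum>i<d. E.ks (c i) (y i)) \<in> RI m"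
    and ind: "\<And>a i. (\<Sum>i<d. E.ks (a i) (y i)) \<in> RI m \<Longrightarrow> i < d \<Longrightarrow> a i = 0"
    by (rule E.k.artinian_maximal_independent[OF RI_artinian[OF m] RI_subspace[OF m] RI_FilE[OF m] E.Fil_k X]) (rule that)
  define F where "F = (\<lambda>c. \<Sum>i<d. E.ks (c i) (y i)) ` PiE {..<d} (\<lambda>_. {c. c ^ q = c})"
  have "finite F" unfolding F_def by (intro finite_imageI finite_PiE finite_frob_fixed[OF q]) simp
  moreover have "\<exists>f\<in>F. x - f \<in> RI m" if x: "x \<in> DD m" for x
  proof -
    obtain c where c: "x - (\<Sum>i<d. E.ks (c i) (y i)) \<in> RI m" using sp[OF x] by blast
    define r where "r = x - (\<Sum>i<d. E.ks (c i) (y i))"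
    have r: "r \<in> RI m" unfolding r_def by (rule c)
    have xr: "x = r + (\<Sum>i<d. E.ks (c i) (y i))" unfolding r_def by simp
    have xm: "T x - x \<in> FilE m" "x \<in> FilE 0" using x unfolding DD_def by auto
    have ym: "T (y i) - y i \<in> FilE m" "y i \<in> FilE 0" if "i < d" for i using y[OF that] unfolding DD_def by auto
    have Tx: "T x = T r + (\<Sum>i<d. E.ks (c i ^ q) (T (y i)))" unfolding xr T_add FT.T_sum T_ks ..
    have Ty0: "T (y i) \<in> FilE 0" if "i < d" for i using E.Fil_add[OF FilEm_0[OF m ym(1)] ym(2), OF that that] by simp
    have Tx0: "T x \<in> FilE 0" using E.Fil_add[OF FilEm_0[OF m xm(1)] xm(2)] by simp
    have "T x - (\<Sum>i<d. E.ks (c i ^ q) (T (y i))) \<in> FilE 0" by (intro E.Fil_diff E.Fil_sum E.Fil_ks Tx0 Ty0) simp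
    hence "T r \<in> FilE 0" unfolding Tx by simp
    hence Tr: "T r \<in> RI m" by (rule RI_T[OF m r])
    have "(\<Sum>i<d. E.ks (c i ^ q - c i) (y i)) =
      (T x - x) - (T r - r) - (\<Sum>i<d. E.ks (c i ^ q) (T (y i) - y i))"
      unfolding Tx by (subst xr) (simp add: E.k.scale_left_diff_distrib E.k.scale_right_diff_distrib sum_subtractf algebra_simps)
    also have "\<dots> \<in> RI m"
    proof (rule E.k.subspace_diff[OF RI_subspace[OF m] E.k.subspace_diff[OF RI_subspace[OF m] _
        E.k.subspace_diff[OF RI_subspace[OF m] Tr r]]])
      show "T x - x \<in> RI m" using xm(1) RI_contains[OF m] by blast
      have "(\<Sum>i<d. E.ks (c i ^ q) (T (y i) - y i)) \<in> FilE m" by (intro E.Fil_sum E.Fil_ks ym) simp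
      thus "(\<Sum>i<d. E.ks (c i ^ q) (T (y i) - y i)) \<in> RI m" using RI_contains[OF m] by blast
    qed
    finally have "(\<Sum>i<d. E.ks (c i ^ q - c i) (y i)) \<in> RI m" .
    from ind[OF this] have cq: "c i ^ q = c i" if "i < d" for i using that by simp
    have "(\<Sum>i<d. E.ks (c i) (y i)) = (\<Sum>i<d. E.ks (restrict c {..<d} i) (y i))" by (intro sum.cong) auto
    moreover have "restrict c {..<d} \<in> PiE {..<d} (\<lambda>_. {c. c ^ q = c})" using cq by auto
    ultimately have "(\<Sum>i<d. E.ks (c i) (y i)) \<in> F" unfolding F_def by (simp only: image_eqI)
    thus ?thesis using c by blast
  qed
  ultimately show ?thesis by blast
qed

text \<open>A filtration of \<open>FilE m\<close> by the number of factors from \<open>RI m\<close>,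
  measuring the progress of errors that have not yet reached \<open>FilE (m + 1)\<close>.\<close>

definition ZZ :: "nat \<Rightarrow> ('v \<Rightarrow> 'v) set" where
  "ZZ i = E.k.span {a \<circ> z \<circ> b |a z b i1 i2. a \<in> pw (RI m) i1 \<and> b \<in> pw (RI m) i2 \<and> i1 + i2 = i \<and> z \<in> FilE m}"

lemma pw_RI_FilE: "a \<in> pw (RI m) i \<Longrightarrow> a \<in> FilE 0" using pw_FilE0[OF RI_FilE[OF m]] by blast

lemma ZZ_0: "FilE m \<subseteq> ZZ 0"
proof
  fix z assume z: "z \<in> FilE m"
  have "id \<circ> z \<circ> id \<in> ZZ 0" unfolding ZZ_def
    by (rule E.k.span_base) (use z in \<open>auto intro!: exI[of _ id]\<close>)
  thus "z \<in> ZZ 0" by simp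
qed

lemma ZZ_FilE: "ZZ i \<subseteq> FilE m"
  unfolding ZZ_def
proof (rule E.k.span_minimal[OF _ E.Fil_k], rule subsetI)
  fix x assume "x \<in> {a \<circ> z \<circ> b |a z b i1 i2. a \<in> pw (RI m) i1 \<and> b \<in> pw (RI m) i2 \<and> i1 + i2 = i \<and> z \<in> FilE m}"
  then obtain a z b i1 i2 where x: "x = a \<circ> z \<circ> b" "a \<in> pw (RI m) i1" "b \<in> pw (RI m) i2" "z \<in> FilE m" by blast
  show "x \<in> FilE m" unfolding x(1)
    by (intro FilE_comp0'[OF FilE_comp0] pw_RI_FilE[OF x(2)] pw_RI_FilE[OF x(3)] x(4))
qed

lemma ZZ_left:
  assumes r: "r \<in> RI m" and z: "z \<in> ZZ i" shows "r \<circ> z \<in> ZZ (Suc i)"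
proof -
  have rE: "r \<in> End_space" using r RI_FilE[OF m] FilE_End by blast
  have sub: "E.k.subspace {x. r \<circ> x \<in> ZZ (Suc i)}"
    by (rule E.k.subspaceI)
      (simp_all add: comp_zero[OF rE] comp_add[OF rE] comp_ks[OF rE] ZZ_def E.k.span_zero E.k.span_add E.k.span_scale)
  have "ZZ i \<subseteq> {x. r \<circ> x \<in> ZZ (Suc i)}"
  proof (subst ZZ_def, rule E.k.span_minimal[OF subsetI sub])
    fix x assume "x \<in> {a \<circ> z \<circ> b |a z b i1 i2. a \<in> pw (RI m) i1 \<and> b \<in> pw (RI m) i2 \<and> i1 + i2 = i \<and> z \<in> FilE m}"
    then obtain a z b i1 i2 where x: "x = a \<circ> z \<circ> b" "a \<in> pw (RI m) i1" "b \<in> pw (RI m) i2" "i1 + i2 = i" "z \<in> FilE m" by blast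
    have "r \<circ> x = (r \<circ> a) \<circ> z \<circ> b" unfolding x(1) by (simp add: comp_assoc)
    moreover have "r \<circ> a \<in> pw (RI m) (Suc i1)" by (rule pw_SucI[OF r x(2)])
    moreover have "Suc i1 + i2 = Suc i" using x(4) by simp
    ultimately have "r \<circ> x \<in> ZZ (Suc i)" unfolding ZZ_def using x(3,5) by (intro E.k.span_base) blast
    thus "x \<in> {x. r \<circ> x \<in> ZZ (Suc i)}" by simp
  qed
  thus ?thesis using z by blast
qed

lemma ZZ_right:
  assumes r: "r \<in> RI m" and z: "z \<in> ZZ i" shows "z \<circ> r \<in> ZZ (Suc i)"
proof -
  have sub: "E.k.subspace {x. x \<circ> r \<in> ZZ (Suc i)}"
    by (rule E.k.subspaceI)
      (simp_all add: zero_comp add_comp ks_comp ZZ_def E.k.span_zero E.k.span_add E.k.span_scale)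
  have r1: "r \<in> pw (RI m) 1" using pw_SucI[OF r, of id 0] by simp
  have "ZZ i \<subseteq> {x. x \<circ> r \<in> ZZ (Suc i)}"
  proof (subst ZZ_def, rule E.k.span_minimal[OF subsetI sub])
    fix x assume "x \<in> {a \<circ> z \<circ> b |a z b i1 i2. a \<in> pw (RI m) i1 \<and> b \<in> pw (RI m) i2 \<and> i1 + i2 = i \<and> z \<in> FilE m}"
    then obtain a z b i1 i2 where x: "x = a \<circ> z \<circ> b" "a \<in> pw (RI m) i1" "b \<in> pw (RI m) i2" "i1 + i2 = i" "z \<in> FilE m" by blast
    have "x \<circ> r = a \<circ> z \<circ> (b \<circ> r)" unfolding x(1) by (simp add: comp_assoc)
    moreover have "b \<circ> r \<in> pw (RI m) (i2 + 1)" by (rule pw_add[OF x(3) r1])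
    moreover have "i1 + (i2 + 1) = Suc i" using x(4) by simp
    ultimately have "x \<circ> r \<in> ZZ (Suc i)" unfolding ZZ_def using x(2,5) by (intro E.k.span_base) blast
    thus "x \<in> {x. x \<circ> r \<in> ZZ (Suc i)}" by simp
  qed
  thus ?thesis using z by blast
qed

text \<open>Of N + N factors at least N stand on the same side of z, and these give one power of
  \<epsilon>.\<close>

lemma ZZ_deep: "\<exists>N. ZZ N \<subseteq> FilE (m + 1)"
proof -
  obtain N where N: "pw (RI m) N \<subseteq> FilE 1" using RI_nilpotent[OF m] by blast
  have big: "pw (RI m) i \<subseteq> FilE 1" if "i \<ge> N" for i by (rule pw_eventually[OF RI_FilE[OF m] N that])
  have "ZZ (N + N) \<subseteq> FilE (m + 1)"
    unfolding ZZ_def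
  proof (rule E.k.span_minimal[OF _ E.Fil_k], rule subsetI)
    fix x assume "x \<in> {a \<circ> z \<circ> b |a z b i1 i2. a \<in> pw (RI m) i1 \<and> b \<in> pw (RI m) i2 \<and> i1 + i2 = N + N \<and> z \<in> FilE m}"
    then obtain a z b i1 i2 where x: "x = a \<circ> z \<circ> b" "a \<in> pw (RI m) i1" "b \<in> pw (RI m) i2" "i1 + i2 = N + N" "z \<in> FilE m" by blast
    have a: "a \<in> FilE 0" by (rule pw_RI_FilE[OF x(2)])
    have b: "b \<in> FilE 0" by (rule pw_RI_FilE[OF x(3)])
    show "x \<in> FilE (m + 1)"
    proof (cases "i1 \<ge> N")
      case True
      hence "a \<in> FilE 1" using big x(2) by blast
      hence "a \<circ> z \<circ> b \<in> FilE (1 + m + 0)" by (intro FilE_comp x(5) b)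
      thus ?thesis unfolding x(1) by (simp add: add.commute)
    next
      case False
      hence "b \<in> FilE 1" using big[of i2] x(3,4) by auto
      hence "a \<circ> z \<circ> b \<in> FilE (0 + m + 1)" by (intro FilE_comp x(5) a)
      thus ?thesis unfolding x(1) by simp
    qed
  qed
  thus ?thesis ..
qed

text \<open>The image of T - 1 on integral endomorphisms, up to \<open>FilE (m + 1)\<close>. As T is
  only semilinear, this is treated as an additive group and not as a k-subspace.\<close>

definition Zc :: "('v \<Rightarrow> 'v) set" where "Zc = {u. \<exists>y\<in>FilE 0. T y - y - u \<in> FilE (m + 1)}"

lemma Zc_I: "y \<in> FilE 0 \<Longrightarrow> T y - y - u \<in> FilE (m + 1) \<Longrightarrow> u \<in> Zc" unfolding Zc_def by blast

lemma Zc_add: "u \<in> Zc \<Longrightarrow> v \<in> Zc \<Longrightarrow> u + v \<in> Zc"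
proof -
  assume "u \<in> Zc" "v \<in> Zc"
  then obtain x y where xy: "x \<in> FilE 0" "y \<in> FilE 0" "T x - x - u \<in> FilE (m + 1)" "T y - y - v \<in> FilE (m + 1)" unfolding Zc_def by blast
  have "T (x + y) - (x + y) - (u + v) = (T x - x - u) + (T y - y - v)" by (simp add: T_add algebra_simps)
  also have "\<dots> \<in> FilE (m + 1)" by (rule E.Fil_add[OF xy(3,4)])
  finally show ?thesis by (rule Zc_I[OF E.Fil_add[OF xy(1,2)]])
qed

lemma Zc_neg: "u \<in> Zc \<Longrightarrow> - u \<in> Zc"
proof -
  assume "u \<in> Zc"
  then obtain x where x: "x \<in> FilE 0" "T x - x - u \<in> FilE (m + 1)" unfolding Zc_def by blast
  have "T (- x) - (- x) - (- u) = - (T x - x - u)" by (simp add: T_minus)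
  also have "\<dots> \<in> FilE (m + 1)" by (rule E.Fil_neg[OF x(2)])
  finally show ?thesis by (rule Zc_I[OF E.Fil_neg[OF x(1)]])
qed

context
  assumes ip: "iso_prop m"
begin

text \<open>If \<open>g\<close> and \<open>g0\<close> solve the equation for \<open>z\<close> and \<open>z0\<close> and agree modulo \<open>RI m\<close>, then \<open>g = g0 (1 + y)\<close>
  with \<open>y\<close> in \<open>RI m\<close>, and \<open>z - z0 = (T y - y) + z0 T y - y z\<close>, the last two terms being in \<open>ZZ (Suc i)\<close>.\<close>

lemma ZZ_step: "\<exists>F. finite F \<and> (\<forall>z\<in>ZZ i. \<exists>f\<in>F. \<exists>u\<in>Zc. \<exists>w\<in>ZZ (Suc i). z = f + u + w)"
proof -
  obtain F where F: "finite F" "\<And>y. y \<in> DD m \<Longrightarrow> \<exists>f\<in>F. y - f \<in> RI m" using DD_finite by blast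
  define sol where "sol f z g \<longleftrightarrow> z \<in> ZZ i \<and> g \<in> GLM \<and> T g = g \<circ> (id + z) \<and> g - f \<in> RI m" for f z g
  have ex: "\<exists>f\<in>F. \<exists>g. sol f z g" if z: "z \<in> ZZ i" for z
  proof -
    have zm: "z \<in> FilE m" using ZZ_FilE z by blast
    have "- z \<in> FilE 1" by (rule FilEm_1[OF m E.Fil_neg[OF zm]])
    hence "id - (- z) \<in> GLM" by (rule GLM_one_minus)
    hence "id + z \<in> GLM" by simp
    moreover have "(id + z) - id \<in> FilE m" using zm by simp
    ultimately obtain g where g: "g \<in> GLM" "T g = g \<circ> (id + z)" using ip unfolding iso_prop_def by blast
    have "T g - g = g \<circ> z" unfolding g(2) comp_add[OF GLM_End[OF g(1)]] by simp
    also have "\<dots> \<in> FilE m" by (rule FilE_comp0[OF GLM_FilE[OF g(1)] zm])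
    finally have "g \<in> DD m" unfolding DD_def using GLM_FilE[OF g(1)] by simp
    then obtain f where "f \<in> F" "g - f \<in> RI m" using F(2) by blast
    thus ?thesis using z g unfolding sol_def by blast
  qed
  \<comment> \<open>One representative for each class f of solutions that occurs; their images form
    the finite set sought.\<close>
  define z0 where "z0 f = (SOME z. \<exists>g. sol f z g)" for f
  have "\<exists>u\<in>Zc. \<exists>w\<in>ZZ (Suc i). z = z0 f + u + w" if s: "sol f z g" for f z g
  proof -
    have "\<exists>g. sol f (z0 f) g" unfolding z0_def by (rule someI_ex[of "\<lambda>z. \<exists>g. sol f z g"], intro exI, rule s)
    then obtain g0 where g0: "sol f (z0 f) g0" ..
    let ?t = "z0 f"
    have g: "z \<in> ZZ i" "g \<in> GLM" "T g = g \<circ> (id + z)" "g - f \<in> RI m" using s unfolding sol_def by auto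
    have t: "?t \<in> ZZ i" "g0 \<in> GLM" "T g0 = g0 \<circ> (id + ?t)" "g0 - f \<in> RI m" using g0 unfolding sol_def by auto
    have tm: "?t \<in> FilE m" and zm: "z \<in> FilE m" using ZZ_FilE t(1) g(1) by blast+
    obtain k where k: "k \<in> GLM" "g0 \<circ> k = id" "k \<circ> g0 = id" by (rule GLM_inv[OF t(2)])
    have kE: "k \<in> End_space" by (rule GLM_End[OF k(1)])
    define y where "y = k \<circ> (g - g0)"
    have gy: "g = g0 \<circ> (id + y)"
      unfolding y_def comp_add[OF GLM_End[OF t(2)]] comp_assoc[symmetric] k(2) by simp
    have Tk: "T k \<circ> T g0 = id" unfolding T_comp[symmetric] k(3) by simp
    have "T g0 - g0 = g0 \<circ> ?t" unfolding t(3) comp_add[OF GLM_End[OF t(2)]] by simp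
    have tGL: "id + ?t \<in> GLM" using GLM_one_minus[OF FilEm_1[OF m E.Fil_neg[OF tm]]] by simp
    \<comment> \<open>With j = (1 + t)^-1, the inverse k of g0 satisfies T k = j k, which is
      congruent to k; so k lies in \<open>DD m\<close> and multiplication by k keeps
      \<open>RI m\<close>.\<close>
    obtain j where j: "j \<in> GLM" "(id + ?t) \<circ> j = id" "j \<circ> (id + ?t) = id" by (rule GLM_inv[OF tGL])
    have jE: "j \<in> End_space" by (rule GLM_End[OF j(1)])
    have jm: "j - id = - (j \<circ> ?t)"
    proof -
      have "j + (j \<circ> ?t) = id" using j(3) unfolding comp_add[OF jE] by simp
      thus ?thesis by (metis add_diff_cancel_left' diff_add_cancel minus_diff_eq)
    qed
    have "T k = T k \<circ> ((T g0 \<circ> j) \<circ> k)"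
      unfolding t(3) comp_assoc[of g0] j(2) by (simp add: k(2))
    also have "\<dots> = (T k \<circ> T g0) \<circ> (j \<circ> k)" by (simp add: comp_assoc)
    finally have Tk': "T k = j \<circ> k" unfolding Tk by simp
    have "T k - k = (j - id) \<circ> k" unfolding Tk' diff_comp by simp
    also have "\<dots> = - ((j \<circ> ?t) \<circ> k)" unfolding jm minus_comp ..
    also have "\<dots> \<in> FilE m" by (intro E.Fil_neg FilE_comp0' FilE_comp0 GLM_FilE k j tm)
    finally have kD: "k \<in> DD m" unfolding DD_def using GLM_FilE[OF k(1)] by simp
    have "(g - f) - (g0 - f) \<in> RI m" by (rule E.k.subspace_diff[OF RI_subspace[OF m] g(4) t(4)])
    hence "g - g0 \<in> RI m" by simp
    hence yR: "y \<in> RI m" unfolding y_def by (rule DD_RI(1)[OF m kD])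
    have y0: "y \<in> FilE 0" using yR RI_FilE[OF m] by blast
    have "g0 \<circ> ((id + ?t) \<circ> T (id + y)) = T g" unfolding gy T_comp t(3) by (simp add: comp_assoc)
    also have "\<dots> = g0 \<circ> ((id + y) \<circ> (id + z))" unfolding g(3) by (subst gy) (simp add: comp_assoc)
    finally have "k \<circ> (g0 \<circ> ((id + ?t) \<circ> T (id + y))) = k \<circ> (g0 \<circ> ((id + y) \<circ> (id + z)))" by simp
    hence eq: "(id + ?t) \<circ> T (id + y) = (id + y) \<circ> (id + z)" unfolding comp_assoc[symmetric] k(3) by simp
    have tE: "?t \<in> End_space" by (rule FilE_End[OF tm])
    have yE: "y \<in> End_space" by (rule FilE_End[OF y0])
    have eq2: "id + T y + (?t + (?t \<circ> T y)) = id + z + (y + (y \<circ> z))"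
      using eq unfolding T_add T_id add_comp comp_add[OF tE] comp_add[OF yE] by simp
    have "T y = (j \<circ> ((id + y) \<circ> (id + z))) - id"
    proof -
      have "T (id + y) = j \<circ> ((id + y) \<circ> (id + z))" unfolding eq[symmetric] comp_assoc[symmetric] j(3) by simp
      thus ?thesis unfolding T_add T_id by (metis add_diff_cancel_left')
    qed
    also have "\<dots> \<in> FilE 0"
      by (intro E.Fil_diff FilE_comp0 E.Fil_add FilE_id y0 FilEm_0[OF m zm] GLM_FilE[OF j(1)])
    finally have Ty: "T y \<in> RI m" by (rule RI_T[OF m yR])
    define w where "w = (?t \<circ> T y) - (y \<circ> z)"
    have "w \<in> ZZ (Suc i)" unfolding w_def
      using ZZ_right[OF Ty t(1)] ZZ_left[OF yR g(1)] unfolding ZZ_def by (intro E.k.span_diff)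
    moreover have "z = ?t + (T y - y) + w" unfolding w_def using eq2 by (simp add: algebra_simps)
    moreover have "T y - y \<in> Zc" by (rule Zc_I[OF y0]) simp
    ultimately show ?thesis by blast
  qed
  hence "\<forall>z\<in>ZZ i. \<exists>f\<in>z0 ` F. \<exists>u\<in>Zc. \<exists>w\<in>ZZ (Suc i). z = f + u + w" using ex by blast
  thus ?thesis using F(1) by (intro exI[of _ "z0 ` F"]) simp
qed

text \<open>Beginning with \<open>ZZ 0\<close>, each use of \<open>ZZ_step\<close> passes from
  \<open>ZZ i\<close> to \<open>ZZ (Suc i)\<close> at the cost of finitely many representatives and
  an element of \<open>Zc\<close>, until \<open>ZZ_deep\<close> absorbs the rest.\<close>

lemma FilE_finite_Zc: "\<exists>F. finite F \<and> (\<forall>z\<in>FilE m. \<exists>f\<in>F. z - f \<in> Zc)"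
proof -
  have A: "\<exists>F. finite F \<and> (\<forall>z\<in>FilE m. \<exists>f\<in>F. \<exists>u\<in>Zc. \<exists>w\<in>ZZ i. z = f + u + w)" for i
  proof (induction i)
    case 0
    have "0 \<in> Zc" by (rule Zc_I[of 0]) simp_all
    hence "\<exists>f\<in>{0}. \<exists>u\<in>Zc. \<exists>w\<in>ZZ 0. z = f + u + w" if "z \<in> FilE m" for z
      using subsetD[OF ZZ_0 that] by (intro bexI[of _ 0] bexI[of _ z]) simp_all
    thus ?case by (intro exI[of _ "{0}"] conjI ballI) simp_all
  next
    case (Suc i)
    then obtain F where F: "finite F" "\<And>z. z \<in> FilE m \<Longrightarrow> \<exists>f\<in>F. \<exists>u\<in>Zc. \<exists>w\<in>ZZ i. z = f + u + w" by blast
    obtain G where G: "finite G \<and> (\<forall>z\<in>ZZ i. \<exists>f\<in>G. \<exists>u\<in>Zc. \<exists>w\<in>ZZ (Suc i). z = f + u + w)" using ZZ_step[of i] ..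
    define X where "X = (\<lambda>(f, g). f + g) ` (F \<times> G)"
    have "\<exists>f\<in>X. \<exists>u\<in>Zc. \<exists>w\<in>ZZ (Suc i). z = f + u + w" if zm: "z \<in> FilE m" for z
    proof -
      obtain f u w where 1: "f \<in> F" "u \<in> Zc" "w \<in> ZZ i" "z = f + u + w" using F(2)[OF zm] by blast
      obtain g u' w' where 2: "g \<in> G" "u' \<in> Zc" "w' \<in> ZZ (Suc i)" "w = g + u' + w'" using bspec[OF conjunct2[OF G] 1(3)] by blast
      have "z = (f + g) + (u + u') + w'" unfolding 1(4) 2(4) by (simp add: add.assoc add.left_commute)
      moreover have "f + g \<in> X" unfolding X_def using 1(1) 2(1) by auto
      ultimately show ?thesis using Zc_add[OF 1(2) 2(2)] 2(3) by blast
    qed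
    moreover have "finite X" unfolding X_def using F(1) conjunct1[OF G] by simp
    ultimately show ?case by blast
  qed
  obtain N where N: "ZZ N \<subseteq> FilE (m + 1)" using ZZ_deep ..
  obtain F where F: "finite F \<and> (\<forall>z\<in>FilE m. \<exists>f\<in>F. \<exists>u\<in>Zc. \<exists>w\<in>ZZ N. z = f + u + w)" using A[of N] ..
  have "\<exists>f\<in>F. z - f \<in> Zc" if zm: "z \<in> FilE m" for z
  proof -
    obtain f u w where 1: "f \<in> F" "u \<in> Zc" "w \<in> ZZ N" "z = f + u + w" using bspec[OF conjunct2[OF F] zm] by blast
    have "w \<in> FilE (m + 1)" using 1(3) N by blast
    hence "w \<in> Zc" by (intro Zc_I[of 0]) (simp_all add: E.Fil_neg)
    hence "u + w \<in> Zc" by (rule Zc_add[OF 1(2)])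
    moreover have "z - f = u + w" unfolding 1(4) by (simp add: add.assoc)
    ultimately have "z - f \<in> Zc" by (simp only:)
    thus ?thesis using 1(1) by blast
  qed
  thus ?thesis using conjunct1[OF F] by blast
qed

text \<open>Infinitely many multiples of z fall into one of the finitely many classes; subtracting a
  fixed one of them moves all into \<open>Zc\<close>.\<close>

lemma infinite_Zc_multiples:
  assumes z: "z \<in> FilE m" shows "infinite {a. E.ks a z \<in> Zc}"
proof
  assume fin: "finite {a. E.ks a z \<in> Zc}"
  obtain F where F: "finite F" "\<And>z. z \<in> FilE m \<Longrightarrow> \<exists>f\<in>F. z - f \<in> Zc" using FilE_finite_Zc by blast
  have "\<forall>a\<in>UNIV. \<exists>f\<in>F. E.ks a z - f \<in> Zc" using F(2)[OF E.Fil_ks[OF z]] by blast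
  from pigeonhole_infinite_rel[OF infinite_UNIV_alg_closed F(1) this]
  obtain f where inf: "infinite {a. E.ks a z - f \<in> Zc}" by auto
  then obtain a0 where a0: "E.ks a0 z - f \<in> Zc" using not_finite_existsD by blast
  have "(\<lambda>a. a - a0) ` {a. E.ks a z - f \<in> Zc} \<subseteq> {a. E.ks a z \<in> Zc}"
  proof (rule image_subsetI)
    fix a assume "a \<in> {a. E.ks a z - f \<in> Zc}"
    hence "(E.ks a z - f) + (- (E.ks a0 z - f)) \<in> Zc" by (intro Zc_add Zc_neg a0) simp
    thus "a - a0 \<in> {a. E.ks a z \<in> Zc}" by (simp add: E.k.scale_left_diff_distrib)
  qed
  hence "finite ((\<lambda>a. a - a0) ` {a. E.ks a z - f \<in> Zc})" using fin finite_subset by blast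
  moreover have "inj_on (\<lambda>a. a - a0) {a. E.ks a z - f \<in> Zc}" by (simp add: inj_on_def)
  ultimately show False using inf finite_imageD by blast
qed

end

end

end

lemma group_shuffle:
  fixes p :: "'a::ab_group_add"
  shows "p = t - (a + b) \<Longrightarrow> p + a = t - b" "p = t + (a + b) \<Longrightarrow> p - a = t + b" "p = a + t + b \<Longrightarrow> p - t = a + b"
  by simp_all

section \<open>From infinitely many multiples to membership in O_H\<close>

context crystal
begin

lemma growth_plus: "\<exists>I. \<forall>i\<ge>I. \<forall>f\<in>FilE 0. (T ^^ i) (PP f) \<in> FilE N"
  by (rule growth) blast

text \<open>Growth takes care of all large iterates, leaving finitely many conditions. The iterate
  T'^0 of \<open>PM z\<close> does not occur among them; its integrality follows by subtracting the
  other two components from z.\<close>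

lemma OH_intro:
  assumes J: "\<forall>i\<ge>J. (T ^^ i) (PP z) \<in> FilE 0" "\<forall>i\<ge>J. (T' ^^ i) (PM z) \<in> FilE 0"
    and z: "z \<in> FilE 0" "PZ z \<in> OZ"
    and P: "\<And>j. j < J \<Longrightarrow> (T ^^ j) (PP z) \<in> FilE 0"
    and M: "\<And>j. j < J \<Longrightarrow> (T' ^^ Suc j) (PM z) \<in> FilE 0"
  shows "z \<in> OH"
proof -
  have zE: "z \<in> End_space" by (rule FilE_End[OF z(1)])
  have p: "(T ^^ j) (PP z) \<in> FilE 0" for j using P J(1) by (cases "j < J") auto
  have "PP z \<in> FilE 0" using p[of 0] by simp
  hence "z - PP z - PZ z \<in> FilE 0" by (intro E.Fil_diff z(1) OZ_D(2)[OF z(2)])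
  moreover have "z - PP z - PZ z = PM z" using P_sum[OF zE] by (metis add_diff_cancel_left' diff_diff_add)
  ultimately have m0: "PM z \<in> FilE 0" by simp
  have "(T' ^^ j) (PM z) \<in> FilE 0" for j
  proof (cases j)
    case 0 thus ?thesis using m0 by simp
  next
    case (Suc i)
    show ?thesis
    proof (cases "i < J")
      case True thus ?thesis using M Suc by simp
    next
      case False thus ?thesis using J(2)[rule_format, of j] Suc by simp
    qed
  qed
  thus ?thesis unfolding OH_iff OP_def OM_def using zE z(2) p PR_VR[OF zE] by blast
qed

text \<open>For \<open>T y - y = b ^ (q ^ I) z + e\<close> the components of \<open>y\<close> of nonzero slope are \<open>\<Sum> b ^ (q ^ n) w n\<close> modulo
  \<open>FilE 0\<close>, where the \<open>w n\<close> are the \<open>T'\<^sup>j z\<^sub>-\<close> and the \<open>- T\<^sup>j z\<^sub>+\<close>. As there are infinitely many \<open>b\<close>, every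
  \<open>w n\<close> is integral up to a term \<open>r n\<close> of slope zero, and \<open>r n\<close> is integral by the coboundary lemma.\<close>

lemma OH_from_multiples:
  assumes inf: "infinite S" and z: "z \<in> FilE 0"
    and S: "\<And>a. a \<in> S \<Longrightarrow> \<exists>y\<in>FilE 0. T y - y - E.ks a z \<in> OH"
  shows "z \<in> OH"
proof -
  obtain n0 where n0: "QZ n0 = OZ" using QZ_stable ..
  obtain J1 where J1: "\<forall>i\<ge>J1. \<forall>f\<in>FilE 0. (T ^^ i) (PP f) \<in> FilE 0" using growth_plus[of 0] ..
  obtain J2 where J2: "\<forall>i\<ge>J2. \<forall>f\<in>FilE 0. (T' ^^ i) (PM f) \<in> FilE 0" using growth_minus[of 0] ..
  \<comment> \<open>The successor makes J, and hence I, positive: index I - 1 is used at the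
    end.\<close>
  define J where "J = Suc (max J1 J2)"
  have JP: "(T ^^ i) (PP f) \<in> FilE 0" if "i \<ge> J" "f \<in> FilE 0" for i f using J1 that unfolding J_def by simp
  have JM: "(T' ^^ i) (PM f) \<in> FilE 0" if "i \<ge> J" "f \<in> FilE 0" for i f using J2 that unfolding J_def by simp
  \<comment> \<open>J places for the iterates of z_- under T', preceded by the n0 vanishing places
    that \<open>coboundary_lemma\<close> demands.\<close>
  define I where "I = J + n0"
  define K0 where "K0 = I + J"
  have I1: "I \<ge> 1" unfolding I_def J_def by simp
  define w where "w n = (if n < n0 then 0 else if n < I then (T' ^^ (I - n)) (PM z) else - (T ^^ (n - I)) (PP z))" for n
  define S' where "S' = {b. b ^ (q ^ I) \<in> S}"
  have S': "infinite S'"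
  proof
    assume "finite S'"
    hence "finite ((\<lambda>b. b ^ (q ^ I)) ` S')" by (rule finite_imageI)
    moreover have "S \<subseteq> (\<lambda>b. b ^ (q ^ I)) ` S'"
    proof
      fix a assume a: "a \<in> S"
      obtain b where "b ^ (q ^ I) = a" using frob_pow_root[OF q] by blast
      thus "a \<in> (\<lambda>b. b ^ (q ^ I)) ` S'" unfolding S'_def using a by auto
    qed
    ultimately show False using inf finite_subset by blast
  qed
  have sumw: "(\<Sum>n<K0. E.ks (b ^ (q ^ n)) (w n)) =
    (\<Sum>j<J. (T' ^^ Suc j) (E.ks (b ^ (q ^ I)) (PM z))) - (\<Sum>j<J. (T ^^ j) (E.ks (b ^ (q ^ I)) (PP z)))" for b
  proof -
    define f where "f n = E.ks (b ^ (q ^ n)) (w n)" for n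
    have "(\<Sum>n<I. f n) = (\<Sum>j<I. f (I - Suc j))" by (rule sum.nat_diff_reindex[symmetric])
    also have "\<dots> = (\<Sum>j<J. f (I - Suc j)) + (\<Sum>j<n0. f (I - Suc (J + j)))" unfolding I_def by (rule sum_lessThan_split)
    also have "(\<Sum>j<n0. f (I - Suc (J + j))) = 0"
      by (rule sum.neutral) (auto simp: f_def w_def I_def)
    also have "(\<Sum>j<J. f (I - Suc j)) = (\<Sum>j<J. (T' ^^ Suc j) (E.ks (b ^ (q ^ I)) (PM z)))"
    proof (rule sum.cong[OF refl])
      fix j assume "j \<in> {..<J}"
      hence j: "Suc j \<le> I" "\<not> I - Suc j < n0" "I - Suc j < I" "I - (I - Suc j) = Suc j" unfolding I_def by auto
      have "w (I - Suc j) = (T' ^^ Suc j) (PM z)" unfolding w_def using j(2-4) by simp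
      thus "f (I - Suc j) = (T' ^^ Suc j) (E.ks (b ^ (q ^ I)) (PM z))"
        unfolding f_def T'_pow_ks[OF j(1)] by simp
    qed
    finally have 1: "(\<Sum>n<I. f n) = (\<Sum>j<J. (T' ^^ Suc j) (E.ks (b ^ (q ^ I)) (PM z)))" by simp
    have "f (I + j) = - (T ^^ j) (E.ks (b ^ (q ^ I)) (PP z))" for j
    proof -
      have "w (I + j) = - (T ^^ j) (PP z)" unfolding w_def I_def by simp
      moreover have "(b ^ (q ^ I)) ^ (q ^ j) = b ^ (q ^ (I + j))" unfolding power_mult[symmetric] power_add ..
      ultimately show ?thesis unfolding f_def T_pow_ks by simp
    qed
    hence 2: "(\<Sum>j<J. f (I + j)) = - (\<Sum>j<J. (T ^^ j) (E.ks (b ^ (q ^ I)) (PP z)))" by (simp add: sum_negf)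
    have "(\<Sum>n<K0. f n) = (\<Sum>n<I. f n) + (\<Sum>j<J. f (I + j))" unfolding K0_def by (rule sum_lessThan_split)
    hence "(\<Sum>n<K0. f n) = (\<Sum>j<J. (T' ^^ Suc j) (E.ks (b ^ (q ^ I)) (PM z))) - (\<Sum>j<J. (T ^^ j) (E.ks (b ^ (q ^ I)) (PP z)))" unfolding 1 2 by simp
    thus ?thesis unfolding f_def .
  qed
  have sol: "\<exists>y\<in>FilE 0. \<exists>e\<in>OZ. T (PZ y) - PZ y = E.ks (b ^ (q ^ I)) (PZ z) + e \<and>
      y - PZ y - (\<Sum>n<K0. E.ks (b ^ (q ^ n)) (w n)) \<in> FilE 0" if b: "b \<in> S'" for b
  proof -
    have "b ^ (q ^ I) \<in> S" using b unfolding S'_def by simp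
    then obtain y where y: "y \<in> FilE 0" "T y - y - E.ks (b ^ (q ^ I)) z \<in> OH" using S by blast
    define e where "e = T y - y - E.ks (b ^ (q ^ I)) z"
    have e: "PP e \<in> OP" "PZ e \<in> OZ" "PM e \<in> OM" using y(2) unfolding e_def[symmetric] OH_iff by auto
    have Ty: "T y - y = E.ks (b ^ (q ^ I)) z + e" unfolding e_def by simp
    have R: "T (PR Q y) - PR Q y = E.ks (b ^ (q ^ I)) (PR Q z) + PR Q e" for Q
      unfolding PR_T[symmetric] PR_diff[symmetric] Ty PR_add PR_ks ..
    have eP: "(T ^^ j) (PP e) \<in> FilE 0" for j using e(1) unfolding OP_def by blast
    have eM: "(T' ^^ j) (PM e) \<in> FilE 0" for j using e(3) unfolding OM_def by blast
    define A where "A = (\<Sum>j<J. (T ^^ j) (E.ks (b ^ (q ^ I)) (PP z)))"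
    define B where "B = (\<Sum>j<J. (T' ^^ Suc j) (E.ks (b ^ (q ^ I)) (PM z)))"
    have "PP y = (T ^^ J) (PP y) - (\<Sum>j<J. (T ^^ j) (E.ks (b ^ (q ^ I)) (PP z) + PP e))" by (rule telescope_plus[OF R])
    hence "PP y + A = (T ^^ J) (PP y) - (\<Sum>j<J. (T ^^ j) (PP e))"
      unfolding T_pow_add sum.distrib A_def by (rule group_shuffle(1))
    also have "\<dots> \<in> FilE 0" by (intro E.Fil_diff E.Fil_sum eP JP y(1)) simp
    finally have 1: "PP y + A \<in> FilE 0" .
    have "PM y = (T' ^^ J) (PM y) + (\<Sum>j<J. (T' ^^ Suc j) (E.ks (b ^ (q ^ I)) (PM z) + PM e))" by (rule telescope_minus[OF R])
    hence "PM y - B = (T' ^^ J) (PM y) + (\<Sum>j<J. (T' ^^ Suc j) (PM e))"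
      unfolding T'_pow_add sum.distrib B_def by (rule group_shuffle(2))
    also have "\<dots> \<in> FilE 0" by (intro E.Fil_add E.Fil_sum eM JM y(1)) simp
    finally have 2: "PM y - B \<in> FilE 0" .
    have "y - PZ y = PP y + PM y" by (rule group_shuffle(3)[OF P_sum[OF FilE_End[OF y(1)]]])
    hence "y - PZ y - (B - A) = (PP y + A) + (PM y - B)" by (simp add: algebra_simps)
    also have "\<dots> \<in> FilE 0" by (rule E.Fil_add[OF 1 2])
    finally have "y - PZ y - (\<Sum>n<K0. E.ks (b ^ (q ^ n)) (w n)) \<in> FilE 0" unfolding sumw A_def B_def .
    thus ?thesis using y(1) e(2) R[of "\<lambda>l m. l = m"] by blast
  qed
  \<comment> \<open>\<open>PZ y\<close> is not under control yet, so the coefficients are first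
    shown to be integral only modulo slope zero.\<close>
  define U where "U = {x + y |x y. x \<in> FilE 0 \<and> y \<in> VZ}"
  have U: "E.k.subspace U" unfolding U_def by (intro E.k.subspace_sums E.Fil_k VR_k)
  have "(\<Sum>n<K0. E.ks (b ^ (q ^ n)) (w n)) \<in> U" if b: "b \<in> S'" for b
  proof -
    obtain y where y: "y \<in> FilE 0" "y - PZ y - (\<Sum>n<K0. E.ks (b ^ (q ^ n)) (w n)) \<in> FilE 0" using sol[OF b] by blast
    have "y - (y - PZ y - (\<Sum>n<K0. E.ks (b ^ (q ^ n)) (w n))) \<in> FilE 0" by (rule E.Fil_diff[OF y])
    moreover have "- PZ y \<in> VZ" by (rule E.k.subspace_neg[OF VR_k PR_VR[OF FilE_End[OF y(1)]]])
    moreover have "(\<Sum>n<K0. E.ks (b ^ (q ^ n)) (w n)) =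
      (y - (y - PZ y - (\<Sum>n<K0. E.ks (b ^ (q ^ n)) (w n)))) + (- PZ y)" by simp
    ultimately show ?thesis unfolding U_def by blast
  qed
  hence wU: "w n \<in> U" if "n < K0" for n by (rule E.k.vandermonde_frob_subspace[OF U S' frob_q_gt_1[OF q] _ that])
  have "\<forall>n. \<exists>r. r \<in> VZ \<and> (n < n0 \<or> n \<ge> K0 \<longrightarrow> r = 0) \<and> (n < K0 \<longrightarrow> w n + r \<in> FilE 0)"
  proof
    fix n
    show "\<exists>r. r \<in> VZ \<and> (n < n0 \<or> n \<ge> K0 \<longrightarrow> r = 0) \<and> (n < K0 \<longrightarrow> w n + r \<in> FilE 0)"
    proof (cases "n < n0 \<or> n \<ge> K0")
      case True
      hence "n < K0 \<longrightarrow> w n = 0" unfolding w_def by auto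
      thus ?thesis using VR_0 by (intro exI[of _ 0]) simp
    next
      case False
      hence "w n \<in> U" by (intro wU) simp
      then obtain x y where xy: "w n = x + y" "x \<in> FilE 0" "y \<in> VZ" unfolding U_def by blast
      have "- y \<in> VZ" by (rule E.k.subspace_neg[OF VR_k xy(3)])
      moreover have "w n + - y \<in> FilE 0" using xy(1,2) by simp
      ultimately show ?thesis using False by blast
    qed
  qed
  from choice[OF this] obtain r where r: "\<forall>n. r n \<in> VZ \<and> (n < n0 \<or> n \<ge> K0 \<longrightarrow> r n = 0) \<and> (n < K0 \<longrightarrow> w n + r n \<in> FilE 0)" by (elim exE)
  have rV: "r n \<in> VZ" for n using r by blast
  have r0: "r n = 0" if "n < n0 \<or> n \<ge> K0" for n using r that by blast
  have rw: "w n + r n \<in> FilE 0" if "n < K0" for n using r that by blast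
  \<comment> \<open>Coefficients of the slope-zero equation after \<open>PZ y\<close> is replaced by
    h = PZ y - \<Sum> b ^ (q ^ n) r n; applying T moves the term with r n to index n + 1.\<close>
  define s where "s n = (if n = I then PZ z else 0) + r n - (case n of 0 \<Rightarrow> 0 | Suc n' \<Rightarrow> T (r n'))" for n
  \<comment> \<open>One more than K0 because of this shift of index.\<close>
  define K where "K = Suc K0"
  have "\<exists>t. (\<forall>n. t n \<in> QZ 0) \<and> (\<forall>n\<ge>K. t n = 0) \<and> s 0 + t 0 \<in> OZ \<and>
    (\<forall>n. s (Suc n) - (T (t n) - t (Suc n)) \<in> OZ)"
  proof (rule coboundary_lemma[OF n0 _ S', of 0 n0])
    show "0 + n0 = n0" by simp
    show "s n = 0" if "n < n0 \<or> n \<ge> K" for n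
    proof -
      have "n \<noteq> I" using that unfolding K_def K0_def I_def J_def by auto
      moreover have "r n = 0" using that r0[of n] unfolding K_def by auto
      moreover have "r n' = 0" if "n = Suc n'" for n' using r0[of n'] that \<open>n < n0 \<or> n \<ge> K\<close> unfolding K_def by auto
      ultimately show ?thesis unfolding s_def by (cases n) simp_all
    qed
    fix b assume b: "b \<in> S'"
    obtain y e where y: "y \<in> FilE 0" "e \<in> OZ" "T (PZ y) - PZ y = E.ks (b ^ (q ^ I)) (PZ z) + e"
      "y - PZ y - (\<Sum>n<K0. E.ks (b ^ (q ^ n)) (w n)) \<in> FilE 0" using sol[OF b] by blast
    define h where "h = PZ y - (\<Sum>n<K0. E.ks (b ^ (q ^ n)) (r n))"
    have hV: "h \<in> VZ" unfolding h_def
      by (intro E.k.subspace_diff[OF VR_k] E.k.subspace_sum[OF VR_k] E.k.subspace_scale[OF VR_k] rV PR_VR[OF FilE_End[OF y(1)]])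
    have "h = y - (y - PZ y - (\<Sum>n<K0. E.ks (b ^ (q ^ n)) (w n))) - (\<Sum>n<K0. E.ks (b ^ (q ^ n)) (w n + r n))"
      unfolding h_def E.k.scale_right_distrib sum.distrib by simp
    also have "\<dots> \<in> FilE 0" by (intro E.Fil_diff[OF E.Fil_diff[OF y(1,4)]] E.Fil_sum E.Fil_ks rw) simp
    finally have hQ: "h \<in> QZ 0" by (rule QZ_0I[OF _ hV])
    define G where "G n = E.ks (b ^ (q ^ n)) (if n = I then PZ z else 0)" for n
    define G2 where "G2 n = E.ks (b ^ (q ^ n)) (r n)" for n
    define G3 where "G3 n = E.ks (b ^ (q ^ n)) (case n of 0 \<Rightarrow> 0 | Suc n' \<Rightarrow> T (r n'))" for n
    have g1: "(\<Sum>n<K. G n) = E.ks (b ^ (q ^ I)) (PZ z)"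
    proof -
      have "(\<Sum>n<K. G n) = (\<Sum>n<K. if n = I then G I else 0)" by (rule sum.cong) (auto simp: G_def)
      also have "\<dots> = G I" unfolding K_def K0_def by simp
      finally show ?thesis unfolding G_def by simp
    qed
    have g2: "(\<Sum>n<K. G2 n) = (\<Sum>n<K0. G2 n)" unfolding K_def using r0[of K0] by (simp add: G2_def)
    have g3: "(\<Sum>n<K. G3 n) = T (\<Sum>n<K0. G2 n)"
    proof -
      have "(\<Sum>n<K. G3 n) = (\<Sum>n<K0. G3 (Suc n))" unfolding K_def sum.lessThan_Suc_shift by (simp add: G3_def)
      also have "\<dots> = (\<Sum>n<K0. T (G2 n))"
      proof (rule sum.cong[OF refl])
        fix n
        have "(b ^ (q ^ n)) ^ q = b ^ (q ^ Suc n)" unfolding power_mult[symmetric] by (simp add: mult.commute)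
        thus "G3 (Suc n) = T (G2 n)" unfolding G3_def G2_def T_ks by simp
      qed
      finally show ?thesis unfolding FT.T_sum .
    qed
    have ssum: "(\<Sum>n<K. E.ks (b ^ (q ^ n)) (s n)) = (\<Sum>n<K. G n) + (\<Sum>n<K. G2 n) - (\<Sum>n<K. G3 n)"
      unfolding s_def G_def G2_def G3_def E.k.scale_right_distrib E.k.scale_right_diff_distrib sum_subtractf sum.distrib ..
    have hG: "h = PZ y - (\<Sum>n<K0. G2 n)" unfolding h_def G2_def ..
    have "T h - h - (\<Sum>n<K. E.ks (b ^ (q ^ n)) (s n)) = (T (PZ y) - PZ y) - E.ks (b ^ (q ^ I)) (PZ z)"
      unfolding ssum g1 g2 g3 hG T_diff by (simp add: algebra_simps)
    also have "\<dots> = e" unfolding y(3) by simp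
    finally have "T h - h - (\<Sum>n<K. E.ks (b ^ (q ^ n)) (s n)) \<in> OZ" using y(2) by simp
    thus "\<exists>h\<in>QZ 0. T h - h - (\<Sum>n<K. E.ks (b ^ (q ^ n)) (s n)) \<in> OZ" using hQ by (rule bexI[of _ h])
  qed
  then obtain t where t: "(\<forall>n. t n \<in> QZ 0) \<and> (\<forall>n\<ge>K. t n = 0) \<and> s 0 + t 0 \<in> OZ \<and>
    (\<forall>n. s (Suc n) - (T (t n) - t (Suc n)) \<in> OZ)" ..
  have tQ: "t n \<in> QZ 0" for n using t by blast
  have tK: "t n = 0" if "n \<ge> K" for n using t that by blast
  \<comment> \<open>In terms of u the relations read u (n + 1) \<equiv> T (u n) modulo OZ, except at
    n + 1 = I, where \<open>PZ z\<close> enters.\<close>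
  define u where "u n = r n + t n" for n
  have "s 0 + t 0 \<in> OZ" using t by blast
  moreover have "s 0 = r 0" unfolding s_def using I1 by simp
  ultimately have u0: "u 0 \<in> OZ" unfolding u_def by simp
  have us: "(if Suc n = I then PZ z else 0) + u (Suc n) - T (u n) \<in> OZ" for n
  proof -
    have "s (Suc n) - (T (t n) - t (Suc n)) \<in> OZ" using t by blast
    moreover have "s (Suc n) - (T (t n) - t (Suc n)) = (if Suc n = I then PZ z else 0) + u (Suc n) - T (u n)"
      unfolding s_def u_def T_add by (simp add: algebra_simps)
    ultimately show ?thesis by (simp only:)
  qed
  have up: "n < I \<longrightarrow> u n \<in> OZ" for n
  proof (induction n)
    case (Suc n)
    show ?case
    proof
      assume n: "Suc n < I"
      hence "u n \<in> OZ" using Suc by simp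
      moreover have "u (Suc n) - T (u n) \<in> OZ" using us[of n] n by simp
      ultimately have "(u (Suc n) - T (u n)) + T (u n) \<in> OZ" by (intro E.k.subspace_add[OF OZ_k] T_OZ)
      thus "u (Suc n) \<in> OZ" by simp
    qed
  qed (simp add: u0)
  \<comment> \<open>The values below I are reached from u 0 by T, those from I on are reached from u
    K = 0 by T'; the relation at I then isolates \<open>PZ z\<close>.\<close>
  have down: "I \<le> K - n \<longrightarrow> u (K - n) \<in> OZ" for n
  proof (induction n)
    case 0
    have "u K = 0" unfolding u_def using tK[of K] r0[of K] unfolding K_def by simp
    thus ?case using E.k.subspace_0[OF OZ_k] by simp
  next
    case (Suc n)
    show ?case
    proof
      assume le: "I \<le> K - Suc n"
      show "u (K - Suc n) \<in> OZ"
      proof (cases "n < K")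
        case True
        hence K: "K - n = Suc (K - Suc n)" by simp
        have un: "u (Suc (K - Suc n)) \<in> OZ" using Suc le unfolding K by simp
        have "Suc (K - Suc n) \<noteq> I" using le by simp
        hence "u (Suc (K - Suc n)) - T (u (K - Suc n)) \<in> OZ" using us[of "K - Suc n"] by simp
        hence "u (Suc (K - Suc n)) - (u (Suc (K - Suc n)) - T (u (K - Suc n))) \<in> OZ"
          by (rule E.k.subspace_diff[OF OZ_k un])
        hence "T (u (K - Suc n)) \<in> OZ" by simp
        from T'_OZ[OF this] show ?thesis by simp
      next
        case False thus ?thesis using le I1 by simp
      qed
    qed
  qed
  have uI: "u n \<in> OZ" for n
  proof -
    consider "n < I" | "I \<le> n" "n \<le> K" | "K < n" by linarith
    thus ?thesis
    proof cases
      case 1 thus ?thesis using up by simp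
    next
      case 2 thus ?thesis using down[of "K - n"] by simp
    next
      case 3
      hence "u n = 0" unfolding u_def using tK[of n] r0[of n] unfolding K_def by simp
      thus ?thesis using E.k.subspace_0[OF OZ_k] by simp
    qed
  qed
  have zZ: "PZ z \<in> OZ"
  proof -
    have "PZ z + u (Suc (I - 1)) - T (u (I - 1)) \<in> OZ" using us[of "I - 1"] I1 by simp
    hence "(PZ z + u (Suc (I - 1)) - T (u (I - 1))) + T (u (I - 1)) - u (Suc (I - 1)) \<in> OZ"
      by (rule E.k.subspace_diff[OF OZ_k E.k.subspace_add[OF OZ_k _ T_OZ[OF uI]] uI])
    thus ?thesis by simp
  qed
  have wF: "w n \<in> FilE 0" if n: "n < K0" for n
  proof -
    have "(w n + r n) - u n + t n \<in> FilE 0"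
      by (intro E.Fil_add[OF E.Fil_diff[OF rw[OF n]]] OZ_D(2) uI QZ_FilE[OF tQ])
    thus ?thesis unfolding u_def by simp
  qed
  show ?thesis
  proof (rule OH_intro[of J, OF _ _ z zZ])
    show "\<forall>i\<ge>J. (T ^^ i) (PP z) \<in> FilE 0" using JP z by blast
    show "\<forall>i\<ge>J. (T' ^^ i) (PM z) \<in> FilE 0" using JM z by blast
    fix j assume j: "j < J"
    have "w (I + j) = - (T ^^ j) (PP z)" unfolding w_def I_def by simp
    moreover have "w (I + j) \<in> FilE 0" by (rule wF) (use j in \<open>simp add: K0_def\<close>)
    ultimately show "(T ^^ j) (PP z) \<in> FilE 0" using E.Fil_neg[of "w (I + j)" 0] by simp
    have j': "Suc j \<le> I" "\<not> I - Suc j < n0" "I - Suc j < I" "I - (I - Suc j) = Suc j" using j unfolding I_def by auto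
    have "w (I - Suc j) = (T' ^^ Suc j) (PM z)" unfolding w_def using j'(2-4) by simp
    moreover have "w (I - Suc j) \<in> FilE 0" by (rule wF) (use j'(3) in \<open>simp add: K0_def\<close>)
    ultimately show "(T' ^^ Suc j) (PM z) \<in> FilE 0" by simp
  qed
qed

lemma iso_prop_step:
  assumes m: "m \<ge> 1" and ip: "iso_prop m" and O: "FilE (m + 1) \<subseteq> OH"
  shows "FilE m \<subseteq> OH"
proof
  fix z assume z: "z \<in> FilE m"
  show "z \<in> OH"
  proof (rule OH_from_multiples[OF infinite_Zc_multiples[OF m ip z] FilEm_0[OF m z]])
    fix a assume "a \<in> {a. E.ks a z \<in> Zc m}"
    hence "E.ks a z \<in> Zc m" by simp
    then obtain y where "y \<in> FilE 0" "T y - y - E.ks a z \<in> FilE (m + 1)" unfolding Zc_def[OF m] by blast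
    thus "\<exists>y\<in>FilE 0. T y - y - E.ks a z \<in> OH" using O by blast
  qed
qed

lemma iso_prop_mono: "iso_prop m \<Longrightarrow> m \<le> n \<Longrightarrow> iso_prop n"
  unfolding iso_prop_def using E.Fil_monoD by blast

text \<open>\<open>iso_prop m\<close> is inherited by every deeper level, so
  \<open>iso_prop_step\<close> can be used all the way down from the level supplied by
  \<open>OH_contains\<close>.\<close>

lemma iso_prop_iff_level:
  assumes m: "m \<ge> 1" shows "iso_prop m \<longleftrightarrow> FilE m \<subseteq> OH"
proof
  assume ip: "iso_prop m"
  obtain N where N: "FilE (int N) \<subseteq> OH" using OH_contains ..
  have "FilE (m + int k) \<subseteq> OH \<longrightarrow> FilE m \<subseteq> OH" for k
  proof (induction k)
    case (Suc k)
    show ?case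
    proof
      assume "FilE (m + int (Suc k)) \<subseteq> OH"
      hence "FilE ((m + int k) + 1) \<subseteq> OH" by (simp add: algebra_simps)
      hence "FilE (m + int k) \<subseteq> OH" by (rule iso_prop_step[rotated 2]) (use m iso_prop_mono[OF ip] in auto)
      thus "FilE m \<subseteq> OH" using Suc by blast
    qed
  qed simp
  moreover have "FilE (m + int N) \<subseteq> OH" using N E.Fil_mono[of "int N" "m + int N"] m by auto
  ultimately show "FilE m \<subseteq> OH" by blast
next
  assume "FilE m \<subseteq> OH"
  thus "iso_prop m" by (rule level_implies_iso_prop[OF m])
qed

end

section \<open>The unit-root case\<close>

lemma (in linear_space) independent_family:
  fixes g :: "'i \<Rightarrow> 'b"
  assumes A: "finite A" and z: "\<And>c a. (\<Sum>i\<in>A. scale (c i) (g i)) = 0 \<Longrightarrow> a \<in> A \<Longrightarrow> c a = 0"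
  shows "inj_on g A" "independent (g ` A)"
proof -
  show inj: "inj_on g A"
  proof (rule inj_onI, rule ccontr)
    fix x y assume xy: "x \<in> A" "y \<in> A" "g x = g y" "x \<noteq> y"
    define c :: "'i \<Rightarrow> 'a" where "c a = (if a = x then 1 else 0) - (if a = y then 1 else 0)" for a
    have "(\<Sum>a\<in>A. scale (c a) (g a)) = (\<Sum>a\<in>A. if a = x then g x else 0) - (\<Sum>a\<in>A. if a = y then g y else 0)"
      unfolding sum_subtractf[symmetric] by (rule sum.cong) (auto simp: c_def scale_left_diff_distrib)
    also have "\<dots> = 0" using A xy by simp
    finally have "c x = 0" by (rule z[OF _ xy(1)])
    thus False using xy(4) by (simp add: c_def)
  qed
  show "independent (g ` A)"
  proof (rule independent_if_scalars_zero)
    show "finite (g ` A)" using A by simp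
    fix f x assume f: "(\<Sum>x\<in>g ` A. scale (f x) x) = 0" and "x \<in> g ` A"
    then obtain a where a: "a \<in> A" "x = g a" by blast
    have "(\<Sum>a\<in>A. scale (f (g a)) (g a)) = 0" using f unfolding sum.reindex[OF inj] by (simp add: comp_def)
    from z[OF this a(1)] show "f x = 0" unfolding a(2) .
  qed
qed

section \<open>Reduction modulo \<epsilon>\<close>

context based_space
begin

text \<open>Reduction modulo \<epsilon> without a quotient: on Fil 0 it selects the representative
  in \<open>k.span B\<close>, which stands for M / \<epsilon> M.\<close>

definition c0 :: "'v \<Rightarrow> 'v" where "c0 v = (\<Sum>b\<in>B. ks (fls_nth (cf v b) 0) b)"

lemma c0_add: "c0 (u + v) = c0 u + c0 v"
  by (simp add: c0_def cf_add k.scale_left_distrib sum.distrib)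

lemma c0_ks: "c0 (ks a v) = ks a (c0 v)"
  by (simp add: c0_def ks_def[of _ v] cf_scale k.scale_sum_right)

lemma c0_in: "c0 v \<in> k.span B" unfolding c0_def by (intro k.span_sum k.span_scale k.span_base)

lemma kspan_Fil: "k.span B \<subseteq> Fil 0"
  by (rule k.span_minimal[OF _ Fil_k]) (use basis_Fil in blast)

lemma c0_approx: "v \<in> Fil 0 \<Longrightarrow> v - c0 v \<in> Fil 1"
proof -
  assume v: "v \<in> Fil 0"
  have "cf (c0 v) b = fls_const (fls_nth (cf v b) 0)" if "b \<in> B" for b
    unfolding c0_def ks_def by (rule cf_combination[OF that])
  thus ?thesis using v unfolding Fil_def by (auto simp: cf_diff fls_ge_def)
qed

lemma c0_Fil1: "v \<in> Fil 1 \<Longrightarrow> c0 v = 0"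
  unfolding c0_def Fil_def by (intro sum.neutral) (auto simp: fls_ge_def)

lemma c0_diff: "c0 (u - v) = c0 u - c0 v" using c0_add[of "u - v" v] by simp

lemma Fil1_iff_c0: "v \<in> Fil 0 \<Longrightarrow> v \<in> Fil 1 \<longleftrightarrow> c0 v = 0"
  using c0_Fil1 c0_approx[of v] by auto

lemma c0_span: "x \<in> k.span B \<Longrightarrow> c0 x = x"
proof -
  have "c0 b = b" if b: "b \<in> B" for b
  proof -
    have "c0 b = (\<Sum>b'\<in>B. if b' = b then b else 0)" unfolding c0_def
      by (rule sum.cong) (auto simp: cf_basis[OF b])
    thus ?thesis using b fin_B by simp
  qed
  moreover have "k.subspace {x. c0 x = x}"
    by (rule k.subspaceI) (simp_all add: c0_add c0_ks c0_Fil1)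
  ultimately have "k.span B \<subseteq> {x. c0 x = x}" by (intro k.span_minimal) auto
  thus "x \<in> k.span B \<Longrightarrow> c0 x = x" by blast
qed

lemma k_independent_B: "k.independent B"
proof (rule k.independent_if_scalars_zero[OF fin_B])
  fix f x assume "(\<Sum>x\<in>B. ks (f x) x) = 0" "x \<in> B"
  hence "cf (\<Sum>x\<in>B. scale (fls_const (f x)) x) x = 0" unfolding ks_def by (simp add: cf_0)
  hence "fls_const (f x) = 0" unfolding cf_combination[OF \<open>x \<in> B\<close>] .
  thus "f x = 0" by simp
qed

definition lin :: "('v \<Rightarrow> 'v) \<Rightarrow> 'v \<Rightarrow> 'v" where "lin g v = (\<Sum>b\<in>B. scale (cf v b) (g b))"

lemma lin_End: "lin g \<in> End_space"
  by (rule End_I) (simp_all add: lin_def cf_add cf_scale scale_left_distrib sum.distrib scale_sum_right)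

lemma lin_basis: "b \<in> B \<Longrightarrow> lin g b = g b"
proof -
  assume b: "b \<in> B"
  have "lin g b = (\<Sum>b'\<in>B. if b' = b then g b else 0)" unfolding lin_def
    by (rule sum.cong) (auto simp: cf_basis[OF b])
  thus ?thesis using b fin_B by simp
qed

lemma lin_FilE: "(\<And>b. b \<in> B \<Longrightarrow> g b \<in> Fil 0) \<Longrightarrow> lin g \<in> FilE 0"
  by (rule FilE_basis[OF lin_End]) (simp add: lin_basis)

lemma End_eqI_basis:
  assumes "f \<in> End_space" "g \<in> End_space" "\<And>b. b \<in> B \<Longrightarrow> f b = g b" shows "f = g"
proof
  fix v
  show "f v = g v" unfolding End_expand[OF assms(1), of v] End_expand[OF assms(2), of v] using assms(3) by simp
qed

lemma basis_GLM:
  assumes C: "k.independent C" "k.span C = k.span B" and f: "bij_betw f B C"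
  obtains u where "u \<in> GLM" "\<And>b. b \<in> B \<Longrightarrow> u b = f b"
proof -
  have finC: "finite C" using bij_betw_finite[OF f] fin_B by blast
  have "\<forall>b\<in>B. \<exists>a. b = (\<Sum>b'\<in>B. ks (a b') (f b'))"
  proof
    fix b assume "b \<in> B"
    hence "b \<in> k.span C" unfolding C(2) by (rule k.span_base)
    then obtain a where "b = (\<Sum>v\<in>C. ks (a v) v)" unfolding k.span_finite[OF finC] by blast
    hence "b = (\<Sum>b'\<in>B. ks (a (f b')) (f b'))" unfolding sum.reindex_bij_betw[OF f, of "\<lambda>v. ks (a v) v"] .
    thus "\<exists>a. b = (\<Sum>b'\<in>B. ks (a b') (f b'))" by (rule exI[of _ "\<lambda>b'. a (f b')"])
  qed
  from bchoice[OF this] obtain a where a: "\<forall>b\<in>B. b = (\<Sum>b'\<in>B. ks (a b b') (f b'))" by (elim exE)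
  define u where "u = lin f"
  define u' where "u' = lin (\<lambda>b. \<Sum>b'\<in>B. ks (a b b') b')"
  have fC: "f b \<in> C" if "b \<in> B" for b using f that by (rule bij_betw_apply)
  have fF: "f b \<in> Fil 0" if "b \<in> B" for b
    using k.span_base[OF fC[OF that]] kspan_Fil unfolding C(2) by blast
  have u: "u \<in> FilE 0" unfolding u_def by (rule lin_FilE[OF fF])
  have u': "u' \<in> FilE 0" unfolding u'_def by (rule lin_FilE) (intro Fil_sum Fil_ks basis_Fil)
  have 1: "u \<circ> u' = id"
  proof (rule End_eqI_basis)
    show "u \<circ> u' \<in> End_space" by (intro End_comp FilE_End[OF u] FilE_End[OF u'])
    show "id \<in> End_space" by (rule End_id)
    fix b assume b: "b \<in> B"
    have "u (u' b) = (\<Sum>b'\<in>B. ks (a b b') (u b'))"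
      unfolding u'_def lin_basis[OF b] End_sum_apply[OF FilE_End[OF u]] ks_def End_scale_apply[OF FilE_End[OF u]] ..
    also have "\<dots> = (\<Sum>b'\<in>B. ks (a b b') (f b'))" unfolding u_def by (rule sum.cong) (simp_all add: lin_basis)
    also have "\<dots> = b" using a b by simp
    finally show "(u \<circ> u') b = id b" by (simp add: comp_apply)
  qed
  have 2: "u' \<circ> u = id"
    using linear_inverse_left[of u u'] 1 FilE_End[OF u] FilE_End[OF u'] unfolding End_space_def by blast
  show thesis
  proof (rule that)
    show "u \<in> GLM" unfolding GLM_def using u u' 1 2 by blast
    show "u b = f b" if "b \<in> B" for b unfolding u_def by (rule lin_basis[OF that])
  qed
qed

lemma kspan_basis_extend:
  assumes "k.independent A" "A \<subseteq> k.span B"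
  obtains A' where "A \<subseteq> A'" "k.independent A'" "k.span A' = k.span B" "finite A'"
proof -
  obtain A' where A': "A \<subseteq> A'" "A' \<subseteq> k.span B" "k.independent A'" "k.span B \<subseteq> k.span A'"
    by (rule k.maximal_independent_subset_extend[OF assms(2,1)])
  have "k.span A' = k.span B" using A'(4) k.span_minimal[OF A'(2) k.subspace_span] by blast
  moreover have "finite A'" using k.independent_span_bound[OF fin_B A'(3,2)] by blast
  ultimately show thesis using that A' by blast
qed

text \<open>Complete A and its image to k-bases of \<open>k.span B\<close>. These have equal size,
  so the map extends to a bijection of bases, and both bases are images of B under elements of
  GL(M).\<close>

lemma GLM_extension:
  assumes A: "k.independent A" "A \<subseteq> k.span B" and f: "inj_on f A" "k.independent (f ` A)" "f ` A \<subseteq> k.span B"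
  obtains h where "h \<in> GLM" "\<And>a. a \<in> A \<Longrightarrow> h a = f a"
proof -
  obtain A' where A': "A \<subseteq> A'" "k.independent A'" "k.span A' = k.span B" "finite A'" by (rule kspan_basis_extend[OF A])
  obtain C where C: "f ` A \<subseteq> C" "k.independent C" "k.span C = k.span B" "finite C" by (rule kspan_basis_extend[OF f(2,3)])
  obtain p where p: "bij_betw p B A'" using k.bij_if_span_eq_span_bases[OF k_independent_B A'(2)] A'(3) by auto
  obtain r where r: "bij_betw r B C" using k.bij_if_span_eq_span_bases[OF k_independent_B C(2)] C(3) by auto
  have card: "card A' = card C" using bij_betw_same_card[OF p] bij_betw_same_card[OF r] by simp
  have "card (f ` A) = card A" by (rule card_image[OF f(1)])
  hence "card (A' - A) = card (C - f ` A)"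
    using card_Diff_subset[OF finite_subset[OF A'(1,4)] A'(1)] card_Diff_subset[OF finite_subset[OF C(1,4)] C(1)] card by simp
  then obtain g where g: "bij_betw g (A' - A) (C - f ` A)"
    using finite_same_card_bij[of "A' - A" "C - f ` A"] A'(4) C(4) by blast
  define f' where "f' a = (if a \<in> A then f a else g a)" for a
  have "bij_betw f' A (f ` A)" using inj_on_imp_bij_betw[OF f(1)] by (rule bij_betw_cong[THEN iffD1, rotated]) (simp add: f'_def)
  moreover have "bij_betw f' (A' - A) (C - f ` A)" using g by (rule bij_betw_cong[THEN iffD1, rotated]) (simp add: f'_def)
  ultimately have "bij_betw f' (A \<union> (A' - A)) (f ` A \<union> (C - f ` A))" by (rule bij_betw_combine) blast
  hence f': "bij_betw f' A' C" using A'(1) C(1) by (simp add: Un_absorb1)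
  obtain u1 where u1: "u1 \<in> GLM" "\<And>b. b \<in> B \<Longrightarrow> u1 b = p b" by (rule basis_GLM[OF A'(2,3) p]) (rule that)
  obtain u2 where u2: "u2 \<in> GLM" "\<And>b. b \<in> B \<Longrightarrow> u2 b = (f' \<circ> p) b"
    by (rule basis_GLM[OF C(2,3) bij_betw_trans[OF p f']]) (rule that)
  obtain v where v: "v \<in> GLM" "u1 \<circ> v = id" "v \<circ> u1 = id" by (rule GLM_inv[OF u1(1)])
  show thesis
  proof (rule that)
    show "u2 \<circ> v \<in> GLM" by (rule GLM_comp[OF u2(1) v(1)])
    fix a assume a: "a \<in> A"
    hence "a \<in> p ` B" using A'(1) bij_betw_imp_surj_on[OF p] by blast
    then obtain b where b: "b \<in> B" "a = p b" by blast
    have "v a = b" unfolding b(2) u1(2)[OF b(1), symmetric] using v(3) by (metis comp_apply id_apply)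
    hence "(u2 \<circ> v) a = f' a" using u2(2)[OF b(1)] b(2) by (simp add: comp_apply)
    thus "(u2 \<circ> v) a = f a" using a by (simp add: f'_def)
  qed
qed

lemma GLM_Fil_iff: "g \<in> GLM \<Longrightarrow> g x \<in> Fil n \<longleftrightarrow> x \<in> Fil n"
proof -
  assume g: "g \<in> GLM"
  obtain v where v: "v \<in> GLM" "g \<circ> v = id" "v \<circ> g = id" by (rule GLM_inv[OF g])
  have "v (g x) = x" using v(3) by (metis comp_apply id_apply)
  thus ?thesis using FilE_apply[OF GLM_FilE[OF g], of x n] FilE_apply[OF GLM_FilE[OF v(1)], of "g x" n] by auto
qed

end

context crystal
begin

text \<open>Semilinear maps preserving M without any bijectivity: this covers \<epsilon>^-s \<phi>
  together with its composites with elements of GL(M).\<close>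

definition semi :: "('v \<Rightarrow> 'v) \<Rightarrow> bool" where
  "semi \<theta> \<longleftrightarrow> (\<forall>x y. \<theta> (x + y) = \<theta> x + \<theta> y) \<and> (\<forall>c x. \<theta> (scale c x) = scale (\<sigma> c) (\<theta> x)) \<and> \<theta> ` Fil 0 \<subseteq> Fil 0"

context
  fixes \<theta> assumes semi: "semi \<theta>"
begin

lemma semi_add: "\<theta> (x + y) = \<theta> x + \<theta> y" and semi_scale: "\<theta> (scale c x) = scale (\<sigma> c) (\<theta> x)"
  and semi_Fil0: "x \<in> Fil 0 \<Longrightarrow> \<theta> x \<in> Fil 0"
  using semi unfolding semi_def by blast+

lemma semi_diff: "\<theta> (x - y) = \<theta> x - \<theta> y" using semi_add[of "x - y" y] by simp

lemma semi_sh: "\<theta> (sh n x) = sh n (\<theta> x)" by (simp add: sh_def semi_scale fls_frob_intpow[OF q])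

lemma semi_ks: "\<theta> (ks a x) = ks (a ^ q) (\<theta> x)" by (simp add: ks_def semi_scale fls_frob_const[OF q])

lemma semi_sum: "\<theta> (\<Sum>i\<in>A. f i) = (\<Sum>i\<in>A. \<theta> (f i))"
proof (induction A rule: infinite_finite_induct)
  case (infinite A)
  have "\<theta> 0 = 0" using semi_add[of 0 0] by simp
  thus ?case using infinite by simp
next
  case empty
  have "\<theta> 0 = 0" using semi_add[of 0 0] by simp
  thus ?case by simp
qed (simp add: semi_add)

lemma semi_Fil: "x \<in> Fil n \<Longrightarrow> \<theta> x \<in> Fil n"
proof -
  assume x: "x \<in> Fil n"
  have "sh (- n) x \<in> Fil 0" using x by (simp add: Fil_shift_iff)
  from semi_Fil0[OF this] show ?thesis by (simp add: semi_sh Fil_shift_iff)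
qed

lemma semi_mod: "x \<in> Fil 0 \<Longrightarrow> \<theta> x - \<theta> (c0 x) \<in> Fil 1"
  using semi_Fil[OF c0_approx] by (simp add: semi_diff)

lemma semi_frobenius: "frobenius_map ks q (\<lambda>v. c0 (\<theta> v))"
  by unfold_locales (simp_all add: semi_add semi_ks c0_add c0_ks q)

text \<open>Injectivity modulo \<epsilon> allows \<open>fixed_vectors_span\<close> on M / \<epsilon>
  M; u carries B to a basis of fixed vectors.\<close>

lemma semi_fixed_basis:
  assumes inj: "\<And>x. x \<in> Fil 0 \<Longrightarrow> \<theta> x \<in> Fil 1 \<Longrightarrow> x \<in> Fil 1"
  shows "\<exists>u\<in>GLM. \<forall>b\<in>B. \<theta> (u b) - u b \<in> Fil 1"
proof -
  interpret K: frobenius_map ks q "\<lambda>v. c0 (\<theta> v)" by (rule semi_frobenius)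
  define X where "X = {x \<in> k.span B. c0 (\<theta> x) = x}"
  have span: "k.span B \<subseteq> k.span X"
    unfolding X_def
  proof (rule K.fixed_vectors_span)
    show "k.subspace (k.span B)" by (rule k.subspace_span)
    show "(\<lambda>v. c0 (\<theta> v)) ` k.span B \<subseteq> k.span B" using c0_in by blast
    show "inj_on (\<lambda>v. c0 (\<theta> v)) (k.span B)"
    proof (rule inj_onI)
      fix x y assume xy: "x \<in> k.span B" "y \<in> k.span B" "c0 (\<theta> x) = c0 (\<theta> y)"
      have d: "x - y \<in> k.span B" by (rule k.span_diff[OF xy(1,2)])
      have d0: "x - y \<in> Fil 0" using d kspan_Fil by blast
      have "c0 (\<theta> (x - y)) = 0" using xy(3) by (simp add: semi_diff c0_diff)
      hence "\<theta> (x - y) \<in> Fil 1" using Fil1_iff_c0[OF semi_Fil0[OF d0]] by simp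
      hence "x - y \<in> Fil 1" by (rule inj[OF d0])
      hence "c0 (x - y) = 0" by (rule c0_Fil1)
      thus "x = y" using c0_span[OF d] by simp
    qed
    have "k.artinian_between {0} {x + y |x y. x \<in> {0} \<and> y \<in> k.span B}"
      by (rule k.artinian_finite_span[OF fin_B k.subspace_single_0])
    thus "k.artinian_between {0} (k.span B)" by simp
  qed
  obtain C where C: "C \<subseteq> X" "k.independent C" "X \<subseteq> k.span C" by (rule k.maximal_independent_subset)
  have "k.span X \<subseteq> k.span C" by (rule k.span_minimal[OF C(3) k.subspace_span])
  moreover have "C \<subseteq> k.span B" using C(1) unfolding X_def by blast
  hence "k.span C \<subseteq> k.span B" by (rule k.span_minimal[OF _ k.subspace_span])
  ultimately have sC: "k.span C = k.span B" using span by blast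
  obtain f where f: "bij_betw f B C" using k.bij_if_span_eq_span_bases[OF k_independent_B C(2)] sC by auto
  obtain u where u: "u \<in> GLM" "\<And>b. b \<in> B \<Longrightarrow> u b = f b" by (rule basis_GLM[OF C(2) sC f]) (rule that)
  have "\<theta> (u b) - u b \<in> Fil 1" if b: "b \<in> B" for b
  proof -
    have "u b \<in> X" using bij_betw_apply[OF f b] C(1) u(2)[OF b] by auto
    hence ub: "u b \<in> k.span B" "c0 (\<theta> (u b)) = u b" unfolding X_def by auto
    have "u b \<in> Fil 0" using ub(1) kspan_Fil by blast
    from c0_approx[OF semi_Fil0[OF this]] show ?thesis unfolding ub(2) .
  qed
  thus ?thesis using u(1) by blast
qed

end

lemma semi_comp_GLM: "semi \<theta> \<Longrightarrow> h \<in> GLM \<Longrightarrow> semi (\<lambda>x. h (\<theta> x))"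
proof -
  assume s: "semi \<theta>" and h: "h \<in> GLM"
  have "h (\<theta> x) \<in> Fil 0" if "x \<in> Fil 0" for x using semi_Fil0[OF s that] GLM_Fil_iff[OF h] by blast
  thus ?thesis unfolding semi_def
    by (auto simp: semi_add[OF s] semi_scale[OF s] End_add_apply[OF GLM_End[OF h]] End_scale_apply[OF GLM_End[OF h]])
qed

end

section \<open>Crystals with \<phi> M = \<epsilon>^s M\<close>

context crystal
begin

text \<open>\<phi> is then \<epsilon>^s times a semilinear bijection of M. Existence of such an s
  turns out to be equivalent to \<open>iso_prop 0\<close>.\<close>

definition unit_root :: "int \<Rightarrow> bool" where "unit_root s \<longleftrightarrow> \<phi> ` Fil 0 = Fil s"

lemma unit_root_iff:
  assumes "unit_root s" shows "\<phi> x \<in> Fil (n + s) \<longleftrightarrow> x \<in> Fil n"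
proof
  have E: "\<phi> ` Fil 0 = Fil s" using assms unfolding unit_root_def .
  {
    assume "x \<in> Fil n"
    hence "sh (- n) x \<in> Fil 0" by (simp add: Fil_shift_iff)
    hence "\<phi> (sh (- n) x) \<in> Fil s" using E by blast
    thus "\<phi> x \<in> Fil (n + s)" by (simp add: phi_sh Fil_shift_iff add.commute)
  }
  assume "\<phi> x \<in> Fil (n + s)"
  hence "\<phi> (sh (- n) x) \<in> \<phi> ` Fil 0" unfolding E by (simp add: phi_sh Fil_shift_iff add.commute)
  then obtain y where "y \<in> Fil 0" "\<phi> (sh (- n) x) = \<phi> y" by blast
  hence "sh (- n) x \<in> Fil 0" by (metis phi_inv(2))
  thus "x \<in> Fil n" by (simp add: Fil_shift_iff)
qed

lemma unit_root_phi':
  assumes "unit_root s" shows "\<phi>' x \<in> Fil (n - s) \<longleftrightarrow> x \<in> Fil n"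
  using unit_root_iff[OF assms, of "\<phi>' x" "n - s"] by simp

lemma unit_root_T:
  assumes u: "unit_root s" and f: "f \<in> FilE n" shows "T f \<in> FilE n" "T' f \<in> FilE n"
proof -
  have E: "f \<in> End_space" by (rule FilE_End[OF f])
  show "T f \<in> FilE n"
  proof (rule FilE_I[OF T_End[OF E]])
    fix x assume "x \<in> Fil 0"
    hence "\<phi>' x \<in> Fil (0 - s)" using unit_root_phi'[OF u] by blast
    hence "f (\<phi>' x) \<in> Fil (n - s)" using FilE_apply[OF f] by fastforce
    hence "\<phi> (f (\<phi>' x)) \<in> Fil (n - s + s)" using unit_root_iff[OF u] by blast
    thus "T f x \<in> Fil n" by (simp add: T_apply)
  qed
  show "T' f \<in> FilE n"
  proof (rule FilE_I[OF T'_End[OF E]])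
    fix x assume "x \<in> Fil 0"
    hence "\<phi> x \<in> Fil (0 + s)" using unit_root_iff[OF u] by blast
    hence "f (\<phi> x) \<in> Fil (n + s)" using FilE_apply[OF f] by (fastforce simp: add.commute)
    hence "\<phi>' (f (\<phi> x)) \<in> Fil (n + s - s)" using unit_root_phi'[OF u] by blast
    thus "T' f x \<in> Fil n" by (simp add: T'_apply)
  qed
qed

lemma unit_root_T_pow:
  assumes u: "unit_root s" and f: "f \<in> FilE n" shows "(T ^^ i) f \<in> FilE n" "(T' ^^ i) f \<in> FilE n"
  using f by (induction i) (simp_all add: comp_apply unit_root_T[OF u])

text \<open>T and T' preserve every \<open>FilE N\<close>. An element of V_+ has T-iterates tending
  to zero, and applying T' back shows that it already lies in every \<open>FilE N\<close>; likewise
  for V_- with the roles exchanged.\<close>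

lemma unit_root_level:
  assumes u: "unit_root s"
  shows "FilE 0 = OH" "OP = {0}" "OM = {0}"
proof -
  have P0: "PP f = 0" if f: "f \<in> FilE 0" for f
  proof (rule E.Fil_sep)
    fix N
    obtain I where "\<forall>i\<ge>I. \<forall>f\<in>FilE 0. (T ^^ i) (PP f) \<in> FilE N" using growth_plus[of N] ..
    hence "(T ^^ I) (PP f) \<in> FilE N" using f by blast
    from unit_root_T_pow(2)[OF u this, of I] show "PP f \<in> FilE N" by simp
  qed
  have M0: "PM f = 0" if f: "f \<in> FilE 0" for f
  proof (rule E.Fil_sep)
    fix N
    obtain I where "\<forall>i\<ge>I. \<forall>f\<in>FilE 0. (T' ^^ i) (PM f) \<in> FilE N" using growth_minus[of N] ..
    hence "(T' ^^ I) (PM f) \<in> FilE N" using f by blast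
    from unit_root_T_pow(1)[OF u this, of I] show "PM f \<in> FilE N" by simp
  qed
  have z: "0 \<in> OP" "0 \<in> OM" "0 \<in> OZ"
    using end_int.subspace_0[OF OP_int] end_int.subspace_0[OF OM_int] end_int.subspace_0[OF OZ_int] by auto
  have "f \<in> OH" if f: "f \<in> FilE 0" for f
  proof -
    have fE: "f \<in> End_space" by (rule FilE_End[OF f])
    have fz: "PZ f = f" using P_sum[OF fE] P0[OF f] M0[OF f] by simp
    have "f \<in> OZ" unfolding OZ_def using PR_VR[OF fE, of "\<lambda>l m. l = m"] unit_root_T_pow[OF u f] unfolding fz by blast
    thus ?thesis unfolding OH_iff P0[OF f] M0[OF f] fz using fE z by blast
  qed
  thus "FilE 0 = OH" using OH_FilE by blast
  show "OP = {0}"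
  proof -
    have "f = 0" if "f \<in> OP" for f using VR_PR[OF OP_D(1)[OF that]] P0[OF OP_D(2)[OF that]] by simp
    thus ?thesis using z by blast
  qed
  show "OM = {0}"
  proof -
    have "f = 0" if "f \<in> OM" for f using VR_PR[OF OM_D(1)[OF that]] M0[OF OM_D(2)[OF that]] by simp
    thus ?thesis using z by blast
  qed
qed

lemma unit_root_shift:
  assumes u: "unit_root s" defines "\<psi> \<equiv> \<lambda>x. sh (- s) (\<phi> x)"
  shows "semi \<psi>" "\<And>x n. \<psi> x \<in> Fil n \<longleftrightarrow> x \<in> Fil n"
proof -
  show iff: "\<psi> x \<in> Fil n \<longleftrightarrow> x \<in> Fil n" for x n
    unfolding \<psi>_def Fil_shift_iff using unit_root_iff[OF u, of x n] by simp
  show "semi \<psi>" unfolding semi_def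
    using iff by (auto simp: \<psi>_def phi_add phi_scale sh_add sh_scale)
qed

text \<open>Both \<psi> and h \<psi> have a basis of fixed vectors modulo \<epsilon>. The g carrying
  the second basis to the first solves the equation modulo \<epsilon>, and \<open>iso_prop 1\<close>
  finishes.\<close>

lemma unit_root_iso_prop:
  assumes u: "unit_root s" shows "iso_prop 0"
  unfolding iso_prop_def
proof (intro ballI impI)
  fix h assume h: "h \<in> GLM"
  define \<psi> where "\<psi> = (\<lambda>x. sh (- s) (\<phi> x))"
  have sp: "semi \<psi>" and iff: "\<And>x n. \<psi> x \<in> Fil n \<longleftrightarrow> x \<in> Fil n" unfolding \<psi>_def using unit_root_shift[OF u] by auto
  have sh: "semi (\<lambda>x. h (\<psi> x))" by (rule semi_comp_GLM[OF sp h])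
  obtain u1 where u1: "u1 \<in> GLM" "\<forall>b\<in>B. \<psi> (u1 b) - u1 b \<in> Fil 1" using semi_fixed_basis[OF sp] iff by blast
  have "\<exists>u\<in>GLM. \<forall>b\<in>B. h (\<psi> (u b)) - u b \<in> Fil 1"
    by (rule semi_fixed_basis[OF sh]) (simp add: GLM_Fil_iff[OF h] iff)
  then obtain u2 where u2: "u2 \<in> GLM" "\<forall>b\<in>B. h (\<psi> (u2 b)) - u2 b \<in> Fil 1" by blast
  obtain v where v: "v \<in> GLM" "u2 \<circ> v = id" "v \<circ> u2 = id" by (rule GLM_inv[OF u2(1)])
  define g where "g = u1 \<circ> v"
  have g: "g \<in> GLM" unfolding g_def by (rule GLM_comp[OF u1(1) v(1)])
  have gE: "g \<in> End_space" and hE: "h \<in> End_space" by (rule GLM_End[OF g], rule GLM_End[OF h])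
  obtain g' where g': "g' \<in> GLM" "g \<circ> g' = id" "g' \<circ> g = id" by (rule GLM_inv[OF g])
  have "T g \<circ> T g' = id" "T g' \<circ> T g = id" unfolding T_comp[symmetric] g' by simp_all
  hence Tg: "T g \<in> GLM" unfolding GLM_def
    using unit_root_T(1)[OF u GLM_FilE[OF g]] unit_root_T(1)[OF u GLM_FilE[OF g'(1)]] by blast
  have gu: "g (u2 b) = u1 b" for b
    using v(3) unfolding g_def by (metis comp_apply id_apply)
  \<comment> \<open>The defect of the equation for g. It is semilinear, so it needs to be small only
    on the basis u2 b.\<close>
  define \<delta> where "\<delta> x = \<psi> (g x) - g (h (\<psi> x))" for x
  have dadd: "\<delta> (x + y) = \<delta> x + \<delta> y" for x y unfolding \<delta>_def
    by (simp add: End_add_apply[OF gE] End_add_apply[OF hE] semi_add[OF sp])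
  have dsc: "\<delta> (scale c x) = scale (\<sigma> c) (\<delta> x)" for c x unfolding \<delta>_def
    by (simp add: End_scale_apply[OF gE] End_scale_apply[OF hE] semi_scale[OF sp] scale_right_diff_distrib)
  have d0: "\<delta> 0 = 0" using dadd[of 0 0] by simp
  have dsum: "\<delta> (\<Sum>i\<in>A. f i) = (\<Sum>i\<in>A. \<delta> (f i))" for A and f :: "'v \<Rightarrow> 'v"
    by (induction A rule: infinite_finite_induct) (simp_all add: d0 dadd)
  have db: "\<delta> (u2 b) \<in> Fil 1" if b: "b \<in> B" for b
  proof -
    have "h (\<psi> (u2 b)) - u2 b \<in> Fil 1" using u2(2) b by blast
    hence "g (h (\<psi> (u2 b)) - u2 b) \<in> Fil 1" using GLM_Fil_iff[OF g] by blast
    moreover have "\<psi> (u1 b) - u1 b \<in> Fil 1" using u1(2) b by blast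
    ultimately have "(\<psi> (u1 b) - u1 b) - g (h (\<psi> (u2 b)) - u2 b) \<in> Fil 1" by (rule Fil_diff[rotated])
    thus ?thesis unfolding \<delta>_def gu End_diff_apply[OF gE] by simp
  qed
  have dF: "\<delta> x \<in> Fil 1" if x: "x \<in> Fil 0" for x
  proof -
    define x' where "x' = v x"
    have x': "x' \<in> Fil 0" unfolding x'_def using GLM_Fil_iff[OF v(1)] x by blast
    have "x = u2 x'" using v(2) unfolding x'_def by (metis comp_apply id_apply)
    also have "\<dots> = (\<Sum>b\<in>B. scale (cf x' b) (u2 b))" by (rule End_expand[OF GLM_End[OF u2(1)]])
    finally have "\<delta> x = (\<Sum>b\<in>B. scale (\<sigma> (cf x' b)) (\<delta> (u2 b)))" by (simp add: dsum dsc)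
    also have "\<dots> \<in> Fil 1"
    proof (rule Fil_sum)
      fix b assume b: "b \<in> B"
      have "fls_ge 0 (\<sigma> (cf x' b))" using x' b unfolding Fil_def sigma_ge by simp
      from Fil_mult[OF this db[OF b]] show "scale (\<sigma> (cf x' b)) (\<delta> (u2 b)) \<in> Fil 1" by simp
    qed
    finally show ?thesis .
  qed
  have e: "(g \<circ> h) - T g \<in> FilE 1"
  proof (rule FilE_I)
    show "(g \<circ> h) - T g \<in> End_space" by (intro End_diff End_comp gE hE T_End)
    fix y assume y: "y \<in> Fil 0"
    define x where "x = \<phi>' (sh s y)"
    have px: "\<psi> x = y" unfolding \<psi>_def x_def by simp
    have x: "x \<in> Fil 0" using iff[of x 0] px y by simp
    have "\<phi>' y = sh (- s) x" unfolding x_def phi'_sh by simp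
    hence "T g y = \<psi> (g x)" unfolding T_apply \<psi>_def by (simp add: End_sh_apply[OF gE] phi_sh)
    hence "((g \<circ> h) - T g) y = - \<delta> x" unfolding \<delta>_def px by (simp add: fun_applies comp_apply)
    thus "((g \<circ> h) - T g) y \<in> Fil 1" using Fil_neg[OF dF[OF x]] by simp
  qed
  obtain h1 w where h1: "h1 \<in> GLM" "h1 \<circ> T g = g \<circ> h" "w \<in> GLM" "h1 - id = ((g \<circ> h) - T g) \<circ> w"
    by (rule gauge_step[OF h g Tg])
  have "h1 - id \<in> FilE 1" unfolding h1(4) by (rule FilE_comp0'[OF e GLM_FilE[OF h1(3)]])
  moreover have "iso_prop 1"
    using iso_prop_iff_level[of 1] unit_root_level(1)[OF u] E.Fil_mono[of 0 1] by simp
  ultimately obtain g1 where g1: "g1 \<in> GLM" "T g1 = g1 \<circ> h1" unfolding iso_prop_def using h1(1) by blast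
  have "T (g1 \<circ> g) = g1 \<circ> (h1 \<circ> T g)" unfolding T_comp g1(2) by (simp add: comp_assoc)
  hence "T (g1 \<circ> g) = (g1 \<circ> g) \<circ> h" unfolding h1(2) by (simp add: comp_assoc)
  thus "\<exists>g\<in>GLM. T g = g \<circ> h" using GLM_comp[OF g1(1) g] by blast
qed

text \<open>Some coordinate of x has valuation exactly n; dividing by it gives the map v \<mapsto>
  (v_b / x_b) y, which is integral.\<close>

lemma transitive:
  assumes x: "x \<in> Fil n" "x \<notin> Fil (n + 1)" and y: "y \<in> Fil n"
  obtains f where "f \<in> FilE 0" "f x = y"
proof -
  obtain b where b: "b \<in> B" "fls_ge n (cf x b)" "\<not> fls_ge (n + 1) (cf x b)" using x unfolding Fil_def by blast
  have c: "cf x b \<noteq> 0" "fls_subdegree (cf x b) = n" using b(2,3) unfolding fls_ge_iff_subdegree by auto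
  define f where "f v = scale (cf v b / cf x b) y" for v
  have fE: "f \<in> End_space"
    by (rule End_I) (simp_all add: f_def cf_add cf_scale add_divide_distrib scale_left_distrib)
  have "f \<in> FilE 0"
  proof (rule FilE_I[OF fE])
    fix v assume "v \<in> Fil 0"
    hence "fls_ge 0 (cf v b)" using b(1) unfolding Fil_def by blast
    hence "fls_ge (- n) (cf v b / cf x b)" using c unfolding fls_ge_iff_subdegree
      by (cases "cf v b = 0") (auto simp: fls_divide_subdegree)
    from Fil_mult[OF this y] show "f v \<in> Fil 0" unfolding f_def by simp
  qed
  moreover have "f x = y" unfolding f_def using c(1) by simp
  ultimately show thesis by (rule that)
qed

lemma max_Fil:
  assumes "B \<noteq> {}" obtains s where "\<phi> ` Fil 0 \<subseteq> Fil s" "\<not> \<phi> ` Fil 0 \<subseteq> Fil (s + 1)"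
proof -
  obtain b where b: "b \<in> B" using assms by blast
  have "b \<noteq> 0" using b indep_B dependent_zero by blast
  hence "\<phi> b \<noteq> 0" by (simp add: phi_eq_0)
  then obtain n where "\<phi> b \<notin> Fil n" using Fil_sep by blast
  hence "\<phi> b \<notin> Fil (int (nat n))" using Fil_monoD[of "\<phi> b" "int (nat n)" n] by auto
  hence "\<not> \<phi> ` Fil 0 \<subseteq> Fil (int (nat n))" using basis_Fil[OF b] by blast
  then obtain k where k: "\<forall>i\<le>k. \<not> \<not> \<phi> ` Fil 0 \<subseteq> Fil (int i)" "\<not> \<phi> ` Fil 0 \<subseteq> Fil (int (Suc k))"
    using ex_least_nat_less[of "\<lambda>k. \<not> \<phi> ` Fil 0 \<subseteq> Fil (int k)" "nat n"] phi_Fil0 by auto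
  show thesis by (rule that[of "int k"]) (use k in \<open>auto simp: add.commute\<close>)
qed

text \<open>The zero module is set apart because its image under \<phi> lies in every Fil s, so no
  largest s exists.\<close>

lemma trivial_unit_root: "B = {} \<Longrightarrow> unit_root 0"
  unfolding unit_root_def Fil_def using bij_is_surj[OF phi_bij] by simp

text \<open>Choose x in M with \<phi> x of the least valuation s. Any y in Fil s is f (\<phi> x) for
  an integral f, and then y = \<phi> (T' f x) with T' f x in M.\<close>

lemma stable_unit_root:
  assumes "\<And>f. f \<in> FilE 0 \<Longrightarrow> T' f \<in> FilE 0"
  shows "\<exists>s. unit_root s"
proof (cases "B = {}")
  case True thus ?thesis using trivial_unit_root by blast
next
  case False
  then obtain s where s: "\<phi> ` Fil 0 \<subseteq> Fil s" "\<not> \<phi> ` Fil 0 \<subseteq> Fil (s + 1)" by (rule max_Fil)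
  then obtain x where x: "x \<in> Fil 0" "\<phi> x \<notin> Fil (s + 1)" by blast
  have "y \<in> \<phi> ` Fil 0" if y: "y \<in> Fil s" for y
  proof -
    have px: "\<phi> x \<in> Fil s" using s(1) x(1) by blast
    obtain f where f: "f \<in> FilE 0" "f (\<phi> x) = y" by (rule transitive[OF px x(2) y])
    have "T' f x \<in> Fil 0" using FilE_apply[OF assms[OF f(1)] x(1)] by simp
    moreover have "\<phi> (T' f x) = y" unfolding T'_apply by (simp add: f(2))
    ultimately show ?thesis by blast
  qed
  thus ?thesis unfolding unit_root_def using s(1) by blast
qed

end

section \<open>Topological nilpotence\<close>

context based_space
begin

lemma pw_list: "x \<in> pw A n \<Longrightarrow> \<exists>fs. set fs \<subseteq> A \<and> length fs = n \<and> x = foldr (\<circ>) fs id"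
proof (induction n arbitrary: x)
  case (Suc n)
  from Suc.prems obtain a b where ab: "x = a \<circ> b" "a \<in> A" "b \<in> pw A n" by (rule pw_SucE)
  from Suc.IH[OF ab(3)] obtain fs where "set fs \<subseteq> A" "length fs = n" "b = foldr (\<circ>) fs id" by blast
  moreover have "foldr (\<circ>) (a # fs) id = a \<circ> foldr (\<circ>) fs id" unfolding foldr.simps comp_apply ..
  ultimately show ?case using ab by (intro exI[of _ "a # fs"] conjI) (simp_all only: set_simps list.size, auto)
qed simp

lemma topologically_nilpotent_pw:
  assumes "topologically_nilpotent (FilE 0) A"
  shows "\<exists>N. \<forall>n\<ge>N. pw A n \<subseteq> FilE 1"
proof -
  obtain N where N: "\<forall>fs. set fs \<subseteq> A \<and> length fs \<ge> N \<longrightarrow> foldr (\<circ>) fs id \<in> eps_mult 1 (FilE 0)"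
    using assms unfolding topologically_nilpotent_def by blast
  have "pw A n \<subseteq> FilE 1" if "n \<ge> N" for n
  proof
    fix x assume "x \<in> pw A n"
    from pw_list[OF this] obtain fs where "set fs \<subseteq> A" "length fs = n" "x = foldr (\<circ>) fs id" by blast
    hence "x \<in> eps_mult 1 (FilE 0)" using N that by blast
    thus "x \<in> FilE 1" unfolding eps_mult_eq by simp
  qed
  thus ?thesis by blast
qed

lemma topologically_nilpotent_zero: "topologically_nilpotent (FilE 0) {0}"
  unfolding topologically_nilpotent_def
proof (intro allI exI[of _ 1] impI)
  fix m and fs :: "('v \<Rightarrow> 'v) list" assume "set fs \<subseteq> {0} \<and> 1 \<le> length fs"
  then obtain gs where "fs = 0 # gs" by (cases fs) auto
  hence "foldr (\<circ>) fs id = 0 \<circ> foldr (\<circ>) gs id" by (simp only: foldr.simps comp_apply)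
  hence "foldr (\<circ>) fs id = 0" by (simp only: zero_comp)
  thus "foldr (\<circ>) fs id \<in> eps_mult m (FilE 0)" unfolding eps_mult_eq by simp
qed

end

context crystal
begin

text \<open>Left multiplication by x turns a word of length k into a sum of words of lengths k + 2
  and k + 1, so the minimal length increases with each factor.\<close>

lemma word_span_comp:
  assumes x: "x \<in> End_space" "x = u + v" "u \<in> pw A 2" "v \<in> pw A 1"
    and y: "y \<in> E.k.span (\<Union>k\<in>{n..}. pw A k)"
  shows "x \<circ> y \<in> E.k.span (\<Union>k\<in>{Suc n..}. pw A k)" (is "_ \<in> ?S")
proof -
  have "E.k.subspace {y. x \<circ> y \<in> ?S}"
    by (rule E.k.subspaceI)
      (simp_all add: comp_zero[OF x(1)] comp_add[OF x(1)] comp_ks[OF x(1)] E.k.span_zero E.k.span_add E.k.span_scale)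
  moreover have "(\<Union>k\<in>{n..}. pw A k) \<subseteq> {y. x \<circ> y \<in> ?S}"
  proof
    fix y assume "y \<in> (\<Union>k\<in>{n..}. pw A k)"
    then obtain k where k: "k \<ge> n" "y \<in> pw A k" by auto
    have "u \<circ> y \<in> ?S" by (rule E.k.span_base, rule UN_I[of "2 + k"], use k(1) in simp, rule pw_add[OF x(3) k(2)])
    moreover have "v \<circ> y \<in> ?S" by (rule E.k.span_base, rule UN_I[of "1 + k"], use k(1) in simp, rule pw_add[OF x(4) k(2)])
    ultimately have "x \<circ> y \<in> ?S" unfolding x(2) add_comp by (rule E.k.span_add)
    thus "y \<in> {y. x \<circ> y \<in> ?S}" by simp
  qed
  ultimately have "E.k.span (\<Union>k\<in>{n..}. pw A k) \<subseteq> {y. x \<circ> y \<in> ?S}" by (intro E.k.span_minimal)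
  thus ?thesis using y by blast
qed

abbreviation "OPM \<equiv> {a + c |a c. a \<in> OP \<and> c \<in> OM}"

text \<open>If \<open>f\<close> maps \<open>y\<close> to a primitive vector, choose an integral \<open>h\<close> with \<open>h (f y) = y\<close>: the powers of \<open>h \<circ> f\<close>
  fix \<open>y\<close>, but they are sums of long words in \<open>OPM\<close>.\<close>

lemma nilpotent_vanish:
  assumes H: "FilE 0 = OH" and nil: "topologically_nilpotent (FilE 0) OPM"
    and f: "f \<in> VP \<or> f \<in> VM" shows "f = 0"
proof (rule ccontr)
  assume "f \<noteq> 0"
  have fE: "f \<in> End_space" using f VR_End by blast
  obtain n1 where n1: "f \<in> FilE n1" using FilE_exhaust[OF fE] ..
  obtain n2 where n2: "f \<notin> FilE n2" using E.Fil_sep \<open>f \<noteq> 0\<close> by blast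
  have "\<not> f \<in> FilE (n1 + int (nat (n2 - n1)))" using n2 E.Fil_monoD[of f "n1 + int (nat (n2 - n1))" n2] by auto
  then obtain k where k: "\<forall>i\<le>k. \<not> \<not> f \<in> FilE (n1 + int i)" "\<not> f \<in> FilE (n1 + int (Suc k))"
    using ex_least_nat_less[of "\<lambda>k. \<not> f \<in> FilE (n1 + int k)" "nat (n2 - n1)"] n1 by auto
  \<comment> \<open>The exact power of \<epsilon> dividing f; after division the map is integral and
    nonzero modulo \<epsilon>.\<close>
  define n where "n = n1 + int k"
  have fn: "f \<in> FilE n" "f \<notin> FilE (n + 1)" using k(1)[rule_format, of k] k(2) unfolding n_def by (simp_all add: algebra_simps)
  define g where "g = E.sh (- n) f"
  have g: "g \<in> FilE 0" "g \<notin> FilE 1" unfolding g_def E.Fil_shift_iff using fn by (simp_all add: add.commute)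
  have gV: "g \<in> VP \<or> g \<in> VM" unfolding g_def E.sh_def using f endo.subspace_scale[OF VR_subspace] by blast
  have P: "x \<in> OP" if "x \<in> FilE 0" "x \<in> VP" for x
    using that(1) unfolding H OH_iff VR_PR[OF that(2)] by blast
  have M: "x \<in> OM" if "x \<in> FilE 0" "x \<in> VM" for x
    using that(1) unfolding H OH_iff VR_PR[OF that(2)] by blast
  have z: "0 \<in> OP" "0 \<in> OM" using end_int.subspace_0[OF OP_int] end_int.subspace_0[OF OM_int] by auto
  have A: "x \<in> OPM" if "x \<in> FilE 0" "x \<in> VP \<or> x \<in> VM" for x
    using that(2)
  proof
    assume "x \<in> VP"
    hence "x + 0 \<in> OPM" using P[OF that(1)] z by blast
    thus ?thesis by simp
  next
    assume "x \<in> VM"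
    hence "0 + x \<in> OPM" using M[OF that(1)] z by blast
    thus ?thesis by simp
  qed
  obtain y where y: "y \<in> Fil 0" "g y \<notin> Fil 1" using g FilE_I[OF FilE_End[OF g(1)], of 1] by blast
  have gy: "g y \<in> Fil 0" using FilE_apply[OF g(1) y(1)] by simp
  obtain h where h: "h \<in> FilE 0" "h (g y) = y" by (rule transitive[of "g y" 0 y]) (use gy y in auto)
  have hE: "h \<in> End_space" by (rule FilE_End[OF h(1)])
  have hO: "PP h \<in> OP" "PZ h \<in> OZ" "PM h \<in> OM" using h(1) unfolding H OH_iff by auto
  \<comment> \<open>Only part of h lies in \<open>OPM\<close>. That part composed with g is a word
    of length two, while the slope-zero part composed with g stays in V_+ or V_- and is a word of
    length one.\<close>
  define u where "u = (PP h + PM h) \<circ> g"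
  define v where "v = PZ h \<circ> g"
  define x where "x = h \<circ> g"
  have xE: "x \<in> End_space" unfolding x_def by (intro End_comp hE FilE_End[OF g(1)])
  have "h = (PP h + PM h) + PZ h" using P_sum[OF hE] by (simp add: add.assoc add.commute add.left_commute)
  hence xuv: "x = u + v" unfolding x_def u_def v_def add_comp[symmetric] by simp
  have gA: "g \<in> OPM" by (rule A[OF g(1) gV])
  have "v \<in> FilE 0" unfolding v_def by (rule FilE_comp0[OF OZ_D(2)[OF hO(2)] g(1)])
  moreover have "v \<in> VP \<or> v \<in> VM" using gV unfolding v_def
  proof
    assume "g \<in> VP"
    hence "PZ h \<circ> g \<in> VP" by (rule VR_comp[OF OZ_D(1)[OF hO(2)]]) simp
    thus "PZ h \<circ> g \<in> VP \<or> PZ h \<circ> g \<in> VM" ..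
  next
    assume "g \<in> VM"
    hence "PZ h \<circ> g \<in> VM" by (rule VR_comp[OF OZ_D(1)[OF hO(2)]]) simp
    thus "PZ h \<circ> g \<in> VP \<or> PZ h \<circ> g \<in> VM" ..
  qed
  ultimately have "v \<in> OPM" by (rule A)
  hence v1: "v \<in> pw OPM 1" using pw_SucI[of v OPM id 0] by simp
  have "PP h + PM h \<in> OPM" using hO by blast
  hence u2: "u \<in> pw OPM 2" unfolding u_def using pw_SucI[OF _ pw_SucI[OF gA, of id 0]] by (simp add: numeral_2_eq_2)
  have xn: "x ^^ n \<in> E.k.span (\<Union>k\<in>{n..}. pw OPM k)" for n
  proof (induction n)
    case 0
    have "id \<in> (\<Union>k\<in>{0..}. pw OPM k)" by (rule UN_I[of 0]) simp_all
    thus ?case using E.k.span_base by (simp add: id_def)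
  next
    case (Suc n)
    show ?case unfolding funpow.simps by (rule word_span_comp[OF xE xuv u2 v1 Suc])
  qed
  obtain N where N: "\<forall>n\<ge>N. pw OPM n \<subseteq> FilE 1" using topologically_nilpotent_pw[OF nil] ..
  have "E.k.span (\<Union>k\<in>{N..}. pw OPM k) \<subseteq> FilE 1"
    by (rule E.k.span_minimal[OF _ E.Fil_k]) (use N in blast)
  hence "x ^^ N \<in> FilE 1" using xn by blast
  hence "(x ^^ N) y \<in> Fil 1" using FilE_apply[of "x ^^ N" 1 y 0] y(1) by simp
  moreover have "(x ^^ n) y = y" for n by (induction n) (simp_all add: comp_apply x_def h(2))
  ultimately have "y \<in> Fil 1" by simp
  hence "g y \<in> Fil 1" using FilE_apply[OF g(1), of y 1] by simp
  thus False using y(2) by blast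
qed

lemma nilpotent_unit_root:
  assumes H: "FilE 0 = OH" and nil: "topologically_nilpotent (FilE 0) OPM"
  shows "\<exists>s. unit_root s"
proof (rule stable_unit_root)
  fix f assume f: "f \<in> FilE 0"
  have fE: "f \<in> End_space" by (rule FilE_End[OF f])
  have "PP f = 0" "PM f = 0" using nilpotent_vanish[OF assms] PR_VR[OF fE] by blast+
  hence "f = PZ f" using P_sum[OF fE] by simp
  moreover have "PZ f \<in> OZ" using f unfolding H OH_iff by blast
  ultimately show "T' f \<in> FilE 0" using OZ_D(2)[OF T'_OZ] by simp
qed

text \<open>A conjugation invariant of \<open>\<theta>\<close> modulo \<open>\<epsilon>\<close>. Unless \<open>\<psi>\<close> is zero or injective modulo \<open>\<epsilon>\<close>, it is not
  constant among the maps \<open>h \<circ> \<psi>\<close>.\<close>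

definition step_kernel :: "('v \<Rightarrow> 'v) \<Rightarrow> bool" where
  "step_kernel \<theta> \<longleftrightarrow> (\<exists>u\<in>Fil 0. \<theta> u \<notin> Fil 1 \<and> \<theta> (\<theta> u) \<in> Fil 1)"

lemma step_kernel_conj:
  assumes g: "g \<in> GLM" and c: "\<And>x. \<theta> (g x) = g (\<eta> x)" and e: "step_kernel \<eta>" shows "step_kernel \<theta>"
proof -
  obtain u where u: "u \<in> Fil 0" "\<eta> u \<notin> Fil 1" "\<eta> (\<eta> u) \<in> Fil 1" using e unfolding step_kernel_def by blast
  have "g u \<in> Fil 0" "\<theta> (g u) \<notin> Fil 1" "\<theta> (\<theta> (g u)) \<in> Fil 1" unfolding c GLM_Fil_iff[OF g] using u by auto
  thus ?thesis unfolding step_kernel_def by blast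
qed

section \<open>The case m = 0: semilinear maps modulo \<epsilon>\<close>

context
  fixes \<psi> assumes semi: "semi \<psi>" and nonzero: "\<exists>u\<in>Fil 0. \<psi> u \<notin> Fil 1"
    and kernel: "\<exists>x\<in>Fil 0. \<psi> x \<in> Fil 1 \<and> x \<notin> Fil 1"
begin

text \<open>Take h sending a nonzero value of \<psi> modulo \<epsilon> to a nonzero kernel vector of
  \<psi> modulo \<epsilon>.\<close>

lemma step_kernel_exists: "\<exists>h\<in>GLM. step_kernel (\<lambda>x. h (\<psi> x))"
proof -
  obtain u0 where u0: "u0 \<in> Fil 0" "\<psi> u0 \<notin> Fil 1" using nonzero by blast
  obtain x0 where x0: "x0 \<in> Fil 0" "\<psi> x0 \<in> Fil 1" "x0 \<notin> Fil 1" using kernel by blast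
  define w where "w = c0 (\<psi> u0)"
  define v where "v = c0 x0"
  have w0: "w \<noteq> 0" unfolding w_def using u0 Fil1_iff_c0[OF semi_Fil0[OF semi u0(1)]] by simp
  have v0: "v \<noteq> 0" unfolding v_def using x0 Fil1_iff_c0 by blast
  obtain h where h: "h \<in> GLM" "\<And>a. a \<in> {w} \<Longrightarrow> h a = v"
    by (rule GLM_extension[of "{w}" "\<lambda>_. v"])
      (use w0 v0 c0_in in \<open>auto simp: w_def v_def k.dependent_single\<close>)
  have hE: "h \<in> End_space" by (rule GLM_End[OF h(1)])
  have hw: "h w = v" using h(2) by simp
  have "\<psi> u0 - w \<in> Fil 1" unfolding w_def by (rule c0_approx[OF semi_Fil0[OF semi u0(1)]])
  hence "h (\<psi> u0 - w) \<in> Fil 1" using GLM_Fil_iff[OF h(1)] by blast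
  hence d: "h (\<psi> u0) - v \<in> Fil 1" unfolding End_diff_apply[OF hE] hw .
  have v1: "v \<notin> Fil 1"
  proof
    assume "v \<in> Fil 1"
    from Fil_add[OF c0_approx[OF x0(1)] this[unfolded v_def]] show False using x0(3) by simp
  qed
  have 1: "h (\<psi> u0) \<notin> Fil 1"
  proof
    assume "h (\<psi> u0) \<in> Fil 1"
    from Fil_diff[OF this d] show False using v1 by simp
  qed
  have "\<psi> (h (\<psi> u0)) - \<psi> v \<in> Fil 1" using semi_Fil[OF semi d] unfolding semi_diff[OF semi] .
  moreover have "\<psi> x0 - \<psi> v \<in> Fil 1" unfolding v_def by (rule semi_mod[OF semi x0(1)])
  hence "\<psi> v \<in> Fil 1" using Fil_diff[OF x0(2)] by fastforce
  ultimately have "\<psi> (h (\<psi> u0)) - \<psi> v + \<psi> v \<in> Fil 1" by (rule Fil_add)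
  hence "h (\<psi> (h (\<psi> u0))) \<in> Fil 1" using GLM_Fil_iff[OF h(1)] by simp
  thus ?thesis unfolding step_kernel_def using u0(1) 1 h(1) by blast
qed

text \<open>Let A be a basis of a complement of the kernel modulo \<epsilon>. If h sends each \<psi>
  a back to a, the image of h \<psi> modulo \<epsilon> is spanned by A, where h \<psi> is
  injective.\<close>

lemma step_kernel_avoidable: "\<exists>h\<in>GLM. \<not> step_kernel (\<lambda>x. h (\<psi> x))"
proof -
  interpret K: frobenius_map ks q "\<lambda>v. c0 (\<psi> v)" by (rule semi_frobenius[OF semi])
  define Kr where "Kr = {x \<in> k.span B. c0 (\<psi> x) = 0}"
  obtain Z where Z: "Z \<subseteq> Kr" "k.independent Z" "Kr \<subseteq> k.span Z" by (rule k.maximal_independent_subset)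
  have "Z \<subseteq> k.span B" using Z(1) unfolding Kr_def by blast
  then obtain Z' where Z': "Z \<subseteq> Z'" "k.independent Z'" "k.span Z' = k.span B" "finite Z'"
    by (rule kspan_basis_extend[OF Z(2)])
  define A where "A = Z' - Z"
  have fin: "finite A" "finite Z" "Z' = Z \<union> A" "Z \<inter> A = {}" unfolding A_def using Z'(1,4) finite_subset by auto
  have AB: "a \<in> k.span B" if "a \<in> Z'" for a using k.span_base[OF that] unfolding Z'(3) .
  have indep: "d a = 0" if "(\<Sum>a\<in>Z'. ks (d a) a) = 0" "a \<in> Z'" for d a
    using k.independentD[OF Z'(2,4) subset_refl that] .
  have fam: "c a = 0" if c: "(\<Sum>i\<in>A. ks (c i) (c0 (\<psi> i))) = 0" and a: "a \<in> A" for c a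
  proof -
    have "\<forall>i. \<exists>d. d ^ q = c i" using frob_root[OF q] by blast
    from choice[OF this] obtain d where d: "\<forall>i. d i ^ q = c i" by (elim exE)
    define y where "y = (\<Sum>i\<in>A. ks (d i) i)"
    have "c0 (\<psi> y) = 0" unfolding y_def K.T_sum K.T_scale using c d by simp
    moreover have "y \<in> k.span B" unfolding y_def using AB fin(3) by (intro k.span_sum k.span_scale) auto
    ultimately have "y \<in> k.span Z" using Z(3) unfolding Kr_def by blast
    then obtain e where e: "y = (\<Sum>z\<in>Z. ks (e z) z)" unfolding k.span_finite[OF fin(2)] by blast
    have "(\<Sum>i\<in>Z'. ks (if i \<in> A then d i else - e i) i) =
      (\<Sum>i\<in>Z. ks (if i \<in> A then d i else - e i) i) + (\<Sum>i\<in>A. ks (if i \<in> A then d i else - e i) i)"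
      unfolding fin(3) by (rule sum.union_disjoint[OF fin(2,1,4)])
    also have "(\<Sum>i\<in>Z. ks (if i \<in> A then d i else - e i) i) = - y"
      unfolding e sum_negf[symmetric] by (rule sum.cong) (use fin(4) in auto)
    also have "(\<Sum>i\<in>A. ks (if i \<in> A then d i else - e i) i) = y" unfolding y_def by (rule sum.cong) auto
    finally have "(\<Sum>i\<in>Z'. ks (if i \<in> A then d i else - e i) i) = 0" by simp
    from indep[OF this, of a] have "d a = 0" using a fin(3) by simp
    thus ?thesis using d frob_q_gt_1[OF q] by (metis frob_eq_0[OF q])
  qed
  have inj: "inj_on (\<lambda>a. c0 (\<psi> a)) A" by (rule k.independent_family(1)[OF fin(1)]) (erule fam, assumption)
  have ind: "k.independent ((\<lambda>a. c0 (\<psi> a)) ` A)" by (rule k.independent_family(2)[OF fin(1)]) (erule fam, assumption)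
  define f where "f = inv_into A (\<lambda>a. c0 (\<psi> a))"
  have fA: "f (c0 (\<psi> a)) = a" if "a \<in> A" for a unfolding f_def by (rule inv_into_f_f[OF inj that])
  have fim: "f ` (\<lambda>a. c0 (\<psi> a)) ` A = A" unfolding image_image using fA by simp
  obtain h where h: "h \<in> GLM" "\<And>a. a \<in> (\<lambda>a. c0 (\<psi> a)) ` A \<Longrightarrow> h a = f a"
  proof (rule GLM_extension[OF ind])
    show "(\<lambda>a. c0 (\<psi> a)) ` A \<subseteq> k.span B" using c0_in by blast
    show "inj_on f ((\<lambda>a. c0 (\<psi> a)) ` A)" unfolding f_def by (rule inj_on_inv_into) simp
    show "k.independent (f ` (\<lambda>a. c0 (\<psi> a)) ` A)" unfolding fim
      by (rule k.independent_mono[OF Z'(2)]) (simp add: A_def)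
    show "f ` (\<lambda>a. c0 (\<psi> a)) ` A \<subseteq> k.span B" unfolding fim using AB fin(3) by blast
  qed (rule that)
  have hE: "h \<in> End_space" by (rule GLM_End[OF h(1)])
  define \<theta> where "\<theta> x = h (\<psi> x)" for x
  have s\<theta>: "semi \<theta>" unfolding \<theta>_def by (rule semi_comp_GLM[OF semi h(1)])
  have \<theta>Z: "\<theta> z \<in> Fil 1" if "z \<in> Z" for z
  proof -
    have "z \<in> Fil 0" "c0 (\<psi> z) = 0" using Z(1) that kspan_Fil unfolding Kr_def by auto
    hence "\<psi> z \<in> Fil 1" using Fil1_iff_c0[OF semi_Fil0[OF semi]] by blast
    thus ?thesis unfolding \<theta>_def using GLM_Fil_iff[OF h(1)] by blast
  qed
  have \<theta>A: "\<theta> a - a \<in> Fil 1" if a: "a \<in> A" for a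
  proof -
    have "a \<in> Fil 0" using AB[of a] a fin(3) kspan_Fil by blast
    hence "\<psi> a - c0 (\<psi> a) \<in> Fil 1" by (intro c0_approx semi_Fil0[OF semi])
    hence "h (\<psi> a - c0 (\<psi> a)) \<in> Fil 1" using GLM_Fil_iff[OF h(1)] by blast
    moreover have "h (c0 (\<psi> a)) = a" using h(2) fA a by simp
    ultimately show ?thesis unfolding \<theta>_def End_diff_apply[OF hE] by simp
  qed
  have red: "\<theta> (\<Sum>x\<in>Z'. ks (e x) x) - (\<Sum>a\<in>A. ks (e a ^ q) a) \<in> Fil 1" for e
  proof -
    have "\<theta> (\<Sum>x\<in>Z'. ks (e x) x) = (\<Sum>x\<in>Z. ks (e x ^ q) (\<theta> x)) + (\<Sum>x\<in>A. ks (e x ^ q) (\<theta> x))"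
      unfolding semi_sum[OF s\<theta>] semi_ks[OF s\<theta>] fin(3) by (rule sum.union_disjoint[OF fin(2,1,4)])
    hence "\<theta> (\<Sum>x\<in>Z'. ks (e x) x) - (\<Sum>a\<in>A. ks (e a ^ q) a) =
      (\<Sum>x\<in>Z. ks (e x ^ q) (\<theta> x)) + (\<Sum>x\<in>A. ks (e x ^ q) (\<theta> x - x))"
      by (simp add: k.scale_right_diff_distrib sum_subtractf)
    also have "\<dots> \<in> Fil 1" by (intro Fil_add Fil_sum Fil_ks \<theta>Z \<theta>A)
    finally show ?thesis .
  qed
  have "\<not> step_kernel \<theta>"
  proof
    assume "step_kernel \<theta>"
    then obtain u where u: "u \<in> Fil 0" "\<theta> u \<notin> Fil 1" "\<theta> (\<theta> u) \<in> Fil 1" unfolding step_kernel_def by blast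
    have "c0 u \<in> k.span Z'" unfolding Z'(3) by (rule c0_in)
    then obtain e where e: "c0 u = (\<Sum>x\<in>Z'. ks (e x) x)" unfolding k.span_finite[OF Z'(4)] by blast
    \<comment> \<open>The coordinates of \<theta> u modulo Fil 1 with respect to Z'; those on the
      kernel part Z vanish.\<close>
    define e' where "e' x = (if x \<in> A then e x ^ q else 0)" for x
    define y1 where "y1 = (\<Sum>a\<in>A. ks (e a ^ q) a)"
    define y2 where "y2 = (\<Sum>a\<in>A. ks (e' a ^ q) a)"
    have "(\<Sum>x\<in>Z'. ks (e' x) x) = (\<Sum>x\<in>Z. ks (e' x) x) + (\<Sum>x\<in>A. ks (e' x) x)"
      unfolding fin(3) by (rule sum.union_disjoint[OF fin(2,1,4)])
    also have "(\<Sum>x\<in>Z. ks (e' x) x) = 0" by (rule sum.neutral) (use fin(4) in \<open>auto simp: e'_def\<close>)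
    also have "(\<Sum>x\<in>A. ks (e' x) x) = y1" unfolding y1_def by (rule sum.cong) (auto simp: e'_def)
    finally have y1: "(\<Sum>x\<in>Z'. ks (e' x) x) = y1" by simp
    have "(\<theta> u - \<theta> (c0 u)) + (\<theta> (c0 u) - y1) \<in> Fil 1"
      using semi_mod[OF s\<theta> u(1)] red[of e] unfolding e[symmetric] y1_def by (rule Fil_add)
    hence d1: "\<theta> u - y1 \<in> Fil 1" by simp
    have dA: "\<theta> y1 - y2 \<in> Fil 1" using red[of e'] unfolding y1 y2_def .
    have dB: "\<theta> (\<theta> u) - \<theta> y1 \<in> Fil 1" using semi_Fil[OF s\<theta> d1] unfolding semi_diff[OF s\<theta>] .
    have "\<theta> (\<theta> u) - ((\<theta> (\<theta> u) - \<theta> y1) + (\<theta> y1 - y2)) \<in> Fil 1" by (rule Fil_diff[OF u(3) Fil_add[OF dB dA]])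
    hence y2F: "y2 \<in> Fil 1" by simp
    have "y2 \<in> k.span B" unfolding y2_def using AB fin(3) by (intro k.span_sum k.span_scale) auto
    hence y20: "y2 = 0" using c0_Fil1[OF y2F] c0_span[of y2] by simp
    have "(\<Sum>x\<in>Z'. ks (e' x ^ q) x) = (\<Sum>x\<in>Z. ks (e' x ^ q) x) + y2"
      unfolding fin(3) y2_def by (rule sum.union_disjoint[OF fin(2,1,4)])
    also have "(\<Sum>x\<in>Z. ks (e' x ^ q) x) = 0"
      by (rule sum.neutral) (use fin(4) frob_q_gt_1[OF q] in \<open>auto simp: e'_def\<close>)
    finally have "(\<Sum>x\<in>Z'. ks (e' x ^ q) x) = 0" using y20 by simp
    from indep[OF this] have "e' x ^ q = 0" if "x \<in> Z'" for x using that .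
    hence "e' x = 0" if "x \<in> Z'" for x using that frob_eq_0[OF q, of "e' x"] by simp
    hence "y1 = 0" unfolding y1[symmetric] by (intro sum.neutral) simp
    thus False using d1 u(2) by simp
  qed
  thus ?thesis using h(1) unfolding \<theta>_def by blast
qed

end

text \<open>Dividing \<phi> by the largest possible \<epsilon>^s gives \<psi> nonzero modulo
  \<epsilon>. Level 0 makes every h \<psi> conjugate to \<psi>, so \<open>step_kernel\<close> must
  take the same value on all of them; hence \<psi> is injective modulo \<epsilon>, and therefore
  \<phi> M is all of \<epsilon>^s M.\<close>

lemma iso_prop_unit_root:
  assumes ip: "iso_prop 0" shows "\<exists>s. unit_root s"
proof (cases "B = {}")
  case True thus ?thesis using trivial_unit_root by blast
next
  case False
  then obtain s where s: "\<phi> ` Fil 0 \<subseteq> Fil s" "\<not> \<phi> ` Fil 0 \<subseteq> Fil (s + 1)" by (rule max_Fil)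
  define \<psi> where "\<psi> x = sh (- s) (\<phi> x)" for x
  have sp: "semi \<psi>" unfolding semi_def
    using s(1) by (auto simp: \<psi>_def phi_add phi_scale sh_add sh_scale Fil_shift_iff)
  have nz: "\<exists>u\<in>Fil 0. \<psi> u \<notin> Fil 1" using s(2) unfolding \<psi>_def Fil_shift_iff by (auto simp: add.commute)
  have conj: "\<exists>g\<in>GLM. \<forall>x. \<psi> (g x) = g (h (\<psi> x))" if h: "h \<in> GLM" for h
  proof -
    have "h - id \<in> FilE 0" by (rule E.Fil_diff[OF GLM_FilE[OF h] FilE_id])
    then obtain g where g: "g \<in> GLM" "T g = g \<circ> h" using ip h unfolding iso_prop_def by blast
    have "\<psi> (g x) = g (h (\<psi> x))" for x
    proof -
      have "\<phi> (g x) = T g (\<phi> x)" unfolding T_apply by simp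
      also have "\<dots> = g (h (\<phi> x))" unfolding g(2) comp_apply ..
      finally show ?thesis unfolding \<psi>_def
        by (simp add: End_sh_apply[OF GLM_End[OF g(1)]] End_sh_apply[OF GLM_End[OF h]])
    qed
    thus ?thesis using g(1) by blast
  qed
  have inj: "x \<in> Fil 1" if x: "x \<in> Fil 0" "\<psi> x \<in> Fil 1" for x
  proof (rule ccontr)
    assume "x \<notin> Fil 1"
    hence ker: "\<exists>x\<in>Fil 0. \<psi> x \<in> Fil 1 \<and> x \<notin> Fil 1" using x by blast
    obtain h1 where h1: "h1 \<in> GLM" "step_kernel (\<lambda>x. h1 (\<psi> x))" using step_kernel_exists[OF sp nz ker] by blast
    obtain h2 where h2: "h2 \<in> GLM" "\<not> step_kernel (\<lambda>x. h2 (\<psi> x))" using step_kernel_avoidable[OF sp nz ker] by blast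
    obtain g1 where g1: "g1 \<in> GLM" "\<forall>x. \<psi> (g1 x) = g1 (h1 (\<psi> x))" using conj[OF h1(1)] by blast
    obtain g2 where g2: "g2 \<in> GLM" "\<forall>x. \<psi> (g2 x) = g2 (h2 (\<psi> x))" using conj[OF h2(1)] by blast
    obtain v where v: "v \<in> GLM" "g2 \<circ> v = id" "v \<circ> g2 = id" by (rule GLM_inv[OF g2(1)])
    have vg: "v (g2 x) = x" "g2 (v x) = x" for x using v(2,3) by (metis comp_apply id_apply)+
    have sk: "step_kernel \<psi>" by (rule step_kernel_conj[OF g1(1) _ h1(2)]) (use g1(2) in blast)
    have hv: "h2 (\<psi> (v x)) = v (\<psi> x)" for x
    proof -
      have "v (\<psi> (g2 (v x))) = v (g2 (h2 (\<psi> (v x))))" using g2(2) by simp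
      thus ?thesis unfolding vg by simp
    qed
    have "step_kernel (\<lambda>x. h2 (\<psi> x))"
      by (rule step_kernel_conj[of v "\<lambda>x. h2 (\<psi> x)" \<psi>, OF v(1) hv sk])
    thus False using h2(2) by blast
  qed
  \<comment> \<open>Injectivity modulo \<epsilon> removes one pole at a time: scaled into Fil 0, x
    is sent into Fil 1 and so was divisible by \<epsilon>.\<close>
  have "x \<in> Fil 0" if "\<psi> x \<in> Fil 0" for x
  proof -
    obtain n where n: "x \<in> Fil n" using Fil_exhaust by blast
    have "x \<in> Fil (- int k) \<longrightarrow> x \<in> Fil 0" for k
    proof (induction k)
      case (Suc k)
      show ?case
      proof
        assume a: "x \<in> Fil (- int (Suc k))"
        define y where "y = sh (int (Suc k)) x"
        have y0: "y \<in> Fil 0" unfolding y_def using a by (simp add: Fil_shift_iff)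
        have "\<psi> x \<in> Fil (- int k)" using that by (rule Fil_monoD) simp
        hence "\<psi> y \<in> Fil 1" unfolding y_def semi_sh[OF sp] Fil_shift_iff by simp
        hence "y \<in> Fil 1" by (rule inj[OF y0])
        hence "x \<in> Fil (- int k)" unfolding y_def Fil_shift_iff by simp
        thus "x \<in> Fil 0" using Suc by blast
      qed
    qed simp
    moreover have "x \<in> Fil (- int (nat (- n)))" by (rule Fil_monoD[OF n]) simp
    ultimately show ?thesis by blast
  qed
  hence "x \<in> Fil 0" if "\<phi> x \<in> Fil s" for x using that unfolding \<psi>_def Fil_shift_iff by simp
  hence "Fil s \<subseteq> \<phi> ` Fil 0" by (metis image_eqI phi_inv(1) subsetI)
  thus ?thesis unfolding unit_root_def using s(1) by blast
qed

text \<open>Both sides are equivalent to the existence of s with \<open>unit_root s\<close>. This is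
  the discrepancy between level 0 and H = O_H that case (a) of the level torsion repairs.\<close>

lemma iso_prop_0_iff: "iso_prop 0 \<longleftrightarrow> FilE 0 = OH \<and> topologically_nilpotent (FilE 0) OPM"
proof
  assume "iso_prop 0"
  then obtain s where s: "unit_root s" using iso_prop_unit_root by blast
  have "OPM = {0}" unfolding unit_root_level(2,3)[OF s] by simp
  thus "FilE 0 = OH \<and> topologically_nilpotent (FilE 0) OPM"
    using topologically_nilpotent_zero unit_root_level(1)[OF s] by simp
next
  assume "FilE 0 = OH \<and> topologically_nilpotent (FilE 0) OPM"
  then obtain s where "unit_root s" using nilpotent_unit_root by blast
  thus "iso_prop 0" by (rule unit_root_iso_prop)
qed

section \<open>Translation back to the isomorphism number and the level torsion\<close>

lemma isomorphism_number_eq: "isomorphism_number (Fil 0) \<phi> = (LEAST n. iso_prop (int n))"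
proof -
  have "h \<circ> \<phi> = inv g \<circ> \<phi> \<circ> g \<longleftrightarrow> T g = g \<circ> h" if g: "g \<in> GLM" for h g
  proof -
    have "bij g" using g unfolding GL_lattice_eq[symmetric] GL_lattice_def by blast
    hence gi: "inv g (g x) = x" "g (inv g x) = x" for x by (simp_all add: bij_is_inj bij_is_surj surj_f_inv_f)
    show ?thesis
    proof
      assume e: "h \<circ> \<phi> = inv g \<circ> \<phi> \<circ> g"
      show "T g = g \<circ> h"
      proof
        fix x
        have "h (\<phi> (\<phi>' x)) = inv g (\<phi> (g (\<phi>' x)))" using e by (metis comp_apply)
        thus "T g x = (g \<circ> h) x" unfolding T_apply comp_apply by (metis gi(2) phi_inv(1))
      qed
    next
      assume e: "T g = g \<circ> h"
      show "h \<circ> \<phi> = inv g \<circ> \<phi> \<circ> g"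
      proof
        fix x
        have "T g (\<phi> x) = g (h (\<phi> x))" unfolding e comp_apply ..
        hence "\<phi> (g x) = g (h (\<phi> x))" unfolding T_apply by simp
        thus "(h \<circ> \<phi>) x = (inv g \<circ> \<phi> \<circ> g) x" unfolding comp_apply by (metis gi(1))
      qed
    qed
  qed
  hence "(\<exists>g\<in>GLM. h \<circ> \<phi> = inv g \<circ> \<phi> \<circ> g) \<longleftrightarrow> (\<exists>g\<in>GLM. T g = g \<circ> h)" for h by blast
  thus ?thesis unfolding isomorphism_number_def iso_prop_def End_lattice_eq eps_mult_eq GL_lattice_eq by simp
qed

text \<open>Outside case (a), \<open>iso_prop n\<close> and inclusion of \<open>FilE n\<close> in
  O_H agree for every n, including 0, so the two minima coincide. In case (a) level 1 holds and
  level 0 fails.\<close>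

lemma isomorphism_number_eq_level_torsion: "isomorphism_number (Fil 0) \<phi> = level_torsion (Fil 0) \<phi>"
proof -
  have lt: "level_torsion (Fil 0) \<phi> =
    (if FilE 0 = OH \<and> \<not> topologically_nilpotent (FilE 0) OPM then 1 else (LEAST n. FilE (int n) \<subseteq> OH))"
    unfolding level_torsion_def Let_def End_lattice_eq O_level_eq O_plus_eq O_minus_eq eps_mult_eq ..
  show ?thesis
  proof (cases "FilE 0 = OH \<and> \<not> topologically_nilpotent (FilE 0) OPM")
    case True
    have "FilE 1 \<subseteq> OH" using True E.Fil_mono[of 0 1] by simp
    hence 1: "iso_prop (int 1)" using iso_prop_iff_level[of 1] by simp
    have "(LEAST n. iso_prop (int n)) = 1"
    proof (rule Least_equality)
      show "iso_prop (int 1)" by (rule 1)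
      fix n assume n: "iso_prop (int n)"
      have "\<not> iso_prop 0" using True iso_prop_0_iff by blast
      hence "n \<noteq> 0" using n by (cases n) auto
      thus "1 \<le> n" by simp
    qed
    thus ?thesis unfolding isomorphism_number_eq lt if_P[OF True] .
  next
    case False
    have "iso_prop (int n) \<longleftrightarrow> FilE (int n) \<subseteq> OH" for n
    proof (cases "n = 0")
      case True
      have "FilE 0 \<subseteq> OH \<longleftrightarrow> FilE 0 = OH" using OH_FilE by blast
      thus ?thesis using True False iso_prop_0_iff by auto
    next
      case False thus ?thesis using iso_prop_iff_level[of "int n"] by simp
    qed
    thus ?thesis unfolding isomorphism_number_eq lt if_not_P[OF False] by simp
  qed
qed

end

theorem theorem1p2:
  fixes scale :: "'k::alg_closed_field fls \<Rightarrow> 'v::ab_group_add \<Rightarrow> 'v"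
    and p q e :: nat and M :: "'v set" and \<phi> :: "'v \<Rightarrow> 'v"
  assumes "CHAR('k) = p" and "p > 0" and "q = p ^ e" and "e > 0"
    and "F_crystal scale q M \<phi>"
  shows "fls_vector_space.isomorphism_number scale M \<phi> =
         fls_vector_space.level_torsion scale M \<phi>"
proof -
  interpret F: F_crystal scale q M \<phi> by (rule assms(5))
  obtain B where B: "finite B" "F.independent B" "F.span B = UNIV" "M = F.int.span B"
    using F.lattice unfolding F.lattice_of_def by blast
  interpret bs: based_space scale B by unfold_locales (use B in auto)
  have M: "M = bs.Fil 0" unfolding bs.Fil_0_eq B(4) ..
  interpret cr: crystal scale B q \<phi>
  proof unfold_locales
    show "frob_exponent TYPE('k) q" using frob_exponent_prime_power[OF assms(1,2,4)] assms(3) by simp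
    show "\<phi> ` bs.Fil 0 \<subseteq> bs.Fil 0" using F.phi_lattice unfolding M .
  qed (rule F.phi_add F.phi_scale F.phi_bij)+
  show ?thesis unfolding M by (rule cr.isomorphism_number_eq_level_torsion)
qed

end
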